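(* Let $N\ge 2$, let $1\le q<p<\infty$, and let $\Omega\subset\mathbb{R}^N$ be a bounded convex open set. Then \[ \lambda_{p,q}(\Omega)\ \ge\ K_{p,q,N}\left(\frac{P(\Omega)}{|\Omega|^{1-\frac1p+\frac1q}}\right)^p, \qquad K_{p,q,N}=\left(\frac{\pi_{p,q}}{2N}\right)^p\prod_{j=2}^N\left(\frac{pq}{j(p-q)}+1\right)^{\frac pq-1}. \] Moreover, the inequality is asymptotically sharp: for the thin domains \[ \Omega_\varepsilon=\Big\{(x,y)\in\mathbb{R}^{N-1}\times\mathbb{R}:\ |x|<1,\ 0<y<\varepsilon(1-|x|)\Big\},\qquad \varepsilon>0, \] one has $\displaystyle\lim_{\varepsilon\to0}\lambda_{p,q}(\Omega_\varepsilon)\left(\frac{|\Omega_\varepsilon|^{1-\frac1p+\frac1q}}{P(\Omega_\varepsilon)}\right)^p=K_{p,q,N}$.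
   Context: For an open set $\Omega\subset\mathbb{R}^N$, $\lambda_{p,q}(\Omega):=\inf\{\int_\Omega|\nabla\psi|^p\,dx:\ \psi\in C_0^\infty(\Omega),\ \int_\Omega|\psi|^q\,dx=1\}$. $\pi_{p,q}:=\inf\{\|u'\|_{L^p((0,1))}:\ u\in C_0^\infty((0,1)),\ \|u\|_{L^q((0,1))}=1\}$. $|\Omega|$ is the $N$-dimensional Lebesgue measure and $P(\Omega)$ is the perimeter of $\Omega$ in the sense of De Giorgi. *)

theory Defs
  imports "HOL-Analysis.Analysis"
begin

definition tsupp :: "('a::real_normed_vector \<Rightarrow> 'b::zero) \<Rightarrow> 'a set" where
  "tsupp f = closure {x. f x \<noteq> 0}"

definition smooth_fun :: "('a::euclidean_space \<Rightarrow> real) \<Rightarrow> bool" where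
  "smooth_fun f \<longleftrightarrow> (\<exists>F. f \<in> F \<and>
     (\<forall>g\<in>F. (\<forall>x. g differentiable (at x)) \<and> continuous_on UNIV g \<and>
        (\<forall>b\<in>Basis. (\<lambda>x. frechet_derivative g (at x) b) \<in> F)))"

definition Cc_inf :: "'a::euclidean_space set \<Rightarrow> ('a \<Rightarrow> real) set" where
  "Cc_inf \<Omega> = {\<psi>. smooth_fun \<psi> \<and> compact (tsupp \<psi>) \<and> tsupp \<psi> \<subseteq> \<Omega>}"

definition grad :: "('a::euclidean_space \<Rightarrow> real) \<Rightarrow> 'a \<Rightarrow> 'a" where
  "grad f x = (\<Sum>b\<in>Basis. frechet_derivative f (at x) b *\<^sub>R b)"

definition diverg :: "('a::euclidean_space \<Rightarrow> 'a) \<Rightarrow> 'a \<Rightarrow> real" where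
  "diverg \<phi> x = (\<Sum>b\<in>Basis. frechet_derivative \<phi> (at x) b \<bullet> b)"

definition C1c_fields :: "('a::euclidean_space \<Rightarrow> 'a) set" where
  "C1c_fields = {\<phi>. (\<forall>x. \<phi> differentiable (at x)) \<and>
     (\<forall>b\<in>Basis. continuous_on UNIV (\<lambda>x. frechet_derivative \<phi> (at x) b)) \<and>
     compact (tsupp \<phi>)}"

definition perimeter :: "'a::euclidean_space set \<Rightarrow> real" where
  "perimeter E = Sup {integral E (diverg \<phi>) | \<phi>. \<phi> \<in> C1c_fields \<and> (\<forall>x. norm (\<phi> x) \<le> 1)}"

definition lambda_pq :: "real \<Rightarrow> real \<Rightarrow> 'a::euclidean_space set \<Rightarrow> real" where
  "lambda_pq p q \<Omega> = Inf {integral \<Omega> (\<lambda>x. norm (grad \<psi> x) powr p) | \<psi>.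
      \<psi> \<in> Cc_inf \<Omega> \<and> integral \<Omega> (\<lambda>x. \<bar>\<psi> x\<bar> powr q) = 1}"

definition pi_pq :: "real \<Rightarrow> real \<Rightarrow> real" where
  "pi_pq p q = Inf {(integral {0<..<1} (\<lambda>x. \<bar>deriv u x\<bar> powr p)) powr (1/p) | u.
      u \<in> Cc_inf {0<..<1::real} \<and> (integral {0<..<1} (\<lambda>x. \<bar>u x\<bar> powr q)) powr (1/q) = 1}"

definition K_const :: "real \<Rightarrow> real \<Rightarrow> nat \<Rightarrow> real" where
  "K_const p q N = (pi_pq p q / (2 * real N)) powr p *
     (\<Prod>j\<in>{2..N}. (p * q / (real j * (p - q)) + 1) powr (p / q - 1))"

text \<open>Thin domains: the distinguished direction b (a basis vector) plays the role
  of the last coordinate y; z - (z.b)b is the R^(N-1) component x.\<close>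
definition thin_dom :: "'a::euclidean_space \<Rightarrow> real \<Rightarrow> 'a set" where
  "thin_dom b \<epsilon> = {z. norm (z - (z \<bullet> b) *\<^sub>R b) < 1 \<and> 0 < z \<bullet> b \<and>
                        z \<bullet> b < \<epsilon> * (1 - norm (z - (z \<bullet> b) *\<^sub>R b))}"

end

theory Submission
  imports Defs
begin

text \<open>Let \<open>d\<close> be the distance to the boundary, \<open>N\<close> the dimension and \<open>\<beta> = p q / (p - q)\<close>. By the Brunn-Minkowski
  inequality the \<open>N\<close>-th root of the volume of \<open>{d > t}\<close> is concave in \<open>t\<close>, and its initial slope is controlled by the perimeter,
  so \<open>|{d > t}| \<le> V (1 - t P / (N V))\<^sup>N\<close>; hence \<open>\<integral> d powr \<beta>\<close> is at most its value for a cone.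
  On a polyhedron inside the domain, cut into the cells of points closest to a given face, a test function
  restricted to a segment orthogonal to the face vanishes at one end, which gives a one-dimensional Sobolev inequality with
  constant \<open>\<pi>\<^sub>p\<^sub>q / 2\<close>. Young's inequality turns it into a bound linear in the energies, with remainder
  proportional to \<open>\<integral> d powr \<beta>\<close>, that can be integrated over all segments and optimised in the free parameter.
  For the thin domains, scaled products of a radial factor with a near-optimal one-dimensional profile along the
  vertical segments attain the bound in the limit.\<close>

subsection \<open>Integration along lines and layer cakes\<close>

text \<open>As p/q exceeds 1, inequalities for powers p/q of integrals over segments cannot simply
  be added over all segments; this obstacle shapes the lower bound. For a segment of length h the
  power is replaced by its tangent at m h^(1+\<beta>). Because (p/q - 1) \<beta> = p, the
  coefficient of the mass then does not depend on h, and the remainder h^(1+\<beta>) is the integral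
  of (1+\<beta>) t^\<beta> along the segment. So the domain enters only through a bound M for
  1+\<beta> times the moment of d, and m = 1/M is optimal. The 1/2 next to \<pi> comes from
  reflection: a test function need not vanish where a segment leaves its cell, and reflecting there
  doubles the length. With T = N V / P the cone yields M = V T^\<beta> / prod (1 + \<beta>/j) over j
  from 2 to N; the factor j = 1 cancels against 1+\<beta>, which is why the product in K starts at
  2. Polyhedra make all segments of a cell parallel and stand in for boundary regularity in the
  perimeter estimate. On the thin domains, profiles k^(\<beta>/q) v(y/k) on fibres of height k have
  mass proportional to k^(1+\<beta>), as equality in the tangent bound requires.\<close>

lemma nn_integral_lborel_translate:
  fixes f :: "'a::euclidean_space \<Rightarrow> ennreal"
  assumes [measurable]: "f \<in> borel_measurable borel"
  shows "(\<integral>\<^sup>+x. f (x + c) \<partial>lborel) = (\<integral>\<^sup>+x. f x \<partial>lborel)"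
proof -
  have "(\<integral>\<^sup>+x. f x \<partial>lborel) = (\<integral>\<^sup>+x. f x \<partial>(distr lborel borel ((+) c)))"
    by (simp add: lborel_distr_plus)
  also have "\<dots> = (\<integral>\<^sup>+x. f (c + x) \<partial>lborel)" by (subst nn_integral_distr) auto
  finally show ?thesis by (simp add: add.commute)
qed

abbreviation slab :: "'a::euclidean_space \<Rightarrow> 'a set" where
  "slab a \<equiv> {z. 0 < z \<bullet> a \<and> z \<bullet> a < 1}"

text \<open>Integrating over all lines in direction \<open>a\<close> and averaging over the position along the line
  replaces a rotation of coordinates.\<close>
lemma nn_integral_along_direction:
  fixes f :: "'a::euclidean_space \<Rightarrow> ennreal"
  assumes [measurable]: "f \<in> borel_measurable borel" and a: "norm a = 1"
  shows "(\<integral>\<^sup>+x. f x \<partial>lborel) = (\<integral>\<^sup>+z. indicator (slab a) z * (\<integral>\<^sup>+s. f (z + s *\<^sub>R a) \<partial>lborel) \<partial>lborel)"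
proof -
  have aa: "a \<bullet> a = 1" using a by (simp add: norm_eq_1)
  have [measurable]: "slab a \<in> sets borel"
    by (intro borel_open open_Collect_conj open_Collect_less continuous_intros)
  have "(\<integral>\<^sup>+z. indicator (slab a) z * (\<integral>\<^sup>+s. f (z + s *\<^sub>R a) \<partial>lborel) \<partial>lborel)
      = (\<integral>\<^sup>+z. (\<integral>\<^sup>+s. indicator (slab a) z * f (z + s *\<^sub>R a) \<partial>lborel) \<partial>lborel)"
    by (intro nn_integral_cong nn_integral_cmult[symmetric]) measurable
  also have "\<dots> = (\<integral>\<^sup>+s. (\<integral>\<^sup>+z. indicator (slab a) z * f (z + s *\<^sub>R a) \<partial>lborel) \<partial>lborel)"
    by (intro lborel_pair.Fubini'[symmetric]) measurable
  also have "\<dots> = (\<integral>\<^sup>+s. (\<integral>\<^sup>+z. indicator (slab a) (z - s *\<^sub>R a) * f z \<partial>lborel) \<partial>lborel)"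
  proof (rule nn_integral_cong)
    fix s :: real
    show "(\<integral>\<^sup>+z. indicator (slab a) z * f (z + s *\<^sub>R a) \<partial>lborel) = (\<integral>\<^sup>+z. indicator (slab a) (z - s *\<^sub>R a) * f z \<partial>lborel)"
      using nn_integral_lborel_translate[of "\<lambda>z. indicator (slab a) (z - s *\<^sub>R a) * f z" "s *\<^sub>R a"] by simp
  qed
  also have "\<dots> = (\<integral>\<^sup>+z. (\<integral>\<^sup>+s. indicator (slab a) (z - s *\<^sub>R a) * f z \<partial>lborel) \<partial>lborel)"
    by (intro lborel_pair.Fubini') measurable
  also have "\<dots> = (\<integral>\<^sup>+z. f z \<partial>lborel)"
  proof (rule nn_integral_cong)
    fix z :: 'a
    \<comment> \<open>The translates of the slab that contain a fixed point correspond to an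
      interval of s of length 1, so every point is counted with total weight 1.\<close>
    have "(\<integral>\<^sup>+s. indicator (slab a) (z - s *\<^sub>R a) * f z \<partial>lborel) = (\<integral>\<^sup>+s. f z * indicator {z \<bullet> a - 1<..<z \<bullet> a} s \<partial>lborel)"
      by (intro nn_integral_cong) (auto simp: indicator_def inner_diff_left aa)
    also have "\<dots> = f z" by (subst nn_integral_cmult_indicator) auto
    finally show "(\<integral>\<^sup>+s. indicator (slab a) (z - s *\<^sub>R a) * f z \<partial>lborel) = f z" .
  qed
  finally show ?thesis by simp
qed

section \<open>Moments of functions distributed like the height in a cone\<close>

lemma Beta_prod:
  assumes "\<beta> > (0::real)"
  shows "\<beta> * Beta \<beta> (real N + 1) = 1 / (\<Prod>j\<in>{1..N}. 1 + \<beta> / real j)"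
proof (induction N)
  case 0
  have "\<beta> \<notin> \<int>\<^sub>\<le>\<^sub>0" using assms nonpos_Ints_nonpos by fastforce
  then have "Beta \<beta> 1 = 1 / \<beta>" using assms by (simp add: Beta_def Gamma_plus1 Gamma_eq_zero_iff)
  then show ?case using assms by simp
next
  case (Suc N)
  have nz: "real N + 1 \<notin> \<int>\<^sub>\<le>\<^sub>0" by (auto elim!: nonpos_Ints_cases')
  have "(\<beta> + (real N + 1)) * Beta \<beta> (real N + 1 + 1) = (real N + 1) * Beta \<beta> (real N + 1)"
    by (rule Beta_plus1_right[OF nz])
  then have *: "Beta \<beta> (real (Suc N) + 1) = (real N + 1) * Beta \<beta> (real N + 1) / (\<beta> + (real N + 1))"
    using assms by (simp add: field_simps)
  have "\<beta> * Beta \<beta> (real (Suc N) + 1) = (\<beta> * Beta \<beta> (real N + 1)) * ((real N + 1) / (\<beta> + (real N + 1)))"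
    unfolding * by simp
  also have "\<dots> = 1 / ((\<Prod>j\<in>{1..N}. 1 + \<beta> / real j) * (1 + \<beta> / real (Suc N)))"
    unfolding Suc using assms by (simp add: field_simps)
  finally show ?case by simp
qed

text \<open>Rescaling to the unit interval leaves the Beta integral B(\<beta>, N+1). The recursion
  in its second argument turns that integral into a product over j = 1..N, the source of the product
  in \<open>K_const\<close>.\<close>

lemma nn_integral_Beta_scaled:
  fixes T \<beta> :: real
  assumes \<beta>: "\<beta> > 0" and T: "T > 0"
  shows "(\<integral>\<^sup>+t. indicator {0<..<T} t * ennreal (\<beta> * t powr (\<beta> - 1) * (1 - t / T) ^ N) \<partial>lborel)
       = ennreal (T powr \<beta> / (\<Prod>j\<in>{1..N}. 1 + \<beta> / real j))"
proof -
  let ?f = "\<lambda>t. indicator {0<..<1} t * (\<beta> * t powr (\<beta> - 1) * (1 - t) ^ N) :: real"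
  have "((\<lambda>t. t powr (\<beta> - 1) * (1 - t) powr (real N + 1 - 1)) has_integral Beta \<beta> (real N + 1)) {0..1}"
    using \<beta> by (intro has_integral_Beta_real) auto
  then have "((\<lambda>t. \<beta> * (t powr (\<beta> - 1) * (1 - t) powr real N)) has_integral \<beta> * Beta \<beta> (real N + 1)) {0<..<1}"
    by (intro has_integral_mult_right) (simp add: has_integral_Icc_iff_Ioo)
  then have "((\<lambda>t. if t \<in> {0<..<1} then \<beta> * (t powr (\<beta> - 1) * (1 - t) powr real N) else 0) has_integral \<beta> * Beta \<beta> (real N + 1)) UNIV"
    by (subst has_integral_restrict_UNIV)
  moreover have "(\<lambda>t. if t \<in> {0<..<1} then \<beta> * (t powr (\<beta> - 1) * (1 - t) powr real N) else 0) = ?f"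
    by (auto simp: fun_eq_iff indicator_def powr_realpow)
  ultimately have hi: "(?f has_integral \<beta> * Beta \<beta> (real N + 1)) UNIV" by simp
  have 1: "(\<integral>\<^sup>+t. ennreal (?f t) \<partial>lborel) = ennreal (\<beta> * Beta \<beta> (real N + 1))"
    by (rule nn_integral_has_integral_lborel[OF _ _ hi]) (use \<beta> in \<open>auto simp: indicator_def\<close>)
  have "(\<integral>\<^sup>+t. indicator {0<..<T} t * ennreal (\<beta> * t powr (\<beta> - 1) * (1 - t / T) ^ N) \<partial>lborel)
     = ennreal \<bar>T\<bar> * (\<integral>\<^sup>+t. indicator {0<..<T} (0 + T * t) * ennreal (\<beta> * (0 + T * t) powr (\<beta> - 1) * (1 - (0 + T * t) / T) ^ N) \<partial>lborel)"
    using T by (intro nn_integral_real_affine) auto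
  also have "\<dots> = ennreal T * (\<integral>\<^sup>+t. ennreal (T powr (\<beta> - 1)) * ennreal (?f t) \<partial>lborel)"
  proof -
    have "indicator {0<..<T} (0 + T * t) * ennreal (\<beta> * (0 + T * t) powr (\<beta> - 1) * (1 - (0 + T * t) / T) ^ N)
        = ennreal (T powr (\<beta> - 1)) * ennreal (?f t)" for t
    proof (cases "t \<in> {0<..<1}")
      case True
      then have "0 + T * t \<in> {0<..<T}" using T by simp
      then have "indicator {0<..<T} (0 + T * t) * ennreal (\<beta> * (0 + T * t) powr (\<beta> - 1) * (1 - (0 + T * t) / T) ^ N)
        = ennreal (\<beta> * (T powr (\<beta> - 1) * t powr (\<beta> - 1)) * (1 - t) ^ N)"
        using True T by (simp add: powr_mult)
      also have "\<dots> = ennreal (T powr (\<beta> - 1) * ?f t)" using True by (simp add: ac_simps)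
      finally show ?thesis by (simp add: ennreal_mult')
    next
      case False
      then have "0 + T * t \<notin> {0<..<T}" using T by (auto simp: zero_less_mult_iff)
      then have "indicator {0<..<T} (0 + T * t) = (0::ennreal)" "?f t = 0" using False by (simp_all only: indicator_simps mult_zero_left not_False_eq_True)
      then show ?thesis by (simp only: mult_zero_left mult_zero_right ennreal_0)
    qed
    then show ?thesis using T by simp
  qed
  also have "\<dots> = ennreal (T * T powr (\<beta> - 1) * (\<beta> * Beta \<beta> (real N + 1)))"
  proof -
    have "(\<integral>\<^sup>+t. ennreal (T powr (\<beta> - 1)) * ennreal (?f t) \<partial>lborel) = ennreal (T powr (\<beta> - 1)) * (\<integral>\<^sup>+t. ennreal (?f t) \<partial>lborel)"
      by (rule nn_integral_cmult) measurable
    then show ?thesis unfolding 1 using T by (simp add: ennreal_mult'[symmetric] mult.assoc)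
  qed
  also have "T * T powr (\<beta> - 1) = T powr \<beta>" using T by (simp add: powr_diff)
  finally show ?thesis by (simp add: Beta_prod[OF \<beta>])
qed

lemma nn_integral_powr_from_0:
  fixes c \<beta> :: real
  assumes "\<beta> > 0" "c \<ge> 0"
  shows "(\<integral>\<^sup>+t. indicator {0<..<c} t * ennreal (\<beta> * t powr (\<beta> - 1)) \<partial>lborel) = ennreal (c powr \<beta>)"
proof -
  have "((\<lambda>t. \<beta> * t powr (\<beta> - 1)) has_integral \<beta> * (c powr (\<beta> - 1 + 1) / (\<beta> - 1 + 1))) {0..c}"
    using assms by (intro has_integral_mult_right has_integral_powr_from_0) auto
  then have "((\<lambda>t. \<beta> * t powr (\<beta> - 1)) has_integral c powr \<beta>) {0<..<c}"
    using assms by (simp add: has_integral_Icc_iff_Ioo)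
  then have "((\<lambda>t. if t \<in> {0<..<c} then \<beta> * t powr (\<beta> - 1) else 0) has_integral c powr \<beta>) UNIV"
    by (subst has_integral_restrict_UNIV)
  moreover have "(\<lambda>t. if t \<in> {0<..<c} then \<beta> * t powr (\<beta> - 1) else 0) = (\<lambda>t. indicator {0<..<c} t * (\<beta> * t powr (\<beta> - 1)))"
    by (auto simp: fun_eq_iff indicator_def)
  ultimately have hi: "((\<lambda>t. indicator {0<..<c} t * (\<beta> * t powr (\<beta> - 1))) has_integral c powr \<beta>) UNIV" by simp
  have "(\<integral>\<^sup>+t. ennreal (indicator {0<..<c} t * (\<beta> * t powr (\<beta> - 1))) \<partial>lborel) = ennreal (c powr \<beta>)"
    by (rule nn_integral_has_integral_lborel[OF _ _ hi]) (use assms in \<open>auto simp: indicator_def\<close>)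
  then show ?thesis by (simp add: ennreal_mult' ennreal_indicator)
qed

text \<open>g^\<beta> is the integral of \<beta> t^(\<beta>-1) over 0 < t < g; exchanging the two
  integrations leaves the measures of superlevel sets.\<close>

lemma layer_cake_powr:
  fixes g :: "'a::euclidean_space \<Rightarrow> real"
  assumes [measurable]: "S \<in> sets borel" "g \<in> borel_measurable borel"
    and g: "\<And>x. x \<in> S \<Longrightarrow> 0 \<le> g x" and \<beta>: "\<beta> > 0"
  shows "(\<integral>\<^sup>+x. indicator S x * ennreal (g x powr \<beta>) \<partial>lborel)
       = (\<integral>\<^sup>+t. indicator {0<..} t * ennreal (\<beta> * t powr (\<beta> - 1)) * emeasure lborel {x \<in> S. t < g x} \<partial>lborel)"
proof -
  have "(\<integral>\<^sup>+x. indicator S x * ennreal (g x powr \<beta>) \<partial>lborel)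
     = (\<integral>\<^sup>+x. (\<integral>\<^sup>+t. indicator {0<..} t * ennreal (\<beta> * t powr (\<beta> - 1)) * indicator {x \<in> S. t < g x} x \<partial>lborel) \<partial>lborel)"
  proof (intro nn_integral_cong)
    fix x
    show "indicator S x * ennreal (g x powr \<beta>) = (\<integral>\<^sup>+t. indicator {0<..} t * ennreal (\<beta> * t powr (\<beta> - 1)) * indicator {x \<in> S. t < g x} x \<partial>lborel)"
    proof (cases "x \<in> S")
      case True
      have "(\<integral>\<^sup>+t. indicator {0<..} t * ennreal (\<beta> * t powr (\<beta> - 1)) * indicator {x \<in> S. t < g x} x \<partial>lborel)
         = (\<integral>\<^sup>+t. indicator {0<..<g x} t * ennreal (\<beta> * t powr (\<beta> - 1)) \<partial>lborel)"
        using True by (intro nn_integral_cong) (auto simp: indicator_def)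
      then show ?thesis using nn_integral_powr_from_0[OF \<beta> g[OF True]] True by simp
    qed simp
  qed
  also have "\<dots> = (\<integral>\<^sup>+t. (\<integral>\<^sup>+x. indicator {0<..} t * ennreal (\<beta> * t powr (\<beta> - 1)) * indicator {x \<in> S. t < g x} x \<partial>lborel) \<partial>lborel)"
    by (intro lborel_pair.Fubini'[symmetric]) measurable
  also have "\<dots> = (\<integral>\<^sup>+t. indicator {0<..} t * ennreal (\<beta> * t powr (\<beta> - 1)) * emeasure lborel {x \<in> S. t < g x} \<partial>lborel)"
    by (intro nn_integral_cong nn_integral_cmult_indicator) measurable
  finally show ?thesis .
qed

text \<open>V (1 - t/T)^N is the volume above level t in a cone of volume V and height T, so the
  moment of g is compared with the moment of the height in that cone. It serves the distance
  function of a convex domain.\<close>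

lemma powr_integral_le_of_cone_distribution:
  fixes g :: "'a::euclidean_space \<Rightarrow> real"
  assumes "S \<in> sets borel" "g \<in> borel_measurable borel"
    and g: "\<And>x. x \<in> S \<Longrightarrow> 0 \<le> g x" and \<beta>: "\<beta> > 0" and T: "T > 0" and V: "V \<ge> 0"
    and le: "\<And>t. 0 < t \<Longrightarrow> t < T \<Longrightarrow> emeasure lborel {x \<in> S. t < g x} \<le> ennreal (V * (1 - t / T) ^ N)"
    and 0: "\<And>t. T \<le> t \<Longrightarrow> emeasure lborel {x \<in> S. t < g x} = 0"
  shows "(\<integral>\<^sup>+x. indicator S x * ennreal (g x powr \<beta>) \<partial>lborel) \<le> ennreal (V * T powr \<beta> / (\<Prod>j\<in>{1..N}. 1 + \<beta> / real j))"
proof -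
  have lc: "(\<integral>\<^sup>+x. indicator S x * ennreal (g x powr \<beta>) \<partial>lborel)
       = (\<integral>\<^sup>+t. indicator {0<..} t * ennreal (\<beta> * t powr (\<beta> - 1)) * emeasure lborel {x \<in> S. t < g x} \<partial>lborel)"
    using assms by (intro layer_cake_powr)
  have "(\<integral>\<^sup>+x. indicator S x * ennreal (g x powr \<beta>) \<partial>lborel)
     \<le> (\<integral>\<^sup>+t. ennreal V * (indicator {0<..<T} t * ennreal (\<beta> * t powr (\<beta> - 1) * (1 - t / T) ^ N)) \<partial>lborel)"
    unfolding lc
  proof (rule nn_integral_mono)
    fix t :: real
    consider "t \<le> 0" | "0 < t" "t < T" | "T \<le> t" by linarith
    then show "indicator {0<..} t * ennreal (\<beta> * t powr (\<beta> - 1)) * emeasure lborel {x \<in> S. t < g x}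
        \<le> ennreal V * (indicator {0<..<T} t * ennreal (\<beta> * t powr (\<beta> - 1) * (1 - t / T) ^ N))"
    proof cases
      case 2
      have "ennreal (\<beta> * t powr (\<beta> - 1)) * emeasure lborel {x \<in> S. t < g x} \<le> ennreal (\<beta> * t powr (\<beta> - 1)) * ennreal (V * (1 - t / T) ^ N)"
        using le[OF 2] by (intro mult_left_mono) auto
      also have "\<dots> = ennreal V * ennreal (\<beta> * t powr (\<beta> - 1) * (1 - t / T) ^ N)"
        using V \<beta> 2 by (subst (1 2) ennreal_mult[symmetric]) (auto simp: ac_simps)
      finally show ?thesis using 2 by simp
    qed (use 0 in auto)
  qed
  also have "\<dots> = ennreal V * ennreal (T powr \<beta> / (\<Prod>j\<in>{1..N}. 1 + \<beta> / real j))"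
    by (subst nn_integral_cmult) (simp_all add: nn_integral_Beta_scaled[OF \<beta> T])
  also have "\<dots> = ennreal (V * T powr \<beta> / (\<Prod>j\<in>{1..N}. 1 + \<beta> / real j))"
    using V by (simp add: ennreal_mult'[symmetric])
  finally show ?thesis .
qed

text \<open>The exact counterpart of the comparison, for the model cone \<open>thin_dom b 1\<close>
  with its height coordinate. Equality here is what makes the constant attained in the
  limit.\<close>

lemma powr_integral_eq_of_cone_distribution:
  fixes g :: "'a::euclidean_space \<Rightarrow> real"
  assumes "S \<in> sets borel" "g \<in> borel_measurable borel"
    and g: "\<And>x. x \<in> S \<Longrightarrow> 0 \<le> g x" and \<beta>: "\<beta> > 0" and T: "T > 0" and V: "V \<ge> 0"
    and le: "\<And>t. 0 < t \<Longrightarrow> t < T \<Longrightarrow> emeasure lborel {x \<in> S. t < g x} = ennreal (V * (1 - t / T) ^ N)"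
    and 0: "\<And>t. T \<le> t \<Longrightarrow> emeasure lborel {x \<in> S. t < g x} = 0"
  shows "(\<integral>\<^sup>+x. indicator S x * ennreal (g x powr \<beta>) \<partial>lborel) = ennreal (V * T powr \<beta> / (\<Prod>j\<in>{1..N}. 1 + \<beta> / real j))"
proof -
  have lc: "(\<integral>\<^sup>+x. indicator S x * ennreal (g x powr \<beta>) \<partial>lborel)
       = (\<integral>\<^sup>+t. indicator {0<..} t * ennreal (\<beta> * t powr (\<beta> - 1)) * emeasure lborel {x \<in> S. t < g x} \<partial>lborel)"
    using assms by (intro layer_cake_powr)
  have "(\<integral>\<^sup>+x. indicator S x * ennreal (g x powr \<beta>) \<partial>lborel)
     = (\<integral>\<^sup>+t. ennreal V * (indicator {0<..<T} t * ennreal (\<beta> * t powr (\<beta> - 1) * (1 - t / T) ^ N)) \<partial>lborel)"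
    unfolding lc
  proof (rule nn_integral_cong)
    fix t :: real
    consider "t \<le> 0" | "0 < t" "t < T" | "T \<le> t" by linarith
    then show "indicator {0<..} t * ennreal (\<beta> * t powr (\<beta> - 1)) * emeasure lborel {x \<in> S. t < g x}
        = ennreal V * (indicator {0<..<T} t * ennreal (\<beta> * t powr (\<beta> - 1) * (1 - t / T) ^ N))"
    proof cases
      case 2
      have "ennreal (\<beta> * t powr (\<beta> - 1)) * ennreal (V * (1 - t / T) ^ N) = ennreal V * ennreal (\<beta> * t powr (\<beta> - 1) * (1 - t / T) ^ N)"
        using V \<beta> 2 by (subst (1 2) ennreal_mult[symmetric]) (auto simp: ac_simps)
      then show ?thesis using 2 le[OF 2] by simp
    qed (use 0 in auto)
  qed
  also have "\<dots> = ennreal V * ennreal (T powr \<beta> / (\<Prod>j\<in>{1..N}. 1 + \<beta> / real j))"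
    by (subst nn_integral_cmult) (simp_all add: nn_integral_Beta_scaled[OF \<beta> T])
  also have "\<dots> = ennreal (V * T powr \<beta> / (\<Prod>j\<in>{1..N}. 1 + \<beta> / real j))"
    using V by (simp add: ennreal_mult'[symmetric])
  finally show ?thesis .
qed

subsection \<open>The Brunn-Minkowski inequality for open sets\<close>

text \<open>The Minkowski sum, written so that \<open>open_sums\<close> and
  \<open>bounded_sums\<close> apply to it as it stands.\<close>

abbreviation msum :: "'a::real_normed_vector set \<Rightarrow> 'a set \<Rightarrow> 'a set" where
  "msum A B \<equiv> (\<Union>x\<in>A. \<Union>y\<in>B. {x + y})"

lemma msum_commute: "msum A B = msum B A"
proof -
  have "msum A B \<subseteq> msum B A" for A B :: "'a set"
  proof
    fix z assume "z \<in> msum A B"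
    then obtain x y where "x \<in> A" "y \<in> B" "z = y + x" by (auto simp: add.commute)
    then show "z \<in> msum B A" by blast
  qed
  then show ?thesis by (intro equalityI)
qed

text \<open>AM-GM is applied to the ratios a_i/(a_i+b_i) and to b_i/(a_i+b_i); the two arithmetic
  means add up to 1. This is Brunn-Minkowski for a pair of boxes with edge lengths a and b.\<close>

lemma prod_powr_superadditive:
  fixes a b :: "'i \<Rightarrow> real"
  assumes "finite S" "S \<noteq> {}" and pos: "\<And>i. i \<in> S \<Longrightarrow> 0 < a i" "\<And>i. i \<in> S \<Longrightarrow> 0 < b i"
  shows "(\<Prod>i\<in>S. a i) powr (1 / card S) + (\<Prod>i\<in>S. b i) powr (1 / card S)
          \<le> (\<Prod>i\<in>S. a i + b i) powr (1 / card S)"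
proof -
  let ?r = "1 / real (card S)"
  let ?P = "\<Prod>i\<in>S. a i + b i"
  have P: "?P > 0" using pos by (intro prod_pos) (simp add: add_pos_pos)
  have *: "(\<Prod>i\<in>S. f i) powr ?r \<le> (\<Sum>i\<in>S. f i / (a i + b i) / card S) * ?P powr ?r"
    if f: "\<And>i. i \<in> S \<Longrightarrow> 0 < f i" for f
  proof -
    have "(\<Prod>i\<in>S. f i) = (\<Prod>i\<in>S. f i / (a i + b i)) * ?P"
      using P by (simp add: prod_dividef)
    then have "(\<Prod>i\<in>S. f i) powr ?r = (\<Prod>i\<in>S. f i / (a i + b i)) powr ?r * ?P powr ?r"
      using P pos f by (simp add: powr_mult prod_nonneg add_pos_pos less_imp_le)
    also have "\<dots> \<le> (\<Sum>i\<in>S. f i / (a i + b i) / card S) * ?P powr ?r"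
      using arith_geom_mean[OF assms(1,2), of "\<lambda>i. f i / (a i + b i)"] pos f
      by (intro mult_right_mono) (auto simp: add_nonneg_nonneg less_imp_le)
    finally show ?thesis .
  qed
  have "(\<Sum>i\<in>S. a i / (a i + b i) / card S) + (\<Sum>i\<in>S. b i / (a i + b i) / card S) = (\<Sum>i\<in>S. 1 / real (card S))"
    unfolding sum.distrib[symmetric]
  proof (rule sum.cong)
    fix i assume "i \<in> S"
    then have "a i + b i \<noteq> 0" using pos[of i] by linarith
    then show "a i / (a i + b i) / card S + b i / (a i + b i) / card S = 1 / real (card S)"
      by (simp flip: add_divide_distrib)
  qed simp
  also have "\<dots> = 1" using assms(1,2) by (simp add: card_gt_0_iff)
  finally show ?thesis using *[of a] *[of b] pos
    by (simp add: distrib_right[symmetric])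
       (smt (verit) distrib_right mult_cancel_right1)
qed

section \<open>Finite unions of disjoint boxes and the Hadwiger-Ohmann induction\<close>

definition disjoint_boxes :: "'a::euclidean_space set set \<Rightarrow> bool" where
  "disjoint_boxes \<A> \<longleftrightarrow> finite \<A> \<and> (\<forall>X\<in>\<A>. X \<noteq> {} \<and> (\<exists>l u. X = box l u)) \<and> pairwise disjnt \<A>"

lemma disjoint_boxes_props:
  assumes "disjoint_boxes \<A>"
  shows "open (\<Union>\<A>)" "bounded (\<Union>\<A>)" "\<Union>\<A> \<in> lmeasurable" "finite \<A>"
proof -
  show 1: "open (\<Union>\<A>)" using assms unfolding disjoint_boxes_def by (metis open_Union open_box)
  show 2: "bounded (\<Union>\<A>)" using assms unfolding disjoint_boxes_def by (metis bounded_Union bounded_box)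
  show "\<Union>\<A> \<in> lmeasurable" using 1 2 by (rule lmeasurable_open[rotated])
  show "finite \<A>" using assms by (simp add: disjoint_boxes_def)
qed

lemma measure_disjoint_boxes_pos:
  assumes "disjoint_boxes \<A>" "\<A> \<noteq> {}"
  shows "measure lebesgue (\<Union>\<A>) > 0"
proof -
  have "\<not> negligible (\<Union>\<A>)"
    using assms disjoint_boxes_props(1)[OF assms(1)] by (auto simp: disjoint_boxes_def dest: open_not_negligible)
  then show ?thesis
    using disjoint_boxes_props(3)[OF assms(1)] by (simp add: negligible_iff_measure0 zero_less_measure_iff)
qed

text \<open>Empty traces are discarded, so that a box lying on the wrong side of a cut really lowers
  the number of boxes, which is the induction measure.\<close>

definition box_cut :: "'a set set \<Rightarrow> 'a set \<Rightarrow> 'a set set" where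
  "box_cut \<A> H = (\<lambda>X. X \<inter> H) ` \<A> - {{}}"

lemma Union_box_cut: "\<Union>(box_cut \<A> H) = \<Union>\<A> \<inter> H"
proof -
  have "\<Union>(F - {{}}) = \<Union>F" for F :: "'a set set" by blast
  then show ?thesis unfolding box_cut_def by (simp add: Int_Union Int_commute image_def) 
qed

lemma box_cut_boxes:
  assumes "disjoint_boxes \<A>" and "\<And>l u. \<exists>l' u'. box l u \<inter> H = box l' u'"
  shows "disjoint_boxes (box_cut \<A> H)" "card (box_cut \<A> H) \<le> card \<A>"
    "X \<in> \<A> \<Longrightarrow> X \<inter> H = {} \<Longrightarrow> card (box_cut \<A> H) < card \<A>"
proof -
  have fin: "finite \<A>" using assms by (simp add: disjoint_boxes_def)
  show "disjoint_boxes (box_cut \<A> H)"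
    unfolding disjoint_boxes_def
  proof (intro conjI ballI)
    show "finite (box_cut \<A> H)" using fin by (simp add: box_cut_def)
    show "pairwise disjnt (box_cut \<A> H)"
      using assms(1) unfolding disjoint_boxes_def box_cut_def pairwise_def disjnt_def by blast
    fix Y assume "Y \<in> box_cut \<A> H"
    then obtain X where X: "X \<in> \<A>" "Y = X \<inter> H" "Y \<noteq> {}" by (auto simp: box_cut_def)
    then show "Y \<noteq> {}" by simp
    obtain l u where "X = box l u" using assms(1) X(1) unfolding disjoint_boxes_def by blast
    then show "\<exists>l u. Y = box l u" using X(2) assms(2)[of l u] by simp
  qed
  show "card (box_cut \<A> H) \<le> card \<A>"
    unfolding box_cut_def using fin by (meson Diff_subset card_image_le card_mono finite_imageI le_trans)
  assume X: "X \<in> \<A>" "X \<inter> H = {}"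
  then have "box_cut \<A> H \<subseteq> (\<lambda>X. X \<inter> H) ` (\<A> - {X})" by (auto simp: box_cut_def)
  then have "card (box_cut \<A> H) \<le> card (\<A> - {X})"
    using fin by (meson card_image_le card_mono finite_Diff finite_imageI le_trans)
  also have "\<dots> < card \<A>" using X fin by (meson card_Diff1_less)
  finally show "card (box_cut \<A> H) < card \<A>" .
qed

lemma box_Int_halfspace:
  fixes b :: "'a::euclidean_space"
  assumes b: "b \<in> Basis"
  shows "\<exists>l' u'. box l u \<inter> {x. x \<bullet> b < c} = box l' u'" "\<exists>l' u'. box l u \<inter> {x. x \<bullet> b > c} = box l' u'"
proof -
  have iff: "(\<forall>i\<in>Basis. P i) \<longleftrightarrow> P b \<and> (\<forall>i\<in>Basis - {b}. P i)" for P :: "'a \<Rightarrow> bool" using b by blast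
  define v w where "v = u + (min (u \<bullet> b) c - u \<bullet> b) *\<^sub>R b" and "w = l + (max (l \<bullet> b) c - l \<bullet> b) *\<^sub>R b"
  have vw: "v \<bullet> b = min (u \<bullet> b) c" "w \<bullet> b = max (l \<bullet> b) c"
    using b by (simp_all add: v_def w_def inner_add_left)
  have vw': "v \<bullet> i = u \<bullet> i" "w \<bullet> i = l \<bullet> i" if "i \<in> Basis - {b}" for i
    using b that by (auto simp: v_def w_def inner_add_left inner_Basis)
  have "x \<in> box l u \<inter> {x. x \<bullet> b < c} \<longleftrightarrow> x \<in> box l v" for x
    unfolding mem_box iff Int_iff mem_Collect_eq using vw' by (simp add: vw) blast
  then show "\<exists>l' u'. box l u \<inter> {x. x \<bullet> b < c} = box l' u'" by blast
  have "x \<in> box l u \<inter> {x. x \<bullet> b > c} \<longleftrightarrow> x \<in> box w u" for x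
    unfolding mem_box iff Int_iff mem_Collect_eq using vw' by (simp add: vw) blast
  then show "\<exists>l' u'. box l u \<inter> {x. x \<bullet> b > c} = box l' u'" by blast
qed

lemma measure_halfspace_split:
  fixes b :: "'a::euclidean_space"
  assumes "S \<in> lmeasurable" "b \<noteq> 0"
  shows "measure lebesgue S = measure lebesgue (S \<inter> {x. x \<bullet> b < c}) + measure lebesgue (S \<inter> {x. x \<bullet> b > c})"
proof -
  have n: "negligible {x. b \<bullet> x = c}" using assms negligible_hyperplane by blast
  have m: "S \<inter> {x. x \<bullet> b < c} \<in> lmeasurable" "S \<inter> {x. x \<bullet> b > c} \<in> lmeasurable"
    using assms by (auto intro!: fmeasurable_Int_fmeasurable 
        simp: inner_commute intro: borel_open open_halfspace_lt open_halfspace_gt)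
  have "measure lebesgue S = measure lebesgue ((S \<inter> {x. x \<bullet> b < c}) \<union> (S \<inter> {x. x \<bullet> b > c}))"
  proof (rule measure_negligible_symdiff[symmetric])
    show "negligible (S - (S \<inter> {x. x \<bullet> b < c} \<union> S \<inter> {x. c < x \<bullet> b}) \<union> (S \<inter> {x. x \<bullet> b < c} \<union> S \<inter> {x. c < x \<bullet> b} - S))"
      by (rule negligible_subset[OF n]) (auto simp: inner_commute)
  qed (use m assms in auto)
  also have "\<dots> = measure lebesgue (S \<inter> {x. x \<bullet> b < c}) + measure lebesgue (S \<inter> {x. x \<bullet> b > c})"
    using m by (subst measure_Un2) (auto intro!: arg_cong[where f="measure lebesgue"])
  finally show ?thesis .
qed

text \<open>The volume cut off by a moving hyperplane is continuous, because each hyperplane is null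
  (dominated convergence), and it runs from 0 to the whole as the hyperplane sweeps a bounded set;
  then the intermediate value theorem applies.\<close>

lemma measure_halfspace_attains:
  fixes b :: "'a::euclidean_space"
  assumes S: "S \<in> lmeasurable" "bounded S" and b: "b \<noteq> 0" and \<theta>: "0 \<le> \<theta>" "\<theta> \<le> 1"
  shows "\<exists>c. measure lebesgue (S \<inter> {x. x \<bullet> b < c}) = \<theta> * measure lebesgue S"
proof -
  define G where "G c = measure lebesgue (S \<inter> {x. x \<bullet> b < c})" for c
  have m: "S \<inter> {x. x \<bullet> b < c} \<in> lmeasurable" for c
    using S by (auto intro!: fmeasurable_Int_fmeasurable simp: inner_commute intro: borel_open open_halfspace_lt)
  have n: "negligible {x. b \<bullet> x = c}" for c using b negligible_hyperplane by blast
  have G: "G c = integral\<^sup>L lebesgue (indicat_real (S \<inter> {x. x \<bullet> b < c}))" for c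
    unfolding G_def using m by simp
  have cont: "continuous_on UNIV G"
    unfolding continuous_on_sequentially
  proof (intro ballI allI impI, elim conjE)
    fix c cs assume lim: "cs \<longlonglongrightarrow> (c::real)"
    have "(\<lambda>n. integral\<^sup>L lebesgue (indicat_real (S \<inter> {x. x \<bullet> b < cs n}))) \<longlonglongrightarrow> integral\<^sup>L lebesgue (indicat_real (S \<inter> {x. x \<bullet> b < c}))"
    proof (rule integral_dominated_convergence[where w="indicat_real S"])
      have "AE x in lebesgue. x \<notin> {x. b \<bullet> x = c}"
        using n[of c] by (intro AE_not_in) (simp add: negligible_iff_null_sets)
      then show "AE x in lebesgue. (\<lambda>n. indicat_real (S \<inter> {x. x \<bullet> b < cs n}) x) \<longlonglongrightarrow> indicat_real (S \<inter> {x. x \<bullet> b < c}) x"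
      proof eventually_elim
        case (elim x)
        then consider "x \<bullet> b < c" | "x \<bullet> b > c" by (force simp: inner_commute)
        then show ?case
        proof cases
          case 1
          with lim have "\<forall>\<^sub>F n in sequentially. x \<bullet> b < cs n" by (rule order_tendstoD)
          then have "\<forall>\<^sub>F n in sequentially. indicat_real (S \<inter> {x. x \<bullet> b < cs n}) x = indicat_real (S \<inter> {x. x \<bullet> b < c}) x"
            by eventually_elim (use 1 in \<open>auto simp: indicator_def\<close>)
          then show ?thesis by (rule tendsto_eventually)
        next
          case 2
          with lim have "\<forall>\<^sub>F n in sequentially. x \<bullet> b > cs n" by (rule order_tendstoD)
          then have "\<forall>\<^sub>F n in sequentially. indicat_real (S \<inter> {x. x \<bullet> b < cs n}) x = indicat_real (S \<inter> {x. x \<bullet> b < c}) x"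
            by eventually_elim (use 2 in \<open>auto simp: indicator_def\<close>)
          then show ?thesis by (rule tendsto_eventually)
        qed
      qed
      show "\<And>n. indicat_real (S \<inter> {x. x \<bullet> b < cs n}) \<in> borel_measurable lebesgue" using m by auto
      show "integrable lebesgue (indicat_real S)" using S(1) by (simp add: lmeasurable_iff_integrable)
    qed (use m in \<open>auto simp: indicator_def\<close>)
    then show "(G \<circ> cs) \<longlonglongrightarrow> G c" by (simp add: G o_def)
  qed
  obtain R where R: "\<And>x. x \<in> S \<Longrightarrow> norm x \<le> R" using S by (meson bounded_iff)
  define r where "r = \<bar>R\<bar> * norm b + 1"
  have rb: "\<bar>x \<bullet> b\<bar> < r" if "x \<in> S" for x
  proof -
    have "\<bar>x \<bullet> b\<bar> \<le> norm x * norm b" by (rule Cauchy_Schwarz_ineq2)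
    also have "\<dots> \<le> \<bar>R\<bar> * norm b" using R[OF that] by (intro mult_right_mono) auto
    finally show ?thesis by (simp add: r_def)
  qed
  have "S \<inter> {x. x \<bullet> b < - r} = {}" using rb by force
  then have 0: "G (-r) = 0" by (simp add: G_def)
  have "S \<inter> {x. x \<bullet> b < r} = S" using rb by force
  then have 1: "G r = measure lebesgue S" by (simp add: G_def)
  have "0 \<le> \<theta> * measure lebesgue S" "\<theta> * measure lebesgue S \<le> measure lebesgue S"
    using \<theta> by (auto simp: mult_left_le_one_le)
  moreover have "- r \<le> r" 
  proof -
    have "r \<ge> 1" by (simp add: r_def)
    then show ?thesis by linarith
  qed
  moreover have "continuous_on {-r..r} G" using cont continuous_on_subset by blast
  ultimately show ?thesis using IVT'[of G "-r" "\<theta> * measure lebesgue S" r] 0 1 by (auto simp: G_def)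
qed

text \<open>Two disjoint boxes of one family are separated by a coordinate hyperplane. Cut that
  family along it, and the other family by a parallel hyperplane in the same volume ratio \<theta>.
  Both pairs of halves have fewer boxes in total, and their Minkowski sums lie on opposite sides of
  a hyperplane, so the volumes add. The induction hypothesis is a premise so that the step can be
  used with the roles of the families exchanged.\<close>

lemma Brunn_Minkowski_boxes_step:
  fixes \<A> \<B> :: "'a::euclidean_space set set"
  defines "r \<equiv> 1 / real DIM('a)"
  assumes A: "disjoint_boxes \<A>" "\<A> \<noteq> {}" and B: "disjoint_boxes \<B>" "\<B> \<noteq> {}"
    and two: "card \<A> \<ge> 2"
    and IH: "\<And>\<A>' \<B>' :: 'a set set. disjoint_boxes \<A>' \<Longrightarrow> \<A>' \<noteq> {} \<Longrightarrow> disjoint_boxes \<B>' \<Longrightarrow> \<B>' \<noteq> {} \<Longrightarrow>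
        card \<A>' + card \<B>' < card \<A> + card \<B> \<Longrightarrow>
        measure lebesgue (\<Union>\<A>') powr r + measure lebesgue (\<Union>\<B>') powr r \<le> measure lebesgue (msum (\<Union>\<A>') (\<Union>\<B>')) powr r"
  shows "measure lebesgue (\<Union>\<A>) powr r + measure lebesgue (\<Union>\<B>) powr r \<le> measure lebesgue (msum (\<Union>\<A>) (\<Union>\<B>)) powr r"
proof -
  have r: "r > 0" "1 / r = real DIM('a)" and rr: "r * (1 / r) = 1" by (auto simp: r_def)
  let ?m = "measure lebesgue"
  obtain X Y where XY: "X \<in> \<A>" "Y \<in> \<A>" "X \<noteq> Y"
    using two by (metis card_2_iff' card_le_Suc_iff numeral_2_eq_2 ex_card obtain_subset_with_card_n insertI1 insertCI subset_iff)
  then obtain l u l' u' where box: "X = box l u" "Y = box l' u'" and ne: "X \<noteq> {}" "Y \<noteq> {}"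
    and dis: "X \<inter> Y = {}"
    using A(1) unfolding disjoint_boxes_def pairwise_def disjnt_def by meson
  then obtain b where b: "b \<in> Basis" "u \<bullet> b \<le> l' \<bullet> b \<or> u' \<bullet> b \<le> l \<bullet> b"
    using disjoint_interval(4)[of l u l' u'] by (force simp: box_ne_empty)
  obtain c where c: "(X \<subseteq> {x. x \<bullet> b < c} \<and> Y \<subseteq> {x. x \<bullet> b > c}) \<or> (Y \<subseteq> {x. x \<bullet> b < c} \<and> X \<subseteq> {x. x \<bullet> b > c})"
  proof (cases "u \<bullet> b \<le> l' \<bullet> b")
    case True
    then show ?thesis using b box that[of "u \<bullet> b"] by (force simp: mem_box)
  next
    case False
    then show ?thesis using b box that[of "u' \<bullet> b"] by (force simp: mem_box)
  qed
  have b0: "b \<noteq> 0" using b by auto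
  let ?L = "\<lambda>c. {x. x \<bullet> b < c}" and ?G = "\<lambda>c. {x. x \<bullet> b > c}"
  have HL: "\<exists>l' u'. box l u \<inter> ?L c = box l' u'" and HG: "\<exists>l' u'. box l u \<inter> ?G c = box l' u'" for l u c
    using box_Int_halfspace[OF b(1)] by blast+
  have Am: "disjoint_boxes (box_cut \<A> (?L c))" "card (box_cut \<A> (?L c)) < card \<A>"
           "disjoint_boxes (box_cut \<A> (?G c))" "card (box_cut \<A> (?G c)) < card \<A>"
  proof -
    have LG: "?L c \<inter> ?G c = {}" by auto
    from c obtain Z Z' where Z: "Z \<in> \<A>" "Z \<subseteq> ?L c" "Z' \<in> \<A>" "Z' \<subseteq> ?G c"
      using XY(1,2) by metis
    then have "Z' \<inter> ?L c = {}" "Z \<inter> ?G c = {}" using LG by auto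
    then show "card (box_cut \<A> (?L c)) < card \<A>" "card (box_cut \<A> (?G c)) < card \<A>"
      using box_cut_boxes(3)[OF A(1) HL Z(3)] box_cut_boxes(3)[OF A(1) HG Z(1)] by simp_all
    show "disjoint_boxes (box_cut \<A> (?L c))" "disjoint_boxes (box_cut \<A> (?G c))"
      using box_cut_boxes(1)[OF A(1) HL] box_cut_boxes(1)[OF A(1) HG] .
  qed
  have Ane: "box_cut \<A> (?L c) \<noteq> {}" "box_cut \<A> (?G c) \<noteq> {}"
  proof -
    have in_cut: "box_cut \<A> H \<noteq> {}" if "Z \<in> \<A>" "Z \<subseteq> H" "Z \<noteq> {}" for Z H
    proof -
      have "Z = Z \<inter> H" using that by blast
      then have "Z \<in> box_cut \<A> H" using that unfolding box_cut_def by (metis DiffI imageI singletonD)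
      then show ?thesis by blast
    qed
    from c obtain Z Z' where "Z \<in> \<A>" "Z \<subseteq> ?L c" "Z \<noteq> {}" "Z' \<in> \<A>" "Z' \<subseteq> ?G c" "Z' \<noteq> {}"
      using XY(1,2) ne by metis
    then show "box_cut \<A> (?L c) \<noteq> {}" "box_cut \<A> (?G c) \<noteq> {}"
      using in_cut by metis+
  qed
  let ?A = "\<Union>\<A>" and ?B = "\<Union>\<B>"
  have mA: "?A \<in> lmeasurable" and mB: "?B \<in> lmeasurable" using A B disjoint_boxes_props by blast+
  have Apos: "?m ?A > 0" and Bpos: "?m ?B > 0" using A B measure_disjoint_boxes_pos by blast+
  have Alpos: "?m (?A \<inter> ?L c) > 0" "?m (?A \<inter> ?G c) > 0"
    using Am Ane measure_disjoint_boxes_pos by (metis Union_box_cut)+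
  define \<theta> where "\<theta> = ?m (?A \<inter> ?L c) / ?m ?A"
  have sA: "?m ?A = ?m (?A \<inter> ?L c) + ?m (?A \<inter> ?G c)" by (rule measure_halfspace_split[OF mA b0])
  have \<theta>: "0 < \<theta>" "\<theta> < 1" "?m (?A \<inter> ?L c) = \<theta> * ?m ?A" "?m (?A \<inter> ?G c) = (1 - \<theta>) * ?m ?A"
    using Apos Alpos sA by (auto simp: \<theta>_def field_simps)
  obtain d where d: "?m (?B \<inter> ?L d) = \<theta> * ?m ?B"
    using measure_halfspace_attains[OF mB disjoint_boxes_props(2)[OF B(1)] b0, of \<theta>] \<theta> by auto
  have "?m ?B = ?m (?B \<inter> ?L d) + ?m (?B \<inter> ?G d)" by (rule measure_halfspace_split[OF mB b0])
  then have d': "?m (?B \<inter> ?G d) = (1 - \<theta>) * ?m ?B" using d by (simp add: algebra_simps)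
  have Bm: "disjoint_boxes (box_cut \<B> (?L d))" "card (box_cut \<B> (?L d)) \<le> card \<B>"
           "disjoint_boxes (box_cut \<B> (?G d))" "card (box_cut \<B> (?G d)) \<le> card \<B>"
    using box_cut_boxes[OF B(1) HL] box_cut_boxes[OF B(1) HG] by blast+
  have "?m (?B \<inter> ?L d) > 0" "?m (?B \<inter> ?G d) > 0" using d d' \<theta> Bpos by auto
  then have "\<Union>(box_cut \<B> (?L d)) \<noteq> {}" "\<Union>(box_cut \<B> (?G d)) \<noteq> {}" unfolding Union_box_cut by force+
  then have Bne: "box_cut \<B> (?L d) \<noteq> {}" "box_cut \<B> (?G d) \<noteq> {}" by force+
  define W where "W = ?m ?A powr r + ?m ?B powr r"
  have W: "W > 0" using Apos by (simp add: W_def add_pos_nonneg)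
  have I1: "?m (?A \<inter> ?L c) powr r + ?m (?B \<inter> ?L d) powr r \<le> ?m (msum (?A \<inter> ?L c) (?B \<inter> ?L d)) powr r"
    using IH[OF Am(1) Ane(1) Bm(1) Bne(1)] Am(2) Bm(2) unfolding Union_box_cut by linarith
  have I2: "?m (?A \<inter> ?G c) powr r + ?m (?B \<inter> ?G d) powr r \<le> ?m (msum (?A \<inter> ?G c) (?B \<inter> ?G d)) powr r"
    using IH[OF Am(3) Ane(2) Bm(3) Bne(2)] Am(4) Bm(4) unfolding Union_box_cut by linarith
  \<comment> \<open>Homogeneity: scaling both volumes by the same t pulls t^(1/N) out of the sum of
    roots. This is why the two cuts must have equal ratios.\<close>
  have up: "t * W powr real DIM('a) \<le> s" if "t > 0" "s \<ge> 0" "(t * ?m ?A) powr r + (t * ?m ?B) powr r \<le> s powr r" for t s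
  proof -
    have "t powr r * W \<le> s powr r" using that Apos Bpos by (simp add: W_def powr_mult distrib_left)
    then have "(t powr r * W) powr (1/r) \<le> (s powr r) powr (1/r)"
      using that W r by (intro powr_mono2) auto
    then have "t powr 1 * W powr (1/r) \<le> s powr 1"
      using that W rr by (simp only: powr_mult powr_powr powr_ge_zero less_imp_le)
    then show ?thesis using that W r by simp
  qed
  let ?S1 = "msum (?A \<inter> ?L c) (?B \<inter> ?L d)" and ?S2 = "msum (?A \<inter> ?G c) (?B \<inter> ?G d)"
  have oA: "open ?A" "bounded ?A" "open ?B" "bounded ?B" using A B disjoint_boxes_props by blast+
  have oL: "open (?L c)" "open (?G c)" for c
    using open_halfspace_lt[of b c] open_halfspace_gt[of c b] by (simp_all add: inner_commute)
  have mm: "msum P Q \<in> lmeasurable" if "open P" "bounded P" "bounded Q" for P Q :: "'a set"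
    using that by (intro lmeasurable_open bounded_sums open_sums disjI1)
  have mS: "?S1 \<in> lmeasurable" "?S2 \<in> lmeasurable" "msum ?A ?B \<in> lmeasurable"
    by (intro mm open_Int bounded_Int disjI1 oA oL)+
  \<comment> \<open>The hyperplane at level c + d separates the two sums.\<close>
  have dS: "?S1 \<inter> ?S2 = {}" 
  proof (rule equals0I)
    fix z assume "z \<in> ?S1 \<inter> ?S2"
    then have z: "z \<in> ?S1" "z \<in> ?S2" by (rule IntD1, rule IntD2)
    from z(1) obtain x y where xy: "z = x + y" "x \<bullet> b < c" "y \<bullet> b < d"
      unfolding UN_iff singleton_iff by blast
    from z(2) obtain x' y' where xy': "z = x' + y'" "x' \<bullet> b > c" "y' \<bullet> b > d"
      unfolding UN_iff singleton_iff by blast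
    have "z \<bullet> b < c + d" using xy by (simp add: inner_add_left)
    moreover have "z \<bullet> b > c + d" using xy' by (simp add: inner_add_left)
    ultimately show False by simp
  qed
  have "W powr real DIM('a) = \<theta> * W powr real DIM('a) + (1 - \<theta>) * W powr real DIM('a)" by (simp add: algebra_simps)
  also have "\<dots> \<le> ?m ?S1 + ?m ?S2"
    using up[of \<theta> "?m ?S1"] up[of "1-\<theta>" "?m ?S2"] I1 I2 \<theta> d d' by (intro add_mono) auto
  also have "\<dots> = ?m (?S1 \<union> ?S2)" using mS dS by (subst measure_Un3) auto
  also have "\<dots> \<le> ?m (msum ?A ?B)"
    using mS by (intro measure_mono_fmeasurable) (auto intro: fmeasurableD)
  finally have "(W powr real DIM('a)) powr r \<le> ?m (msum ?A ?B) powr r"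
    using r by (intro powr_mono2) auto
  then show ?thesis using W by (simp add: powr_powr W_def r_def)
qed

text \<open>Induction on the total number of boxes. If some family has two members, the cutting step
  applies; otherwise two single boxes remain, whose sum contains the box with added corners, and the
  product inequality finishes.\<close>

lemma Brunn_Minkowski_boxes:
  fixes \<A> \<B> :: "'a::euclidean_space set set"
  assumes "disjoint_boxes \<A>" "\<A> \<noteq> {}" "disjoint_boxes \<B>" "\<B> \<noteq> {}"
  shows "measure lebesgue (\<Union>\<A>) powr (1 / DIM('a)) + measure lebesgue (\<Union>\<B>) powr (1 / DIM('a))
         \<le> measure lebesgue (msum (\<Union>\<A>) (\<Union>\<B>)) powr (1 / DIM('a))"
  using assms
proof (induction "card \<A> + card \<B>" arbitrary: \<A> \<B> rule: less_induct)
  case less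
  consider "card \<A> \<ge> 2" | "card \<B> \<ge> 2" | "card \<A> \<le> 1" "card \<B> \<le> 1" by linarith
  then show ?case
  proof cases
    case 1
    show ?thesis by (rule Brunn_Minkowski_boxes_step[OF less.prems 1 less.hyps])
  next
    case 2
    have "measure lebesgue (\<Union>\<B>) powr (1 / DIM('a)) + measure lebesgue (\<Union>\<A>) powr (1 / DIM('a))
         \<le> measure lebesgue (msum (\<Union>\<B>) (\<Union>\<A>)) powr (1 / DIM('a))"
    proof (rule Brunn_Minkowski_boxes_step[OF less.prems(3,4,1,2) 2])
      fix \<A>' \<B>' :: "'a set set"
      assume "disjoint_boxes \<A>'" "\<A>' \<noteq> {}" "disjoint_boxes \<B>'" "\<B>' \<noteq> {}" "card \<A>' + card \<B>' < card \<B> + card \<A>"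
      then show "measure lebesgue (\<Union>\<A>') powr (1 / DIM('a)) + measure lebesgue (\<Union>\<B>') powr (1 / DIM('a))
         \<le> measure lebesgue (msum (\<Union>\<A>') (\<Union>\<B>')) powr (1 / DIM('a))"
        by (intro less.hyps) simp_all
    qed
    then show ?thesis by (subst msum_commute) simp
  next
    case 3
    then obtain X Y where XY: "\<A> = {X}" "\<B> = {Y}"
    proof -
      have "card \<A> = 1" "card \<B> = 1"
        using 3 less.prems disjoint_boxes_props(4)[of \<A>] disjoint_boxes_props(4)[of \<B>]
        by (simp_all add: le_antisym card_gt_0_iff Suc_le_eq)
      then show ?thesis using that by (auto simp: card_1_singleton_iff)
    qed
    then obtain l u l' u' where box: "X = box l u" "Y = box l' u'" and ne: "X \<noteq> {}" "Y \<noteq> {}"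
    proof -
      have "\<exists>l u. X = box l u" "\<exists>l u. Y = box l u" "X \<noteq> {}" "Y \<noteq> {}"
        using less.prems XY by (simp_all add: disjoint_boxes_def)
      then show ?thesis using that by blast
    qed
    have lu: "\<And>i. i \<in> Basis \<Longrightarrow> l \<bullet> i < u \<bullet> i" "\<And>i. i \<in> Basis \<Longrightarrow> l' \<bullet> i < u' \<bullet> i"
      using ne box by (auto simp: box_ne_empty)
    have mb: "measure lebesgue (box l u) = (\<Prod>i\<in>Basis. u \<bullet> i - l \<bullet> i)" if "\<And>i. i \<in> Basis \<Longrightarrow> l \<bullet> i < u \<bullet> i" for l u :: 'a
      using that by (simp add: less_imp_le inner_diff_left)
    have sub: "box (l + l') (u + u') \<subseteq> msum X Y"
    proof
      fix z assume z: "z \<in> box (l + l') (u + u')"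
      \<comment> \<open>The relative position of z in the i-th edge of the sum box; the points at
        the same relative position in the two given boxes add up to z.\<close>
      define t where "t i = (z \<bullet> i - (l \<bullet> i + l' \<bullet> i)) / ((u \<bullet> i + u' \<bullet> i) - (l \<bullet> i + l' \<bullet> i))" for i
      define x where "x = (\<Sum>i\<in>Basis. (l \<bullet> i + t i * (u \<bullet> i - l \<bullet> i)) *\<^sub>R i)"
      have t: "0 < t i" "t i < 1" if "i \<in> Basis" for i
        using z lu that unfolding t_def by (auto simp: mem_box inner_add_left divide_simps)
      have D: "z \<bullet> i = (l \<bullet> i + l' \<bullet> i) + t i * ((u \<bullet> i - l \<bullet> i) + (u' \<bullet> i - l' \<bullet> i))" if "i \<in> Basis" for i
        using lu[OF that] unfolding t_def by (simp add: field_simps)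
      have xi: "x \<bullet> i = l \<bullet> i + t i * (u \<bullet> i - l \<bullet> i)" if "i \<in> Basis" for i
        using that by (simp add: x_def)
      have *: "0 < t i * (u \<bullet> i - l \<bullet> i)" "t i * (u \<bullet> i - l \<bullet> i) < u \<bullet> i - l \<bullet> i"
         "0 < t i * (u' \<bullet> i - l' \<bullet> i)" "t i * (u' \<bullet> i - l' \<bullet> i) < u' \<bullet> i - l' \<bullet> i" if "i \<in> Basis" for i
        using t[OF that] lu[OF that] by auto
      have "x \<in> X" unfolding box mem_box
      proof (intro ballI)
        fix i :: 'a assume i: "i \<in> Basis"
        show "l \<bullet> i < x \<bullet> i \<and> x \<bullet> i < u \<bullet> i" using *[OF i] xi[OF i] by linarith
      qed
      moreover have "z - x \<in> Y" unfolding box mem_box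
      proof (intro ballI)
        fix i :: 'a assume i: "i \<in> Basis"
        have "(z - x) \<bullet> i = l' \<bullet> i + t i * (u' \<bullet> i - l' \<bullet> i)"
          using D[OF i] xi[OF i] by (simp add: inner_diff_left algebra_simps)
        then show "l' \<bullet> i < (z - x) \<bullet> i \<and> (z - x) \<bullet> i < u' \<bullet> i" using *[OF i] by linarith
      qed
      moreover have "z = x + (z - x)" by simp
      ultimately show "z \<in> msum X Y" unfolding UN_iff singleton_iff by blast
    qed
    have mS: "msum X Y \<in> lmeasurable"
      unfolding box by (intro lmeasurable_open bounded_sums open_sums disjI1 bounded_box open_box)
    have "measure lebesgue X powr (1 / DIM('a)) + measure lebesgue Y powr (1 / DIM('a)) 
       \<le> (\<Prod>i\<in>Basis. (u \<bullet> i - l \<bullet> i) + (u' \<bullet> i - l' \<bullet> i)) powr (1 / DIM('a))"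
    proof -
      have "measure lebesgue X = (\<Prod>i\<in>Basis. u \<bullet> i - l \<bullet> i)" "measure lebesgue Y = (\<Prod>i\<in>Basis. u' \<bullet> i - l' \<bullet> i)"
        unfolding box using lu by (simp_all only: mb)
      moreover have "0 < u \<bullet> i - l \<bullet> i" "0 < u' \<bullet> i - l' \<bullet> i" if "i \<in> Basis" for i
        using lu[OF that] by simp_all
      ultimately show ?thesis by (simp add: prod_powr_superadditive)
    qed
    also have "(\<Prod>i\<in>(Basis::'a set). (u \<bullet> i - l \<bullet> i) + (u' \<bullet> i - l' \<bullet> i)) = measure lebesgue (box (l + l') (u + u'))"
    proof (subst mb)
      fix i :: 'a assume "i \<in> Basis"
      then show "(l + l') \<bullet> i < (u + u') \<bullet> i" using lu[of i] by (simp add: inner_add_left)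
    qed (simp add: inner_add_left algebra_simps)
    also have "\<dots> powr (1 / DIM('a)) \<le> measure lebesgue (msum X Y) powr (1 / DIM('a))"
      using sub mS by (intro powr_mono2 measure_mono_fmeasurable) auto
    finally show ?thesis using XY by (simp only: cSup_singleton)
  qed
qed

text \<open>Finitely many closed boxes of a countable cover already exceed the level a. Their union
  is refined to a division, and passing to the interiors of its members loses only a null set of
  frontiers.\<close>

lemma open_inner_boxes:
  fixes S :: "'a::euclidean_space set"
  assumes S: "open S" "bounded S" and e: "a < measure lebesgue S" "0 \<le> a"
  obtains \<A> where "disjoint_boxes \<A>" "\<A> \<noteq> {}" "\<Union>\<A> \<subseteq> S" "a < measure lebesgue (\<Union>\<A>)"
proof -
  have mS: "S \<in> lmeasurable" using S by (intro lmeasurable_open)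
  obtain \<D> where D: "countable \<D>" "\<D> \<subseteq> Pow S" "\<And>X. X \<in> \<D> \<Longrightarrow> \<exists>a b. X = cbox a b" "\<Union>\<D> = S"
    using open_countable_Union_open_cbox[OF S(1)] by metis
  have "\<D> \<noteq> {}" using D e by auto
  define F where "F n = \<Union>(from_nat_into \<D> ` {..n})" for n :: nat
  have Fs: "F n \<subseteq> S" for n using D(2) from_nat_into[OF \<open>\<D> \<noteq> {}\<close>] by (fastforce simp: F_def)
  have mX: "X \<in> lmeasurable" if "X \<in> \<D>" for X using D(3)[OF that] by auto
  have mF: "F n \<in> lmeasurable" for n
    unfolding F_def using from_nat_into[OF \<open>\<D> \<noteq> {}\<close>] mX by (intro fmeasurable.finite_Union) auto
  have UF: "(\<Union>n. F n) = S"
  proof -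
    have "(\<Union>n. F n) = \<Union>(range (from_nat_into \<D>))" unfolding F_def by auto
    then show ?thesis using D \<open>\<D> \<noteq> {}\<close> by (simp add: range_from_nat_into)
  qed
  have "(\<lambda>n. measure lebesgue (F n)) \<longlonglongrightarrow> measure lebesgue (\<Union>n. F n)"
  proof (rule Lim_measure_incseq)
    show "incseq F" unfolding incseq_def F_def by force
    show "range F \<subseteq> sets lebesgue" using mF by auto
    show "emeasure lebesgue (\<Union>n. F n) \<noteq> \<infinity>" using fmeasurableD2[OF mS] UF by simp
  qed
  then have "\<forall>\<^sub>F n in sequentially. a < measure lebesgue (F n)" 
    using e UF by (simp add: order_tendstoD)
  then obtain n where n: "a < measure lebesgue (F n)" by (auto simp: eventually_sequentially)
  obtain p where p: "p division_of (F n)"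
    unfolding F_def
    using elementary_unions_intervals[of "from_nat_into \<D> ` {..n}"] D(3) from_nat_into[OF \<open>\<D> \<noteq> {}\<close>] by blast
  define \<A> where "\<A> = interior ` p - {{}}"
  have A: "disjoint_boxes \<A>" unfolding disjoint_boxes_def
  proof (intro conjI)
    show "finite \<A>" using p by (simp add: \<A>_def division_of_finite)
    show "\<forall>X\<in>\<A>. X \<noteq> {} \<and> (\<exists>l u. X = box l u)" using division_ofD(4)[OF p] interior_cbox by (fastforce simp: \<A>_def)
    show "pairwise disjnt \<A>" unfolding pairwise_def disjnt_def \<A>_def using division_ofD(5)[OF p] by blast
  qed
  have neg: "negligible (F n - \<Union>\<A>)"
  proof (rule negligible_subset)
    show "negligible (\<Union>k\<in>p. frontier k)"
    proof (intro negligible_Union finite_imageI)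
      show "finite p" using p by (rule division_of_finite)
      fix T assume "T \<in> frontier ` p"
      then obtain a b where "T = frontier (cbox a b)" using division_ofD(4)[OF p] by blast
      then show "negligible T" by (simp add: negligible_convex_frontier)
    qed
    show "F n - \<Union>\<A> \<subseteq> (\<Union>k\<in>p. frontier k)"
    proof
      fix x assume x: "x \<in> F n - \<Union>\<A>"
      then obtain k where k: "k \<in> p" "x \<in> k" using division_ofD(6)[OF p] by auto
      then have "x \<notin> interior k" using x by (auto simp: \<A>_def)
      moreover have "x \<in> closure k" using k closure_subset by auto
      ultimately show "x \<in> (\<Union>k\<in>p. frontier k)" using k by (auto simp: frontier_def)
    qed
  qed
  have sub: "\<Union>\<A> \<subseteq> F n" 
  proof
    fix x assume "x \<in> \<Union>\<A>"
    then obtain k where "k \<in> p" "x \<in> interior k" unfolding \<A>_def by blast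
    then show "x \<in> F n" using division_ofD(2)[OF p] interior_subset by blast
  qed
  have eq: "measure lebesgue (\<Union>\<A>) = measure lebesgue (F n)"
    
  proof (intro measure_negligible_symdiff mF)
    have "\<Union>\<A> - F n = {}" using sub by blast
    then show "negligible (F n - \<Union>\<A> \<union> (\<Union>\<A> - F n))" using neg by simp
  qed
  show ?thesis
  proof (rule that[OF A])
    show "\<A> \<noteq> {}" using eq n e by force
    show "\<Union>\<A> \<subseteq> S" using sub Fs by blast
    show "a < measure lebesgue (\<Union>\<A>)" using eq n by simp
  qed
qed

theorem Brunn_Minkowski_open:
  fixes A B :: "'a::euclidean_space set"
  assumes A: "open A" "bounded A" "A \<noteq> {}" and B: "open B" "bounded B" "B \<noteq> {}"
  shows "measure lebesgue A powr (1 / DIM('a)) + measure lebesgue B powr (1 / DIM('a))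
         \<le> measure lebesgue (msum A B) powr (1 / DIM('a))"
proof -
  let ?r = "1 / real DIM('a)" and ?m = "measure lebesgue"
  have mA: "A \<in> lmeasurable" and mB: "B \<in> lmeasurable" using A B by (auto intro: lmeasurable_open)
  have mS: "msum A B \<in> lmeasurable"
      using A B by (intro lmeasurable_open bounded_sums open_sums disjI1)
  have pos: "?m A > 0" "?m B > 0"
    using A B mA mB open_not_negligible by (metis negligible_iff_measure0 zero_less_measure_iff)+
  have key: "a powr ?r + b powr ?r \<le> ?m (msum A B) powr ?r" if ab: "0 \<le> a" "a < ?m A" "0 \<le> b" "b < ?m B" for a b
  proof -
    obtain \<A> where \<A>: "disjoint_boxes \<A>" "\<A> \<noteq> {}" "\<Union>\<A> \<subseteq> A" "a < ?m (\<Union>\<A>)"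
      using open_inner_boxes[OF A(1,2)] ab by blast
    obtain \<B> where \<B>: "disjoint_boxes \<B>" "\<B> \<noteq> {}" "\<Union>\<B> \<subseteq> B" "b < ?m (\<Union>\<B>)"
      using open_inner_boxes[OF B(1,2)] ab by blast
    have "a powr ?r + b powr ?r \<le> ?m (\<Union>\<A>) powr ?r + ?m (\<Union>\<B>) powr ?r"
      using ab \<A> \<B> by (intro add_mono powr_mono2) auto
    also have "\<dots> \<le> ?m (msum (\<Union>\<A>) (\<Union>\<B>)) powr ?r"
      using \<A> \<B> by (intro Brunn_Minkowski_boxes)
    also have "\<dots> \<le> ?m (msum A B) powr ?r"
    proof (intro powr_mono2 measure_mono_fmeasurable)
      show "msum (\<Union>\<A>) (\<Union>\<B>) \<subseteq> msum A B" using \<A> \<B> by blast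
      show "msum (\<Union>\<A>) (\<Union>\<B>) \<in> sets lebesgue"
        using open_sums[of "\<Union>\<A>" "\<Union>\<B>"] disjoint_boxes_props(1)[OF \<A>(1)] by auto
    qed (use mS in auto)
    finally show ?thesis .
  qed
  \<comment> \<open>The estimate is available strictly below both volumes; it is used at t times the
    volumes and t tends to 1.\<close>
  have lim: "((\<lambda>t. (t * ?m A) powr ?r + (t * ?m B) powr ?r) \<longlongrightarrow> (1 * ?m A) powr ?r + (1 * ?m B) powr ?r) (at_left 1)"
    using pos by (intro tendsto_intros) auto
  have "\<forall>\<^sub>F t in at_left 1. (t * ?m A) powr ?r + (t * ?m B) powr ?r \<le> ?m (msum A B) powr ?r"
    using eventually_at_left_real[of 0 1, simplified] 
  proof eventually_elim
    case (elim t)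
    then show ?case using pos by (intro key) auto
  qed
  from tendsto_upperbound[OF lim this] show ?thesis by simp
qed

subsection \<open>Smooth functions\<close>

text \<open>A graded and local form of smoothness. \<open>smooth_fun\<close> asks for a family
  closed under partial derivatives, which is awkward for products and compositions;
  \<open>Ck\<close> allows induction on the order, and the open set U allows gluing.\<close>

fun Ck :: "nat \<Rightarrow> 'a::euclidean_space set \<Rightarrow> ('a \<Rightarrow> real) \<Rightarrow> bool" where
  "Ck 0 U f \<longleftrightarrow> continuous_on U f"
| "Ck (Suc n) U f \<longleftrightarrow> (\<forall>x\<in>U. f differentiable (at x)) \<and> (\<forall>b\<in>Basis. Ck n U (\<lambda>x. frechet_derivative f (at x) b))"

lemma Ck_cong:
  assumes "open U" "\<And>x. x \<in> U \<Longrightarrow> f x = g x"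
  shows "Ck n U f \<longleftrightarrow> Ck n U g"
proof -
  have "Ck n U g" if "open U" "\<And>x. x \<in> U \<Longrightarrow> f x = g x" "Ck n U f" for f g
    using that
  proof (induction n arbitrary: f g)
    case 0
    then show ?case using continuous_on_cong[of U U f g] by simp
  next
    case (Suc n)
    have d: "(g has_derivative frechet_derivative f (at x)) (at x)" if "x \<in> U" for x
      using that Suc.prems by (intro has_derivative_transform_within_open[of f _ x UNIV U g])
        (auto simp: frechet_derivative_works)
    then have e: "frechet_derivative g (at x) = frechet_derivative f (at x)" if "x \<in> U" for x
      using frechet_derivative_at[OF d[OF that]] by simp
    show ?case
      unfolding Ck.simps
    proof (intro conjI ballI)
      show "g differentiable at x" if "x \<in> U" for x using d[OF that] differentiable_def by blast
      show "Ck n U (\<lambda>x. frechet_derivative g (at x) b)" if "b \<in> Basis" for b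
        by (rule Suc.IH[of "\<lambda>x. frechet_derivative f (at x) b"]) (use Suc.prems e that in auto)
    qed
  qed
  from this[of f g] this[of g f] show ?thesis using assms by auto
qed

lemma Ck_SucI:
  assumes "open U" "\<And>x. x \<in> U \<Longrightarrow> (f has_derivative f' x) (at x)" "\<And>b. b \<in> Basis \<Longrightarrow> Ck n U (\<lambda>x. f' x b)"
  shows "Ck (Suc n) U f"
  unfolding Ck.simps
proof (intro conjI ballI)
  show "f differentiable at x" if "x \<in> U" for x using assms(2)[OF that] differentiable_def by blast
  fix b :: 'a assume b: "b \<in> Basis"
  have "frechet_derivative f (at x) = f' x" if "x \<in> U" for x using frechet_derivative_at[OF assms(2)[OF that]] by simp
  then show "Ck n U (\<lambda>x. frechet_derivative f (at x) b)"
    using Ck_cong[OF assms(1), of "\<lambda>x. frechet_derivative f (at x) b" "\<lambda>x. f' x b"] assms(3)[OF b] by simp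
qed

lemma Ck_Suc_has_derivative: "Ck (Suc n) U f \<Longrightarrow> x \<in> U \<Longrightarrow> (f has_derivative frechet_derivative f (at x)) (at x)"
  by (simp add: frechet_derivative_works)

lemma Ck_continuous_on: "Ck n U f \<Longrightarrow> continuous_on U f"
  by (cases n) (auto intro!: continuous_at_imp_continuous_on differentiable_imp_continuous_within)

lemma Ck_SucD: "Ck (Suc n) U f \<Longrightarrow> Ck n U f"
proof (induction n arbitrary: f)
  case 0
  then show ?case using Ck_continuous_on[of "Suc 0" U f] by simp
next
  case (Suc n)
  then show ?case using Ck.simps(2) by blast
qed

lemma Ck_subset: "Ck n U f \<Longrightarrow> V \<subseteq> U \<Longrightarrow> Ck n V f"
  by (induction n arbitrary: f) (auto intro: continuous_on_subset)

text \<open>Smoothness is local. The trial functions are glued this way from a region where a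
  formula is smooth and a region where a cutoff vanishes.\<close>

lemma Ck_Un:
  assumes "open U" "open V" "Ck n U f" "Ck n V f"
  shows "Ck n (U \<union> V) f"
  using assms(3,4)
proof (induction n arbitrary: f)
  case 0
  then show ?case using assms(1,2) by (simp add: continuous_on_open_Un)
qed auto

lemma Ck_const [simp]: "Ck n U (\<lambda>x. c)"
  by (induction n arbitrary: c) (auto simp: frechet_derivative_const)

lemma Ck_add:
  assumes "open U" "Ck n U f" "Ck n U g"
  shows "Ck n U (\<lambda>x. f x + g x)"
  using assms(2,3)
proof (induction n arbitrary: f g)
  case 0
  then show ?case by (auto intro: continuous_intros)
next
  case (Suc n)
  show ?case
  proof (rule Ck_SucI[OF assms(1), where f'="\<lambda>x b. frechet_derivative f (at x) b + frechet_derivative g (at x) b"])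
    show "((\<lambda>x. f x + g x) has_derivative (\<lambda>b. frechet_derivative f (at x) b + frechet_derivative g (at x) b)) (at x)" if "x \<in> U" for x
      using that Suc.prems by (intro has_derivative_add Ck_Suc_has_derivative)
    show "Ck n U (\<lambda>x. frechet_derivative f (at x) b + frechet_derivative g (at x) b)" if "b \<in> Basis" for b
      using Suc.prems that by (intro Suc.IH) auto
  qed
qed

lemma Ck_mult:
  assumes "open U" "Ck n U f" "Ck n U g"
  shows "Ck n U (\<lambda>x. f x * g x)"
  using assms(2,3)
proof (induction n arbitrary: f g)
  case 0
  then show ?case by (auto intro: continuous_intros)
next
  case (Suc n)
  show ?case
  proof (rule Ck_SucI[OF assms(1), where f'="\<lambda>x b. f x * frechet_derivative g (at x) b + frechet_derivative f (at x) b * g x"])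
    show "((\<lambda>x. f x * g x) has_derivative (\<lambda>b. f x * frechet_derivative g (at x) b + frechet_derivative f (at x) b * g x)) (at x)" if "x \<in> U" for x
      using that Suc.prems by (intro has_derivative_mult Ck_Suc_has_derivative)
    show "Ck n U (\<lambda>x. f x * frechet_derivative g (at x) b + frechet_derivative f (at x) b * g x)" if "b \<in> Basis" for b
      using Suc.prems Suc.prems[THEN Ck_SucD] that by (intro Ck_add assms(1) Suc.IH) simp_all
  qed
qed

lemma Ck_sum:
  assumes "open U" "\<And>i. i \<in> I \<Longrightarrow> Ck n U (f i)"
  shows "Ck n U (\<lambda>x. \<Sum>i\<in>I. f i x)"
  using assms(2)
proof (induction I rule: infinite_finite_induct)
  case (insert i I)
  then show ?case by (simp add: Ck_add[OF assms(1)])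
qed auto

lemma Ck_minus: "open U \<Longrightarrow> Ck n U f \<Longrightarrow> Ck n U (\<lambda>x. - f x)"
  using Ck_mult[of U n "\<lambda>_. -1" f] by simp

lemma Ck_diff: "open U \<Longrightarrow> Ck n U f \<Longrightarrow> Ck n U g \<Longrightarrow> Ck n U (\<lambda>x. f x - g x)"
  using Ck_add[of U n f "\<lambda>x. - g x"] Ck_minus[of U n g] by simp

lemma Ck_bounded_linear:
  assumes "bounded_linear f"
  shows "Ck n UNIV f"
proof (cases n)
  case 0
  then show ?thesis using bounded_linear.continuous_on[OF assms continuous_on_id] by simp
next
  case (Suc m)
  show ?thesis unfolding Suc
    by (rule Ck_SucI[where f'="\<lambda>x. f"]) (auto intro: bounded_linear_imp_has_derivative assms)
qed

lemma Ck_inner [simp]: "Ck n UNIV (\<lambda>x. x \<bullet> b)"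
  by (intro Ck_bounded_linear bounded_linear_inner_left)

text \<open>The derivative of the composite at a basis vector b is a derivative of f in the
  direction L b, which need not be a basis vector; expanding L b in the basis returns to the partial
  derivatives that \<open>Ck\<close> speaks of.\<close>

lemma Ck_compose_affine:
  fixes f :: "'b::euclidean_space \<Rightarrow> real" and L :: "'a::euclidean_space \<Rightarrow> 'b"
  assumes L: "bounded_linear L" and U: "open U" and V: "\<And>x. x \<in> U \<Longrightarrow> L x + c \<in> V" and f: "Ck n V f"
  shows "Ck n U (\<lambda>x. f (L x + c))"
  using f
proof (induction n arbitrary: f)
  case 0
  have "continuous_on U (\<lambda>x. L x + c)" by (intro continuous_intros bounded_linear.continuous_on[OF L])
  with 0 show ?case using V by (auto intro!: continuous_on_compose2[of V f U])
next
  case (Suc n)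
  let ?D = "\<lambda>x. frechet_derivative f (at x)"
  show ?case
  proof (rule Ck_SucI[OF U, where f'="\<lambda>x b. ?D (L x + c) (L b)"])
    show "((\<lambda>x. f (L x + c)) has_derivative (\<lambda>b. ?D (L x + c) (L b))) (at x)" if "x \<in> U" for x
    proof (rule has_derivative_compose[where g=f])
      show "((\<lambda>x. L x + c) has_derivative L) (at x)"
        using has_derivative_add[OF bounded_linear_imp_has_derivative[OF L] has_derivative_const] by simp
      show "(f has_derivative ?D (L x + c)) (at (L x + c))"
        using Suc.prems V[OF that] by (rule Ck_Suc_has_derivative)
    qed
    fix b :: 'a assume "b \<in> Basis"
    have lin: "?D (L x + c) (L b) = (\<Sum>j\<in>Basis. (L b \<bullet> j) * ?D (L x + c) j)" if "x \<in> U" for x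
    proof -
      have l: "linear (?D (L x + c))" using Suc.prems V[OF that] by (simp add: linear_frechet_derivative)
      have "?D (L x + c) (L b) = ?D (L x + c) (\<Sum>j\<in>Basis. (L b \<bullet> j) *\<^sub>R j)" by (simp add: euclidean_representation)
      also have "\<dots> = (\<Sum>j\<in>Basis. (L b \<bullet> j) * ?D (L x + c) j)" using l by (simp add: linear_sum linear_cmul)
      finally show ?thesis .
    qed
    have "Ck n U (\<lambda>x. \<Sum>j\<in>Basis. (L b \<bullet> j) * ?D (L x + c) j)"
      using Suc.prems by (intro Ck_sum Ck_mult U Ck_const Suc.IH) auto
    then show "Ck n U (\<lambda>x. ?D (L x + c) (L b))"
      using Ck_cong[OF U lin] by simp
  qed
qed

lemma Ck_compose:
  fixes g :: "real \<Rightarrow> real" and f :: "'a::euclidean_space \<Rightarrow> real"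
  assumes U: "open U" and V: "\<And>x. x \<in> U \<Longrightarrow> f x \<in> V" and "Ck n V g" "Ck n U f"
  shows "Ck n U (\<lambda>x. g (f x))"
  using assms(3,4)
proof (induction n arbitrary: g)
  case 0
  then show ?case using V by (auto intro!: continuous_on_compose2[of V g U])
next
  case (Suc n)
  let ?D = "\<lambda>y. frechet_derivative g (at y)" and ?F = "\<lambda>x. frechet_derivative f (at x)"
  show ?case
  proof (rule Ck_SucI[OF U, where f'="\<lambda>x b. ?D (f x) 1 * ?F x b"])
    show "((\<lambda>x. g (f x)) has_derivative (\<lambda>b. ?D (f x) 1 * ?F x b)) (at x)" if x: "x \<in> U" for x
    proof -
      have g: "(g has_derivative ?D (f x)) (at (f x))" using Suc.prems(1) V[OF x] by (rule Ck_Suc_has_derivative)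
      have "linear (?D (f x))" using g has_derivative_linear by blast
      then have "?D (f x) h = ?D (f x) 1 * h" for h using linear_cmul[of "?D (f x)" h 1] by simp
      then have "(\<lambda>b. ?D (f x) 1 * ?F x b) = (\<lambda>b. ?D (f x) (?F x b))" by metis
      then show ?thesis
        using has_derivative_compose[OF Ck_Suc_has_derivative[OF Suc.prems(2) x] g] by simp
    qed
    show "Ck n U (\<lambda>x. ?D (f x) 1 * ?F x b)" if "b \<in> Basis" for b
    proof (rule Ck_mult[OF U])
      have "Ck n V (\<lambda>y. ?D y 1)" using Suc.prems(1) by simp
      then show "Ck n U (\<lambda>x. ?D (f x) 1)" using Ck_SucD[OF Suc.prems(2)] by (rule Suc.IH)
      show "Ck n U (\<lambda>x. ?F x b)" using Suc.prems(2) that by simp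
    qed
  qed
qed

lemma Ck_real_SucI:
  fixes f :: "real \<Rightarrow> real"
  assumes "open U" "\<And>x. x \<in> U \<Longrightarrow> (f has_real_derivative f' x) (at x)" "Ck n U f'"
  shows "Ck (Suc n) U f"
  using assms by (intro Ck_SucI[where f'="\<lambda>x h. f' x * h"]) (auto simp: has_field_derivative_def)

lemma Ck_exp: "Ck n UNIV (exp :: real \<Rightarrow> real)"
proof (induction n)
  case (Suc n)
  then show ?case by (intro Ck_real_SucI[where f'=exp]) (auto intro!: derivative_eq_intros)
qed (simp add: continuous_on_exp continuous_on_id)

lemma Ck_inverse: "Ck n (- {0}) (inverse :: real \<Rightarrow> real)"
proof (induction n)
  case 0
  show ?case by (auto intro!: continuous_intros)
next
  case (Suc n)
  show ?case
  proof (rule Ck_real_SucI[where f'="\<lambda>x. - (inverse x * inverse x)"])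
    show "Ck n (- {0}) (\<lambda>x::real. - (inverse x * inverse x))" by (intro Ck_minus Ck_mult Suc) auto
  qed (auto intro!: derivative_eq_intros)
qed

lemma Ck_ln: "Ck n {0<..} (ln :: real \<Rightarrow> real)"
proof (cases n)
  case 0
  then show ?thesis by (auto intro!: continuous_intros)
next
  case (Suc m)
  show ?thesis unfolding Suc
    by (rule Ck_real_SucI[where f'=inverse])
       (auto intro!: derivative_eq_intros Ck_subset[OF Ck_inverse] simp: divide_inverse)
qed

lemma Ck_powr: "Ck n {0<..} (\<lambda>x::real. x powr a)"
proof -
  have "Ck n {0<..} (\<lambda>x::real. exp (a * ln x))"
    by (rule Ck_compose[where V=UNIV]) (auto intro!: Ck_exp Ck_mult Ck_ln)
  then show ?thesis by (subst Ck_cong[where g="\<lambda>x. exp (a * ln x)"]) (auto simp: powr_def)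
qed

lemma Ck_sqrt: "Ck n {0<..} sqrt"
  using Ck_powr[of n "1/2"] by (subst Ck_cong[where g="\<lambda>x. x powr (1/2)"]) (auto simp: powr_half_sqrt)

lemma Ck_norm_power2: "Ck n UNIV (\<lambda>x::'a::euclidean_space. (norm x)\<^sup>2)"
proof -
  have "Ck n UNIV (\<lambda>x::'a. \<Sum>j\<in>Basis. (x \<bullet> j) * (x \<bullet> j))"
    by (rule Ck_sum[OF open_UNIV Ck_mult[OF open_UNIV Ck_inner Ck_inner]])
  moreover have "(\<lambda>x::'a. \<Sum>j\<in>Basis. (x \<bullet> j) * (x \<bullet> j)) = (\<lambda>x. (norm x)\<^sup>2)"
    unfolding power2_norm_eq_inner fun_eq_iff using euclidean_inner by metis
  ultimately show ?thesis by simp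
qed

text \<open>For the converse the witness family is the set of all functions that are
  \<open>Ck\<close> of every order; it is closed under partial derivatives by construction.\<close>

lemma smooth_fun_iff_Ck: "smooth_fun f \<longleftrightarrow> (\<forall>n. Ck n UNIV f)"
proof
  assume "smooth_fun f"
  then obtain F where F: "f \<in> F" "\<And>g. g \<in> F \<Longrightarrow> (\<forall>x. g differentiable (at x)) \<and> continuous_on UNIV g \<and>
        (\<forall>b\<in>Basis. (\<lambda>x. frechet_derivative g (at x) b) \<in> F)"
    unfolding smooth_fun_def by blast
  have "Ck n UNIV g" if "g \<in> F" for n g
    using that by (induction n arbitrary: g) (use F(2) in auto)
  then show "\<forall>n. Ck n UNIV f" using F(1) by blast
next
  assume f: "\<forall>n. Ck n UNIV f"
  show "smooth_fun f"
    unfolding smooth_fun_def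
  proof (intro exI[of _ "{f. \<forall>n. Ck n UNIV f}"] conjI ballI allI)
    fix g :: "'a \<Rightarrow> real" and x b :: 'a assume g: "g \<in> {f. \<forall>n. Ck n UNIV f}"
    then have "Ck (Suc n) UNIV g" for n by blast
    then show "continuous_on UNIV g" by (rule Ck_continuous_on)
    from \<open>\<And>n. Ck (Suc n) UNIV g\<close> show "g differentiable at x" 
       "b \<in> Basis \<Longrightarrow> (\<lambda>x. frechet_derivative g (at x) b) \<in> {f. \<forall>n. Ck n UNIV f}"
      by auto
  qed (use f in auto)
qed

lemma Cc_infI:
  assumes "\<And>n. Ck n UNIV \<psi>" "compact K" "K \<subseteq> \<Omega>" "\<And>x. x \<notin> K \<Longrightarrow> \<psi> x = 0"
  shows "\<psi> \<in> Cc_inf \<Omega>"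
proof -
  have "tsupp \<psi> \<subseteq> K" unfolding tsupp_def
    using assms(4) by (intro closure_minimal compact_imp_closed assms(2)) auto
  moreover have "closed (tsupp \<psi>)" by (simp add: tsupp_def)
  ultimately have "compact (tsupp \<psi>)" using assms(2) by (metis compact_Int_closed inf.absorb_iff2 inf_commute)
  then show ?thesis
    using assms \<open>tsupp \<psi> \<subseteq> K\<close> by (auto simp: Cc_inf_def smooth_fun_iff_Ck)
qed

lemma Cc_infD:
  assumes "\<psi> \<in> Cc_inf \<Omega>"
  shows "Ck n UNIV \<psi>" "compact (tsupp \<psi>)" "tsupp \<psi> \<subseteq> \<Omega>" "x \<notin> tsupp \<psi> \<Longrightarrow> \<psi> x = 0"
    "\<psi> differentiable (at x)" "continuous_on UNIV \<psi>"
proof -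
  show "Ck n UNIV \<psi>" for n using assms by (simp add: Cc_inf_def smooth_fun_iff_Ck)
  from this[of "Suc 0"] show "\<psi> differentiable (at x)" by simp
  show "continuous_on UNIV \<psi>" using \<open>Ck 0 UNIV \<psi>\<close> by simp
  show "compact (tsupp \<psi>)" "tsupp \<psi> \<subseteq> \<Omega>" using assms by (auto simp: Cc_inf_def)
  show "x \<notin> tsupp \<psi> \<Longrightarrow> \<psi> x = 0" using closure_subset[of "{x. \<psi> x \<noteq> 0}"] by (auto simp: tsupp_def)
qed

lemma Cc_inf_scale:
  assumes "\<psi> \<in> Cc_inf \<Omega>" shows "(\<lambda>x. c * \<psi> x) \<in> Cc_inf \<Omega>"
proof (rule Cc_infI[where K="tsupp \<psi>"])
  show "Ck n UNIV (\<lambda>x. c * \<psi> x)" for n by (rule Ck_mult[OF open_UNIV Ck_const Cc_infD(1)[OF assms]])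
qed (use Cc_infD[OF assms] in auto)

subsection \<open>Cutoff functions\<close>

text \<open>For k = 0 the classical flat function. The powers of 1/x are carried along because
  derivatives of members are linear combinations of members of the family, which makes smoothness a
  one-line induction.\<close>

definition flat_exp :: "nat \<Rightarrow> real \<Rightarrow> real" where
  "flat_exp k x = (if x \<le> 0 then 0 else inverse x ^ k * exp (- inverse x))"

lemma flat_exp_tendsto_0: "((\<lambda>x. inverse x ^ k * exp (- inverse x)) \<longlongrightarrow> (0::real)) (at_right 0)"
proof -
  have "((\<lambda>y::real. y ^ k / exp y) \<longlongrightarrow> 0) at_top" by (rule tendsto_power_div_exp_0)
  then have "((\<lambda>x. inverse x ^ k / exp (inverse x)) \<longlongrightarrow> (0::real)) (at_right 0)"
    by (rule filterlim_compose[OF _ filterlim_inverse_at_top_right])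
  then show ?thesis by (simp add: exp_minus divide_inverse)
qed

lemma flat_exp_has_derivative:
  "(flat_exp k has_real_derivative (- real k * flat_exp (Suc k) x + flat_exp (Suc (Suc k)) x)) (at x)"
proof -
  consider "x < 0" | "x = 0" | "x > 0" by linarith
  then show ?thesis
  proof cases
    case 1
    have "\<forall>\<^sub>F y in nhds x. flat_exp k y = 0"
      using eventually_nhds_in_open[of "{..<0}" x] 1 by (auto elim!: eventually_mono simp: flat_exp_def)
    then have "(flat_exp k has_real_derivative 0) (at x)"
      by (subst DERIV_cong_ev[OF refl _ refl, of _ "\<lambda>_. 0"]) auto
    then show ?thesis using 1 by (simp add: flat_exp_def)
  next
    case 2
    \<comment> \<open>From the right the difference quotient is the formula with k + 1 in place of
      k, which tends to 0; from the left it is identically 0.\<close>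
    have "((\<lambda>h. (flat_exp k (0 + h) - flat_exp k 0) / h) \<longlongrightarrow> 0) (at 0)"
    proof (rule filterlim_split_at)
      show "((\<lambda>h. (flat_exp k (0 + h) - flat_exp k 0) / h) \<longlongrightarrow> 0) (at_left 0)"
        by (rule tendsto_eventually) (auto simp: flat_exp_def eventually_at_filter)
      have "\<forall>\<^sub>F h in at_right 0. inverse h ^ Suc k * exp (- inverse h) = (flat_exp k (0 + h) - flat_exp k 0) / h"
        by (auto simp: flat_exp_def eventually_at_filter divide_inverse)
      then show "((\<lambda>h. (flat_exp k (0 + h) - flat_exp k 0) / h) \<longlongrightarrow> 0) (at_right 0)"
        by (rule Lim_transform_eventually[OF flat_exp_tendsto_0])
    qed
    then show ?thesis using 2 by (simp add: DERIV_def flat_exp_def)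
  next
    case 3
    have "((\<lambda>x. inverse x ^ k * exp (- inverse x)) has_real_derivative
         (- real k * (inverse x ^ Suc k * exp (- inverse x)) + inverse x ^ Suc (Suc k) * exp (- inverse x))) (at x)"
    proof -
      have 1: "(inverse has_real_derivative - (inverse x * inverse x)) (at x)"
        using 3 by (auto intro!: derivative_eq_intros)
      have "((\<lambda>x. inverse x ^ k) has_real_derivative real k * inverse x ^ (k - Suc 0) * - (inverse x * inverse x)) (at x)"
        using DERIV_power[OF 1, of k] by (simp add: ac_simps)
      moreover have "real k * inverse x ^ (k - Suc 0) * - (inverse x * inverse x) = - real k * inverse x ^ Suc k"
        by (cases k) (simp_all add: algebra_simps)
      ultimately have 2: "((\<lambda>x. inverse x ^ k) has_real_derivative - real k * inverse x ^ Suc k) (at x)" by metis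
      have "((\<lambda>x. exp (- inverse x)) has_real_derivative exp (- inverse x) * (inverse x * inverse x)) (at x)"
        using 3 by (auto intro!: derivative_eq_intros)
      from DERIV_mult[OF 2 this] show ?thesis by (simp add: algebra_simps)
    qed
    moreover have "\<forall>\<^sub>F y in nhds x. inverse y ^ k * exp (- inverse y) = flat_exp k y"
      using eventually_nhds_in_open[of "{0<..}" x] 3 by (auto elim!: eventually_mono simp: flat_exp_def)
    ultimately show ?thesis using 3
      by (subst DERIV_cong_ev[OF refl _ refl, of _ "\<lambda>x. inverse x ^ k * exp (- inverse x)"])
         (auto simp: flat_exp_def elim: eventually_mono)
  qed
qed

lemma Ck_flat_exp: "Ck n UNIV (flat_exp k)"
proof (induction n arbitrary: k)
  case 0
  have "continuous_on UNIV (flat_exp k)"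
    using flat_exp_has_derivative[of k] by (intro continuous_at_imp_continuous_on) (auto intro: DERIV_isCont)
  then show ?case by simp
next
  case (Suc n)
  have "Ck n UNIV (\<lambda>x. - real k * flat_exp (Suc k) x + flat_exp (Suc (Suc k)) x)"
    by (intro Ck_add Ck_mult Ck_const Suc open_UNIV)
  then show ?case
    using flat_exp_has_derivative[of k] by (intro Ck_real_SucI[where f'="\<lambda>x. - real k * flat_exp (Suc k) x + flat_exp (Suc (Suc k)) x"]) auto
qed

definition smooth_step :: "real \<Rightarrow> real" where
  "smooth_step x = flat_exp 0 x / (flat_exp 0 x + flat_exp 0 (1 - x))"

lemma flat_exp_nonneg: "flat_exp k x \<ge> 0" and flat_exp_pos: "x > 0 \<Longrightarrow> flat_exp k x > 0"
  and flat_exp_zero: "x \<le> 0 \<Longrightarrow> flat_exp k x = 0"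
  by (auto simp: flat_exp_def)

lemma flat_exp_mono: "u \<le> v \<Longrightarrow> flat_exp 0 u \<le> flat_exp 0 v"
  unfolding flat_exp_def by (cases "u \<le> 0") (simp_all add: le_imp_inverse_le)

lemma smooth_step_denominator: "flat_exp 0 x + flat_exp 0 (1 - x) > 0"
  using flat_exp_nonneg[of 0 x] flat_exp_nonneg[of 0 "1-x"] flat_exp_pos[of x 0] flat_exp_pos[of "1-x" 0]
  by (cases "x > 0") linarith+

lemma Ck_smooth_step: "Ck n UNIV smooth_step"
proof -
  have m: "Ck n UNIV (\<lambda>x::real. flat_exp 0 (- x + 1))"
    by (rule Ck_compose_affine[OF bounded_linear_minus[OF bounded_linear_ident] open_UNIV UNIV_I Ck_flat_exp])
  have d: "flat_exp 0 x + flat_exp 0 (- x + 1) \<in> - {0}" for x using smooth_step_denominator[of x] by simp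
  have "Ck n UNIV (\<lambda>x. inverse (flat_exp 0 x + flat_exp 0 (- x + 1)))"
    by (rule Ck_compose[OF open_UNIV d Ck_inverse Ck_add[OF open_UNIV Ck_flat_exp m]])
  then have "Ck n UNIV (\<lambda>x. flat_exp 0 x * inverse (flat_exp 0 x + flat_exp 0 ((- x) + 1)))"
    by (rule Ck_mult[OF open_UNIV Ck_flat_exp])
  moreover have "smooth_step = (\<lambda>x. flat_exp 0 x * inverse (flat_exp 0 x + flat_exp 0 ((- x) + 1)))"
    by (auto simp: smooth_step_def divide_inverse fun_eq_iff)
  ultimately show ?thesis by simp
qed

lemma smooth_step_bounds: "0 \<le> smooth_step x" "smooth_step x \<le> 1"
  using smooth_step_denominator[of x] flat_exp_nonneg[of 0 x] flat_exp_nonneg[of 0 "1-x"]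
  by (auto simp: smooth_step_def divide_le_eq_1)

lemma smooth_step_eq: "x \<le> 0 \<Longrightarrow> smooth_step x = 0" "x \<ge> 1 \<Longrightarrow> smooth_step x = 1"
  using flat_exp_pos[of x 0] by (auto simp: smooth_step_def flat_exp_zero)

lemma smooth_step_mono: "mono smooth_step"
proof (rule monoI)
  fix x y :: real assume "x \<le> y"
  have "flat_exp 0 x * flat_exp 0 (1 - y) \<le> flat_exp 0 y * flat_exp 0 (1 - x)"
    using \<open>x \<le> y\<close> by (intro mult_mono flat_exp_mono flat_exp_nonneg) auto
  then show "smooth_step x \<le> smooth_step y"
    unfolding smooth_step_def using smooth_step_denominator[of x] smooth_step_denominator[of y]
    by (simp add: frac_le_eq divide_le_eq mult_nonneg_nonneg pos_divide_le_eq pos_le_divide_eq field_simps)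
qed

subsection \<open>The one-dimensional Sobolev inequality\<close>

lemma powr_above_tangent:
  fixes x r :: real
  assumes "x \<ge> 0" "r \<ge> 1"
  shows "r * x - (r - 1) \<le> x powr r"
proof (cases "x = 0")
  case False
  then have x: "x > 0" using assms by simp
  have "x powr r - 1 powr r \<ge> (r * 1 powr (r - 1)) * (x - 1)"
  proof (rule convex_on_imp_above_tangent[where A="{0<..}"])
    show "convex_on {0<..} (\<lambda>x. x powr r)" using assms(2) by (rule powr_convex)
    show "((\<lambda>x. x powr r) has_real_derivative r * 1 powr (r - 1)) (at 1 within {0<..})"
      by (auto intro!: derivative_eq_intros)
  qed (use x in \<open>auto simp: interior_open\<close>)
  then show ?thesis by (simp add: algebra_simps)
qed (use assms in simp)

text \<open>The tangent at 1 of the convex function x^r, made homogeneous through x = A/B: the graph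
  of A^r lies above its tangent at B, with equality at A = B.\<close>

lemma powr_Young_tangent:
  fixes A B r :: real
  assumes "A \<ge> 0" "B > 0" "r \<ge> 1"
  shows "r * B powr (r - 1) * A - (r - 1) * B powr r \<le> A powr r"
proof -
  have "B powr r * (r * (A / B) - (r - 1)) \<le> B powr r * (A / B) powr r"
    using assms by (intro mult_left_mono powr_above_tangent) auto
  also have "\<dots> = A powr r" using assms by (simp add: powr_divide)
  also have "B powr r * (r * (A / B) - (r - 1)) = r * (B powr r / B) * A - (r - 1) * B powr r"
    by (simp add: algebra_simps)
  also have "B powr r / B = B powr (r - 1)" using assms by (simp add: powr_diff)
  finally show ?thesis .
qed

lemma smooth_real_deriv:
  fixes u :: "real \<Rightarrow> real"
  assumes "\<And>n. Ck n UNIV u"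
  shows "(u has_real_derivative deriv u t) (at t)" "continuous_on UNIV u" "continuous_on UNIV (deriv u)"
    "deriv u = (\<lambda>t. frechet_derivative u (at t) 1)"
proof -
  have d: "u differentiable (at t)" for t using assms[of "Suc 0"] by simp
  show 1: "(u has_real_derivative deriv u t) (at t)" for t
    using d[of t] by (simp add: DERIV_deriv_iff_real_differentiable)
  show 2: "deriv u = (\<lambda>t. frechet_derivative u (at t) 1)"
  proof
    fix t
    have "(u has_derivative (*) (deriv u t)) (at t)" using 1[of t] by (simp add: has_field_derivative_def)
    from frechet_derivative_at[OF this] have "frechet_derivative u (at t) = (*) (deriv u t)" by simp
    then show "deriv u t = frechet_derivative u (at t) 1" by simp
  qed
  show "continuous_on UNIV u" using Ck_continuous_on[OF assms] .
  have "Ck 0 UNIV (\<lambda>t. frechet_derivative u (at t) 1)" using assms[of "Suc 0"] by simp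
  then show "continuous_on UNIV (deriv u)" unfolding 2 by simp
qed

lemma continuous_on_abs_powr:
  fixes f :: "'a::topological_space \<Rightarrow> real"
  assumes "continuous_on S f" "r > 0"
  shows "continuous_on S (\<lambda>x. \<bar>f x\<bar> powr r)"
  using assms by (intro continuous_on_powr' continuous_intros) auto

lemma pi_pq_le:
  assumes "v \<in> Cc_inf {0<..<1::real}" "(integral {0<..<1} (\<lambda>x. \<bar>v x\<bar> powr q)) powr (1/q) = 1"
  shows "pi_pq p q \<le> (integral {0<..<1} (\<lambda>x. \<bar>deriv v x\<bar> powr p)) powr (1/p)"
  unfolding pi_pq_def by (rule cInf_lower) (use assms in \<open>auto intro!: bdd_belowI[of _ 0]\<close>)

text \<open>The homogeneous form of the definition: a function of positive mass S is multiplied by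
  S^(-1/q) to become a competitor. Nonnegativity of the infimum is a premise here because it permits
  raising the bound to the power p.\<close>

lemma pi_pq_Sobolev:
  assumes v: "v \<in> Cc_inf {0<..<1::real}" and pq: "1 \<le> q" "q < p" and \<pi>: "0 \<le> pi_pq p q"
  shows "pi_pq p q powr p * (integral {0..1} (\<lambda>x. \<bar>v x\<bar> powr q)) powr (p / q) \<le> integral {0..1} (\<lambda>x. \<bar>deriv v x\<bar> powr p)"
proof -
  let ?S = "integral {0..1} (\<lambda>x. \<bar>v x\<bar> powr q)" and ?E = "integral {0..1} (\<lambda>x. \<bar>deriv v x\<bar> powr p)"
  note sm = Cc_infD(1)[OF v]
  have p0: "p > 0" "q > 0" using pq by auto
  have "continuous_on {0..1} (\<lambda>x. \<bar>v x\<bar> powr q)" "continuous_on {0..1} (\<lambda>x. \<bar>deriv v x\<bar> powr p)"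
    using smooth_real_deriv(2,3)[OF sm] p0 by (auto intro!: continuous_on_abs_powr intro: continuous_on_subset)
  then have int: "(\<lambda>x. \<bar>v x\<bar> powr q) integrable_on {0..1}" "(\<lambda>x. \<bar>deriv v x\<bar> powr p) integrable_on {0..1}"
    by (auto intro: integrable_continuous_real)
  have S0: "?S \<ge> 0" and E0: "?E \<ge> 0" using int by (auto intro!: integral_nonneg)
  show ?thesis
  proof (cases "?S = 0")
    case False
    then have S: "?S > 0" using S0 by simp
    define k where "k = ?S powr (- 1 / q)"
    have k: "k > 0" using S by (simp add: k_def)
    define w where "w x = k * v x" for x
    have w: "w \<in> Cc_inf {0<..<1}" unfolding w_def by (rule Cc_inf_scale[OF v])
    have dw: "deriv w x = k * deriv v x" for x
      unfolding w_def using smooth_real_deriv(1)[OF sm, of x] by (intro DERIV_imp_deriv) (auto intro!: derivative_eq_intros)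
    have "integral {0<..<1} (\<lambda>x. \<bar>w x\<bar> powr q) = k powr q * ?S"
      using k by (simp add: integral_open_interval_real w_def abs_mult powr_mult)
    also have "k powr q = ?S powr (- 1)" using p0 by (simp add: k_def powr_powr)
    also have "?S powr (- 1) = 1 / ?S" using S by (simp add: powr_minus divide_inverse)
    finally have n1: "(integral {0<..<1} (\<lambda>x. \<bar>w x\<bar> powr q)) powr (1/q) = 1" using S by simp
    have "integral {0<..<1} (\<lambda>x. \<bar>deriv w x\<bar> powr p) = k powr p * ?E"
      using k by (simp add: integral_open_interval_real dw abs_mult powr_mult)
    then have "pi_pq p q \<le> (k powr p * ?E) powr (1/p)" using pi_pq_le[OF w n1, of p] by simp
    then have "pi_pq p q powr p \<le> ((k powr p * ?E) powr (1/p)) powr p"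
      using \<pi> p0 by (intro powr_mono2) auto
    also have "\<dots> = k powr p * ?E" using p0 k E0 by (simp add: powr_powr)
    also have "k powr p = ?S powr (- (p / q))" by (simp add: k_def powr_powr)
    finally have "pi_pq p q powr p * ?S powr (p / q) \<le> (?S powr (- (p / q)) * ?E) * ?S powr (p / q)"
      by (intro mult_right_mono) auto
    also have "\<dots> = ?E" using S by (simp add: powr_minus)
    finally show ?thesis .
  qed (use E0 in simp)
qed

text \<open>Reflecting \<open>u\<close> at \<open>h\<close> by the smooth fold \<open>fold_map\<close> of \<open>{0..1}\<close> onto an interval ending at \<open>h - \<kappa>\<close>
  keeps the competitor smooth.\<close>
definition fold_map :: "real \<Rightarrow> real \<Rightarrow> real \<Rightarrow> real" where
  "fold_map h \<kappa> x = h - sqrt (h\<^sup>2 * (2 * x - 1)\<^sup>2 + \<kappa>\<^sup>2)"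

definition fold_map' :: "real \<Rightarrow> real \<Rightarrow> real \<Rightarrow> real" where
  "fold_map' h \<kappa> x = 2 * h\<^sup>2 * (1 - 2 * x) / sqrt (h\<^sup>2 * (2 * x - 1)\<^sup>2 + \<kappa>\<^sup>2)"

context
  fixes h \<kappa> :: real
  assumes h\<kappa>: "h > 0" "\<kappa> > 0"
begin

lemma fold_map_arg_pos: "h\<^sup>2 * (2 * x - 1)\<^sup>2 + \<kappa>\<^sup>2 > 0"
  using h\<kappa> by (intro add_nonneg_pos) auto

lemma fold_map_has_derivative: "(fold_map h \<kappa> has_real_derivative fold_map' h \<kappa> x) (at x within S)"
proof -
  have s: "sqrt (h\<^sup>2 * (2 * x - 1)\<^sup>2 + \<kappa>\<^sup>2) > 0" using fold_map_arg_pos by simp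
  have "((\<lambda>x. h - sqrt (h\<^sup>2 * (2 * x - 1)\<^sup>2 + \<kappa>\<^sup>2)) has_real_derivative
     0 - (h\<^sup>2 * (2 * (2 * x - 1) * 2)) * (inverse (sqrt (h\<^sup>2 * (2 * x - 1)\<^sup>2 + \<kappa>\<^sup>2)) / 2)) (at x within S)"
    using fold_map_arg_pos[of x]
    by (auto intro!: derivative_eq_intros DERIV_real_sqrt[THEN DERIV_chain2] simp: power2_eq_square)
  moreover have "0 - (h\<^sup>2 * (2 * (2 * x - 1) * 2)) * (inverse (sqrt (h\<^sup>2 * (2 * x - 1)\<^sup>2 + \<kappa>\<^sup>2)) / 2) = fold_map' h \<kappa> x"
    using s by (simp add: fold_map'_def field_simps)
  ultimately show ?thesis unfolding fold_map_def[abs_def] by simp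
qed

text \<open>2h is the slope of the unsmoothed fold h - h |2x - 1|; smoothing the absolute value only
  flattens it.\<close>

lemma fold_map'_bound: "\<bar>fold_map' h \<kappa> x\<bar> \<le> 2 * h"
proof -
  let ?s = "sqrt (h\<^sup>2 * (2 * x - 1)\<^sup>2 + \<kappa>\<^sup>2)"
  have s: "?s > 0" using fold_map_arg_pos by simp
  have "h * \<bar>2 * x - 1\<bar> = sqrt ((h * (2 * x - 1))\<^sup>2)" using h\<kappa> by (simp add: abs_mult)
  also have "\<dots> \<le> ?s" by (rule real_sqrt_le_mono) (simp add: power_mult_distrib)
  finally have "2 * h * (h * \<bar>2 * x - 1\<bar>) \<le> 2 * h * ?s" using h\<kappa> by (intro mult_left_mono) auto
  moreover have "\<bar>fold_map' h \<kappa> x\<bar> = 2 * h * (h * \<bar>2 * x - 1\<bar>) / ?s"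
    using s h\<kappa> by (simp add: fold_map'_def abs_mult power2_eq_square abs_minus_commute)
  ultimately show ?thesis using s by (simp add: pos_divide_le_eq)
qed

lemma Ck_fold_map: "Ck n UNIV (fold_map h \<kappa>)"
proof -
  have i: "Ck n UNIV (\<lambda>x::real. x)" by (rule Ck_bounded_linear[OF bounded_linear_ident])
  have l: "Ck n UNIV (\<lambda>x::real. 2 * x - 1)" by (rule Ck_diff[OF open_UNIV Ck_mult[OF open_UNIV Ck_const i] Ck_const])
  have "Ck n UNIV (\<lambda>x::real. h\<^sup>2 * ((2 * x - 1) * (2 * x - 1)) + \<kappa>\<^sup>2)"
    by (rule Ck_add[OF open_UNIV Ck_mult[OF open_UNIV Ck_const Ck_mult[OF open_UNIV l l]] Ck_const])
  then have a: "Ck n UNIV (\<lambda>x::real. h\<^sup>2 * (2 * x - 1)\<^sup>2 + \<kappa>\<^sup>2)" by (simp add: power2_eq_square)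
  have "Ck n UNIV (\<lambda>x. sqrt (h\<^sup>2 * (2 * x - 1)\<^sup>2 + \<kappa>\<^sup>2))"
    by (rule Ck_compose[OF open_UNIV _ Ck_sqrt a]) (use fold_map_arg_pos in simp)
  from Ck_diff[OF open_UNIV Ck_const this] show ?thesis unfolding fold_map_def[abs_def] .
qed

lemma fold_map_symmetric: "fold_map h \<kappa> (1 - x) = fold_map h \<kappa> x" "fold_map' h \<kappa> (1 - x) = - fold_map' h \<kappa> x"
proof -
  have "(2 * (1 - x) - 1)\<^sup>2 = (2 * x - 1)\<^sup>2" by (simp add: power2_eq_square algebra_simps)
  then show "fold_map h \<kappa> (1 - x) = fold_map h \<kappa> x" "fold_map' h \<kappa> (1 - x) = - fold_map' h \<kappa> x"
    by (auto simp: fold_map_def fold_map'_def minus_divide_left[symmetric] algebra_simps minus_divide_left)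
qed

lemma integral_symmetric_unit_interval:
  fixes f :: "real \<Rightarrow> real"
  assumes "continuous_on UNIV f" "\<And>x. f (1 - x) = f x"
  shows "integral {0..1} f = 2 * integral {0..1/2} f"
proof -
  have int: "f integrable_on {a..b}" for a b using assms(1) by (intro integrable_continuous_real) (auto intro: continuous_on_subset)
  have "((\<lambda>x. (-1) *\<^sub>R f (1 - x)) has_integral (integral {1 - 1/2..1 - 1} f - integral {1 - 1..1 - 1/2} f)) {1/2..1}"
    by (rule has_integral_substitution_general[where c=0 and d=1 and s="{}" and g="\<lambda>x. 1 - x"])
       (auto intro!: derivative_eq_intros continuous_intros intro: continuous_on_subset[OF assms(1)])
  then have "((\<lambda>x. - f x) has_integral - integral {0..1/2} f) {1/2..1}" using assms(2) by simp
  from has_integral_neg[OF this] have "(f has_integral integral {0..1/2} f) {1/2..1}" by simp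
  then have "integral {1/2..1} f = integral {0..1/2} f" by (rule integral_unique)
  then show ?thesis using Henstock_Kurzweil_Integration.integral_combine[of 0 "1/2" 1 f] int by simp
qed

text \<open>On the left half the fold increases from a value at most 0 up to h - \<kappa>. The
  stretch below 0 contributes nothing since F vanishes there.\<close>

lemma fold_map_substitution:
  fixes F :: "real \<Rightarrow> real"
  assumes "continuous_on UNIV F" "\<And>t. t \<le> 0 \<Longrightarrow> F t = 0" "\<kappa> < h"
  shows "((\<lambda>x. fold_map' h \<kappa> x * F (fold_map h \<kappa> x)) has_integral integral {0..h - \<kappa>} F) {0..1/2}"
proof -
  let ?G = "fold_map h \<kappa>"
  have e: "?G (1/2) = h - \<kappa>" using h\<kappa> by (simp add: fold_map_def)
  have "sqrt (h\<^sup>2) \<le> sqrt (h\<^sup>2 + \<kappa>\<^sup>2)" by (rule real_sqrt_le_mono) simp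
  then have e0: "?G 0 \<le> 0" using h\<kappa> by (simp add: fold_map_def)
  have int: "F integrable_on {a..b}" for a b using assms(1) by (intro integrable_continuous_real) (auto intro: continuous_on_subset)
  have "((\<lambda>x. fold_map' h \<kappa> x *\<^sub>R F (?G x)) has_integral (integral {?G 0..?G (1/2)} F - integral {?G (1/2)..?G 0} F)) {0..1/2}"
  proof (rule has_integral_substitution_general[where c="- \<bar>?G 0\<bar> - h" and d="h" and s="{}"])
    show "continuous_on {0..1/2} ?G"
      by (rule DERIV_continuous_on[OF fold_map_has_derivative])
    show "?G ` {0..1/2} \<subseteq> {- \<bar>?G 0\<bar> - h..h}"
    proof
      fix y assume "y \<in> ?G ` {0..1/2}"
      then obtain x where x: "0 \<le> x" "x \<le> 1/2" "y = ?G x" by auto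
      have "h\<^sup>2 * (2 * x - 1)\<^sup>2 \<le> h\<^sup>2 * 1" using x by (intro mult_left_mono) (auto simp: abs_square_le_1)
      then have "sqrt (h\<^sup>2 * (2 * x - 1)\<^sup>2 + \<kappa>\<^sup>2) \<le> sqrt (h\<^sup>2 + \<kappa>\<^sup>2)" by (intro real_sqrt_le_mono) simp
      then have "?G 0 \<le> y" using x by (simp add: fold_map_def)
      moreover have "y \<le> h" using x by (simp add: fold_map_def)
      ultimately show "y \<in> {- \<bar>?G 0\<bar> - h..h}" using h\<kappa> by auto
    qed
  qed (use assms(1) h\<kappa> in \<open>auto intro: continuous_on_subset fold_map_has_derivative\<close>)
  moreover have "integral {?G (1/2)..?G 0} F = 0"
    using e e0 assms(3) by simp
  moreover have "integral {?G 0..?G (1/2)} F = integral {?G 0..0} F + integral {0..h - \<kappa>} F"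
    using Henstock_Kurzweil_Integration.integral_combine[of "?G 0" 0 "h - \<kappa>" F] e e0 assms(3) int by simp
  moreover have "integral {?G 0..0} F = integral {?G 0..0} (\<lambda>_. 0)"
    by (rule integral_cong) (use assms(2) in auto)
  ultimately show ?thesis by simp
qed

end

text \<open>u vanishes near 0 but is free at h. Composing it with the fold gives a competitor on the
  unit interval that runs through u twice, that is, an even reflection of total length 2h. Scaling
  by 2h together with the doubling of mass and energy produces the constant (\<pi>/2)^p and the
  exponent 1 - p - p/q of h.\<close>

lemma half_interval_Sobolev:
  fixes u :: "real \<Rightarrow> real"
  assumes u: "\<And>n. Ck n UNIV u" and \<delta>: "\<delta> > 0" "\<And>t. t \<le> \<delta> \<Longrightarrow> u t = 0" and h: "h > 0"
    and pq: "1 \<le> q" "q < p" and \<pi>: "0 \<le> pi_pq p q"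
  shows "(pi_pq p q / 2) powr p * h powr (1 - p - p / q) * (integral {0..h} (\<lambda>t. \<bar>u t\<bar> powr q)) powr (p / q)
       \<le> integral {0..h} (\<lambda>t. \<bar>deriv u t\<bar> powr p)"
proof -
  let ?U = "\<lambda>t. \<bar>u t\<bar> powr q" and ?D = "\<lambda>t. \<bar>deriv u t\<bar> powr p"
  have p0: "p > 0" "q > 0" "p \<ge> 1" using pq by auto
  have cU: "continuous_on UNIV ?U" and cD: "continuous_on UNIV ?D"
    using smooth_real_deriv(2,3)[OF u] p0 by (auto intro!: continuous_on_abs_powr)
  have du0: "deriv u t = 0" if "t \<le> 0" for t
  proof -
    have "\<forall>\<^sub>F x in nhds t. u x = 0"
      using eventually_nhds_in_open[of "{..<\<delta>}" t] that \<delta> by (auto elim!: eventually_mono)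
    then have "(u has_real_derivative 0) (at t)" by (subst DERIV_cong_ev[OF refl _ refl, of _ "\<lambda>_. 0"]) auto
    then show ?thesis by (rule DERIV_imp_deriv)
  qed
  have U0: "?U t = 0" and D0: "?D t = 0" if "t \<le> 0" for t using that \<delta> du0[OF that] by auto
  have intU: "?U integrable_on {a..b}" and intD: "?D integrable_on {a..b}" for a b
    using cU cD by (auto intro!: integrable_continuous_real intro: continuous_on_subset)
  let ?E = "integral {0..h} ?D"
  \<comment> \<open>The smoothed fold reaches only h - \<kappa>, so the mass is controlled on the
    shorter interval; \<kappa> tends to 0 afterwards.\<close>
  have key: "pi_pq p q powr p * (integral {0..h - \<kappa>} ?U / h) powr (p / q) \<le> 2 * (2 * h) powr (p - 1) * ?E"
    if \<kappa>: "0 < \<kappa>" "\<kappa> < h" for \<kappa>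
  proof -
    let ?G = "fold_map h \<kappa>" and ?G' = "fold_map' h \<kappa>"
    define v where "v x = u (?G x)" for x
    have cG: "continuous_on UNIV ?G" by (rule DERIV_continuous_on[OF fold_map_has_derivative[OF h \<kappa>(1)]])
    have dv: "deriv v x = deriv u (?G x) * ?G' x" for x
      unfolding v_def by (rule DERIV_imp_deriv, rule DERIV_chain2[OF smooth_real_deriv(1)[OF u] fold_map_has_derivative[OF h \<kappa>(1)]])
    have v: "v \<in> Cc_inf {0<..<1}"
    proof (rule Cc_infI)
      show "Ck n UNIV v" for n
        unfolding v_def[abs_def] by (rule Ck_compose[OF open_UNIV UNIV_I u Ck_fold_map[OF h \<kappa>(1)]])
      let ?K = "{x. \<delta> \<le> ?G x}"
      have "closed ?K" by (intro closed_Collect_le cG continuous_intros)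
      show sub: "?K \<subseteq> {0<..<1}"
      proof
        fix x assume "x \<in> ?K"
        then have "sqrt (h\<^sup>2 * (2 * x - 1)\<^sup>2 + \<kappa>\<^sup>2) \<le> h - \<delta>" by (simp add: fold_map_def)
        moreover have "sqrt ((h * (2 * x - 1))\<^sup>2) = h * \<bar>2 * x - 1\<bar>" using h by (simp add: abs_mult)
        moreover have "sqrt ((h * (2 * x - 1))\<^sup>2) \<le> sqrt (h\<^sup>2 * (2 * x - 1)\<^sup>2 + \<kappa>\<^sup>2)"
          by (rule real_sqrt_le_mono) (simp add: power_mult_distrib)
        ultimately have "h * \<bar>2 * x - 1\<bar> < h * 1" using \<delta>(1) by linarith
        then have "\<bar>2 * x - 1\<bar> < 1" using h by (simp only: mult_less_cancel_left_pos)
        then show "x \<in> {0<..<1}" by auto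
      qed
      have "closed ?K \<and> bounded ?K" 
      proof -
        have "bounded {0<..<1::real}" by (rule bounded_subset[of "{0..1}"]) auto
        then show ?thesis using sub \<open>closed ?K\<close> bounded_subset by blast
      qed
      then show "compact ?K" by (simp add: compact_eq_bounded_closed)
      show "v x = 0" if "x \<notin> ?K" for x using that \<delta>(2) by (simp add: v_def)
    qed
    have cv: "continuous_on UNIV (\<lambda>x. \<bar>v x\<bar> powr q)" "continuous_on UNIV (\<lambda>x. \<bar>deriv v x\<bar> powr p)"
      using smooth_real_deriv(2,3)[OF Cc_infD(1)[OF v]] p0 by (auto intro!: continuous_on_abs_powr)
    have G'0: "0 \<le> ?G' x" if "x \<in> {0..1/2}" for x
      using that fold_map_arg_pos[OF h \<kappa>(1), of x] by (simp add: fold_map'_def)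
    have G'le: "?G' x \<le> 2 * h" for x using fold_map'_bound[OF h \<kappa>(1), of x] by linarith
    have "integral {0..1} (\<lambda>x. \<bar>v x\<bar> powr q) = 2 * integral {0..1/2} (\<lambda>x. \<bar>v x\<bar> powr q)"
      by (rule integral_symmetric_unit_interval[OF h \<kappa>(1) cv(1)]) (simp add: v_def fold_map_symmetric[OF h \<kappa>(1)])
    moreover have "integral {0..h - \<kappa>} ?U \<le> integral {0..1/2} (\<lambda>x. 2 * h * \<bar>v x\<bar> powr q)"
    proof (rule has_integral_le[OF fold_map_substitution[OF h \<kappa>(1) cU U0 \<kappa>(2)] integrable_integral])
      show "(\<lambda>x. 2 * h * \<bar>v x\<bar> powr q) integrable_on {0..1/2}"
        by (intro integrable_continuous_real continuous_on_mult continuous_on_const continuous_on_subset[OF cv(1)]) auto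
      show "?G' x * ?U (?G x) \<le> 2 * h * \<bar>v x\<bar> powr q" for x
        unfolding v_def using G'le by (intro mult_right_mono) auto
    qed
    ultimately have lowS: "integral {0..h - \<kappa>} ?U / h \<le> integral {0..1} (\<lambda>x. \<bar>v x\<bar> powr q)"
      using h by (simp add: pos_divide_le_eq mult.commute)
    have "integral {0..1} (\<lambda>x. \<bar>deriv v x\<bar> powr p) = 2 * integral {0..1/2} (\<lambda>x. \<bar>deriv v x\<bar> powr p)"
      by (rule integral_symmetric_unit_interval[OF h \<kappa>(1) cv(2)]) (simp add: dv fold_map_symmetric[OF h \<kappa>(1)])
    also have "integral {0..1/2} (\<lambda>x. \<bar>deriv v x\<bar> powr p) \<le> (2 * h) powr (p - 1) * integral {0..h - \<kappa>} ?D"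
    proof (rule has_integral_le[OF integrable_integral has_integral_mult_right[OF fold_map_substitution[OF h \<kappa>(1) cD D0 \<kappa>(2)]]])
      show "(\<lambda>x. \<bar>deriv v x\<bar> powr p) integrable_on {0..1/2}"
        using cv(2) by (intro integrable_continuous_real) (auto intro: continuous_on_subset)
      fix x :: real assume x: "x \<in> {0..1/2}"
      \<comment> \<open>One factor of the derivative is kept for the substitution rule; the
        remaining power p - 1 is bounded by the maximal slope.\<close>
      have "?G' x powr p \<le> (2 * h) powr (p - 1) * ?G' x"
      proof (cases "?G' x = 0")
        case False
        then have g: "?G' x > 0" using G'0[OF x] by simp
        then have "?G' x powr p = ?G' x powr (p - 1) * ?G' x" by (simp add: powr_diff)
        also have "\<dots> \<le> (2 * h) powr (p - 1) * ?G' x" using g G'le p0 by (intro mult_right_mono powr_mono2) auto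
        finally show ?thesis .
      qed (use p0 in simp)
      then have "?D (?G x) * ?G' x powr p \<le> ?D (?G x) * ((2 * h) powr (p - 1) * ?G' x)" by (intro mult_left_mono) auto
      then show "\<bar>deriv v x\<bar> powr p \<le> (2 * h) powr (p - 1) * (?G' x * ?D (?G x))"
        using G'0[OF x] by (simp add: dv abs_mult powr_mult ac_simps)
    qed
    also have "integral {0..h - \<kappa>} ?D \<le> ?E" using \<kappa> by (intro integral_subset_le intD) auto
    finally have upE: "integral {0..1} (\<lambda>x. \<bar>deriv v x\<bar> powr p) \<le> 2 * (2 * h) powr (p - 1) * ?E"
      by (simp add: mult_left_mono)
    have "pi_pq p q powr p * (integral {0..h - \<kappa>} ?U / h) powr (p / q) \<le> pi_pq p q powr p * (integral {0..1} (\<lambda>x. \<bar>v x\<bar> powr q)) powr (p / q)"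
      using lowS h p0 by (intro mult_left_mono powr_mono2 divide_nonneg_pos integral_nonneg intU) auto
    also have "\<dots> \<le> integral {0..1} (\<lambda>x. \<bar>deriv v x\<bar> powr p)" by (rule pi_pq_Sobolev[OF v pq \<pi>])
    finally show ?thesis using upE by linarith
  qed
  have "((\<lambda>\<kappa>. pi_pq p q powr p * (integral {0..h - \<kappa>} ?U / h) powr (p / q)) \<longlongrightarrow> pi_pq p q powr p * (integral {0..h - 0} ?U / h) powr (p / q)) (at_right 0)"
  proof -
    have c: "continuous_on {0..h} (\<lambda>x. integral {0..x} ?U)" by (rule indefinite_integral_continuous_1[OF intU])
    have "((\<lambda>x. integral {0..x} ?U) \<longlongrightarrow> integral {0..h} ?U) (at h within {0..h})"
      using c h by (simp add: continuous_on_def)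
    moreover have "filterlim (\<lambda>\<kappa>. h - \<kappa>) (at h within {0..h}) (at_right 0)"
      unfolding filterlim_at
    proof (intro conjI)
      show "((\<lambda>\<kappa>. h - \<kappa>) \<longlongrightarrow> h) (at_right 0)" by (auto intro!: tendsto_eq_intros)
      show "\<forall>\<^sub>F x in at_right 0. h - x \<in> {0..h} \<and> h - x \<noteq> h"
        using eventually_at_right_real[OF h] by eventually_elim auto
    qed
    ultimately have "((\<lambda>\<kappa>. integral {0..h - \<kappa>} ?U) \<longlongrightarrow> integral {0..h} ?U) (at_right 0)"
      by (rule filterlim_compose)
    then have T: "((\<lambda>\<kappa>. integral {0..h - \<kappa>} ?U / h) \<longlongrightarrow> integral {0..h} ?U / h) (at_right 0)"
      using h by (intro tendsto_intros) auto
    have "\<forall>\<^sub>F x in at_right 0. 0 \<le> integral {0..h - x} ?U / h" 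
      using h by (intro always_eventually allI divide_nonneg_pos integral_nonneg intU) auto
    then have "((\<lambda>\<kappa>. (integral {0..h - \<kappa>} ?U / h) powr (p / q)) \<longlongrightarrow> (integral {0..h} ?U / h) powr (p / q)) (at_right 0)"
      using p0 by (intro tendsto_powr'[OF T tendsto_const]) auto
    then show ?thesis by (auto intro: tendsto_mult_left)
  qed
  moreover have "\<forall>\<^sub>F \<kappa> in at_right 0. pi_pq p q powr p * (integral {0..h - \<kappa>} ?U / h) powr (p / q) \<le> 2 * (2 * h) powr (p - 1) * ?E"
    using eventually_at_right_real[OF h] by eventually_elim (use key in auto)
  ultimately have fin: "pi_pq p q powr p * (integral {0..h} ?U / h) powr (p / q) \<le> 2 * (2 * h) powr (p - 1) * ?E"
    by (auto dest: tendsto_upperbound)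
  have A0: "integral {0..h} ?U \<ge> 0" using intU by (intro integral_nonneg) auto
  have "(pi_pq p q / 2) powr p * h powr (1 - p - p / q) * (integral {0..h} ?U) powr (p / q)
     = (pi_pq p q powr p * (integral {0..h} ?U / h) powr (p / q)) * (2 powr - p * h powr (1 - p))"
    using h A0 \<pi> by (simp add: powr_divide powr_diff powr_minus powr_add field_simps)
  also have "\<dots> \<le> (2 * (2 * h) powr (p - 1) * ?E) * (2 powr - p * h powr (1 - p))"
    using fin by (intro mult_right_mono) auto
  also have "\<dots> = ?E" using h by (simp add: powr_mult powr_diff powr_minus field_simps)
  finally show ?thesis .
qed

text \<open>The power p/q of the mass is replaced by its tangent at B = m h^(1+\<beta>). The
  exponent is chosen so that (1+\<beta>)(p/q - 1) = p + p/q - 1 cancels the power of h in front: the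
  coefficient of the mass becomes the same for all segments, and these inequalities can be summed.
  The parameter m remains free for the whole domain.\<close>

lemma half_interval_Sobolev_linearised:
  fixes u :: "real \<Rightarrow> real"
  assumes u: "\<And>n. Ck n UNIV u" and \<delta>: "\<delta> > 0" "\<And>t. t \<le> \<delta> \<Longrightarrow> u t = 0" and h: "h > 0"
    and pq: "1 \<le> q" "q < p" and \<pi>: "0 \<le> pi_pq p q" and m: "m > 0" and \<beta>: "\<beta> = p * q / (p - q)"
  defines "c \<equiv> (pi_pq p q / 2) powr p"
  shows "c * (p / q) * m powr (p / q - 1) * integral {0..h} (\<lambda>t. \<bar>u t\<bar> powr q)
     \<le> integral {0..h} (\<lambda>t. \<bar>deriv u t\<bar> powr p) + c * (p / q - 1) * m powr (p / q) * h powr (1 + \<beta>)"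
proof -
  let ?r = "p / q" and ?A = "integral {0..h} (\<lambda>t. \<bar>u t\<bar> powr q)" and ?g = "1 - p - p / q"
  have p0: "p > 0" "q > 0" "?r \<ge> 1" using pq by auto
  have A0: "?A \<ge> 0"
    using smooth_real_deriv(2)[OF u] p0
    by (intro integral_nonneg integrable_continuous_real continuous_on_abs_powr) (auto intro: continuous_on_subset)
  let ?B = "m * h powr (1 + \<beta>)"
  have e: "(1 + \<beta>) * (?r - 1) = - ?g" using pq by (simp add: \<beta> field_simps)
  then have e2: "(1 + \<beta>) * ?r + ?g = 1 + \<beta>" by (simp add: algebra_simps)
  have y: "?r * ?B powr (?r - 1) * ?A - (?r - 1) * ?B powr ?r \<le> ?A powr ?r"
    using A0 m h p0 by (intro powr_Young_tangent) auto
  have B1: "h powr ?g * ?B powr (?r - 1) = m powr (?r - 1)"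
  proof -
    have "(h powr (1 + \<beta>)) powr (?r - 1) = h powr (- ?g)" by (simp only: powr_powr e)
    moreover have "h powr ?g * h powr (- ?g) = 1" using h by (simp only: powr_add[symmetric] right_minus powr_zero_eq_one) simp
    ultimately have "h powr ?g * (m powr (?r - 1) * (h powr (1 + \<beta>)) powr (?r - 1)) = m powr (?r - 1)"
      by (metis mult.left_commute mult.right_neutral)
    then show ?thesis using m by (simp add: powr_mult)
  qed
  have "h powr ?g * ?B powr ?r = m powr ?r * (h powr ((1 + \<beta>) * ?r) * h powr ?g)"
    using m h by (simp add: powr_mult powr_powr)
  also have "h powr ((1 + \<beta>) * ?r) * h powr ?g = h powr (1 + \<beta>)" using h by (simp only: powr_add[symmetric] e2)
  finally have B2: "h powr ?g * ?B powr ?r = m powr ?r * h powr (1 + \<beta>)" .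
  have "c * ?r * m powr (?r - 1) * ?A - c * (?r - 1) * m powr ?r * h powr (1 + \<beta>)
     = c * h powr ?g * (?r * ?B powr (?r - 1) * ?A - (?r - 1) * ?B powr ?r)"
  proof -
    have gen: "C * X * (R * Y * Z - (R - 1) * W) = C * R * (X * Y) * Z - C * (R - 1) * (X * W)" for C X R Y Z W :: real
      by (simp add: algebra_simps)
    show ?thesis unfolding gen B1 B2 by (simp add: mult.assoc)
  qed
  also have "\<dots> \<le> c * h powr ?g * ?A powr ?r" using y by (intro mult_left_mono) (auto simp: c_def)
  also have "\<dots> \<le> integral {0..h} (\<lambda>t. \<bar>deriv u t\<bar> powr p)"
    unfolding c_def by (rule half_interval_Sobolev[OF u \<delta> h pq \<pi>])
  finally show ?thesis by linarith
qed

subsection \<open>Polyhedra and their distance functions\<close>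

lemma lborel_integral_translate:
  fixes f :: "'a::euclidean_space \<Rightarrow> real"
  assumes [measurable]: "f \<in> borel_measurable borel"
  shows "(\<integral>x. f (x + c) \<partial>lborel) = (\<integral>x. f x \<partial>lborel)"
proof -
  have "(\<integral>x. f x \<partial>lborel) = (\<integral>x. f x \<partial>(distr lborel borel ((+) c)))"
    by (simp add: lborel_distr_plus)
  also have "\<dots> = (\<integral>x. f (c + x) \<partial>lborel)" by (subst integral_distr) auto
  finally show ?thesis by (simp add: add.commute)
qed

lemma integrable_lborel_bounded_support:
  fixes f :: "'a::euclidean_space \<Rightarrow> real"
  assumes [measurable]: "f \<in> borel_measurable borel" and S: "bounded S"
    and b: "\<And>x. x \<in> S \<Longrightarrow> \<bar>f x\<bar> \<le> C" and 0: "\<And>x. x \<notin> S \<Longrightarrow> f x = 0"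
  shows "integrable lborel f"
proof -
  obtain R where R: "S \<subseteq> cball 0 R" using bounded_subset_ballD[OF S, of 0] ball_subset_cball by blast
  have "integrable lborel (\<lambda>x. \<bar>C\<bar> * indicat_real (cball 0 R :: 'a set) x)"
    using emeasure_bounded_finite[of "cball (0::'a) R"] by simp
  then show ?thesis
  proof (rule Bochner_Integration.integrable_bound)
    show "AE x in lborel. norm (f x) \<le> norm (\<bar>C\<bar> * indicat_real (cball 0 R) x)"
    proof (intro AE_I2)
      fix x
      show "norm (f x) \<le> norm (\<bar>C\<bar> * indicat_real (cball 0 R) x)"
      proof (cases "x \<in> S")
        case True
        then have "indicat_real (cball 0 R) x = 1" using R by auto
        then show ?thesis using b[OF True] by simp
      qed (simp add: 0)
    qed
  qed simp
qed

lemma integral_eq_lborel_indicator: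
  fixes f :: "'a::euclidean_space \<Rightarrow> real"
  assumes "integrable lborel (\<lambda>x. indicat_real S x * f x)"
  shows "integral S f = (\<integral>x. indicat_real S x * f x \<partial>lborel)"
proof -
  have "integral S f = integral UNIV (\<lambda>x. if x \<in> S then f x else 0)" by (simp add: integral_restrict_UNIV)
  also have "(\<lambda>x. if x \<in> S then f x else 0) = (\<lambda>x. indicat_real S x * f x)" by (auto simp: indicator_def)
  also have "integral UNIV \<dots> = (\<integral>x. indicat_real S x * f x \<partial>lborel)" by (rule integral_lborel[OF assms])
  finally show ?thesis .
qed

text \<open>Each boundary point is strictly separated from the convex hull of K, and by compactness
  finitely many of the open half-spaces cover the frontier. The complementary polyhedron is
  connected, misses the frontier and meets \<Omega> in K, so it stays inside \<Omega>.\<close>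

lemma polyhedron_between:
  fixes \<Omega> :: "'a::euclidean_space set"
  assumes \<Omega>: "open \<Omega>" "bounded \<Omega>" and K: "compact K" "K \<noteq> {}" "convex hull K \<subseteq> \<Omega>"
  obtains n :: nat and a :: "nat \<Rightarrow> 'a" and c :: "nat \<Rightarrow> real"
    where "n > 0" "\<And>i. i < n \<Longrightarrow> norm (a i) = 1" "\<And>i x. i < n \<Longrightarrow> x \<in> K \<Longrightarrow> a i \<bullet> x < c i"
      "{x. \<forall>i<n. a i \<bullet> x \<le> c i} \<subseteq> \<Omega>"
proof -
  let ?K = "convex hull K"
  have cK: "compact ?K" "convex ?K" "closed ?K" using K by (auto simp: compact_convex_hull compact_imp_closed)
  have "\<exists>a c. norm a = 1 \<and> a \<bullet> z > c \<and> (\<forall>x\<in>?K. a \<bullet> x < c)" if z: "z \<in> frontier \<Omega>" for z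
  proof -
    have "z \<notin> ?K" using z K(3) \<Omega>(1) by (auto simp: frontier_def interior_open)
    then obtain a b where ab: "a \<bullet> z < b" "\<forall>x\<in>?K. b < a \<bullet> x"
      using separating_hyperplane_closed_point cK by blast
    have "a \<noteq> 0" using ab K(2) hull_subset[of K convex] by force
    then have n: "norm a > 0" by simp
    let ?a = "- (a /\<^sub>R norm a)"
    have "norm ?a = 1" using n by simp
    moreover have "?a \<bullet> z > - (b / norm a)" using ab n by (simp add: divide_inverse mult.commute)
    moreover have "?a \<bullet> x < - (b / norm a)" if "x \<in> ?K" for x
      using ab(2) that n by (simp add: divide_inverse mult.commute)
    ultimately show ?thesis by blast
  qed
  then obtain A C where AC: "\<And>z. z \<in> frontier \<Omega> \<Longrightarrow> norm (A z) = 1 \<and> A z \<bullet> z > C z \<and> (\<forall>x\<in>?K. A z \<bullet> x < C z)"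
    by metis
  have "compact (frontier \<Omega>)" using \<Omega> by (simp add: compact_frontier_bounded)
  then obtain F where F: "F \<subseteq> frontier \<Omega>" "finite F" "frontier \<Omega> \<subseteq> (\<Union>z\<in>F. {x. A z \<bullet> x > C z})"
  proof (rule compactE_image)
    show "open {x. A z \<bullet> x > C z}" for z by (rule open_halfspace_gt)
    show "frontier \<Omega> \<subseteq> (\<Union>z\<in>frontier \<Omega>. {x. A z \<bullet> x > C z})" using AC by blast
  qed blast
  obtain e where e: "bij_betw e {..<card F} F" using ex_bij_betw_nat_finite[OF F(2)] by (metis atLeast0LessThan)
  define a c where "a = (\<lambda>i. A (e i))" and "c = (\<lambda>i. C (e i))"
  have eF: "e i \<in> frontier \<Omega>" if "i < card F" for i using e that F(1) by (auto simp: bij_betw_def)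
  let ?Q = "{x. \<forall>i<card F. a i \<bullet> x \<le> c i}"
  have Qfr: "?Q \<inter> frontier \<Omega> = {}"
  proof (rule equals0I)
    fix x assume x: "x \<in> ?Q \<inter> frontier \<Omega>"
    then obtain z where z: "z \<in> F" "A z \<bullet> x > C z" using F(3) by blast
    then obtain i where "i < card F" "e i = z" using e by (metis bij_betw_def imageE lessThan_iff)
    then have "A z \<bullet> x \<le> C z" using x by (auto simp: a_def c_def)
    then show False using z by simp
  qed
  have "?Q = (\<Inter>i\<in>{..<card F}. {x. a i \<bullet> x \<le> c i})" by auto
  then have Qc: "convex ?Q" by (simp add: convex_INT convex_halfspace_le)
  have KQ: "a i \<bullet> x < c i" if "i < card F" "x \<in> K" for i x
    using AC[OF eF[OF that(1)]] that(2) hull_subset[of K convex] by (auto simp: a_def c_def)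
  have QO: "?Q \<subseteq> \<Omega>"
  proof (rule ccontr)
    assume "\<not> ?Q \<subseteq> \<Omega>"
    moreover obtain k where "k \<in> K" using K by blast
    then have "k \<in> ?Q \<inter> \<Omega>" using KQ K(3) hull_subset[of K convex] by force
    ultimately have "?Q \<inter> frontier \<Omega> \<noteq> {}"
      by (intro connected_Int_frontier convex_connected Qc) auto
    then show False using Qfr by blast
  qed
  \<comment> \<open>Without any face the polyhedron would be the whole space, contradicting
    boundedness.\<close>
  have "card F > 0"
  proof (rule ccontr)
    assume "\<not> card F > 0"
    then have "UNIV \<subseteq> \<Omega>" using QO by auto
    then have "bounded (UNIV :: 'a set)" using \<Omega>(2) bounded_subset by blast
    then show False using not_bounded_UNIV by blast
  qed
  then show ?thesis
    using KQ QO AC[OF eF] by (intro that[of "card F" a c]) (auto simp: a_def)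
qed

section \<open>Depth below the faces of a polyhedron, and fluxes through it\<close>

definition poly_dist :: "nat \<Rightarrow> (nat \<Rightarrow> 'a::euclidean_space) \<Rightarrow> (nat \<Rightarrow> real) \<Rightarrow> 'a \<Rightarrow> real" where
  "poly_dist n a c x = Min ((\<lambda>i. c i - a i \<bullet> x) ` {..<n})"

lemma poly_dist_le: "i < n \<Longrightarrow> poly_dist n a c x \<le> c i - a i \<bullet> x"
  unfolding poly_dist_def by (intro Min_le) auto

lemma poly_dist_attained: "n > 0 \<Longrightarrow> \<exists>i<n. poly_dist n a c x = c i - a i \<bullet> x"
proof -
  assume "n > 0"
  then have "poly_dist n a c x \<in> (\<lambda>i. c i - a i \<bullet> x) ` {..<n}"
    unfolding poly_dist_def by (intro Min_in) (auto simp: lessThan_empty_iff)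
  then show ?thesis by auto
qed

lemma poly_dist_ge: "n > 0 \<Longrightarrow> (\<And>i. i < n \<Longrightarrow> t \<le> c i - a i \<bullet> x) \<Longrightarrow> t \<le> poly_dist n a c x"
  using poly_dist_attained[of n a c x] by auto

lemma poly_dist_lipschitz:
  assumes "n > 0" "\<And>i. i < n \<Longrightarrow> norm (a i) = 1"
  shows "\<bar>poly_dist n a c x - poly_dist n a c y\<bar> \<le> norm (x - y)"
proof -
  have "poly_dist n a c x - poly_dist n a c y \<le> norm (x - y)" for x y
  proof -
    obtain i where i: "i < n" "poly_dist n a c y = c i - a i \<bullet> y" using poly_dist_attained[OF assms(1)] by blast
    have "poly_dist n a c x \<le> c i - a i \<bullet> x" using i by (simp add: poly_dist_le)
    then have "poly_dist n a c x - poly_dist n a c y \<le> a i \<bullet> (y - x)" using i by (simp add: inner_diff_right)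
    also have "\<dots> \<le> norm (a i) * norm (y - x)" by (rule norm_cauchy_schwarz)
    finally show ?thesis using assms(2)[OF i(1)] by (simp add: norm_minus_commute)
  qed
  from this[of x y] this[of y x] show ?thesis by (simp add: norm_minus_commute abs_le_iff)
qed

lemma continuous_on_poly_dist:
  assumes "n > 0" "\<And>i. i < n \<Longrightarrow> norm (a i) = 1"
  shows "continuous_on S (poly_dist n a c)"
proof -
  have "1-lipschitz_on S (poly_dist n a c)"
    by (rule lipschitz_onI) (use poly_dist_lipschitz[OF assms] in \<open>simp_all add: dist_norm\<close>)
  then show ?thesis by (rule lipschitz_on_continuous_on)
qed

text \<open>Away from the finitely many hyperplanes on which two faces with different normals are
  equally far, the face attaining the minimum stays the same in a neighbourhood. Faces with equal
  normals are harmless: the one with the smaller offset wins everywhere.\<close>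

lemma poly_dist_locally_affine:
  fixes a :: "nat \<Rightarrow> 'a::euclidean_space"
  assumes n: "n > 0"
    and gen: "\<And>i j. i < n \<Longrightarrow> j < n \<Longrightarrow> a i \<noteq> a j \<Longrightarrow> (a i - a j) \<bullet> x \<noteq> c i - c j"
  shows "\<exists>i<n. \<forall>\<^sub>F y in nhds x. poly_dist n a c y = c i - a i \<bullet> y"
proof -
  obtain i where i: "i < n" "poly_dist n a c x = c i - a i \<bullet> x" using poly_dist_attained[OF n] by blast
  have "\<forall>\<^sub>F y in nhds x. c i - a i \<bullet> y \<le> c j - a j \<bullet> y" if j: "j < n" for j
  proof (cases "a i = a j")
    case True
    then have "c i \<le> c j" using poly_dist_le[OF j, of a c x] i by simp
    then show ?thesis using True by simp
  next
    case False
    then have "c i - a i \<bullet> x \<noteq> c j - a j \<bullet> x" using gen[OF i(1) j] by (simp add: inner_diff_left algebra_simps)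
    then have lt: "0 < (c j - a j \<bullet> x) - (c i - a i \<bullet> x)" using poly_dist_le[OF j, of a c x] i by simp
    have "((\<lambda>y. (c j - a j \<bullet> y) - (c i - a i \<bullet> y)) \<longlongrightarrow> (c j - a j \<bullet> x) - (c i - a i \<bullet> x)) (nhds x)"
      by (intro tendsto_intros filterlim_ident)
    from order_tendstoD(1)[OF this lt] show ?thesis by eventually_elim simp
  qed
  then have "\<forall>\<^sub>F y in nhds x. \<forall>j\<in>{..<n}. c i - a i \<bullet> y \<le> c j - a j \<bullet> y"
    by (intro eventually_ball_finite) auto
  then have "\<forall>\<^sub>F y in nhds x. poly_dist n a c y = c i - a i \<bullet> y"
  proof eventually_elim
    case (elim y)
    then show ?case using poly_dist_le[OF i(1), of a c y] poly_dist_ge[OF n, of "c i - a i \<bullet> y" c a y] by force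
  qed
  then show ?thesis using i(1) by blast
qed

lemma AE_hyperplane:
  fixes a :: "'a::euclidean_space"
  assumes "a \<noteq> 0"
  shows "AE x in lborel. a \<bullet> x \<noteq> b"
proof -
  have "{x. a \<bullet> x = b} \<in> null_sets lebesgue"
    using assms negligible_hyperplane[of a b] negligible_iff_null_sets by blast
  moreover have "{x. a \<bullet> x = b} \<in> sets borel"
    by (intro borel_closed closed_hyperplane)
  ultimately have "{x. a \<bullet> x = b} \<in> null_sets lborel"
    by (simp add: null_sets_completion_iff)
  from AE_not_in[OF this] show ?thesis by simp
qed

lemma C1c_fields_directional:
  assumes \<phi>: "\<phi> \<in> C1c_fields" and b: "b \<in> Basis"
  shows "((\<lambda>s. \<phi> (x + s *\<^sub>R b) \<bullet> b) has_real_derivative (frechet_derivative \<phi> (at (x + s *\<^sub>R b)) b \<bullet> b)) (at s)"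
proof -
  let ?y = "x + s *\<^sub>R b"
  have "(\<phi> has_derivative frechet_derivative \<phi> (at ?y)) (at ?y)"
    using \<phi> by (simp add: C1c_fields_def frechet_derivative_works)
  then have "((\<lambda>s. \<phi> (x + s *\<^sub>R b)) has_derivative (\<lambda>h. frechet_derivative \<phi> (at ?y) (h *\<^sub>R b))) (at s)"
    by (rule has_derivative_compose[rotated]) (auto intro!: derivative_eq_intros)
  then have "((\<lambda>s. \<phi> (x + s *\<^sub>R b) \<bullet> b) has_derivative (\<lambda>h. frechet_derivative \<phi> (at ?y) (h *\<^sub>R b) \<bullet> b)) (at s)"
    by (intro has_derivative_inner_left)
  moreover have "linear (frechet_derivative \<phi> (at ?y))"
    using \<phi> by (simp add: C1c_fields_def linear_frechet_derivative)
  then have "(\<lambda>h. frechet_derivative \<phi> (at ?y) (h *\<^sub>R b) \<bullet> b) = (*) (frechet_derivative \<phi> (at ?y) b \<bullet> b)"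
    by (simp add: linear_cmul fun_eq_iff mult.commute)
  ultimately show ?thesis
    by (simp add: has_field_derivative_def)
qed

lemma continuous_on_diverg:
  assumes "\<phi> \<in> C1c_fields"
  shows "continuous_on UNIV (diverg \<phi>)"
  unfolding diverg_def using assms by (auto intro!: continuous_intros simp: C1c_fields_def)

text \<open>Integration by parts against the Lipschitz function \<eta>, done with difference
  quotients: a translation moves the quotient from the field to \<eta>, and both sides pass to the
  limit by dominated convergence. Almost everywhere \<eta> is locally affine, with gradient -a_i/r
  in the strip of depth below r and 0 elsewhere, so the integrand is at most 1/r on the
  strip.\<close>

lemma integral_clamped_poly_dist_diverg_le:
  fixes a :: "nat \<Rightarrow> 'a::euclidean_space"
  assumes n: "n > 0" and a: "\<And>i. i < n \<Longrightarrow> norm (a i) = 1"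
    and bdd: "bounded {x. 0 \<le> poly_dist n a c x}" and r: "r > 0"
    and \<phi>: "\<phi> \<in> C1c_fields" "\<And>x. norm (\<phi> x) \<le> 1"
  defines "\<eta> \<equiv> \<lambda>x. max 0 (min 1 (poly_dist n a c x / r))"
  shows "(\<integral>x. \<eta> x * diverg \<phi> x \<partial>lborel) \<le> measure lborel {x. 0 < poly_dist n a c x \<and> poly_dist n a c x < r} / r"
proof -
  let ?m = "poly_dist n a c"
  let ?Q = "{x. 0 \<le> ?m x}"
  have cm: "continuous_on UNIV ?m" by (rule continuous_on_poly_dist[OF n a])
  have c\<eta>: "continuous_on UNIV \<eta>" unfolding \<eta>_def using r by (intro continuous_intros cm) auto
  have \<eta>m[measurable]: "\<eta> \<in> borel_measurable borel" and mm[measurable]: "?m \<in> borel_measurable borel"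
    using c\<eta> cm by (auto intro: borel_measurable_continuous_onI)
  have \<eta>01: "0 \<le> \<eta> x" "\<eta> x \<le> 1" for x by (auto simp: \<eta>_def)
  have \<eta>0: "\<eta> x = 0" if "x \<notin> ?Q" for x 
  proof -
    have "?m x / r < 0" using that r by (simp add: divide_neg_pos)
    then show ?thesis by (simp add: \<eta>_def)
  qed
  have lip: "\<bar>\<eta> x - \<eta> y\<bar> \<le> norm (x - y) / r" for x y
  proof -
    have "\<bar>\<eta> x - \<eta> y\<bar> \<le> \<bar>?m x / r - ?m y / r\<bar>" unfolding \<eta>_def by (auto simp: max_def min_def)
    also have "\<dots> = \<bar>?m x - ?m y\<bar> / r" using r by (simp add: diff_divide_distrib[symmetric])
    also have "\<dots> \<le> norm (x - y) / r" using r poly_dist_lipschitz[OF n a, where c=c and x=x and y=y] by (intro divide_right_mono) auto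
    finally show ?thesis .
  qed
  have c\<phi>: "continuous_on UNIV \<phi>" using \<phi>(1) 
    by (auto simp: C1c_fields_def intro!: continuous_at_imp_continuous_on differentiable_imp_continuous_within)
  have \<phi>m[measurable]: "\<phi> \<in> borel_measurable borel" using c\<phi> by (rule borel_measurable_continuous_onI)
  have dm[measurable]: "diverg \<phi> \<in> borel_measurable borel" 
    using continuous_on_diverg[OF \<phi>(1)] by (rule borel_measurable_continuous_onI)
  have \<phi>b: "\<bar>\<phi> x \<bullet> b\<bar> \<le> 1" if "b \<in> Basis" for x b
    using Basis_le_norm[OF that, of "\<phi> x"] \<phi>(2)[of x] by linarith
  obtain S where S: "compact S" "\<And>x. x \<notin> S \<Longrightarrow> \<phi> x = 0"
  proof
    show "compact (tsupp \<phi>)" using \<phi>(1) by (simp add: C1c_fields_def)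
    show "\<phi> x = 0" if "x \<notin> tsupp \<phi>" for x
      using that closure_subset[of "{x. \<phi> x \<noteq> 0}"] by (auto simp: tsupp_def)
  qed
  obtain R where R: "R > 0" "?Q \<subseteq> cball 0 R" using bounded_subset_ballD[OF bdd, of 0] ball_subset_cball by blast
  have "\<exists>M. \<forall>x\<in>cball 0 (R+1). \<forall>b\<in>Basis. \<bar>frechet_derivative \<phi> (at x) b \<bullet> b\<bar> \<le> M"
  proof -
    have "\<exists>M. \<forall>x\<in>cball 0 (R+1). \<bar>frechet_derivative \<phi> (at x) b \<bullet> b\<bar> \<le> M" if b: "b \<in> Basis" for b
    proof -
      have "continuous_on (cball 0 (R+1)) (\<lambda>x. frechet_derivative \<phi> (at x) b \<bullet> b)"
        using \<phi>(1) b by (intro continuous_intros) (auto simp: C1c_fields_def intro: continuous_on_subset)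
      then have "bounded ((\<lambda>x. frechet_derivative \<phi> (at x) b \<bullet> b) ` cball 0 (R+1))"
        by (intro compact_imp_bounded compact_continuous_image) auto
      then show ?thesis by (auto simp: bounded_iff)
    qed
    then obtain M where M: "\<And>b. b \<in> Basis \<Longrightarrow> \<forall>x\<in>cball 0 (R+1). \<bar>frechet_derivative \<phi> (at x) b \<bullet> b\<bar> \<le> M b" by metis
    show ?thesis
    proof (intro exI[of _ "Max (M ` Basis)"] ballI)
      fix x b :: 'a assume "x \<in> cball 0 (R+1)" "b \<in> Basis"
      then show "\<bar>frechet_derivative \<phi> (at x) b \<bullet> b\<bar> \<le> Max (M ` Basis)"
        using M[of b] Max_ge[of "M ` Basis" "M b"] by (meson finite_Basis finite_imageI image_eqI order_trans)
    qed
  qed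
  then obtain M where M: "\<And>x b. x \<in> cball 0 (R+1) \<Longrightarrow> b \<in> Basis \<Longrightarrow> \<bar>frechet_derivative \<phi> (at x) b \<bullet> b\<bar> \<le> M" by blast
  define h where "h k = inverse (real (Suc k))" for k
  have h: "0 < h k" "h k \<le> 1" "h \<longlonglongrightarrow> 0" for k
    unfolding h_def using LIMSEQ_inverse_real_of_nat by (auto simp: field_simps)
  \<comment> \<open>D is the discrete divergence of the field; E is its discrete adjoint, the same
    quotient applied to \<eta> with the opposite shift.\<close>
  define D where "D k x = (\<Sum>b\<in>Basis. (\<phi> (x + h k *\<^sub>R b) \<bullet> b - \<phi> x \<bullet> b) / h k)" for k x
  define E where "E k x = (\<Sum>b\<in>Basis. (\<eta> (x - h k *\<^sub>R b) - \<eta> x) / h k * (\<phi> x \<bullet> b))" for k x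
  have Dm[measurable]: "D k \<in> borel_measurable borel" for k unfolding D_def by measurable
  have Em[measurable]: "E k \<in> borel_measurable borel" for k unfolding E_def by measurable
  have DE: "(\<integral>x. \<eta> x * D k x \<partial>lborel) = (\<integral>x. E k x \<partial>lborel)" for k
  proof -
    have i1: "integrable lborel (\<lambda>x. \<eta> x * (\<phi> (x + h k *\<^sub>R b) \<bullet> b))" if "b \<in> Basis" for b
    proof (rule integrable_lborel_bounded_support[where S="?Q" and C=1])
      fix x show "\<bar>\<eta> x * (\<phi> (x + h k *\<^sub>R b) \<bullet> b)\<bar> \<le> 1"
        using \<phi>b[OF that, of "x + h k *\<^sub>R b"] \<eta>01[of x] by (simp add: abs_mult mult_le_one)
    qed (use bdd \<eta>0 in auto)
    have i2: "integrable lborel (\<lambda>x. \<eta> x * (\<phi> x \<bullet> b))" if "b \<in> Basis" for b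
    proof (rule integrable_lborel_bounded_support[where S="?Q" and C=1])
      fix x show "\<bar>\<eta> x * (\<phi> x \<bullet> b)\<bar> \<le> 1"
        using \<phi>b[OF that, of x] \<eta>01[of x] by (simp add: abs_mult mult_le_one)
    qed (use bdd \<eta>0 in auto)
    have i3: "integrable lborel (\<lambda>x. \<eta> (x - h k *\<^sub>R b) * (\<phi> x \<bullet> b))" if "b \<in> Basis" for b
    proof (rule integrable_lborel_bounded_support[where S=S and C=1])
      fix x show "\<bar>\<eta> (x - h k *\<^sub>R b) * (\<phi> x \<bullet> b)\<bar> \<le> 1"
        using \<phi>b[OF that, of x] \<eta>01[of "x - h k *\<^sub>R b"] by (simp add: abs_mult mult_le_one)
    qed (use S in \<open>auto intro: compact_imp_bounded\<close>)
    have tr: "(\<integral>x. \<eta> x * (\<phi> (x + h k *\<^sub>R b) \<bullet> b) \<partial>lborel) = (\<integral>x. \<eta> (x - h k *\<^sub>R b) * (\<phi> x \<bullet> b) \<partial>lborel)" for b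
      using lborel_integral_translate[of "\<lambda>x. \<eta> (x - h k *\<^sub>R b) * (\<phi> x \<bullet> b)" "h k *\<^sub>R b"] by simp
    have "(\<integral>x. \<eta> x * D k x \<partial>lborel) = (\<integral>x. (\<Sum>b\<in>Basis. (\<eta> x * (\<phi> (x + h k *\<^sub>R b) \<bullet> b) - \<eta> x * (\<phi> x \<bullet> b)) / h k) \<partial>lborel)"
      unfolding D_def by (simp add: sum_distrib_left right_diff_distrib diff_divide_distrib)
    also have "\<dots> = (\<Sum>b\<in>Basis. ((\<integral>x. \<eta> x * (\<phi> (x + h k *\<^sub>R b) \<bullet> b) \<partial>lborel) - (\<integral>x. \<eta> x * (\<phi> x \<bullet> b) \<partial>lborel)) / h k)"
      using i1 i2 by (subst Bochner_Integration.integral_sum) auto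
    also have "\<dots> = (\<Sum>b\<in>Basis. ((\<integral>x. \<eta> (x - h k *\<^sub>R b) * (\<phi> x \<bullet> b) \<partial>lborel) - (\<integral>x. \<eta> x * (\<phi> x \<bullet> b) \<partial>lborel)) / h k)"
      by (simp add: tr)
    also have "\<dots> = (\<integral>x. (\<Sum>b\<in>Basis. (\<eta> (x - h k *\<^sub>R b) * (\<phi> x \<bullet> b) - \<eta> x * (\<phi> x \<bullet> b)) / h k) \<partial>lborel)"
      using i3 i2 by (subst Bochner_Integration.integral_sum) auto
    also have "\<dots> = (\<integral>x. E k x \<partial>lborel)"
      unfolding E_def by (simp add: left_diff_distrib diff_divide_distrib)
    finally show ?thesis .
  qed
  have limD: "(\<lambda>k. (\<integral>x. \<eta> x * D k x \<partial>lborel)) \<longlonglongrightarrow> (\<integral>x. \<eta> x * diverg \<phi> x \<partial>lborel)"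
  proof (rule integral_dominated_convergence[where w="\<lambda>x. (real DIM('a) * M) * indicat_real (cball 0 R :: 'a set) x"])
    show "integrable lborel (\<lambda>x. (real DIM('a) * M) * indicat_real (cball 0 R :: 'a set) x)"
      using emeasure_bounded_finite[of "cball (0::'a) R"] by simp
    show "AE x in lborel. (\<lambda>k. \<eta> x * D k x) \<longlonglongrightarrow> \<eta> x * diverg \<phi> x"
    proof (intro AE_I2 tendsto_mult tendsto_const)
      fix x
      show "(\<lambda>k. D k x) \<longlonglongrightarrow> diverg \<phi> x"
        unfolding D_def diverg_def
      proof (intro tendsto_sum)
        fix b :: 'a assume b: "b \<in> Basis"
        have "((\<lambda>s. (\<phi> (x + s *\<^sub>R b) \<bullet> b - \<phi> x \<bullet> b) / s) \<longlongrightarrow> frechet_derivative \<phi> (at x) b \<bullet> b) (at 0)"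
          using C1c_fields_directional[OF \<phi>(1) b, of x 0] by (simp add: DERIV_def)
        moreover have "filterlim h (at 0) sequentially"
          unfolding filterlim_at using h by (auto simp: less_imp_neq[THEN not_sym] eventually_sequentially)
        ultimately show "(\<lambda>k. (\<phi> (x + h k *\<^sub>R b) \<bullet> b - \<phi> x \<bullet> b) / h k) \<longlonglongrightarrow> frechet_derivative \<phi> (at x) b \<bullet> b"
          by (rule filterlim_compose)
      qed
    qed
    show "AE x in lborel. norm (\<eta> x * D k x) \<le> (real DIM('a) * M) * indicat_real (cball 0 R) x" for k
    proof (intro AE_I2)
      fix x :: 'a
      show "norm (\<eta> x * D k x) \<le> (real DIM('a) * M) * indicat_real (cball 0 R) x"
      proof (cases "x \<in> ?Q")
        case True
        then have xR: "x \<in> cball 0 R" using R by blast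
        have *: "\<bar>(\<phi> (x + h k *\<^sub>R b) \<bullet> b - \<phi> x \<bullet> b) / h k\<bar> \<le> M" if b: "b \<in> Basis" for b
        proof -
          obtain z where z: "0 < z" "z < h k" "\<phi> (x + h k *\<^sub>R b) \<bullet> b - \<phi> (x + 0 *\<^sub>R b) \<bullet> b = (h k - 0) * (frechet_derivative \<phi> (at (x + z *\<^sub>R b)) b \<bullet> b)"
            using MVT2[OF h(1)[of k], of "\<lambda>s. \<phi> (x + s *\<^sub>R b) \<bullet> b" "\<lambda>s. frechet_derivative \<phi> (at (x + s *\<^sub>R b)) b \<bullet> b"]
              C1c_fields_directional[OF \<phi>(1) b] by auto
          have "norm (x + z *\<^sub>R b) \<le> norm x + norm (z *\<^sub>R b)" by (rule norm_triangle_ineq)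
          then have "x + z *\<^sub>R b \<in> cball 0 (R+1)" using xR z h(2)[of k] b by simp
          then show ?thesis using M[OF _ b] z h(1)[of k] by (simp add: field_simps)
        qed
        have "\<bar>D k x\<bar> \<le> (\<Sum>b\<in>(Basis::'a set). M)"
          unfolding D_def by (rule order_trans[OF sum_abs sum_mono]) (rule *)
        moreover have "\<bar>\<eta> x * D k x\<bar> \<le> \<bar>D k x\<bar>"
          using \<eta>01[of x] by (simp add: abs_mult mult_left_le_one_le)
        ultimately show ?thesis using xR by simp
      next
        case False
        have "M \<ge> 0" using M[of 0] R SOME_Basis by force
        then show ?thesis using \<eta>0[OF False] by simp
      qed
    qed
  qed measurable
  \<comment> \<open>Taking the pointwise limit with \<open>lim\<close> makes the limit function
    measurable at once; its value is identified only almost everywhere.\<close>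
  define L where "L x = lim (\<lambda>k. E k x)" for x
  have Lm[measurable]: "L \<in> borel_measurable borel" unfolding L_def by measurable
  let ?G = "{x. 0 < ?m x \<and> ?m x < r}"
  have AEL: "AE x in lborel. (\<lambda>k. E k x) \<longlonglongrightarrow> L x \<and> L x \<le> indicat_real ?G x / r"
  proof -
    have "AE x in lborel. \<forall>i\<in>{..<n}. \<forall>j\<in>{..<n}. a i \<noteq> a j \<longrightarrow> (a i - a j) \<bullet> x \<noteq> c i - c j"
    proof (intro AE_finite_allI finite_lessThan)
      fix i j
      show "AE x in lborel. a i \<noteq> a j \<longrightarrow> (a i - a j) \<bullet> x \<noteq> c i - c j"
      proof (cases "a i = a j")
        case False
        then have "AE x in lborel. (a i - a j) \<bullet> x \<noteq> c i - c j" by (intro AE_hyperplane) simp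
        then show ?thesis by eventually_elim simp
      qed simp
    qed
    \<comment> \<open>The depths 0 and r, where the clamping has kinks, are excluded as
      well.\<close>
    moreover have "AE x in lborel. \<forall>i\<in>{..<n}. a i \<bullet> x \<noteq> c i \<and> a i \<bullet> x \<noteq> c i - r"
    proof (intro AE_finite_allI finite_lessThan AE_conjI AE_hyperplane)
      fix i assume "i \<in> {..<n}"
      then show "a i \<noteq> 0" "a i \<noteq> 0" using a[of i] by auto
    qed
    ultimately show ?thesis
    proof eventually_elim
      case (elim x)
      then obtain i where i: "i < n" and loc: "\<forall>\<^sub>F y in nhds x. ?m y = c i - a i \<bullet> y"
        using poly_dist_locally_affine[OF n, of a x c] by blast
      then have mx: "?m x = c i - a i \<bullet> x" using eventually_nhds_x_imp_x by blast
      have "a i \<bullet> x \<noteq> c i" "a i \<bullet> x \<noteq> c i - r" using elim(2) i by blast+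
      then have ne: "?m x \<noteq> 0" "?m x \<noteq> r" using mx by linarith+
      have cont: "(?m \<longlongrightarrow> ?m x) (nhds x)"
        using cm by (simp add: continuous_on_eq_continuous_at isCont_def tendsto_nhds_iff)
      have seq: "filterlim (\<lambda>k. x - h k *\<^sub>R b) (nhds x) sequentially" for b
      proof -
        have "(\<lambda>k. x - h k *\<^sub>R b) \<longlonglongrightarrow> x - 0 *\<^sub>R b" using h by (intro tendsto_intros)
        then show ?thesis by simp
      qed
      consider "?m x < 0 \<or> ?m x > r" | "0 < ?m x" "?m x < r" using ne by linarith
      then have "\<exists>l. (\<lambda>k. E k x) \<longlonglongrightarrow> l \<and> l \<le> indicat_real ?G x / r"
      proof cases
        case 1
        have "\<forall>\<^sub>F y in nhds x. \<eta> y = \<eta> x"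
        proof (cases "?m x < 0")
          case True
          from order_tendstoD(2)[OF cont True] show ?thesis
            by eventually_elim (use True \<eta>0 in simp)
        next
          case False
          then have gt: "?m x > r" using 1 by simp
          from order_tendstoD(1)[OF cont gt] show ?thesis
            by eventually_elim (use gt r in \<open>simp add: \<eta>_def\<close>)
        qed
        then have "\<forall>\<^sub>F k in sequentially. \<eta> (x - h k *\<^sub>R b) = \<eta> x" for b
          using eventually_compose_filterlim[OF _ seq] by blast
        then have "\<forall>\<^sub>F k in sequentially. \<forall>b\<in>Basis. \<eta> (x - h k *\<^sub>R b) = \<eta> x"
          by (intro eventually_ball_finite) auto
        then have "\<forall>\<^sub>F k in sequentially. E k x = 0"
          by eventually_elim (simp add: E_def)
        then have "(\<lambda>k. E k x) \<longlonglongrightarrow> 0" by (rule tendsto_eventually)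
        moreover have "0 \<le> indicat_real ?G x / r" using r by simp
        ultimately show ?thesis by blast
      next
        case 2
        have "\<forall>\<^sub>F y in nhds x. \<eta> y = (c i - a i \<bullet> y) / r"
          using order_tendstoD(1)[OF cont 2(1)] order_tendstoD(2)[OF cont 2(2)] loc
        proof eventually_elim
          case (elim y)
          then have "0 \<le> (c i - a i \<bullet> y) / r" "(c i - a i \<bullet> y) / r \<le> 1" using r by auto
          then show ?case using elim(3) by (simp add: \<eta>_def)
        qed
        then have ev: "\<forall>\<^sub>F k in sequentially. \<eta> (x - h k *\<^sub>R b) = (c i - a i \<bullet> (x - h k *\<^sub>R b)) / r"
          and \<eta>x: "\<eta> x = (c i - a i \<bullet> x) / r" for b
          using eventually_compose_filterlim[OF _ seq] eventually_nhds_x_imp_x by blast+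
        have "\<forall>\<^sub>F k in sequentially. \<forall>b\<in>Basis. \<eta> (x - h k *\<^sub>R b) = (c i - a i \<bullet> (x - h k *\<^sub>R b)) / r"
          using ev by (intro eventually_ball_finite) auto
        then have "\<forall>\<^sub>F k in sequentially. E k x = a i \<bullet> \<phi> x / r"
        proof eventually_elim
          case (elim k)
          have "(\<eta> (x - h k *\<^sub>R b) - \<eta> x) / h k = a i \<bullet> b / r" if "b \<in> Basis" for b
          proof -
            have "\<eta> (x - h k *\<^sub>R b) - \<eta> x = h k * (a i \<bullet> b) / r"
              unfolding elim[rule_format, OF that] \<eta>x using r by (simp add: inner_diff_right field_simps)
            then show ?thesis using h(1)[of k] by simp
          qed
          then have "E k x = (\<Sum>b\<in>Basis. a i \<bullet> b / r * (\<phi> x \<bullet> b))" by (simp add: E_def)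
          also have "\<dots> = a i \<bullet> \<phi> x / r" unfolding euclidean_inner[of "a i" "\<phi> x"] by (simp add: sum_divide_distrib)
          finally show ?case .
        qed
        then have "(\<lambda>k. E k x) \<longlonglongrightarrow> a i \<bullet> \<phi> x / r" by (rule tendsto_eventually)
        moreover have "a i \<bullet> \<phi> x \<le> 1"
          using norm_cauchy_schwarz[of "a i" "\<phi> x"] a[OF i] \<phi>(2)[of x] by simp
        then have "a i \<bullet> \<phi> x / r \<le> indicat_real ?G x / r" using 2 r by (simp add: divide_right_mono)
        ultimately show ?thesis by blast
      qed
      then show ?case using limI[of "\<lambda>k. E k x"] by (auto simp: L_def)
    qed
  qed
  have limE: "(\<lambda>k. (\<integral>x. E k x \<partial>lborel)) \<longlonglongrightarrow> (\<integral>x. L x \<partial>lborel)" and iL: "integrable lborel L"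
  proof -
    have w: "integrable lborel (\<lambda>x. real DIM('a) / r * indicat_real S x)"
      using S(1) emeasure_bounded_finite[OF compact_imp_bounded[OF S(1)]] by (simp add: compact_imp_closed borel_closed)
    have ae: "AE x in lborel. (\<lambda>k. E k x) \<longlonglongrightarrow> L x" using AEL by eventually_elim simp
    have bd: "AE x in lborel. norm (E k x) \<le> real DIM('a) / r * indicat_real S x" for k
    proof (intro AE_I2)
      fix x :: 'a
      show "norm (E k x) \<le> real DIM('a) / r * indicat_real S x"
      proof (cases "x \<in> S")
        case True
        have "\<bar>(\<eta> (x - h k *\<^sub>R b) - \<eta> x) / h k * (\<phi> x \<bullet> b)\<bar> \<le> 1 / r" if b: "b \<in> Basis" for b
        proof -
          have "\<bar>\<eta> (x - h k *\<^sub>R b) - \<eta> x\<bar> \<le> h k / r" using lip[of "x - h k *\<^sub>R b" x] b h(1)[of k] by simp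
          then have "\<bar>(\<eta> (x - h k *\<^sub>R b) - \<eta> x) / h k\<bar> \<le> 1 / r" using h(1)[of k] by (simp add: field_simps)
          then have "\<bar>(\<eta> (x - h k *\<^sub>R b) - \<eta> x) / h k\<bar> * \<bar>\<phi> x \<bullet> b\<bar> \<le> 1 / r * 1"
            using \<phi>b[OF b, of x] r by (intro mult_mono) auto
          then show ?thesis by (simp add: abs_mult)
        qed
        then have "\<bar>E k x\<bar> \<le> (\<Sum>b\<in>(Basis::'a set). 1 / r)"
          unfolding E_def by (intro order_trans[OF sum_abs sum_mono])
        then show ?thesis using True by simp
      qed (simp add: E_def S(2))
    qed
    show "(\<lambda>k. (\<integral>x. E k x \<partial>lborel)) \<longlonglongrightarrow> (\<integral>x. L x \<partial>lborel)"
      by (rule integral_dominated_convergence[OF _ _ w ae bd]) measurable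
    show "integrable lborel L"
      by (rule integrable_dominated_convergence[OF _ _ w ae bd]) measurable
  qed
  have "(\<integral>x. \<eta> x * diverg \<phi> x \<partial>lborel) = (\<integral>x. L x \<partial>lborel)"
    using limD limE unfolding DE by (rule LIMSEQ_unique)
  also have "\<dots> \<le> (\<integral>x. indicat_real ?G x / r \<partial>lborel)"
  proof (rule integral_mono_AE[OF iL])
    have "bounded ?G" by (rule bounded_subset[OF bdd]) auto
    then show "integrable lborel (\<lambda>x. indicat_real ?G x / r)"
      using emeasure_bounded_finite[of ?G] by simp
    show "AE x in lborel. L x \<le> indicat_real ?G x / r" using AEL by eventually_elim simp
  qed
  also have "\<dots> = measure lborel ?G / r" by simp
  finally show ?thesis .
qed

subsection \<open>Inner parallel sets and the perimeter\<close>

lemma infdist_compl_pos_iff: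
  fixes \<Omega> :: "'a::euclidean_space set"
  assumes "open \<Omega>" "bounded \<Omega>"
  shows "0 < infdist x (- \<Omega>) \<longleftrightarrow> x \<in> \<Omega>"
proof -
  have "- \<Omega> \<noteq> {}" using assms(2) not_bounded_UNIV by (metis Compl_empty_eq double_complement)
  then have "x \<in> - \<Omega> \<longleftrightarrow> infdist x (- \<Omega>) = 0"
    using assms(1) by (intro in_closed_iff_infdist_zero) auto
  then show ?thesis using infdist_nonneg[of x "- \<Omega>"] by auto
qed

lemma ball_subset_imp_le_infdist_compl:
  fixes \<Omega> :: "'a::euclidean_space set"
  assumes "bounded \<Omega>" "ball x r \<subseteq> \<Omega>"
  shows "r \<le> infdist x (- \<Omega>)"
proof -
  have ne: "- \<Omega> \<noteq> {}" using assms(1) not_bounded_UNIV by (metis Compl_empty_eq double_complement)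
  then show ?thesis unfolding infdist_notempty[OF ne]
    by (rule cINF_greatest) (use assms(2) in \<open>auto simp: subset_eq not_less[symmetric]\<close>)
qed

abbreviation inner_parallel :: "real \<Rightarrow> 'a::euclidean_space set \<Rightarrow> 'a set" where
  "inner_parallel t \<Omega> \<equiv> {x \<in> \<Omega>. t < infdist x (- \<Omega>)}"

lemma open_inner_parallel: "open \<Omega> \<Longrightarrow> open (inner_parallel t \<Omega>)"
proof -
  assume "open \<Omega>"
  moreover have "open {x. t < infdist x (- \<Omega>)}"
    by (intro open_Collect_less continuous_intros)
  ultimately have "open (\<Omega> \<inter> {x. t < infdist x (- \<Omega>)})" by (rule open_Int)
  then show ?thesis by (simp add: Int_def)
qed

lemma bounded_inner_parallel: "bounded \<Omega> \<Longrightarrow> bounded (inner_parallel t \<Omega>)"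
  by (rule bounded_subset) auto

text \<open>g is the volume of the boundary layer of width \<tau>. The flux is compared with the
  integral of the divergence against a clamped depth that equals 1 on the inner parallel set:
  replacing 1 by \<eta> costs at most M g, and what remains is at most g/\<tau> by the estimate on
  polyhedra. For small \<tau> this says that the layer has volume about \<tau> times the flux or
  more.\<close>

lemma inner_parallel_first_variation:
  fixes \<Omega> :: "'a::euclidean_space set"
  assumes \<Omega>: "open \<Omega>" "bounded \<Omega>" "convex \<Omega>" and ne: "inner_parallel \<tau> \<Omega> \<noteq> {}" and \<tau>: "\<tau> > 0"
    and \<phi>: "\<phi> \<in> C1c_fields" "\<And>x. norm (\<phi> x) \<le> 1" and M: "\<And>x. x \<in> \<Omega> \<Longrightarrow> \<bar>diverg \<phi> x\<bar> \<le> M"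
  defines "g \<equiv> measure lebesgue \<Omega> - measure lebesgue (inner_parallel \<tau> \<Omega>)"
  shows "\<tau> * (integral \<Omega> (diverg \<phi>) - M * g) \<le> g"
proof -
  let ?d = "\<lambda>x. infdist x (- \<Omega>)" and ?B = "inner_parallel \<tau> \<Omega>"
  have oB: "open ?B" "bounded ?B" using \<Omega> by (auto intro: open_inner_parallel bounded_inner_parallel)
  have meas: "\<Omega> \<in> sets lborel" "?B \<in> sets lborel" using \<Omega> oB by auto
  have fin: "emeasure lborel \<Omega> < \<infinity>" using emeasure_bounded_finite[OF \<Omega>(2)] .
  have g: "g = measure lborel (\<Omega> - ?B)"
  proof -
    have "measure lborel (\<Omega> - ?B) = measure lborel \<Omega> - measure lborel ?B"
      using meas fin by (intro measure_Diff) auto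
    then show ?thesis using meas by (simp add: g_def)
  qed
  have dm[measurable]: "diverg \<phi> \<in> borel_measurable borel" 
    using continuous_on_diverg[OF \<phi>(1)] by (rule borel_measurable_continuous_onI)
  have [measurable]: "\<Omega> \<in> sets borel" "?B \<in> sets borel" using meas by auto
  have i\<Omega>: "integrable lborel (\<lambda>x. indicat_real \<Omega> x * diverg \<phi> x)"
  proof (rule integrable_lborel_bounded_support[where S=\<Omega> and C=M])
  qed (use \<Omega> M in auto)
  have I: "integral \<Omega> (diverg \<phi>) = (\<integral>x. indicat_real \<Omega> x * diverg \<phi> x \<partial>lborel)"
    by (rule integral_eq_lborel_indicator[OF i\<Omega>])
  have key: "(\<tau> - \<sigma>) * (integral \<Omega> (diverg \<phi>) - M * g) \<le> g" if \<sigma>: "0 < \<sigma>" "\<sigma> < \<tau>" for \<sigma>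
  proof -
    \<comment> \<open>A compact set between the inner parallel set and \<Omega>, so that a
      polyhedron fits around it inside \<Omega>; the width r = \<tau> - \<sigma> is what is left for
      the layer.\<close>
    define K where "K = {x. \<sigma> \<le> ?d x}"
    define r where "r = \<tau> - \<sigma>"
    have r: "r > 0" using \<sigma> by (simp add: r_def)
    have K\<Omega>: "K \<subseteq> \<Omega>" using \<sigma> infdist_compl_pos_iff[OF \<Omega>(1,2)] by (force simp: K_def)
    have "closed K" unfolding K_def by (intro closed_Collect_le continuous_intros)
    then have cK: "compact K" using K\<Omega> \<Omega>(2) bounded_subset compact_eq_bounded_closed by blast
    have "?B \<subseteq> K" using \<sigma> by (auto simp: K_def)
    then have Kne: "K \<noteq> {}" using ne by blast
    have hK: "convex hull K \<subseteq> \<Omega>" using K\<Omega> \<Omega>(3) by (rule hull_minimal)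
    have "\<exists>(n::nat) (a::nat \<Rightarrow> 'a) c. n > 0 \<and> (\<forall>i<n. norm (a i) = 1) \<and> (\<forall>i<n. \<forall>x\<in>K. a i \<bullet> x < c i) \<and> {x. \<forall>i<n. a i \<bullet> x \<le> c i} \<subseteq> \<Omega>"
      by (rule polyhedron_between[OF \<Omega>(1,2) cK Kne hK]) blast
    then obtain n :: nat and a :: "nat \<Rightarrow> 'a" and c where n: "n > 0" and a: "\<And>i. i < n \<Longrightarrow> norm (a i) = 1" and Kc: "\<And>i x. i < n \<Longrightarrow> x \<in> K \<Longrightarrow> a i \<bullet> x < c i"
      and Q: "{x. \<forall>i<n. a i \<bullet> x \<le> c i} \<subseteq> \<Omega>"
      by blast
    let ?m = "poly_dist n a c"
    have mQ: "{x. 0 \<le> ?m x} \<subseteq> \<Omega>"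
    proof
      fix x assume "x \<in> {x. 0 \<le> ?m x}"
      then have "a i \<bullet> x \<le> c i" if "i < n" for i using poly_dist_le[OF that, of a c x] by simp
      then show "x \<in> \<Omega>" using Q by blast
    qed
    then have bQ: "bounded {x. 0 \<le> ?m x}" using \<Omega>(2) bounded_subset by blast
    define \<eta> where "\<eta> x = max 0 (min 1 (?m x / r))" for x
    have up: "(\<integral>x. \<eta> x * diverg \<phi> x \<partial>lborel) \<le> measure lborel {x. 0 < ?m x \<and> ?m x < r} / r"
      unfolding \<eta>_def by (rule integral_clamped_poly_dist_diverg_le[OF n a bQ r \<phi>])
    \<comment> \<open>The distance to the complement is 1-Lipschitz, so moving by r towards any face
      stays in K, hence on the inner side of that face.\<close>
    have Br: "r \<le> ?m x" if x: "x \<in> ?B" for x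
    proof (rule poly_dist_ge[OF n])
      fix i assume i: "i < n"
      have "?d x \<le> ?d (x + r *\<^sub>R a i) + dist x (x + r *\<^sub>R a i)" by (rule infdist_triangle)
      also have "dist x (x + r *\<^sub>R a i) = r" using r a[OF i] by (simp add: dist_norm)
      finally have "x + r *\<^sub>R a i \<in> K" using x by (simp add: K_def r_def)
      then have "a i \<bullet> (x + r *\<^sub>R a i) < c i" using Kc[OF i] by blast
      moreover have "a i \<bullet> a i = 1" using a[OF i] by (simp add: norm_eq_1)
      ultimately show "r \<le> c i - a i \<bullet> x" by (simp add: inner_add_right)
    qed
    have cm: "continuous_on UNIV ?m" by (rule continuous_on_poly_dist[OF n a])
    then have [measurable]: "?m \<in> borel_measurable borel" by (rule borel_measurable_continuous_onI)
    have [measurable]: "\<eta> \<in> borel_measurable borel" unfolding \<eta>_def by measurable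
    have "measure lborel {x. 0 < ?m x \<and> ?m x < r} \<le> measure lborel (\<Omega> - ?B)"
    proof (rule measure_mono_fmeasurable)
      show "{x. 0 < ?m x \<and> ?m x < r} \<subseteq> \<Omega> - ?B" using mQ Br by fastforce
      show "\<Omega> - ?B \<in> fmeasurable lborel"
        using emeasure_bounded_finite[of "\<Omega> - ?B"] \<Omega>(2) meas by (intro fmeasurableI) auto
    qed simp
    then have up': "(\<integral>x. \<eta> x * diverg \<phi> x \<partial>lborel) \<le> g / r"
      using up r unfolding g by (meson divide_right_mono less_imp_le order_trans)
    have \<eta>01: "0 \<le> \<eta> x" "\<eta> x \<le> 1" for x by (auto simp: \<eta>_def)
    have \<eta>0: "\<eta> x = 0" if "x \<notin> \<Omega>" for x
    proof -
      have "?m x < 0" using that mQ by (meson mem_Collect_eq not_le subsetD)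
      then have "?m x / r < 0" using r by (simp add: divide_neg_pos)
      then show ?thesis by (simp add: \<eta>_def)
    qed
    have \<eta>1: "\<eta> x = 1" if "x \<in> ?B" for x using Br[OF that] r by (simp add: \<eta>_def)
    have i\<eta>: "integrable lborel (\<lambda>x. \<eta> x * diverg \<phi> x)"
    proof (rule integrable_lborel_bounded_support[where S=\<Omega> and C=M])
      fix x assume x: "x \<in> \<Omega>"
      have "\<bar>\<eta> x * diverg \<phi> x\<bar> \<le> 1 * \<bar>diverg \<phi> x\<bar>" unfolding abs_mult using \<eta>01[of x] by (intro mult_right_mono) auto
      then show "\<bar>\<eta> x * diverg \<phi> x\<bar> \<le> M" using M[OF x] by simp
    qed (use \<Omega> \<eta>0 in auto)
    have "integral \<Omega> (diverg \<phi>) - (\<integral>x. \<eta> x * diverg \<phi> x \<partial>lborel) = (\<integral>x. indicat_real \<Omega> x * diverg \<phi> x - \<eta> x * diverg \<phi> x \<partial>lborel)"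
      unfolding I using i\<Omega> i\<eta> by simp
    also have "\<dots> \<le> (\<integral>x. M * indicat_real (\<Omega> - ?B) x \<partial>lborel)"
    proof (rule integral_mono)
      show "integrable lborel (\<lambda>x. indicat_real \<Omega> x * diverg \<phi> x - \<eta> x * diverg \<phi> x)" using i\<Omega> i\<eta> by simp
      show "integrable lborel (\<lambda>x. M * indicat_real (\<Omega> - ?B) x)"
      proof -
        have "bounded (\<Omega> - ?B)" using \<Omega>(2) by (rule bounded_subset) blast
        from emeasure_bounded_finite[OF this] show ?thesis by simp
      qed
      fix x
      show "indicat_real \<Omega> x * diverg \<phi> x - \<eta> x * diverg \<phi> x \<le> M * indicat_real (\<Omega> - ?B) x"
      proof (cases "x \<in> \<Omega> - ?B")
        case True
        then have "indicat_real \<Omega> x * diverg \<phi> x - \<eta> x * diverg \<phi> x = (1 - \<eta> x) * diverg \<phi> x" by (simp add: algebra_simps)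
        also have "\<dots> \<le> \<bar>1 - \<eta> x\<bar> * \<bar>diverg \<phi> x\<bar>" by (metis abs_ge_self abs_mult)
        also have "\<dots> \<le> 1 * M" using \<eta>01[of x] M[of x] True by (intro mult_mono) auto
        finally show ?thesis using True by simp
      next
        case False
        then show ?thesis using \<eta>0[of x] \<eta>1[of x] by (cases "x \<in> \<Omega>") auto
      qed
    qed
    also have "\<dots> = M * g" by (simp add: g)
    finally have "integral \<Omega> (diverg \<phi>) - M * g \<le> g / r" using up' by linarith
    then show ?thesis using r by (simp add: r_def field_simps)
  qed
  have "((\<lambda>\<sigma>. (\<tau> - \<sigma>) * (integral \<Omega> (diverg \<phi>) - M * g)) \<longlongrightarrow> (\<tau> - 0) * (integral \<Omega> (diverg \<phi>) - M * g)) (at_right 0)"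
    by (intro tendsto_intros)
  moreover have "\<forall>\<^sub>F \<sigma> in at_right 0. (\<tau> - \<sigma>) * (integral \<Omega> (diverg \<phi>) - M * g) \<le> g"
    using eventually_at_right_real[OF \<tau>] by eventually_elim (use key in auto)
  ultimately show ?thesis by (auto dest: tendsto_upperbound)
qed

text \<open>Bernoulli gives 1 - z <= (1 - z/N)^N; taking roots shows that the N-th root lies below
  its tangent at V. Negative y is covered, since the flux of a single field may be negative.\<close>

lemma powr_root_Bernoulli:
  fixes V y :: real
  assumes "N > 0" "V > 0" "y \<le> V"
  shows "(V - y) powr (1 / real N) \<le> V powr (1 / real N) * (1 - y / (real N * V))"
proof -
  let ?z = "y / V"
  have z: "?z \<le> 1" using assms by simp
  have zN: "?z / real N \<le> 1"
  proof (cases "?z \<ge> 0")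
    case True
    then have "?z * 1 \<le> ?z * real N" using assms(1) by (intro mult_left_mono) auto
    then have "?z / real N \<le> ?z" using assms(1) by (simp only: pos_divide_le_eq of_nat_0_less_iff mult_1_right)
    then show ?thesis using z by linarith
  next
    case False
    then have "?z < 0" by linarith
    moreover have "0 < real N" using assms(1) by simp
    ultimately have "?z / real N < 0" by (rule divide_neg_pos)
    then show ?thesis by linarith
  qed
  have "1 + real N * (- (?z / real N)) \<le> (1 + - (?z / real N)) ^ N"
    using zN by (intro Bernoulli_inequality) simp
  then have "1 - ?z \<le> (1 - ?z / real N) ^ N" using assms(1) by simp
  then have "(1 - ?z) powr (1 / real N) \<le> ((1 - ?z / real N) ^ N) powr (1 / real N)"
    using z by (intro powr_mono2) auto
  also have "\<dots> = 1 - ?z / real N"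
  proof (cases "1 - ?z / real N = 0")
    case True then show ?thesis using assms(1) by simp
  next
    case False
    then have "1 - ?z / real N > 0" using zN by linarith
    moreover have "(X ^ N) powr (1 / real N) = X" if "X > 0" for X
      using that assms(1) by (simp add: powr_realpow[symmetric] powr_powr)
    ultimately show ?thesis by blast
  qed
  finally have *: "(1 - ?z) powr (1 / real N) \<le> 1 - ?z / real N" .
  have "V - y = V * (1 - ?z)" using assms by (simp add: field_simps)
  then have "(V - y) powr (1 / real N) = V powr (1 / real N) * (1 - ?z) powr (1 / real N)"
    using assms z by (simp add: powr_mult)
  also have "\<dots> \<le> V powr (1 / real N) * (1 - ?z / real N)" using * by (intro mult_left_mono) auto
  finally show ?thesis by (simp add: mult.commute)
qed

text \<open>By convexity (1-s) \<Omega> + s \<Omega>_t lies in \<Omega>_(st), so Brunn-Minkowski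
  bounds the chord of the root of the volume by its value at st. That value is bounded through the
  first variation, and s tends to 0. The claim is made for one field at a time; the supremum over
  fields comes later.\<close>

lemma inner_parallel_volume_field:
  fixes \<Omega> :: "'a::euclidean_space set"
  assumes \<Omega>: "open \<Omega>" "bounded \<Omega>" "convex \<Omega>" and ne: "inner_parallel t \<Omega> \<noteq> {}" and t: "t > 0"
    and \<phi>: "\<phi> \<in> C1c_fields" "\<And>x. norm (\<phi> x) \<le> 1"
  shows "measure lebesgue (inner_parallel t \<Omega>) powr (1 / DIM('a))
     \<le> measure lebesgue \<Omega> powr (1 / DIM('a)) * (1 - t * integral \<Omega> (diverg \<phi>) / (DIM('a) * measure lebesgue \<Omega>))"
proof -
  let ?N = "real DIM('a)" and ?I = "integral \<Omega> (diverg \<phi>)" and ?B = "inner_parallel t \<Omega>"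
  define V where "V = measure lebesgue \<Omega>"
  define v w where "v = V powr (1 / ?N)" and "w = measure lebesgue ?B powr (1 / ?N)"
  have \<Omega>ne: "\<Omega> \<noteq> {}" using ne by auto
  have V: "V > 0"
    using \<Omega> \<Omega>ne open_not_negligible[of \<Omega>] lmeasurable_open[of \<Omega>] unfolding V_def
    by (metis negligible_iff_measure0 zero_less_measure_iff)
  have oB: "open ?B" "bounded ?B" using \<Omega> by (auto intro: open_inner_parallel bounded_inner_parallel)
  have "bounded (diverg \<phi> ` closure \<Omega>)"
    using continuous_on_diverg[OF \<phi>(1)] \<Omega>(2)
    by (intro compact_imp_bounded compact_continuous_image) (auto intro: continuous_on_subset)
  then obtain M where M: "\<And>x. x \<in> closure \<Omega> \<Longrightarrow> \<bar>diverg \<phi> x\<bar> \<le> M" by (auto simp: bounded_iff)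
  then have M\<Omega>: "\<And>x. x \<in> \<Omega> \<Longrightarrow> \<bar>diverg \<phi> x\<bar> \<le> M" using closure_subset by blast
  then have M0: "M \<ge> 0" using \<Omega>ne by (meson abs_ge_zero all_not_in_conv order_trans)
  have key: "w \<le> v - v * (t * ?I / ((1 + s * t * M) * (?N * V)))" if s: "0 < s" "s < 1" for s
  proof -
    let ?A' = "(\<lambda>x. (1 - s) *\<^sub>R x) ` \<Omega>" and ?B' = "(\<lambda>x. s *\<^sub>R x) ` ?B" and ?C = "inner_parallel (s * t) \<Omega>"
    have sub: "msum ?A' ?B' \<subseteq> ?C"
    proof
      fix z assume "z \<in> msum ?A' ?B'"
      then obtain x y where xy: "x \<in> \<Omega>" "y \<in> ?B" "z = (1 - s) *\<^sub>R x + s *\<^sub>R y" unfolding UN_iff by blast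
      define r where "r = infdist y (- \<Omega>)"
      have rt: "t < r" using xy by (simp add: r_def)
      have "ball z (s * r) \<subseteq> \<Omega>"
      proof
        fix u assume u: "u \<in> ball z (s * r)"
        \<comment> \<open>A displacement of z is charged entirely to y, magnified by 1/s; this is
          why a ball of radius s r around z stays in the domain.\<close>
        define y' where "y' = y + (u - z) /\<^sub>R s"
        have "dist y y' = norm (u - z) / s" using s by (simp add: y'_def dist_norm divide_inverse mult.commute)
        also have "\<dots> < r" using u s by (simp add: dist_norm norm_minus_commute divide_less_eq mult.commute)
        finally have "dist y y' < infdist y (- \<Omega>)" by (simp add: r_def)
        then have "y' \<in> \<Omega>" using infdist_le[of y' "- \<Omega>" y] by force
        moreover have "u = (1 - s) *\<^sub>R x + s *\<^sub>R y'" using s by (simp add: y'_def xy(3) scaleR_add_right)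
        ultimately show "u \<in> \<Omega>" using convexD_alt[OF \<Omega>(3) xy(1), of y' s] s by simp
      qed
      then have "s * r \<le> infdist z (- \<Omega>)" by (rule ball_subset_imp_le_infdist_compl[OF \<Omega>(2)])
      moreover have "s * t < s * r" using s rt by simp
      moreover from this have "z \<in> \<Omega>" using \<open>ball z (s * r) \<subseteq> \<Omega>\<close> s t by (auto simp: subset_eq intro: less_trans[of 0 "s * t"])
      ultimately show "z \<in> ?C" by simp
    qed
    have scale: "measure lebesgue ((\<lambda>x. m *\<^sub>R x) ` S) = m ^ DIM('a) * measure lebesgue S" if "m > 0" for m and S :: "'a set"
      using measure_lebesgue_affine[of m 0 S] that by simp
    have oA': "open ?A'" "bounded ?A'" "?A' \<noteq> {}" using \<Omega> \<Omega>ne s by (auto intro!: open_scaling bounded_scaling)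
    have oB': "open ?B'" "bounded ?B'" "?B' \<noteq> {}" using oB ne s by (auto intro!: open_scaling bounded_scaling simp del: Collect_empty_eq)
    have oC: "open ?C" "bounded ?C" using \<Omega> by (auto intro: open_inner_parallel bounded_inner_parallel)
    have root: "(m ^ DIM('a) * X) powr (1 / ?N) = m * X powr (1 / ?N)" if "m > 0" "X \<ge> 0" for m X
      using that by (simp add: powr_mult powr_realpow[symmetric] powr_powr)
    have "(1 - s) * v + s * w = measure lebesgue ?A' powr (1 / ?N) + measure lebesgue ?B' powr (1 / ?N)"
      using s unfolding v_def w_def V_def by (simp add: scale root)
    also have "\<dots> \<le> measure lebesgue (msum ?A' ?B') powr (1 / ?N)"
      by (rule Brunn_Minkowski_open[OF oA' oB'])
    also have "\<dots> \<le> measure lebesgue ?C powr (1 / ?N)"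
    proof (intro powr_mono2 measure_mono_fmeasurable sub)
      show "msum ?A' ?B' \<in> sets lebesgue" by (intro fmeasurableD lmeasurable_open bounded_sums open_sums disjI1 oA' oB')
      show "?C \<in> lmeasurable" using oC by (intro lmeasurable_open)
    qed auto
    finally have BM: "(1 - s) * v + s * w \<le> measure lebesgue ?C powr (1 / ?N)" .
    define g where "g = V - measure lebesgue ?C"
    have Cne: "?C \<noteq> {}" using sub oA'(3) oB'(3) by blast
    have "(s * t) * (?I - M * g) \<le> g"
      unfolding g_def V_def using s t by (intro inner_parallel_first_variation[OF \<Omega> Cne _ \<phi> M\<Omega>]) auto
    then have "s * t * ?I \<le> g * (1 + s * t * M)" by (simp add: algebra_simps)
    moreover have "1 + s * t * M > 0" using s t M0 by (simp add: add_pos_nonneg)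
    ultimately have y: "s * t * ?I / (1 + s * t * M) \<le> g" by (simp add: pos_divide_le_eq)
    have gV: "g \<le> V" by (simp add: g_def)
    have "measure lebesgue ?C powr (1 / ?N) \<le> (V - s * t * ?I / (1 + s * t * M)) powr (1 / ?N)"
      using y by (intro powr_mono2) (auto simp: g_def)
    also have "\<dots> \<le> v * (1 - (s * t * ?I / (1 + s * t * M)) / (?N * V))"
      unfolding v_def using V y gV by (intro powr_root_Bernoulli) auto
    finally have "(1 - s) * v + s * w \<le> v * (1 - (s * t * ?I / (1 + s * t * M)) / (?N * V))" using BM by linarith
    then have "s * w \<le> s * (v - v * (t * ?I / ((1 + s * t * M) * (?N * V))))" by (simp add: algebra_simps)
    then show ?thesis using s by simp
  qed
  \<comment> \<open>The error M g of the first variation survives only in the factor 1 + s t M,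
    which tends to 1.\<close>
  have "((\<lambda>s. v - v * (t * ?I / ((1 + s * t * M) * (?N * V)))) \<longlongrightarrow> v - v * (t * ?I / ((1 + 0 * t * M) * (?N * V)))) (at_right 0)"
    using V by (intro tendsto_intros) auto
  moreover have "\<forall>\<^sub>F s in at_right 0. w \<le> v - v * (t * ?I / ((1 + s * t * M) * (?N * V)))"
  proof -
    have "\<forall>\<^sub>F s in at_right (0::real). s \<in> {0<..<1}" by (rule eventually_at_right_real) simp
    then show ?thesis by eventually_elim (rule key, auto)
  qed
  ultimately have "w \<le> v - v * (t * ?I / (?N * V))" by (auto dest: tendsto_lowerbound)
  then show ?thesis by (simp add: v_def w_def V_def algebra_simps)
qed

lemma inner_parallel_nonempty:
  fixes \<Omega> :: "'a::euclidean_space set"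
  assumes "open \<Omega>" "bounded \<Omega>" "\<Omega> \<noteq> {}"
  obtains t where "t > 0" "inner_parallel t \<Omega> \<noteq> {}"
proof -
  obtain x where "x \<in> \<Omega>" using assms by blast
  then have "infdist x (- \<Omega>) > 0" using infdist_compl_pos_iff[OF assms(1,2)] by blast
  then show ?thesis using \<open>x \<in> \<Omega>\<close> by (intro that[of "infdist x (- \<Omega>) / 2"]) auto
qed

context
  fixes \<Omega> :: "'a::euclidean_space set"
  assumes \<Omega>: "open \<Omega>" "bounded \<Omega>" "convex \<Omega>" "\<Omega> \<noteq> {}"
begin

lemma convex_volume_pos: "measure lebesgue \<Omega> > 0"
  using \<Omega> open_not_negligible[of \<Omega>] lmeasurable_open[of \<Omega>]
  by (metis negligible_iff_measure0 zero_less_measure_iff)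

text \<open>The volume estimate solved for the flux: a bound uniform over all admissible fields. It
  gives finiteness of the perimeter, without which its \<open>Sup\<close> would carry no
  information, and then passes to that supremum.\<close>

lemma flux_le:
  assumes "inner_parallel t \<Omega> \<noteq> {}" "t > 0" "\<phi> \<in> C1c_fields" "\<And>x. norm (\<phi> x) \<le> 1"
  shows "integral \<Omega> (diverg \<phi>) \<le> (1 - measure lebesgue (inner_parallel t \<Omega>) powr (1 / DIM('a)) / measure lebesgue \<Omega> powr (1 / DIM('a)))
      * (DIM('a) * measure lebesgue \<Omega>) / t"
proof -
  have v: "measure lebesgue \<Omega> powr (1 / DIM('a)) > 0" using convex_volume_pos by simp
  have "measure lebesgue (inner_parallel t \<Omega>) powr (1 / DIM('a)) / measure lebesgue \<Omega> powr (1 / DIM('a))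
    \<le> 1 - t * integral \<Omega> (diverg \<phi>) / (DIM('a) * measure lebesgue \<Omega>)"
    using inner_parallel_volume_field[OF \<Omega>(1-3) assms] v by (simp add: pos_divide_le_eq mult.commute)
  then have "t * integral \<Omega> (diverg \<phi>) / (DIM('a) * measure lebesgue \<Omega>)
     \<le> 1 - measure lebesgue (inner_parallel t \<Omega>) powr (1 / DIM('a)) / measure lebesgue \<Omega> powr (1 / DIM('a))"
    by linarith
  then show ?thesis using assms(2) convex_volume_pos by (simp add: pos_divide_le_eq pos_le_divide_eq mult.commute)
qed

lemma bdd_above_flux: "bdd_above {integral \<Omega> (diverg \<phi>) | \<phi>. \<phi> \<in> C1c_fields \<and> (\<forall>x. norm (\<phi> x) \<le> 1)}"
proof -
  obtain t where t: "t > 0" "inner_parallel t \<Omega> \<noteq> {}" using inner_parallel_nonempty \<Omega> by blast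
  show ?thesis by (rule bdd_aboveI) (use flux_le[OF t(2,1)] in blast)
qed

lemma flux_le_perimeter:
  "\<phi> \<in> C1c_fields \<Longrightarrow> (\<And>x. norm (\<phi> x) \<le> 1) \<Longrightarrow> integral \<Omega> (diverg \<phi>) \<le> perimeter \<Omega>"
  unfolding perimeter_def by (rule cSup_upper[OF _ bdd_above_flux]) blast

lemma zero_in_C1c_fields: "(\<lambda>x. 0) \<in> C1c_fields"
  by (auto simp: C1c_fields_def tsupp_def frechet_derivative_const)

lemma perimeter_nonneg: "perimeter \<Omega> \<ge> 0"
proof -
  have "diverg (\<lambda>x. 0 :: 'a) = (\<lambda>x. 0)" by (auto simp: diverg_def frechet_derivative_const)
  then show ?thesis using flux_le_perimeter[OF zero_in_C1c_fields] by simp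
qed

text \<open>The uniform flux bound is passed to the supremum. The first claim expresses that a
  volume root is nonnegative: no inner parallel set survives beyond N V / P.\<close>

theorem inner_parallel_volume:
  assumes "inner_parallel t \<Omega> \<noteq> {}" "t > 0"
  shows "t * perimeter \<Omega> \<le> DIM('a) * measure lebesgue \<Omega>"
    and "measure lebesgue (inner_parallel t \<Omega>) \<le> measure lebesgue \<Omega> * (1 - t * perimeter \<Omega> / (DIM('a) * measure lebesgue \<Omega>)) ^ DIM('a)"
proof -
  let ?V = "measure lebesgue \<Omega>" and ?N = "real DIM('a)" and ?f = "measure lebesgue (inner_parallel t \<Omega>)"
  let ?q = "?f powr (1 / ?N) / ?V powr (1 / ?N)"
  note V = convex_volume_pos
  have "perimeter \<Omega> \<le> (1 - ?q) * (?N * ?V) / t"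
    unfolding perimeter_def
  proof (rule cSup_least)
    show "{integral \<Omega> (diverg \<phi>) |\<phi>. \<phi> \<in> C1c_fields \<and> (\<forall>x. norm (\<phi> x) \<le> 1)} \<noteq> {}"
      using zero_in_C1c_fields by force
  qed (use flux_le[OF assms] in blast)
  then have le: "?q \<le> 1 - t * perimeter \<Omega> / (?N * ?V)"
    using V assms(2) by (simp add: field_simps)
  have "0 \<le> ?q" by simp
  then have "t * perimeter \<Omega> / (?N * ?V) \<le> 1" using le by linarith
  then show "t * perimeter \<Omega> \<le> ?N * ?V" using V by (simp add: pos_divide_le_eq)
  have "?q ^ DIM('a) \<le> (1 - t * perimeter \<Omega> / (?N * ?V)) ^ DIM('a)" using le by (intro power_mono) auto
  moreover have "?q ^ DIM('a) = ?f / ?V"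
  proof -
    have r: "(X powr (1 / ?N)) ^ DIM('a) = X" if "X \<ge> 0" for X :: real
      using that by (cases "X = 0") (simp_all add: powr_realpow[symmetric] powr_powr)
    then show ?thesis by (simp add: power_divide)
  qed
  ultimately show "?f \<le> ?V * (1 - t * perimeter \<Omega> / (?N * ?V)) ^ DIM('a)"
    using V by (simp add: pos_divide_le_eq mult.commute)
qed

end

subsection \<open>The lower bound for convex domains\<close>

lemma continuous_on_grad:
  assumes "\<psi> \<in> Cc_inf \<Omega>"
  shows "continuous_on UNIV (grad \<psi>)"
proof -
  have "Ck (Suc 0) UNIV \<psi>" by (rule Cc_infD(1)[OF assms])
  then have "continuous_on UNIV (\<lambda>x. frechet_derivative \<psi> (at x) b)" if "b \<in> Basis" for b using that by simp
  then show ?thesis unfolding grad_def by (intro continuous_intros)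
qed

lemma grad_inner:
  assumes "\<psi> \<in> Cc_inf \<Omega>"
  shows "frechet_derivative \<psi> (at x) v = grad \<psi> x \<bullet> v"
proof -
  have l: "linear (frechet_derivative \<psi> (at x))" using Cc_infD(5)[OF assms] by (rule linear_frechet_derivative)
  have "frechet_derivative \<psi> (at x) v = frechet_derivative \<psi> (at x) (\<Sum>b\<in>Basis. (v \<bullet> b) *\<^sub>R b)" by (simp add: euclidean_representation)
  also have "\<dots> = (\<Sum>b\<in>Basis. (v \<bullet> b) * frechet_derivative \<psi> (at x) b)" using l by (simp add: linear_sum linear_cmul)
  also have "\<dots> = grad \<psi> x \<bullet> v" by (simp add: grad_def inner_sum_left inner_commute[of v] mult.commute)
  finally show ?thesis .
qed

lemma grad_zero_outside:
  assumes "\<psi> \<in> Cc_inf \<Omega>" "x \<notin> tsupp \<psi>"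
  shows "grad \<psi> x = 0"
proof -
  have "open (- tsupp \<psi>)" by (simp add: tsupp_def open_Compl)
  then have "(\<psi> has_derivative (\<lambda>_. 0)) (at x)"
  proof (rule has_derivative_transform_within_open[OF has_derivative_const])
    show "x \<in> - tsupp \<psi>" using assms(2) by simp
    show "0 = \<psi> y" if "y \<in> - tsupp \<psi>" for y using that Cc_infD(4)[OF assms(1), of y] by simp
  qed
  then have "frechet_derivative \<psi> (at x) = (\<lambda>_. 0)" by (rule frechet_derivative_at[symmetric])
  then show ?thesis by (simp add: grad_def)
qed

text \<open>The bridge between the gauge integrals over \<Omega> in the definitions and nonnegative
  Lebesgue integrals over the whole space, on which Tonelli acts without side conditions.\<close>

lemma nn_integral_compact_support:
  fixes f :: "'a::euclidean_space \<Rightarrow> real"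
  assumes f: "continuous_on UNIV f" "\<And>x. 0 \<le> f x" and K: "compact K" "K \<subseteq> \<Omega>" "\<And>x. x \<notin> K \<Longrightarrow> f x = 0"
  shows "(\<integral>\<^sup>+x. ennreal (f x) \<partial>lborel) = ennreal (integral \<Omega> f)" "integrable lborel f" "f integrable_on \<Omega>"
proof -
  have "bounded (f ` K)" using f(1) K(1) by (intro compact_imp_bounded compact_continuous_image) (auto intro: continuous_on_subset)
  then obtain C where C: "\<And>x. x \<in> K \<Longrightarrow> \<bar>f x\<bar> \<le> C" by (auto simp: bounded_iff)
  show i: "integrable lborel f"
    by (rule integrable_lborel_bounded_support[where S=K and C=C])
       (use f C K in \<open>auto intro: borel_measurable_continuous_onI compact_imp_bounded\<close>)
  have e: "(\<lambda>x. if x \<in> \<Omega> then f x else 0) = f" using K by (auto simp: fun_eq_iff)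
  have u: "f integrable_on UNIV" using has_integral_integral_lborel[OF i] by (rule has_integral_integrable)
  show "f integrable_on \<Omega>" using integrable_restrict_UNIV[of \<Omega> f] u e by simp
  have "integral \<Omega> f = integral UNIV (\<lambda>x. if x \<in> \<Omega> then f x else 0)" by (rule integral_restrict_UNIV[symmetric])
  also have "\<dots> = integral\<^sup>L lborel f" unfolding e by (rule integral_lborel[OF i])
  finally show "(\<integral>\<^sup>+x. ennreal (f x) \<partial>lborel) = ennreal (integral \<Omega> f)"
    using nn_integral_eq_integral[OF i] f(2) by simp
qed

lemma Cc_inf_energies:
  fixes \<psi> :: "'a::euclidean_space \<Rightarrow> real"
  assumes \<psi>: "\<psi> \<in> Cc_inf \<Omega>" and "p > 0" "q > 0"
  shows "(\<integral>\<^sup>+x. ennreal (\<bar>\<psi> x\<bar> powr q) \<partial>lborel) = ennreal (integral \<Omega> (\<lambda>x. \<bar>\<psi> x\<bar> powr q))"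
    "(\<integral>\<^sup>+x. ennreal (norm (grad \<psi> x) powr p) \<partial>lborel) = ennreal (integral \<Omega> (\<lambda>x. norm (grad \<psi> x) powr p))"
    "(\<lambda>x. \<bar>\<psi> x\<bar> powr q) integrable_on \<Omega>" "(\<lambda>x. norm (grad \<psi> x) powr p) integrable_on \<Omega>"
proof -
  have c: "continuous_on UNIV (\<lambda>x. \<bar>\<psi> x\<bar> powr q)" using Cc_infD(6)[OF \<psi>] assms(3) by (rule continuous_on_abs_powr)
  have g: "continuous_on UNIV (\<lambda>x. norm (grad \<psi> x) powr p)"
    using continuous_on_abs_powr[of UNIV "\<lambda>x. norm (grad \<psi> x)" p] continuous_on_grad[OF \<psi>] assms(2) by (simp add: continuous_on_norm)
  note 1 = nn_integral_compact_support[OF c _ Cc_infD(2,3)[OF \<psi>]]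
  note 2 = nn_integral_compact_support[OF g _ Cc_infD(2,3)[OF \<psi>]]
  show "(\<integral>\<^sup>+x. ennreal (\<bar>\<psi> x\<bar> powr q) \<partial>lborel) = ennreal (integral \<Omega> (\<lambda>x. \<bar>\<psi> x\<bar> powr q))"
     "(\<lambda>x. \<bar>\<psi> x\<bar> powr q) integrable_on \<Omega>"
    using 1(1,3) Cc_infD(4)[OF \<psi>] by auto
  show "(\<integral>\<^sup>+x. ennreal (norm (grad \<psi> x) powr p) \<partial>lborel) = ennreal (integral \<Omega> (\<lambda>x. norm (grad \<psi> x) powr p))"
     "(\<lambda>x. norm (grad \<psi> x) powr p) integrable_on \<Omega>"
    using 2(1,3) grad_zero_outside[OF \<psi>] by auto
qed

text \<open>A flat bump on a small ball, which exceeds a positive constant on the half ball and so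
  has positive mass. It shows that the sets behind \<open>lambda_pq\<close> and \<open>pi_pq\<close>
  are nonempty, as any lower bound for their \<open>Inf\<close> requires.\<close>

lemma exists_normalised_Cc_inf:
  fixes \<Omega> :: "'a::euclidean_space set"
  assumes "open \<Omega>" "\<Omega> \<noteq> {}" "q > 0"
  shows "\<exists>\<psi>\<in>Cc_inf \<Omega>. integral \<Omega> (\<lambda>x. \<bar>\<psi> x\<bar> powr q) = 1"
proof -
  obtain x0 where "x0 \<in> \<Omega>" using assms by blast
  then obtain r where r: "r > 0" "cball x0 r \<subseteq> \<Omega>" using assms(1) open_contains_cball by blast
  define \<psi> where "\<psi> x = flat_exp 0 (r\<^sup>2 - (norm (x - x0))\<^sup>2)" for x :: 'a
  have out: "\<psi> x = 0" if "x \<notin> cball x0 r" for x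
  proof -
    have "r \<le> norm (x - x0)" using that by (simp add: dist_norm norm_minus_commute)
    then have "r\<^sup>2 \<le> (norm (x - x0))\<^sup>2" using r by (intro power_mono) auto
    then show ?thesis by (simp add: \<psi>_def flat_exp_zero)
  qed
  have i: "Ck n UNIV (\<lambda>x::'a. x \<bullet> b - x0 \<bullet> b)" for n b by (rule Ck_diff[OF open_UNIV Ck_inner Ck_const])
  have "Ck n UNIV (\<lambda>x::'a. \<Sum>b\<in>Basis. (x \<bullet> b - x0 \<bullet> b) * (x \<bullet> b - x0 \<bullet> b))" for n
    by (rule Ck_sum[OF open_UNIV Ck_mult[OF open_UNIV i i]])
  moreover have "(\<Sum>b\<in>Basis. (x \<bullet> b - x0 \<bullet> b) * (x \<bullet> b - x0 \<bullet> b)) = (norm (x - x0))\<^sup>2" for x :: 'a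
    unfolding power2_norm_eq_inner euclidean_inner[of "x - x0" "x - x0"] by (simp add: inner_diff_left)
  ultimately have sq: "Ck n UNIV (\<lambda>x::'a. (norm (x - x0))\<^sup>2)" for n by simp
  have \<psi>: "\<psi> \<in> Cc_inf \<Omega>"
  proof (rule Cc_infI[where K="cball x0 r"])
    show "Ck n UNIV \<psi>" for n
      unfolding \<psi>_def[abs_def] by (rule Ck_compose[OF open_UNIV UNIV_I Ck_flat_exp Ck_diff[OF open_UNIV Ck_const sq]])
  qed (use r out in auto)
  let ?f = "\<lambda>x. \<bar>\<psi> x\<bar> powr q"
  have int: "?f integrable_on \<Omega>" using Cc_inf_energies(3)[OF \<psi> zero_less_one assms(3)] .
  define e where "e = flat_exp 0 (r\<^sup>2 - (r/2)\<^sup>2) powr q"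
  have epos: "flat_exp 0 (r\<^sup>2 - (r/2)\<^sup>2) > 0" using r by (intro flat_exp_pos) (simp add: power2_eq_square)
  have low: "e \<le> ?f x" if "x \<in> cball x0 (r/2)" for x
  proof -
    have "(norm (x - x0))\<^sup>2 \<le> (r/2)\<^sup>2" using that by (intro power_mono) (auto simp: dist_norm norm_minus_commute)
    then have "flat_exp 0 (r\<^sup>2 - (r/2)\<^sup>2) \<le> \<psi> x" unfolding \<psi>_def by (intro flat_exp_mono) simp
    then show ?thesis unfolding e_def using epos assms(3) by (intro powr_mono2) auto
  qed
  have S0: "integral \<Omega> ?f \<ge> 0" by (rule integral_nonneg[OF int]) simp
  have S: "integral \<Omega> ?f > 0"
  proof (rule ccontr)
    assume "\<not> integral \<Omega> ?f > 0"
    then have "integral \<Omega> ?f = 0" using S0 by simp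
    then have z: "(\<integral>\<^sup>+x. ennreal (?f x) \<partial>lborel) = 0"
      using Cc_inf_energies(1)[OF \<psi> zero_less_one assms(3)] by simp
    have "ennreal e * emeasure lborel (ball x0 (r/2)) = (\<integral>\<^sup>+x. ennreal e * indicator (ball x0 (r/2)) x \<partial>lborel)"
      by (subst nn_integral_cmult_indicator) auto
    also have "\<dots> \<le> (\<integral>\<^sup>+x. ennreal (?f x) \<partial>lborel)"
    proof (rule nn_integral_mono)
      fix x :: 'a
      show "ennreal e * indicator (ball x0 (r/2)) x \<le> ennreal (?f x)"
        using low[of x] by (cases "x \<in> ball x0 (r/2)") (auto intro: ennreal_leI)
    qed
    finally have "ennreal e * emeasure lborel (ball x0 (r/2)) = 0" using z by simp
    moreover have "e > 0" using epos by (simp add: e_def)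
    ultimately have "emeasure lborel (ball x0 (r/2)) = 0" by simp
    then have "negligible (ball x0 (r/2))"
      unfolding negligible_iff_null_sets by (intro null_setsI) auto
    then show False using open_not_negligible[of "ball x0 (r/2)"] r by auto
  qed
  define k where "k = integral \<Omega> ?f powr (- 1 / q)"
  have "integral \<Omega> (\<lambda>x. \<bar>k * \<psi> x\<bar> powr q) = k powr q * integral \<Omega> ?f"
    by (simp add: k_def abs_mult powr_mult)
  also have "k powr q = integral \<Omega> ?f powr (- 1)" using assms(3) by (simp add: k_def powr_powr)
  finally have "integral \<Omega> (\<lambda>x. \<bar>k * \<psi> x\<bar> powr q) = 1" using S by (simp add: powr_minus)
  then show ?thesis using Cc_inf_scale[OF \<psi>, of k] by (intro bexI[of _ "\<lambda>x. k * \<psi> x"])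
qed

section \<open>Cells of points closest to a face\<close>

definition face_cell :: "nat \<Rightarrow> (nat \<Rightarrow> 'a::euclidean_space) \<Rightarrow> (nat \<Rightarrow> real) \<Rightarrow> nat \<Rightarrow> 'a set" where
  "face_cell n a c i = {x. 0 \<le> c i - a i \<bullet> x \<and>
     (\<forall>j\<in>{..<n}. (j < i \<longrightarrow> c i - a i \<bullet> x < c j - a j \<bullet> x) \<and> c i - a i \<bullet> x \<le> c j - a j \<bullet> x)}"

lemma borel_face_cell [measurable]: "face_cell n a c i \<in> sets borel"
  unfolding face_cell_def by measurable

text \<open>Moving by s towards face i lowers the distance to it by exactly s and the distance to
  any other face by at most s, as unit normals satisfy a_j . a_i <= 1. So the trace of a cell on a
  line normal to its face is an interval starting at the face.\<close>

lemma face_cell_towards_face: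
  assumes x: "x \<in> face_cell n a c i" and i: "i < n" and s: "0 \<le> s" "s \<le> c i - a i \<bullet> x"
    and a: "\<And>j. j < n \<Longrightarrow> norm (a j) = 1"
  shows "x + s *\<^sub>R a i \<in> face_cell n a c i"
proof -
  have ai: "a i \<bullet> a i = 1" using a[OF i] by (simp add: norm_eq_1)
  have aj: "s * (a j \<bullet> a i) \<le> s" if "j < n" for j
  proof -
    have "a j \<bullet> a i \<le> norm (a j) * norm (a i)" by (rule norm_cauchy_schwarz)
    then have "a j \<bullet> a i \<le> 1" using a[OF that] a[OF i] by simp
    then show ?thesis using s(1) by (simp add: mult_left_le)
  qed
  have di: "c i - a i \<bullet> (x + s *\<^sub>R a i) = c i - a i \<bullet> x - s" by (simp add: inner_add_right ai)
  have dj: "c j - a j \<bullet> x - s \<le> c j - a j \<bullet> (x + s *\<^sub>R a i)" if "j < n" for j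
    using aj[OF that] by (simp add: inner_add_right)
  show ?thesis
    unfolding face_cell_def mem_Collect_eq di
  proof (intro conjI ballI impI)
    fix j assume "j \<in> {..<n}"
    then have j: "j < n" by simp
    show "c i - a i \<bullet> x - s \<le> c j - a j \<bullet> (x + s *\<^sub>R a i)"
    proof -
      have "c i - a i \<bullet> x \<le> c j - a j \<bullet> x" using x j by (simp add: face_cell_def)
      then show ?thesis using dj[OF j] by linarith
    qed
    show "c i - a i \<bullet> x - s < c j - a j \<bullet> (x + s *\<^sub>R a i)" if "j < i"
    proof -
      have "c i - a i \<bullet> x < c j - a j \<bullet> x" using x j that by (simp add: face_cell_def)
      then show ?thesis using dj[OF j] by linarith
    qed
  qed (use s in simp)
qed

lemma face_cell_poly_dist:
  assumes "x \<in> face_cell n a c i" "i < n" "n > 0"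
  shows "poly_dist n a c x = c i - a i \<bullet> x" "0 \<le> poly_dist n a c x"
proof -
  show 1: "poly_dist n a c x = c i - a i \<bullet> x"
    using assms by (intro antisym poly_dist_le poly_dist_ge) (auto simp: face_cell_def)
  show "0 \<le> poly_dist n a c x" unfolding 1 using assms(1) by (simp add: face_cell_def)
qed

text \<open>Ties go to the smallest index, in accordance with the strict inequalities for j < i in
  \<open>face_cell\<close>; that asymmetry makes the cells disjoint.\<close>

lemma face_cell_exists:
  assumes "n > 0" "0 \<le> poly_dist n a c x"
  shows "\<exists>i<n. x \<in> face_cell n a c i"
proof -
  let ?P = "\<lambda>i. i < n \<and> poly_dist n a c x = c i - a i \<bullet> x"
  define i where "i = (LEAST i. ?P i)"
  have "\<exists>i. ?P i" using poly_dist_attained[OF assms(1), of a c x] by blast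
  then have i: "?P i" unfolding i_def by (rule LeastI_ex)
  have "x \<in> face_cell n a c i"
    unfolding face_cell_def mem_Collect_eq
  proof (intro conjI ballI impI)
    show "0 \<le> c i - a i \<bullet> x" using i assms(2) by simp
    fix j assume j: "j \<in> {..<n}"
    then show le: "c i - a i \<bullet> x \<le> c j - a j \<bullet> x" using i poly_dist_le[of j n a c x] by simp
    assume "j < i"
    then have "\<not> ?P j" unfolding i_def by (rule not_less_Least)
    then show "c i - a i \<bullet> x < c j - a j \<bullet> x" using j i le by simp
  qed
  then show ?thesis using i by blast
qed

lemma face_cell_unique:
  assumes "x \<in> face_cell n a c i" "x \<in> face_cell n a c j" "i < n" "j < n"
  shows "i = j"
proof -
  have "\<not> i < j" if "x \<in> face_cell n a c i" "x \<in> face_cell n a c j" "i < n" "j < n" for i j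
  proof
    assume "i < j"
    then have "c j - a j \<bullet> x < c i - a i \<bullet> x" using that(2,3) by (simp add: face_cell_def)
    moreover have "c i - a i \<bullet> x \<le> c j - a j \<bullet> x" using that(1,4) by (simp add: face_cell_def)
    ultimately show False by simp
  qed
  then show ?thesis using assms by (meson linorder_neqE_nat)
qed

lemma sum_face_cell:
  fixes g :: "nat \<Rightarrow> ennreal"
  assumes "x \<in> face_cell n a c i" "i < n"
  shows "(\<Sum>j<n. indicator (face_cell n a c j) x * g j) = g i"
proof -
  have "(\<Sum>j<n. indicator (face_cell n a c j) x * g j) = (\<Sum>j<n. if j = i then g i else 0)"
  proof (rule sum.cong)
    fix j assume j: "j \<in> {..<n}"
    show "indicator (face_cell n a c j) x * g j = (if j = i then g i else 0)"
    proof (cases "j = i")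
      case False
      then have "x \<notin> face_cell n a c j" using face_cell_unique[OF assms(1) _ assms(2), of j] j by blast
      then show ?thesis using False by (simp add: indicator_def)
    qed (use assms(1) in simp)
  qed simp
  also have "\<dots> = g i" using assms(2) by simp
  finally show ?thesis .
qed

lemma sum_face_cell_outside:
  fixes g :: "nat \<Rightarrow> ennreal"
  assumes "\<And>i. i < n \<Longrightarrow> x \<notin> face_cell n a c i"
  shows "(\<Sum>j<n. indicator (face_cell n a c j) x * g j) = 0"
proof (rule sum.neutral, rule ballI)
  fix j assume "j \<in> {..<n}"
  then have "x \<notin> face_cell n a c j" using assms by simp
  then show "indicator (face_cell n a c j) x * g j = 0" by simp
qed

text \<open>Up to its two endpoints, which do not matter for integrals, a bounded down-closed set of
  nonnegative reals is an open interval. Inserting 0 before taking the supremum covers the empty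
  set, with h = 0.\<close>

lemma down_closed_interval:
  fixes J :: "real set"
  assumes "\<And>t. t \<in> J \<Longrightarrow> 0 \<le> t" "\<And>t t'. t \<in> J \<Longrightarrow> 0 \<le> t' \<Longrightarrow> t' \<le> t \<Longrightarrow> t' \<in> J" "bdd_above J"
  obtains h where "h \<ge> 0" "\<And>t. t \<noteq> 0 \<Longrightarrow> t \<noteq> h \<Longrightarrow> t \<in> J \<longleftrightarrow> t \<in> {0<..<h}"
proof
  let ?h = "Sup (insert 0 J)"
  have b: "bdd_above (insert 0 J)" using assms(3) by simp
  show "?h \<ge> 0" using b by (intro cSup_upper) auto
  fix t :: real assume t: "t \<noteq> 0" "t \<noteq> ?h"
  show "t \<in> J \<longleftrightarrow> t \<in> {0<..<?h}"
  proof
    assume "t \<in> J"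
    moreover from this have "t \<le> ?h" using b by (intro cSup_upper) auto
    ultimately show "t \<in> {0<..<?h}" using t assms(1)[of t] by auto
  next
    assume t': "t \<in> {0<..<?h}"
    then obtain t2 where "t2 \<in> insert 0 J" "t < t2" using less_cSup_iff[OF _ b] by auto
    then show "t \<in> J" using t' assms(2)[of t2 t] by auto
  qed
qed

lemma nn_integral_interval_continuous:
  fixes f :: "real \<Rightarrow> real"
  assumes "continuous_on UNIV f" "\<And>t. 0 \<le> f t"
  shows "(\<integral>\<^sup>+t. indicator {0<..<h} t * ennreal (f t) \<partial>lborel) = ennreal (integral {0..h} f)"
proof -
  have [measurable]: "f \<in> borel_measurable borel" using assms(1) by (rule borel_measurable_continuous_onI)
  have "f integrable_on {0..h}" using assms(1) by (intro integrable_continuous_real) (auto intro: continuous_on_subset)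
  then have "(f has_integral integral {0..h} f) {0<..<h}"
    by (simp add: has_integral_Icc_iff_Ioo[symmetric] integrable_integral)
  then have "((\<lambda>t. if t \<in> {0<..<h} then f t else 0) has_integral integral {0..h} f) UNIV"
    by (subst has_integral_restrict_UNIV)
  moreover have "(\<lambda>t. if t \<in> {0<..<h} then f t else 0) = (\<lambda>t. indicator {0<..<h} t * f t)" by (auto simp: fun_eq_iff)
  ultimately have hi: "((\<lambda>t. indicator {0<..<h} t * f t) has_integral integral {0..h} f) UNIV" by simp
  have "(\<integral>\<^sup>+t. ennreal (indicator {0<..<h} t * f t) \<partial>lborel) = ennreal (integral {0..h} f)"
    by (rule nn_integral_has_integral_lborel[OF _ _ hi]) (use assms in \<open>auto simp: indicator_def\<close>)
  then show ?thesis by (simp add: ennreal_mult' ennreal_indicator)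
qed

section \<open>The Rayleigh quotient of a convex domain\<close>

locale sublinear_exponents =
  fixes p q \<beta> :: real
  assumes pq: "1 \<le> q" "q < p" and \<beta>: "\<beta> = p * q / (p - q)"
begin

lemma exponents_pos: "p > 0" "q > 0" "\<beta> > 0" "p / q > 1" "(p / q - 1) * \<beta> = p"
proof -
  show p: "p > 0" and q: "q > 0" using pq by auto
  show "\<beta> > 0" unfolding \<beta> using p q pq by simp
  show "p / q > 1" using q pq by simp
  have "p / q - 1 = (p - q) / q" using q by (simp add: diff_divide_distrib)
  then show "(p / q - 1) * \<beta> = p" unfolding \<beta> using q pq by simp
qed

lemma pi_nonneg: "pi_pq p q \<ge> 0"
proof -
  obtain u where "u \<in> Cc_inf {0<..<1::real}" "integral {0<..<1} (\<lambda>x. \<bar>u x\<bar> powr q) = 1"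
    using exists_normalised_Cc_inf[of "{0<..<1::real}" q] exponents_pos by auto
  then have "{(integral {0<..<1} (\<lambda>x. \<bar>deriv u x\<bar> powr p)) powr (1/p) | u.
      u \<in> Cc_inf {0<..<1::real} \<and> (integral {0<..<1} (\<lambda>x. \<bar>u x\<bar> powr q)) powr (1/q) = 1} \<noteq> {}"
    by fastforce
  then show ?thesis unfolding pi_pq_def by (rule cInf_greatest) auto
qed

definition low_const :: real where "low_const = (pi_pq p q / 2) powr p"

text \<open>The line is parametrised by the distance t to face i, so the cell becomes 0 < t < h and
  the test function vanishes for t up to \<delta>. The one-dimensional inequality applies because a
  derivative along a unit vector is at most the gradient norm. Its remainder h^(1+\<beta>) is
  rewritten as an integral of (1+\<beta>) t^\<beta> over the trace of the cell, so that it can be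
  integrated over all lines.\<close>

lemma line_inequality:
  fixes a :: "nat \<Rightarrow> 'a::euclidean_space" and z :: 'a
  assumes a: "\<And>j. j < n \<Longrightarrow> norm (a j) = 1" and i: "i < n"
    and bdd: "bounded {x. 0 \<le> poly_dist n a c x}"
    and \<psi>: "\<psi> \<in> Cc_inf \<Omega>" and \<delta>: "\<delta> > 0" "\<And>x. x \<in> tsupp \<psi> \<Longrightarrow> \<delta> < c i - a i \<bullet> x" and m: "m > 0"
  defines "I \<equiv> \<lambda>s. indicator (face_cell n a c i) (z + s *\<^sub>R a i)"
  shows "(\<integral>\<^sup>+s. I s * ennreal (low_const * (p / q) * m powr (p / q - 1) * \<bar>\<psi> (z + s *\<^sub>R a i)\<bar> powr q) \<partial>lborel)
     \<le> (\<integral>\<^sup>+s. I s * ennreal (norm (grad \<psi> (z + s *\<^sub>R a i)) powr p) \<partial>lborel)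
      + (\<integral>\<^sup>+s. I s * ennreal (low_const * (p / q - 1) * m powr (p / q) * ((1 + \<beta>) * (c i - a i \<bullet> (z + s *\<^sub>R a i)) powr \<beta>)) \<partial>lborel)"
proof -
  have ai: "a i \<bullet> a i = 1" using a[OF i] by (simp add: norm_eq_1)
  have n: "n > 0" using i by simp
  let ?c1 = "low_const * (p / q) * m powr (p / q - 1)" and ?c2 = "low_const * (p / q - 1) * m powr (p / q)"
  have c12: "?c1 \<ge> 0" "?c2 \<ge> 0" using exponents_pos by (auto simp: low_const_def)
  define \<tau> where "\<tau> = c i - a i \<bullet> z"
  define P where "P t = z + (\<tau> - t) *\<^sub>R a i" for t
  have dP: "c i - a i \<bullet> P t = t" for t by (simp add: P_def \<tau>_def inner_add_right ai)
  have Pm[measurable]: "P \<in> borel_measurable borel" unfolding P_def by measurable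
  define J where "J = {t. P t \<in> face_cell n a c i}"
  obtain h where h: "h \<ge> 0" "\<And>t. t \<noteq> 0 \<Longrightarrow> t \<noteq> h \<Longrightarrow> t \<in> J \<longleftrightarrow> t \<in> {0<..<h}"
  proof (rule down_closed_interval[of J])
    show "0 \<le> t" if "t \<in> J" for t using that dP[of t] by (simp add: J_def face_cell_def)
    show "t' \<in> J" if "t \<in> J" "0 \<le> t'" "t' \<le> t" for t t'
    proof -
      have "P t + (t - t') *\<^sub>R a i \<in> face_cell n a c i"
        using that by (intro face_cell_towards_face i a) (auto simp: J_def dP)
      moreover have "P t + (t - t') *\<^sub>R a i = P t'" by (simp add: P_def algebra_simps)
      ultimately show ?thesis by (simp add: J_def)
    qed
    obtain R where R: "\<And>x. x \<in> {x. 0 \<le> poly_dist n a c x} \<Longrightarrow> norm x \<le> R" using bdd by (auto simp: bounded_iff)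
    show "bdd_above J"
    proof (rule bdd_aboveI)
      fix t assume "t \<in> J"
      then have "norm (P t) \<le> R" using face_cell_poly_dist(2)[OF _ i n, of "P t" a c] by (intro R) (simp add: J_def)
      moreover have "- (a i \<bullet> P t) \<le> norm (P t)" using Cauchy_Schwarz_ineq2[of "a i" "P t"] a[OF i] by simp
      ultimately show "t \<le> c i + R" using dP[of t] by linarith
    qed
  qed blast
  \<comment> \<open>The substitution s = \<tau> - t reverses the direction: s runs towards the face,
    t measures the distance from it.\<close>
  have rev: "(\<integral>\<^sup>+s. I s * ennreal (f (z + s *\<^sub>R a i)) \<partial>lborel) = (\<integral>\<^sup>+t. indicator {0<..<h} t * ennreal (f (P t)) \<partial>lborel)"
    if [measurable]: "f \<in> borel_measurable borel" for f
  proof -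
    have "(\<integral>\<^sup>+s. I s * ennreal (f (z + s *\<^sub>R a i)) \<partial>lborel)
        = ennreal \<bar>-1\<bar> * (\<integral>\<^sup>+t. I (\<tau> + - 1 * t) * ennreal (f (z + (\<tau> + - 1 * t) *\<^sub>R a i)) \<partial>lborel)"
    proof (rule nn_integral_real_affine)
      have m1: "(\<lambda>x. indicator (face_cell n a c i) x * ennreal (f x)) \<in> borel_measurable borel" by measurable
      have m2: "(\<lambda>s. z + s *\<^sub>R a i) \<in> borel_measurable borel" by measurable
      show "(\<lambda>s. I s * ennreal (f (z + s *\<^sub>R a i))) \<in> borel_measurable borel"
        unfolding I_def by (rule measurable_compose[OF m2 m1])
    qed simp
    also have "\<dots> = (\<integral>\<^sup>+t. indicator J t * ennreal (f (P t)) \<partial>lborel)"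
      by (simp add: I_def P_def J_def indicator_def)
    also have "\<dots> = (\<integral>\<^sup>+t. indicator {0<..<h} t * ennreal (f (P t)) \<partial>lborel)"
    proof (rule nn_integral_cong_AE)
      show "AE t in lborel. indicator J t * ennreal (f (P t)) = indicator {0<..<h} t * ennreal (f (P t))"
        using AE_lborel_singleton[of "0::real"] AE_lborel_singleton[of h]
      proof eventually_elim
        case (elim t)
        then show ?case using h(2)[of t] by (simp add: indicator_def)
      qed
    qed
    finally show ?thesis .
  qed
  define u where "u t = \<psi> (P t)" for t
  have u: "Ck k UNIV u" for k
  proof -
    have "bounded_linear (\<lambda>t. - t *\<^sub>R a i)" using bounded_linear_minus[OF bounded_linear_scaleR_left, of "a i"] by simp
    then have "Ck k UNIV (\<lambda>t. \<psi> (- t *\<^sub>R a i + (z + \<tau> *\<^sub>R a i)))"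
      by (rule Ck_compose_affine[OF _ open_UNIV UNIV_I Cc_infD(1)[OF \<psi>]])
    moreover have "(\<lambda>t. \<psi> (- t *\<^sub>R a i + (z + \<tau> *\<^sub>R a i))) = u"
      by (simp add: u_def P_def fun_eq_iff scaleR_diff_left algebra_simps)
    ultimately show ?thesis by simp
  qed
  have u0: "u t = 0" if "t \<le> \<delta>" for t
    using \<delta>(2)[of "P t"] dP[of t] that Cc_infD(4)[OF \<psi>, of "P t"] by (force simp: u_def)
  have du: "\<bar>deriv u t\<bar> \<le> norm (grad \<psi> (P t))" for t
  proof -
    have "(P has_derivative (\<lambda>h. - h *\<^sub>R a i)) (at t)"
      unfolding P_def by (auto intro!: derivative_eq_intros simp: algebra_simps)
    moreover have "(\<psi> has_derivative frechet_derivative \<psi> (at (P t))) (at (P t))"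
      using Cc_infD(5)[OF \<psi>] by (simp add: frechet_derivative_works)
    ultimately have "((\<lambda>t. \<psi> (P t)) has_derivative (\<lambda>h. frechet_derivative \<psi> (at (P t)) (- h *\<^sub>R a i))) (at t)"
      by (rule has_derivative_compose)
    then have "(u has_derivative (\<lambda>h. - (grad \<psi> (P t) \<bullet> a i) * h)) (at t)"
      unfolding u_def[abs_def] grad_inner[OF \<psi>] by (simp add: mult.commute)
    then have "(u has_real_derivative - (grad \<psi> (P t) \<bullet> a i)) (at t)"
      by (rule has_derivative_imp_has_field_derivative) simp
    then have "deriv u t = - (grad \<psi> (P t) \<bullet> a i)" by (rule DERIV_imp_deriv)
    then show ?thesis using Cauchy_Schwarz_ineq2[of "grad \<psi> (P t)" "a i"] a[OF i] by simp
  qed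
  have cu: "continuous_on UNIV (\<lambda>t. \<bar>u t\<bar> powr q)" "continuous_on UNIV (\<lambda>t. \<bar>deriv u t\<bar> powr p)"
    using smooth_real_deriv(2,3)[OF u] exponents_pos by (auto intro!: continuous_on_abs_powr)
  have [measurable]: "\<psi> \<in> borel_measurable borel" "grad \<psi> \<in> borel_measurable borel"
    using Cc_infD(6)[OF \<psi>] continuous_on_grad[OF \<psi>] by (auto intro: borel_measurable_continuous_onI)
  have L: "(\<integral>\<^sup>+s. I s * ennreal (?c1 * \<bar>\<psi> (z + s *\<^sub>R a i)\<bar> powr q) \<partial>lborel) = ennreal (?c1 * integral {0..h} (\<lambda>t. \<bar>u t\<bar> powr q))"
  proof -
    have "(\<integral>\<^sup>+s. I s * ennreal (?c1 * \<bar>\<psi> (z + s *\<^sub>R a i)\<bar> powr q) \<partial>lborel) = (\<integral>\<^sup>+t. indicator {0<..<h} t * ennreal (?c1 * \<bar>u t\<bar> powr q) \<partial>lborel)"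
      using rev[of "\<lambda>x. ?c1 * \<bar>\<psi> x\<bar> powr q"] by (simp add: u_def)
    also have "\<dots> = ennreal (integral {0..h} (\<lambda>t. ?c1 * \<bar>u t\<bar> powr q))"
    proof (rule nn_integral_interval_continuous)
      show "continuous_on UNIV (\<lambda>t. ?c1 * \<bar>u t\<bar> powr q)" by (rule continuous_on_mult[OF continuous_on_const cu(1)])
      show "0 \<le> ?c1 * \<bar>u t\<bar> powr q" for t by (rule mult_nonneg_nonneg[OF c12(1) powr_ge_zero])
    qed
    also have "integral {0..h} (\<lambda>t. ?c1 * \<bar>u t\<bar> powr q) = ?c1 * integral {0..h} (\<lambda>t. \<bar>u t\<bar> powr q)"
      by (rule integral_mult_right)
    finally show ?thesis .
  qed
  have R1: "ennreal (integral {0..h} (\<lambda>t. \<bar>deriv u t\<bar> powr p)) \<le> (\<integral>\<^sup>+s. I s * ennreal (norm (grad \<psi> (z + s *\<^sub>R a i)) powr p) \<partial>lborel)"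
  proof -
    have "ennreal (integral {0..h} (\<lambda>t. \<bar>deriv u t\<bar> powr p)) = (\<integral>\<^sup>+t. indicator {0<..<h} t * ennreal (\<bar>deriv u t\<bar> powr p) \<partial>lborel)"
      by (rule nn_integral_interval_continuous[symmetric, OF cu(2)]) simp
    also have "\<dots> \<le> (\<integral>\<^sup>+t. indicator {0<..<h} t * ennreal (norm (grad \<psi> (P t)) powr p) \<partial>lborel)"
      using du exponents_pos by (intro nn_integral_mono mult_left_mono ennreal_leI powr_mono2) auto
    also have "\<dots> = (\<integral>\<^sup>+s. I s * ennreal (norm (grad \<psi> (z + s *\<^sub>R a i)) powr p) \<partial>lborel)"
      using rev[of "\<lambda>x. norm (grad \<psi> x) powr p"] by simp
    finally show ?thesis .
  qed
  have R2: "(\<integral>\<^sup>+s. I s * ennreal (?c2 * ((1 + \<beta>) * (c i - a i \<bullet> (z + s *\<^sub>R a i)) powr \<beta>)) \<partial>lborel) = ennreal (?c2 * h powr (1 + \<beta>))"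
  proof -
    have "(\<integral>\<^sup>+s. I s * ennreal (?c2 * ((1 + \<beta>) * (c i - a i \<bullet> (z + s *\<^sub>R a i)) powr \<beta>)) \<partial>lborel)
       = (\<integral>\<^sup>+t. indicator {0<..<h} t * ennreal (?c2 * ((1 + \<beta>) * t powr \<beta>)) \<partial>lborel)"
      using rev[of "\<lambda>x. ?c2 * ((1 + \<beta>) * (c i - a i \<bullet> x) powr \<beta>)"] by (simp add: dP)
    also have "\<dots> = (\<integral>\<^sup>+t. ennreal ?c2 * (indicator {0<..<h} t * ennreal ((1 + \<beta>) * t powr (1 + \<beta> - 1))) \<partial>lborel)"
    proof (rule nn_integral_cong)
      fix t :: real
      have e: "1 + \<beta> - 1 = \<beta>" by simp
      show "indicator {0<..<h} t * ennreal (?c2 * ((1 + \<beta>) * t powr \<beta>)) = ennreal ?c2 * (indicator {0<..<h} t * ennreal ((1 + \<beta>) * t powr (1 + \<beta> - 1)))"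
        unfolding e ennreal_mult'[OF c12(2)] by (rule mult.left_commute)
    qed
    also have "\<dots> = ennreal ?c2 * ennreal (h powr (1 + \<beta>))"
      using nn_integral_powr_from_0[of "1 + \<beta>" h] exponents_pos h by (subst nn_integral_cmult) auto
    finally show ?thesis using c12 by (simp add: ennreal_mult')
  qed
  show ?thesis
  proof (cases "h = 0")
    case True
    then show ?thesis unfolding L by simp
  next
    case False
    then have h0: "h > 0" using h by simp
    have "?c1 * integral {0..h} (\<lambda>t. \<bar>u t\<bar> powr q) \<le> integral {0..h} (\<lambda>t. \<bar>deriv u t\<bar> powr p) + ?c2 * h powr (1 + \<beta>)"
      unfolding low_const_def by (rule half_interval_Sobolev_linearised[OF u \<delta>(1) u0 h0 pq pi_nonneg m \<beta>])
    then have "ennreal (?c1 * integral {0..h} (\<lambda>t. \<bar>u t\<bar> powr q)) \<le> ennreal (integral {0..h} (\<lambda>t. \<bar>deriv u t\<bar> powr p) + ?c2 * h powr (1 + \<beta>))"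
      by (rule ennreal_leI)
    also have "\<dots> = ennreal (integral {0..h} (\<lambda>t. \<bar>deriv u t\<bar> powr p)) + ennreal (?c2 * h powr (1 + \<beta>))"
    proof (rule ennreal_plus)
      show "0 \<le> integral {0..h} (\<lambda>t. \<bar>deriv u t\<bar> powr p)"
        by (intro integral_nonneg integrable_continuous_real continuous_on_subset[OF cu(2)]) auto
      show "0 \<le> ?c2 * h powr (1 + \<beta>)" by (rule mult_nonneg_nonneg[OF c12(2) powr_ge_zero])
    qed
    also have "\<dots> \<le> (\<integral>\<^sup>+s. I s * ennreal (norm (grad \<psi> (z + s *\<^sub>R a i)) powr p) \<partial>lborel) + ennreal (?c2 * h powr (1 + \<beta>))"
      by (intro add_right_mono R1)
    finally show ?thesis unfolding L R2 .
  qed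
qed

text \<open>The line inequality is integrated over the lines normal to the face. All segments of a
  cell are parallel, so a single direction of integration is enough.\<close>

lemma cell_inequality:
  fixes a :: "nat \<Rightarrow> 'a::euclidean_space"
  assumes a: "\<And>j. j < n \<Longrightarrow> norm (a j) = 1" and i: "i < n"
    and bdd: "bounded {x. 0 \<le> poly_dist n a c x}"
    and \<psi>: "\<psi> \<in> Cc_inf \<Omega>" and \<delta>: "\<delta> > 0" "\<And>x. x \<in> tsupp \<psi> \<Longrightarrow> \<delta> < c i - a i \<bullet> x" and m: "m > 0"
  defines "I \<equiv> indicator (face_cell n a c i)"
  shows "(\<integral>\<^sup>+x. I x * ennreal (low_const * (p / q) * m powr (p / q - 1) * \<bar>\<psi> x\<bar> powr q) \<partial>lborel)
     \<le> (\<integral>\<^sup>+x. I x * ennreal (norm (grad \<psi> x) powr p) \<partial>lborel)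
      + (\<integral>\<^sup>+x. I x * ennreal (low_const * (p / q - 1) * m powr (p / q) * ((1 + \<beta>) * (c i - a i \<bullet> x) powr \<beta>)) \<partial>lborel)"
    (is "integral\<^sup>N lborel ?U \<le> integral\<^sup>N lborel ?D + integral\<^sup>N lborel ?W")
proof -
  have [measurable]: "\<psi> \<in> borel_measurable borel" "grad \<psi> \<in> borel_measurable borel"
    using Cc_infD(6)[OF \<psi>] continuous_on_grad[OF \<psi>] by (auto intro: borel_measurable_continuous_onI)
  have [measurable]: "?U \<in> borel_measurable borel" "?D \<in> borel_measurable borel" "?W \<in> borel_measurable borel"
    unfolding I_def by measurable
  have [measurable]: "slab (a i) \<in> sets borel"
    by (intro borel_open open_Collect_conj open_Collect_less continuous_intros)
  note F = nn_integral_along_direction[OF _ a[OF i]]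
  have "integral\<^sup>N lborel ?U = (\<integral>\<^sup>+z. indicator (slab (a i)) z * (\<integral>\<^sup>+s. ?U (z + s *\<^sub>R a i) \<partial>lborel) \<partial>lborel)"
    by (rule F) measurable
  also have "\<dots> \<le> (\<integral>\<^sup>+z. indicator (slab (a i)) z * (\<integral>\<^sup>+s. ?D (z + s *\<^sub>R a i) \<partial>lborel)
        + indicator (slab (a i)) z * (\<integral>\<^sup>+s. ?W (z + s *\<^sub>R a i) \<partial>lborel) \<partial>lborel)"
    unfolding I_def distrib_left[symmetric]
    by (intro nn_integral_mono mult_left_mono line_inequality[OF a i bdd \<psi> \<delta> m]) auto
  also have "\<dots> = (\<integral>\<^sup>+z. indicator (slab (a i)) z * (\<integral>\<^sup>+s. ?D (z + s *\<^sub>R a i) \<partial>lborel) \<partial>lborel)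
        + (\<integral>\<^sup>+z. indicator (slab (a i)) z * (\<integral>\<^sup>+s. ?W (z + s *\<^sub>R a i) \<partial>lborel) \<partial>lborel)"
    by (rule nn_integral_add) measurable
  also have "(\<integral>\<^sup>+z. indicator (slab (a i)) z * (\<integral>\<^sup>+s. ?D (z + s *\<^sub>R a i) \<partial>lborel) \<partial>lborel) = integral\<^sup>N lborel ?D"
    by (rule F[symmetric]) measurable
  also have "(\<integral>\<^sup>+z. indicator (slab (a i)) z * (\<integral>\<^sup>+s. ?W (z + s *\<^sub>R a i) \<partial>lborel) \<partial>lborel) = integral\<^sup>N lborel ?W"
    by (rule F[symmetric]) measurable
  finally show ?thesis .
qed

text \<open>A polyhedron between the support and \<Omega> is cut into cells, and the cell
  inequalities are added. In each cell the distance to its face is the depth in the polyhedron,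
  hence at most the distance to the complement of \<Omega>. The bound thus involves only M, no
  longer the polyhedron.\<close>

lemma Rayleigh_quotient_bound:
  fixes \<Omega> :: "'a::euclidean_space set"
  assumes \<Omega>: "open \<Omega>" "bounded \<Omega>" "convex \<Omega>"
    and M: "M > 0" "(\<integral>\<^sup>+x. indicator \<Omega> x * ennreal ((1 + \<beta>) * infdist x (- \<Omega>) powr \<beta>) \<partial>lborel) \<le> ennreal M"
    and \<psi>: "\<psi> \<in> Cc_inf \<Omega>" "integral \<Omega> (\<lambda>x. \<bar>\<psi> x\<bar> powr q) = 1"
  shows "low_const * M powr (1 - p / q) \<le> integral \<Omega> (\<lambda>x. norm (grad \<psi> x) powr p)"
proof -
  let ?K = "tsupp \<psi>"
  have Kne: "?K \<noteq> {}"
  proof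
    assume "?K = {}"
    then have "\<psi> x = 0" for x using Cc_infD(4)[OF \<psi>(1)] by blast
    then have "integral \<Omega> (\<lambda>x. \<bar>\<psi> x\<bar> powr q) = 0" by simp
    then show False using \<psi>(2) by simp
  qed
  have cK: "compact ?K" by (rule Cc_infD(2)[OF \<psi>(1)])
  have hK: "convex hull ?K \<subseteq> \<Omega>" using Cc_infD(3)[OF \<psi>(1)] \<Omega>(3) by (rule hull_minimal)
  have "\<exists>(n::nat) (a::nat \<Rightarrow> 'a) c. n > 0 \<and> (\<forall>i<n. norm (a i) = 1) \<and> (\<forall>i<n. \<forall>x\<in>?K. a i \<bullet> x < c i) \<and> {x. \<forall>i<n. a i \<bullet> x \<le> c i} \<subseteq> \<Omega>"
    by (rule polyhedron_between[OF \<Omega>(1,2) cK Kne hK]) blast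
  then obtain n :: nat and a :: "nat \<Rightarrow> 'a" and c where n: "n > 0" and a: "\<And>i. i < n \<Longrightarrow> norm (a i) = 1" and Kc: "\<And>i x. i < n \<Longrightarrow> x \<in> ?K \<Longrightarrow> a i \<bullet> x < c i"
    and Q: "{x. \<forall>i<n. a i \<bullet> x \<le> c i} \<subseteq> \<Omega>"
    by blast
  let ?m = "poly_dist n a c"
  have mQ: "x \<in> \<Omega>" if "0 \<le> ?m x" for x
  proof -
    have "a i \<bullet> x \<le> c i" if "i < n" for i using poly_dist_le[OF that, of a c x] \<open>0 \<le> ?m x\<close> by simp
    then show "x \<in> \<Omega>" using Q by blast
  qed
  then have bQ: "bounded {x. 0 \<le> ?m x}" using \<Omega>(2) by (auto intro: bounded_subset)
  have m_le: "?m x \<le> infdist x (- \<Omega>)" if "0 \<le> ?m x" for x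
  proof (rule ball_subset_imp_le_infdist_compl[OF \<Omega>(2)], rule subsetI)
    fix y assume "y \<in> ball x (?m x)"
    then have "norm (x - y) < ?m x" by (simp add: dist_norm)
    moreover have "\<bar>?m x - ?m y\<bar> \<le> norm (x - y)" by (rule poly_dist_lipschitz[OF n a])
    ultimately have "0 \<le> ?m y" by linarith
    then show "y \<in> \<Omega>" by (rule mQ)
  qed
  \<comment> \<open>Half the minimal depth on the compact support: the test function vanishes within
    a common distance of every face.\<close>
  have "\<exists>\<delta>>0. \<forall>x\<in>?K. \<forall>i<n. \<delta> < c i - a i \<bullet> x"
  proof -
    have cm: "continuous_on ?K ?m" by (rule continuous_on_poly_dist[OF n a])
    obtain x0 where x0: "x0 \<in> ?K" "\<And>x. x \<in> ?K \<Longrightarrow> ?m x0 \<le> ?m x"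
      using continuous_attains_inf[OF cK Kne cm] by blast
    obtain i where "i < n" "?m x0 = c i - a i \<bullet> x0" using poly_dist_attained[OF n] by blast
    then have pos: "?m x0 > 0" using Kc[OF _ x0(1), of i] by simp
    show ?thesis
    proof (intro exI[of _ "?m x0 / 2"] conjI ballI allI impI)
      fix x i assume "x \<in> ?K" "i < n"
      then have "?m x0 \<le> c i - a i \<bullet> x" using x0(2)[of x] poly_dist_le[of i n a c x] by linarith
      then show "?m x0 / 2 < c i - a i \<bullet> x" using pos by linarith
    qed (use pos in simp)
  qed
  then obtain \<delta> where \<delta>: "\<delta> > 0" "\<And>x i. x \<in> ?K \<Longrightarrow> i < n \<Longrightarrow> \<delta> < c i - a i \<bullet> x" by blast
  \<comment> \<open>The maximiser of r m^(r-1) - (r-1) m^r M with r = p/q; the maximal value is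
    M^(1-r).\<close>
  define mm where "mm = 1 / M"
  have mm: "mm > 0" using M by (simp add: mm_def)
  let ?c1 = "low_const * (p / q) * mm powr (p / q - 1)" and ?c2 = "low_const * (p / q - 1) * mm powr (p / q)"
  have c12: "?c1 \<ge> 0" "?c2 \<ge> 0" using exponents_pos by (auto simp: low_const_def)
  let ?I = "\<lambda>i. indicator (face_cell n a c i)"
  have [measurable]: "\<psi> \<in> borel_measurable borel" "grad \<psi> \<in> borel_measurable borel"
    using Cc_infD(6)[OF \<psi>(1)] continuous_on_grad[OF \<psi>(1)] by (auto intro: borel_measurable_continuous_onI)
  have cover: "\<exists>i<n. x \<in> face_cell n a c i" if "x \<in> ?K" for x
  proof (rule face_cell_exists[OF n])
    show "0 \<le> ?m x" using Kc[OF _ that] by (intro poly_dist_ge[OF n]) (simp add: less_imp_le)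
  qed
  have "ennreal ?c1 = (\<integral>\<^sup>+x. ennreal ?c1 * ennreal (\<bar>\<psi> x\<bar> powr q) \<partial>lborel)"
    using Cc_inf_energies(1)[OF \<psi>(1) exponents_pos(1,2)] \<psi>(2) by (subst nn_integral_cmult) auto
  also have "\<dots> = (\<integral>\<^sup>+x. (\<Sum>i<n. ?I i x * ennreal (?c1 * \<bar>\<psi> x\<bar> powr q)) \<partial>lborel)"
  proof (rule nn_integral_cong)
    fix x
    show "ennreal ?c1 * ennreal (\<bar>\<psi> x\<bar> powr q) = (\<Sum>i<n. ?I i x * ennreal (?c1 * \<bar>\<psi> x\<bar> powr q))"
    proof (cases "x \<in> ?K")
      case True
      then obtain i where "i < n" "x \<in> face_cell n a c i" using cover by blast
      show ?thesis unfolding sum_face_cell[OF \<open>x \<in> face_cell n a c i\<close> \<open>i < n\<close>]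
        using c12(1) by (rule ennreal_mult'[symmetric])
    next
      case False
      then have "\<psi> x = 0" by (rule Cc_infD(4)[OF \<psi>(1)])
      then show ?thesis by simp
    qed
  qed
  also have "\<dots> = (\<Sum>i<n. (\<integral>\<^sup>+x. ?I i x * ennreal (?c1 * \<bar>\<psi> x\<bar> powr q) \<partial>lborel))"
    by (rule nn_integral_sum) measurable
  also have "\<dots> \<le> (\<Sum>i<n. (\<integral>\<^sup>+x. ?I i x * ennreal (norm (grad \<psi> x) powr p) \<partial>lborel)
      + (\<integral>\<^sup>+x. ?I i x * ennreal (?c2 * ((1 + \<beta>) * (c i - a i \<bullet> x) powr \<beta>)) \<partial>lborel))"
  proof (rule sum_mono)
    fix i assume "i \<in> {..<n}"
    then have i: "i < n" by simp
    show "(\<integral>\<^sup>+x. ?I i x * ennreal (?c1 * \<bar>\<psi> x\<bar> powr q) \<partial>lborel) \<le> (\<integral>\<^sup>+x. ?I i x * ennreal (norm (grad \<psi> x) powr p) \<partial>lborel)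
      + (\<integral>\<^sup>+x. ?I i x * ennreal (?c2 * ((1 + \<beta>) * (c i - a i \<bullet> x) powr \<beta>)) \<partial>lborel)"
      by (rule cell_inequality[OF a i bQ \<psi>(1) \<delta>(1) \<delta>(2)[OF _ i] mm])
  qed
  also have "\<dots> = (\<integral>\<^sup>+x. (\<Sum>i<n. ?I i x * ennreal (norm (grad \<psi> x) powr p)) \<partial>lborel)
      + (\<integral>\<^sup>+x. (\<Sum>i<n. ?I i x * ennreal (?c2 * ((1 + \<beta>) * (c i - a i \<bullet> x) powr \<beta>))) \<partial>lborel)"
    unfolding sum.distrib by (intro arg_cong2[where f="(+)"] nn_integral_sum[symmetric]) measurable
  also have "\<dots> \<le> (\<integral>\<^sup>+x. ennreal (norm (grad \<psi> x) powr p) \<partial>lborel)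
      + (\<integral>\<^sup>+x. ennreal ?c2 * (indicator \<Omega> x * ennreal ((1 + \<beta>) * infdist x (- \<Omega>) powr \<beta>)) \<partial>lborel)"
  proof (intro add_mono nn_integral_mono)
    fix x
    show "(\<Sum>i<n. ?I i x * ennreal (norm (grad \<psi> x) powr p)) \<le> ennreal (norm (grad \<psi> x) powr p)"
    proof (cases "\<exists>i<n. x \<in> face_cell n a c i")
      case True
      then obtain i where i: "i < n" "x \<in> face_cell n a c i" by blast
      show ?thesis unfolding sum_face_cell[OF i(2,1)] ..
    next
      case False
      then have z: "(\<Sum>i<n. ?I i x * ennreal (norm (grad \<psi> x) powr p)) = 0"
        by (intro sum_face_cell_outside) blast
      show ?thesis unfolding z by simp
    qed
    show "(\<Sum>i<n. ?I i x * ennreal (?c2 * ((1 + \<beta>) * (c i - a i \<bullet> x) powr \<beta>)))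
        \<le> ennreal ?c2 * (indicator \<Omega> x * ennreal ((1 + \<beta>) * infdist x (- \<Omega>) powr \<beta>))"
    proof (cases "\<exists>i<n. x \<in> face_cell n a c i")
      case True
      then obtain i where i: "i < n" "x \<in> face_cell n a c i" by blast
      note pd = face_cell_poly_dist[OF i(2,1) n]
      have x\<Omega>: "x \<in> \<Omega>" using mQ pd(2) by simp
      have "(\<Sum>i<n. ?I i x * ennreal (?c2 * ((1 + \<beta>) * (c i - a i \<bullet> x) powr \<beta>))) = ennreal (?c2 * ((1 + \<beta>) * (?m x) powr \<beta>))"
        unfolding sum_face_cell[OF i(2,1)] pd(1) ..
      also have "\<dots> \<le> ennreal (?c2 * ((1 + \<beta>) * infdist x (- \<Omega>) powr \<beta>))"
        using c12 exponents_pos m_le[OF pd(2)] pd(2) by (intro ennreal_leI mult_left_mono powr_mono2) auto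
      finally show ?thesis using x\<Omega> c12 by (simp add: ennreal_mult')
    next
      case False
      then have z: "(\<Sum>i<n. ?I i x * ennreal (?c2 * ((1 + \<beta>) * (c i - a i \<bullet> x) powr \<beta>))) = 0"
        by (intro sum_face_cell_outside) blast
      show ?thesis unfolding z by simp
    qed
  qed
  also have "\<dots> = ennreal (integral \<Omega> (\<lambda>x. norm (grad \<psi> x) powr p))
      + ennreal ?c2 * (\<integral>\<^sup>+x. indicator \<Omega> x * ennreal ((1 + \<beta>) * infdist x (- \<Omega>) powr \<beta>) \<partial>lborel)"
  proof -
    have [measurable]: "(\<lambda>x. infdist x (- \<Omega>)) \<in> borel_measurable borel"
      by (intro borel_measurable_continuous_onI continuous_intros)
    have [measurable]: "\<Omega> \<in> sets borel" using \<Omega> by simp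
    have "(\<integral>\<^sup>+x. ennreal ?c2 * (indicator \<Omega> x * ennreal ((1 + \<beta>) * infdist x (- \<Omega>) powr \<beta>)) \<partial>lborel)
       = ennreal ?c2 * (\<integral>\<^sup>+x. indicator \<Omega> x * ennreal ((1 + \<beta>) * infdist x (- \<Omega>) powr \<beta>) \<partial>lborel)"
      by (rule nn_integral_cmult) measurable
    then show ?thesis
      using Cc_inf_energies(2)[OF \<psi>(1) exponents_pos(1,2)] by (simp only:)
  qed
  also have "\<dots> \<le> ennreal (integral \<Omega> (\<lambda>x. norm (grad \<psi> x) powr p)) + ennreal ?c2 * ennreal M"
    using M(2) by (intro add_left_mono mult_left_mono) auto
  also have "\<dots> = ennreal (integral \<Omega> (\<lambda>x. norm (grad \<psi> x) powr p) + ?c2 * M)"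
    using c12 M(1) by (subst ennreal_plus) (auto simp: ennreal_mult' intro!: integral_nonneg Cc_inf_energies(4)[OF \<psi>(1) exponents_pos(1,2)])
  finally have "?c1 \<le> integral \<Omega> (\<lambda>x. norm (grad \<psi> x) powr p) + ?c2 * M"
    using c12 M(1) by (subst (asm) ennreal_le_iff) (auto intro!: add_nonneg_nonneg mult_nonneg_nonneg integral_nonneg Cc_inf_energies(4)[OF \<psi>(1) exponents_pos(1,2)])
  moreover have "?c1 - ?c2 * M = low_const * M powr (1 - p / q)"
  proof -
    have "mm powr (p / q) * M = mm powr (p / q - 1)" using M mm by (simp add: mm_def powr_diff)
    moreover have "A * r * X - A * (r - 1) * Y * M = A * X" if "Y * M = X" for A r X Y :: real
    proof -
      have "A * (r - 1) * Y * M = A * (r - 1) * X" using that by (simp only: mult.assoc)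
      then show ?thesis by (simp add: algebra_simps)
    qed
    ultimately have 1: "?c1 - ?c2 * M = low_const * mm powr (p / q - 1)" by blast
    have "mm powr (p / q - 1) = M powr (1 - p / q)"
      using M by (simp add: mm_def powr_divide powr_minus_divide[symmetric])
    then show ?thesis unfolding 1 by (rule arg_cong)
  qed
  ultimately show ?thesis by linarith
qed

lemma lambda_pq_ge:
  fixes \<Omega> :: "'a::euclidean_space set"
  assumes "open \<Omega>" "\<Omega> \<noteq> {}"
    and "\<And>\<psi>. \<psi> \<in> Cc_inf \<Omega> \<Longrightarrow> integral \<Omega> (\<lambda>x. \<bar>\<psi> x\<bar> powr q) = 1 \<Longrightarrow> L \<le> integral \<Omega> (\<lambda>x. norm (grad \<psi> x) powr p)"
  shows "L \<le> lambda_pq p q \<Omega>"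
  unfolding lambda_pq_def
proof (rule cInf_greatest)
  let ?S = "{integral \<Omega> (\<lambda>x. norm (grad \<psi> x) powr p) |\<psi>. \<psi> \<in> Cc_inf \<Omega> \<and> integral \<Omega> (\<lambda>x. \<bar>\<psi> x\<bar> powr q) = 1}"
  obtain \<psi> where "\<psi> \<in> Cc_inf \<Omega>" "integral \<Omega> (\<lambda>x. \<bar>\<psi> x\<bar> powr q) = 1"
    using exists_normalised_Cc_inf[OF assms(1,2) exponents_pos(2)] by blast
  then have "integral \<Omega> (\<lambda>x. norm (grad \<psi> x) powr p) \<in> ?S" by (intro CollectI exI[of _ \<psi>]) simp
  then show "?S \<noteq> {}" by (metis empty_iff)
  fix y assume "y \<in> ?S"
  then obtain \<psi> where "\<psi> \<in> Cc_inf \<Omega>" "integral \<Omega> (\<lambda>x. \<bar>\<psi> x\<bar> powr q) = 1" "y = integral \<Omega> (\<lambda>x. norm (grad \<psi> x) powr p)"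
    by (elim CollectE exE conjE)
  then show "L \<le> y" using assms(3) by simp
qed

definition beta_prod :: "nat \<Rightarrow> real" where
  "beta_prod N = (\<Prod>j\<in>{2..N}. 1 + \<beta> / real j)"

lemma beta_prod_pos: "beta_prod N > 0"
  unfolding beta_prod_def using exponents_pos by (intro prod_pos) (simp add: add_pos_nonneg)

text \<open>The factor j = 1 is 1 + \<beta>, the same number that multiplies the moment of the
  distance; it will cancel.\<close>

lemma beta_prod_Suc: "N \<ge> 1 \<Longrightarrow> (\<Prod>j\<in>{1..N}. 1 + \<beta> / real j) = (1 + \<beta>) * beta_prod N"
proof -
  assume "N \<ge> 1"
  then have "{1..N} = insert 1 {2..N}" by auto
  then show ?thesis by (simp add: beta_prod_def)
qed

lemma K_const_eq: "K_const p q N = (pi_pq p q / (2 * real N)) powr p * beta_prod N powr (p / q - 1)"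
proof -
  have "(\<Prod>j\<in>{2..N}. (p * q / (real j * (p - q)) + 1) powr (p / q - 1)) = (\<Prod>j\<in>{2..N}. (1 + \<beta> / real j) powr (p / q - 1))"
    by (intro prod.cong refl) (simp add: \<beta> mult.commute add.commute)
  also have "\<dots> = beta_prod N powr (p / q - 1)"
    unfolding beta_prod_def by (rule prod_powr_distrib[symmetric])
  finally show ?thesis by (simp add: K_const_def)
qed

text \<open>The argument on the right is the value M = V T^\<beta> / \<open>beta_prod\<close> of the
  cone with T = N V / P. Since \<beta> (1 - p/q) = -p, the power of T becomes (P / (N V))^p, the
  perimeter term of the theorem.\<close>

lemma K_const_scaled:
  assumes V: "V > 0" and P: "P > 0" and N: "N > 0"
  shows "K_const p q N * (P / V powr (1 - 1/p + 1/q)) powr p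
     = low_const * (V * (real N * V / P) powr \<beta> / beta_prod N) powr (1 - p / q)"
proof -
  let ?r = "p / q" and ?B = "beta_prod N" and ?N = "real N"
  have B: "?B > 0" by (rule beta_prod_pos)
  have e1: "(1 - 1/p + 1/q) * p = p - 1 + ?r" using exponents_pos(1,2) by (simp add: field_simps)
  have e2: "\<beta> * (1 - ?r) = - p" using exponents_pos(5) by (simp add: algebra_simps)
  have e3: "1 - ?r = - (?r - 1)" by simp
  have "low_const * (V * (?N * V / P) powr \<beta> / ?B) powr (1 - ?r)
     = low_const * (V powr (1 - ?r) * (?N * V / P) powr (\<beta> * (1 - ?r)) / ?B powr (1 - ?r))"
    using V P N B by (simp add: powr_divide powr_mult powr_powr)
  also have "\<dots> = low_const * (V powr (1 - ?r) * (?N * V / P) powr (- p) * ?B powr (?r - 1))"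
    unfolding e2 unfolding e3 powr_minus by (simp add: field_simps)
  also have "(?N * V / P) powr (- p) = (P / (?N * V)) powr p"
    using V P N by (simp add: powr_minus powr_divide)
  finally have R: "low_const * (V * (?N * V / P) powr \<beta> / ?B) powr (1 - ?r)
     = low_const * (V powr (1 - ?r) * (P / (?N * V)) powr p * ?B powr (?r - 1))" .
  have "(P / V powr (1 - 1/p + 1/q)) powr p = P powr p / V powr (p - 1 + ?r)"
    using V P by (simp add: powr_divide powr_powr e1)
  also have "\<dots> = P powr p * V powr (1 - ?r) / V powr p"
    using V by (simp add: powr_add powr_diff field_simps)
  finally have "K_const p q N * (P / V powr (1 - 1/p + 1/q)) powr p
     = (pi_pq p q / (2 * ?N)) powr p * ?B powr (?r - 1) * (P powr p * V powr (1 - ?r) / V powr p)"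
    unfolding K_const_eq by simp
  also have "(pi_pq p q / (2 * ?N)) powr p = low_const / ?N powr p"
    using pi_nonneg N by (simp add: low_const_def powr_divide powr_mult)
  finally show ?thesis unfolding R using V P N by (simp add: powr_divide powr_mult)
qed

text \<open>The volume bound for inner parallel sets says that the distance function is distributed
  at most like the height in a cone of volume V and height T = N V / P. Its moment then gives M for
  the Rayleigh quotient.\<close>

theorem convex_lower_bound:
  fixes \<Omega> :: "'a::euclidean_space set"
  assumes \<Omega>: "open \<Omega>" "bounded \<Omega>" "convex \<Omega>" "\<Omega> \<noteq> {}"
  shows "K_const p q DIM('a) * (perimeter \<Omega> / measure lebesgue \<Omega> powr (1 - 1/p + 1/q)) powr p \<le> lambda_pq p q \<Omega>"
\<comment> \<open>For perimeter 0 the height T would be a division by zero; the claim is then just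
  that \<open>lambda_pq\<close> is nonnegative.\<close>
proof (cases "perimeter \<Omega> = 0")
  case True
  have "0 \<le> lambda_pq p q \<Omega>"
    by (rule lambda_pq_ge[OF \<Omega>(1,4)]) (auto intro!: integral_nonneg Cc_inf_energies(4)[OF _ exponents_pos(1,2)])
  then show ?thesis using True exponents_pos by simp
next
  case False
  let ?V = "measure lebesgue \<Omega>" and ?P = "perimeter \<Omega>" and ?N = "DIM('a)"
  have V: "?V > 0" by (rule convex_volume_pos[OF \<Omega>])
  have P: "?P > 0" using perimeter_nonneg[OF \<Omega>] False by simp
  define T where "T = real ?N * ?V / ?P"
  have T: "T > 0" using V P by (simp add: T_def)
  define M where "M = ?V * T powr \<beta> / beta_prod ?N"
  have M: "M > 0" using V T beta_prod_pos by (simp add: M_def)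
  have [measurable]: "\<Omega> \<in> sets borel" "(\<lambda>x. infdist x (- \<Omega>)) \<in> borel_measurable borel"
    using \<Omega>(1) by (auto intro!: borel_measurable_continuous_onI continuous_intros)
  have em: "emeasure lborel (inner_parallel t \<Omega>) = ennreal (measure lebesgue (inner_parallel t \<Omega>))" for t
  proof -
    have "bounded (inner_parallel t \<Omega>)" by (rule bounded_inner_parallel[OF \<Omega>(2)])
    from emeasure_bounded_finite[OF this] have "emeasure lborel (inner_parallel t \<Omega>) = ennreal (measure lborel (inner_parallel t \<Omega>))"
      by (intro emeasure_eq_ennreal_measure) simp
    also have "measure lborel (inner_parallel t \<Omega>) = measure lebesgue (inner_parallel t \<Omega>)"
      using open_inner_parallel[OF \<Omega>(1)] by simp
    finally show ?thesis .
  qed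
  have vol: "t \<le> T \<and> measure lebesgue (inner_parallel t \<Omega>) \<le> ?V * (1 - t / T) ^ ?N"
    if "inner_parallel t \<Omega> \<noteq> {}" "t > 0" for t
    using inner_parallel_volume[OF \<Omega> that] P V by (simp add: T_def pos_le_divide_eq)
  have "(\<integral>\<^sup>+x. indicator \<Omega> x * ennreal (infdist x (- \<Omega>) powr \<beta>) \<partial>lborel) \<le> ennreal (?V * T powr \<beta> / (\<Prod>j\<in>{1..?N}. 1 + \<beta> / real j))"
  proof (rule powr_integral_le_of_cone_distribution)
    show "emeasure lborel (inner_parallel t \<Omega>) \<le> ennreal (?V * (1 - t / T) ^ ?N)" if "0 < t" "t < T" for t
    proof (cases "inner_parallel t \<Omega> = {}")
      case True
      show ?thesis unfolding True by simp
    next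
      case False
      show ?thesis unfolding em using vol[OF False that(1)] by (intro ennreal_leI) simp
    qed
    show "emeasure lborel (inner_parallel t \<Omega>) = 0" if "T \<le> t" for t
    proof (cases "inner_parallel t \<Omega> = {}")
      case True
      show ?thesis unfolding True by simp
    next
      case False
      \<comment> \<open>Nonemptiness forces t = T, and at this value the cone bound
        vanishes.\<close>
      then have "t \<le> T" "measure lebesgue (inner_parallel t \<Omega>) \<le> ?V * (1 - t / T) ^ ?N" using vol that T by auto
      then have "measure lebesgue (inner_parallel t \<Omega>) \<le> 0" using that T by (simp add: zero_power)
      then show ?thesis unfolding em by (simp add: ennreal_neg)
    qed
  qed (use T V exponents_pos infdist_nonneg in auto)
  then have "ennreal (1 + \<beta>) * (\<integral>\<^sup>+x. indicator \<Omega> x * ennreal (infdist x (- \<Omega>) powr \<beta>) \<partial>lborel)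
      \<le> ennreal (1 + \<beta>) * ennreal (?V * T powr \<beta> / (\<Prod>j\<in>{1..?N}. 1 + \<beta> / real j))"
    by (rule mult_left_mono) simp
  also have "\<dots> = ennreal M"
  proof -
    have pr: "(\<Prod>j\<in>{1..?N}. 1 + \<beta> / real j) = (1 + \<beta>) * beta_prod ?N"
      by (rule beta_prod_Suc) (use DIM_positive[where 'a='a] in simp)
    have 1: "(1 + \<beta>) * (X / ((1 + \<beta>) * Y)) = X / Y" for X Y using exponents_pos(3) by simp
    have 2: "0 \<le> 1 + \<beta>" using exponents_pos(3) by simp
    show ?thesis unfolding pr M_def ennreal_mult'[OF 2, symmetric] 1 ..
  qed
  also have "ennreal (1 + \<beta>) * (\<integral>\<^sup>+x. indicator \<Omega> x * ennreal (infdist x (- \<Omega>) powr \<beta>) \<partial>lborel)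
      = (\<integral>\<^sup>+x. ennreal (1 + \<beta>) * (indicator \<Omega> x * ennreal (infdist x (- \<Omega>) powr \<beta>)) \<partial>lborel)"
    by (rule nn_integral_cmult[symmetric]) measurable
  also have "\<dots> = (\<integral>\<^sup>+x. indicator \<Omega> x * ennreal ((1 + \<beta>) * infdist x (- \<Omega>) powr \<beta>) \<partial>lborel)"
    using exponents_pos(3) by (intro nn_integral_cong) (simp add: ennreal_mult' mult.left_commute)
  finally have "low_const * M powr (1 - p / q) \<le> lambda_pq p q \<Omega>"
    by (intro lambda_pq_ge[OF \<Omega>(1,4)] Rayleigh_quotient_bound[OF \<Omega>(1-3) M])
  then show ?thesis
    unfolding K_const_scaled[OF V P DIM_positive] M_def T_def .
qed

end

subsection \<open>Thin domains\<close>

abbreviation proj :: "'a::euclidean_space \<Rightarrow> 'a \<Rightarrow> 'a" where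
  "proj b z \<equiv> z - (z \<bullet> b) *\<^sub>R b"

text \<open>A cylinder of height 1 over a disc: its N-dimensional measure plays the part of the area
  of the disc, so no (N-1)-dimensional measure is required.\<close>

abbreviation cyl :: "'a::euclidean_space \<Rightarrow> real \<Rightarrow> 'a set" where
  "cyl b r \<equiv> {z. norm (proj b z) < r \<and> 0 < z \<bullet> b \<and> z \<bullet> b < 1}"

context
  fixes b :: "'a::euclidean_space"
  assumes b: "b \<in> Basis"
begin

lemma unit_b: "norm b = 1" "b \<bullet> b = 1"
  using b by auto

lemma proj_shift: "proj b (z + s *\<^sub>R b) = proj b z" "(z + s *\<^sub>R b) \<bullet> b = z \<bullet> b + s"
  by (simp_all add: inner_add_left unit_b algebra_simps)

lemma norm_le_proj: "norm z \<le> norm (proj b z) + \<bar>z \<bullet> b\<bar>"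
  using norm_triangle_ineq[of "proj b z" "(z \<bullet> b) *\<^sub>R b"] by (simp add: unit_b)

lemma continuous_proj_norm: "continuous_on S (\<lambda>z. norm (proj b z))"
  by (intro continuous_intros)

lemma borel_proj_norm [measurable]: "(\<lambda>z. norm (proj b z)) \<in> borel_measurable borel"
  by (intro borel_measurable_continuous_onI continuous_proj_norm)

lemma borel_thin_dom [measurable]: "thin_dom b \<epsilon> \<in> sets borel"
  unfolding thin_dom_def by measurable

lemma borel_cyl [measurable]: "cyl b r \<in> sets borel"
  by measurable

text \<open>Fubini along b. After a shift the inner integral depends on the projection only, so
  integrating it over the unit slab amounts to integrating over the base hyperplane.\<close>

lemma nn_integral_vertical:
  fixes f :: "'a \<Rightarrow> ennreal"
  assumes [measurable]: "f \<in> borel_measurable borel"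
  shows "(\<integral>\<^sup>+z. f z \<partial>lborel) = (\<integral>\<^sup>+z. indicator (slab b) z * (\<integral>\<^sup>+y. f (proj b z + y *\<^sub>R b) \<partial>lborel) \<partial>lborel)"
proof -
  have "(\<integral>\<^sup>+s. f (z + s *\<^sub>R b) \<partial>lborel) = (\<integral>\<^sup>+y. f (proj b z + y *\<^sub>R b) \<partial>lborel)" for z
  proof -
    have [measurable]: "(\<lambda>y. f (proj b z + y *\<^sub>R b)) \<in> borel_measurable borel" by measurable
    have "(\<integral>\<^sup>+s. f (proj b z + (s + z \<bullet> b) *\<^sub>R b) \<partial>lborel) = (\<integral>\<^sup>+y. f (proj b z + y *\<^sub>R b) \<partial>lborel)"
      by (rule nn_integral_lborel_translate) measurable
    moreover have "proj b z + (s + z \<bullet> b) *\<^sub>R b = z + s *\<^sub>R b" for s by (simp add: algebra_simps)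
    ultimately show ?thesis by simp
  qed
  then show ?thesis using nn_integral_along_direction[OF assms unit_b(1)] by simp
qed

lemma proj_vertical: "proj b (proj b z + y *\<^sub>R b) = proj b z" "(proj b z + y *\<^sub>R b) \<bullet> b = y"
    "(proj b z + y *\<^sub>R b) - y *\<^sub>R b = proj b z"
  by (simp_all add: inner_add_left inner_diff_left unit_b algebra_simps)

lemma nn_integral_vertical_scale:
  fixes f :: "'a \<Rightarrow> ennreal"
  assumes [measurable]: "f \<in> borel_measurable borel" and \<epsilon>: "\<epsilon> > 0"
  shows "(\<integral>\<^sup>+z. f (proj b z + ((z \<bullet> b) / \<epsilon>) *\<^sub>R b) \<partial>lborel) = ennreal \<epsilon> * (\<integral>\<^sup>+z. f z \<partial>lborel)"
proof -
  have [measurable]: "slab b \<in> sets borel" by measurable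
  have "(\<integral>\<^sup>+z. f (proj b z + ((z \<bullet> b) / \<epsilon>) *\<^sub>R b) \<partial>lborel)
     = (\<integral>\<^sup>+z. indicator (slab b) z * (\<integral>\<^sup>+y. f (proj b z + (y / \<epsilon>) *\<^sub>R b) \<partial>lborel) \<partial>lborel)"
    by (subst nn_integral_vertical) (measurable, simp only: proj_vertical)
  also have "\<dots> = (\<integral>\<^sup>+z. ennreal \<epsilon> * (indicator (slab b) z * (\<integral>\<^sup>+y. f (proj b z + y *\<^sub>R b) \<partial>lborel)) \<partial>lborel)"
  proof (rule nn_integral_cong)
    fix z
    have "(\<integral>\<^sup>+y. f (proj b z + (y / \<epsilon>) *\<^sub>R b) \<partial>lborel) = ennreal \<bar>\<epsilon>\<bar> * (\<integral>\<^sup>+y. f (proj b z + ((0 + \<epsilon> * y) / \<epsilon>) *\<^sub>R b) \<partial>lborel)"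
      by (rule nn_integral_real_affine) (measurable, use \<epsilon> in simp)
    then show "indicator (slab b) z * (\<integral>\<^sup>+y. f (proj b z + (y / \<epsilon>) *\<^sub>R b) \<partial>lborel)
        = ennreal \<epsilon> * (indicator (slab b) z * (\<integral>\<^sup>+y. f (proj b z + y *\<^sub>R b) \<partial>lborel))"
      using \<epsilon> by (simp add: mult.left_commute)
  qed
  also have "\<dots> = ennreal \<epsilon> * (\<integral>\<^sup>+z. indicator (slab b) z * (\<integral>\<^sup>+y. f (proj b z + y *\<^sub>R b) \<partial>lborel) \<partial>lborel)"
    by (rule nn_integral_cmult) measurable
  also have "\<dots> = ennreal \<epsilon> * (\<integral>\<^sup>+z. f z \<partial>lborel)" using nn_integral_vertical[OF assms(1)] by simp
  finally show ?thesis .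
qed

lemma open_thin_dom: "open (thin_dom b \<epsilon>)"
  unfolding thin_dom_def by (intro open_Collect_conj open_Collect_less continuous_intros)

lemma thin_dom_norm_le:
  assumes "z \<in> thin_dom b \<epsilon>" "\<epsilon> > 0" shows "norm z \<le> 1 + \<epsilon>"
proof -
  note 1 = norm_le_proj[of z]
  have "\<epsilon> * (1 - norm (proj b z)) \<le> \<epsilon> * 1" using assms(2) by (intro mult_left_mono) auto
  then show ?thesis using 1 assms(1) by (simp add: thin_dom_def)
qed

lemma bounded_thin_dom: "\<epsilon> > 0 \<Longrightarrow> bounded (thin_dom b \<epsilon>)"
  using thin_dom_norm_le by (auto simp: bounded_iff)

lemma thin_dom_nonempty: "\<epsilon> > 0 \<Longrightarrow> thin_dom b \<epsilon> \<noteq> {}"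
proof -
  assume "\<epsilon> > 0"
  then have "(\<epsilon> / 2) *\<^sub>R b \<in> thin_dom b \<epsilon>" by (simp add: thin_dom_def unit_b)
  then show ?thesis by blast
qed

lemma convex_thin_dom: "\<epsilon> > 0 \<Longrightarrow> convex (thin_dom b \<epsilon>)"
proof (rule convexI)
  fix x y u v :: real and z w assume \<epsilon>: "\<epsilon> > 0" and z: "z \<in> thin_dom b \<epsilon>" "w \<in> thin_dom b \<epsilon>" and uv: "0 \<le> u" "0 \<le> v" "u + v = 1"
  let ?s = "u *\<^sub>R z + v *\<^sub>R w"
  have p: "proj b ?s = u *\<^sub>R proj b z + v *\<^sub>R proj b w" by (simp add: inner_add_left algebra_simps)
  have n: "norm (proj b ?s) \<le> u * norm (proj b z) + v * norm (proj b w)"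
    unfolding p using norm_triangle_ineq[of "u *\<^sub>R proj b z" "v *\<^sub>R proj b w"] uv by simp
  have i: "?s \<bullet> b = u * (z \<bullet> b) + v * (w \<bullet> b)" by (simp add: inner_add_left)
  have comb: "u * A + v * B < C" if "A < C" "B < C" for A B C :: real
    using convex_bound_lt[OF that uv] .
  have "norm (proj b ?s) < 1" using n comb[of "norm (proj b z)" 1 "norm (proj b w)"] z by (auto simp: thin_dom_def)
  moreover have "0 < ?s \<bullet> b" using comb[of "- (z \<bullet> b)" 0 "- (w \<bullet> b)"] z by (auto simp: thin_dom_def i)
  moreover have "?s \<bullet> b < \<epsilon> * (1 - norm (proj b ?s))"
  proof -
    have "u * (z \<bullet> b - \<epsilon> * (1 - norm (proj b z))) + v * (w \<bullet> b - \<epsilon> * (1 - norm (proj b w))) < 0"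
      using z by (intro comb) (auto simp: thin_dom_def)
    then have "?s \<bullet> b < \<epsilon> * ((u + v) - (u * norm (proj b z) + v * norm (proj b w)))"
      unfolding i by (simp add: algebra_simps)
    also have "\<dots> \<le> \<epsilon> * (1 - norm (proj b ?s))" using n uv \<epsilon> by (intro mult_left_mono) auto
    finally show ?thesis .
  qed
  ultimately show "?s \<in> thin_dom b \<epsilon>" by (simp add: thin_dom_def)
qed

lemma emeasure_thin_dom_finite: "\<epsilon> > 0 \<Longrightarrow> emeasure lborel (thin_dom b \<epsilon>) = ennreal (measure lebesgue (thin_dom b \<epsilon>))"
proof -
  assume "\<epsilon> > 0"
  from emeasure_bounded_finite[OF bounded_thin_dom[OF this]] have "emeasure lborel (thin_dom b \<epsilon>) = ennreal (measure lborel (thin_dom b \<epsilon>))"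
    by (intro emeasure_eq_ennreal_measure) simp
  then show ?thesis by simp
qed

lemma measure_thin_dom_scale:
  assumes \<epsilon>: "\<epsilon> > 0"
  shows "measure lebesgue (thin_dom b \<epsilon>) = \<epsilon> * measure lebesgue (thin_dom b 1)"
proof -
  have "emeasure lborel (thin_dom b \<epsilon>) = (\<integral>\<^sup>+z. indicator (thin_dom b \<epsilon>) z \<partial>lborel)" by simp
  also have "\<dots> = (\<integral>\<^sup>+z. indicator (thin_dom b 1) (proj b z + ((z \<bullet> b) / \<epsilon>) *\<^sub>R b) \<partial>lborel)"
  proof (rule nn_integral_cong)
    fix z
    have "z \<in> thin_dom b \<epsilon> \<longleftrightarrow> proj b z + ((z \<bullet> b) / \<epsilon>) *\<^sub>R b \<in> thin_dom b 1"
      unfolding thin_dom_def mem_Collect_eq proj_vertical using \<epsilon> by (simp add: pos_divide_less_eq zero_less_divide_iff mult.commute)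
    then show "(indicator (thin_dom b \<epsilon>) z :: ennreal) = indicator (thin_dom b 1) (proj b z + ((z \<bullet> b) / \<epsilon>) *\<^sub>R b)"
      by (simp add: indicator_def)
  qed
  also have "\<dots> = ennreal \<epsilon> * emeasure lborel (thin_dom b 1)"
    using \<epsilon> by (subst nn_integral_vertical_scale) auto
  finally have "ennreal (measure lebesgue (thin_dom b \<epsilon>)) = ennreal (\<epsilon> * measure lebesgue (thin_dom b 1))"
    using emeasure_thin_dom_finite[OF \<epsilon>] emeasure_thin_dom_finite[of 1] \<epsilon> by (simp add: ennreal_mult')
  then show ?thesis using \<epsilon> by (subst (asm) ennreal_inj) auto
qed

section \<open>Volume and base of the model cone\<close>

lemma emeasure_thin_dom_above:
  assumes t: "0 < t" "t < 1"
  shows "emeasure lborel {z \<in> thin_dom b 1. t < z \<bullet> b} = ennreal (measure lebesgue (thin_dom b 1) * (1 - t / 1) ^ DIM('a))"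
proof -
  \<comment> \<open>The homothety of ratio 1 - t that fixes the apex b; it maps the whole cone onto
    the part above height t.\<close>
  let ?S = "{z \<in> thin_dom b 1. t < z \<bullet> b}" and ?f = "\<lambda>z. (1 - t) *\<^sub>R z + t *\<^sub>R b"
  have mem: "?f z \<in> ?S \<longleftrightarrow> z \<in> thin_dom b 1" for z
  proof -
    have p: "proj b (?f z) = (1 - t) *\<^sub>R proj b z" by (simp add: inner_add_left unit_b algebra_simps)
    have n: "norm (proj b (?f z)) = (1 - t) * norm (proj b z)" unfolding p using t by simp
    have i: "?f z \<bullet> b = (1 - t) * (z \<bullet> b) + t" by (simp add: inner_add_left unit_b)
    have 1: "t < ?f z \<bullet> b \<longleftrightarrow> 0 < z \<bullet> b" unfolding i using t by (simp add: zero_less_mult_iff)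
    have "(1 - t) * A + t < 1 * (1 - (1 - t) * R) \<longleftrightarrow> (1 - t) * A < (1 - t) * (1 - R)" for A R
      by (simp add: algebra_simps)
    then have "?f z \<bullet> b < 1 * (1 - norm (proj b (?f z))) \<longleftrightarrow> (1 - t) * (z \<bullet> b) < (1 - t) * (1 - norm (proj b z))"
      unfolding n unfolding i by blast
    then have 2: "?f z \<bullet> b < 1 * (1 - norm (proj b (?f z))) \<longleftrightarrow> z \<bullet> b < 1 * (1 - norm (proj b z))" using t by simp
    show ?thesis
    proof
      assume "?f z \<in> ?S"
      then show "z \<in> thin_dom b 1" using 1 2 by (auto simp: thin_dom_def)
    next
      assume z: "z \<in> thin_dom b 1"
      then have "t < ?f z \<bullet> b" "?f z \<bullet> b < 1 * (1 - norm (proj b (?f z)))" using 1 2 by (auto simp: thin_dom_def)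
      moreover have "R < 1 \<and> 0 < Y" if "t < Y" "Y < 1 * (1 - R)" for R Y :: real using that t by auto
      ultimately show "?f z \<in> ?S" unfolding thin_dom_def mem_Collect_eq by blast
    qed
  qed
  have "?S = ?f ` thin_dom b 1"
  proof
    show "?f ` thin_dom b 1 \<subseteq> ?S" using mem by blast
    show "?S \<subseteq> ?f ` thin_dom b 1"
    proof
      fix w assume w: "w \<in> ?S"
      define z where "z = (w - t *\<^sub>R b) /\<^sub>R (1 - t)"
      have "w = ?f z" using t by (simp add: z_def)
      then show "w \<in> ?f ` thin_dom b 1" using w mem[of z] by blast
    qed
  qed
  then have "measure lebesgue ?S = \<bar>1 - t\<bar> ^ DIM('a) * measure lebesgue (thin_dom b 1)"
    using measure_lebesgue_affine[of "1 - t" "t *\<^sub>R b" "thin_dom b 1"] by simp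
  moreover have "emeasure lborel ?S = ennreal (measure lebesgue ?S)"
  proof -
    have "bounded ?S" by (rule bounded_subset[OF bounded_thin_dom[of 1]]) auto
    from emeasure_bounded_finite[OF this] have "emeasure lborel ?S = ennreal (measure lborel ?S)"
      by (intro emeasure_eq_ennreal_measure) simp
    moreover have "?S \<in> sets borel" by measurable
    ultimately show ?thesis by simp
  qed
  ultimately show ?thesis using t by (simp add: mult.commute)
qed

lemma thin_dom_1_height: "z \<in> thin_dom b 1 \<Longrightarrow> z \<bullet> b < 1"
proof -
  assume "z \<in> thin_dom b 1"
  then have "z \<bullet> b < 1 - norm (proj b z)" by (simp add: thin_dom_def)
  then show ?thesis using norm_ge_zero[of "proj b z"] by linarith
qed

text \<open>Volume of a cone against the area of its base. The part below height t fits in a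
  cylinder of volume t times the base, and the part above has volume V (1-t)^N; dividing by t and
  letting t tend to 0 leaves N V. Bernoulli supplies (1-t)^N <= 1 / (1 + N t).\<close>

lemma cyl_measure_ge: "real DIM('a) * measure lebesgue (thin_dom b 1) \<le> measure lborel (cyl b 1)"
proof -
  let ?V = "measure lebesgue (thin_dom b 1)" and ?\<omega> = "measure lborel (cyl b 1)" and ?N = "real DIM('a)"
  have bc: "bounded (cyl b 1)"
  proof -
    have "norm z \<le> 2" if "z \<in> cyl b 1" for z
    proof -
      show ?thesis using norm_le_proj[of z] that by simp
    qed
    then show ?thesis by (auto simp: bounded_iff)
  qed
  have em: "emeasure lborel (cyl b 1) = ennreal ?\<omega>"
    using emeasure_bounded_finite[OF bc] by (intro emeasure_eq_ennreal_measure) simp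
  have key: "?V * ?N / (1 + ?N * t) \<le> ?\<omega>" if t: "0 < t" "t < 1" for t
  proof -
    let ?A = "{z. norm (proj b z) < 1 \<and> 0 < z \<bullet> b \<and> z \<bullet> b \<le> t}"
    have eA: "emeasure lborel ?A = ennreal t * ennreal ?\<omega>"
    proof -
      have m1[measurable]: "?A \<in> sets borel" and m2[measurable]: "cyl b 1 \<in> sets borel" "slab b \<in> sets borel" by measurable
      have "emeasure lborel ?A = (\<integral>\<^sup>+z. indicator ?A z \<partial>lborel)" by simp
      also have "\<dots> = (\<integral>\<^sup>+z. indicator (slab b) z * (\<integral>\<^sup>+y. indicator ?A (proj b z + y *\<^sub>R b) \<partial>lborel) \<partial>lborel)"
        by (rule nn_integral_vertical) measurable
      also have "\<dots> = (\<integral>\<^sup>+z. ennreal t * indicator (cyl b 1) z \<partial>lborel)"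
      proof (rule nn_integral_cong)
        fix z
        have "(\<integral>\<^sup>+y. indicator ?A (proj b z + y *\<^sub>R b) \<partial>lborel) = (\<integral>\<^sup>+y. (if norm (proj b z) < 1 then 1 else 0) * indicator {0<..t} y \<partial>lborel)"
          unfolding indicator_def mem_Collect_eq proj_vertical by (intro nn_integral_cong) auto
        also have "\<dots> = (if norm (proj b z) < 1 then 1 else 0) * ennreal t"
          using t by (subst nn_integral_cmult_indicator) auto
        finally show "indicator (slab b) z * (\<integral>\<^sup>+y. indicator ?A (proj b z + y *\<^sub>R b) \<partial>lborel) = ennreal t * indicator (cyl b 1) z"
          by (auto simp: indicator_def)
      qed
      also have "\<dots> = ennreal t * emeasure lborel (cyl b 1)" by (rule nn_integral_cmult_indicator) measurable
      finally show ?thesis unfolding em .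
    qed
    have "emeasure lborel (thin_dom b 1) \<le> emeasure lborel (?A \<union> {z \<in> thin_dom b 1. t < z \<bullet> b})"
    proof (rule emeasure_mono)
      show "thin_dom b 1 \<subseteq> ?A \<union> {z \<in> thin_dom b 1. t < z \<bullet> b}" by (auto simp: thin_dom_def)
      have "?A \<in> sets borel" "{z \<in> thin_dom b 1. t < z \<bullet> b} \<in> sets borel" by measurable
      then show "?A \<union> {z \<in> thin_dom b 1. t < z \<bullet> b} \<in> sets lborel" by simp
    qed
    also have "\<dots> \<le> emeasure lborel ?A + emeasure lborel {z \<in> thin_dom b 1. t < z \<bullet> b}"
    proof (rule emeasure_subadditive)
      have "?A \<in> sets borel" "{z \<in> thin_dom b 1. t < z \<bullet> b} \<in> sets borel" by measurable
      then show "?A \<in> sets lborel" "{z \<in> thin_dom b 1. t < z \<bullet> b} \<in> sets lborel" by simp_all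
    qed
    also have "\<dots> = ennreal (t * ?\<omega> + ?V * (1 - t) ^ DIM('a))"
      unfolding eA emeasure_thin_dom_above[OF t] using t by (simp add: ennreal_mult'[symmetric] ennreal_plus[symmetric] del: ennreal_plus)
    finally have "?V \<le> t * ?\<omega> + ?V * (1 - t) ^ DIM('a)"
      unfolding emeasure_thin_dom_finite[OF zero_less_one] using t by (subst (asm) ennreal_le_iff) auto
    moreover have "(1 - t) ^ DIM('a) \<le> 1 / (1 + ?N * t)"
    proof -
      have "1 + ?N * t \<le> (1 + t) ^ DIM('a)" using t by (intro Bernoulli_inequality) simp
      then have "(1 - t) ^ DIM('a) * (1 + ?N * t) \<le> (1 - t) ^ DIM('a) * (1 + t) ^ DIM('a)"
        using t by (intro mult_left_mono) auto
      also have "\<dots> = (1 - t * t) ^ DIM('a)" by (simp add: power_mult_distrib[symmetric] algebra_simps)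
      also have "\<dots> \<le> 1" using t by (intro power_le_one) (auto simp: mult_le_one)
      finally show ?thesis using t by (simp add: pos_le_divide_eq add_pos_pos)
    qed
    then have "?V * (1 - t) ^ DIM('a) \<le> ?V * (1 / (1 + ?N * t))" by (intro mult_left_mono) auto
    ultimately have "?V - ?V / (1 + ?N * t) \<le> t * ?\<omega>" by simp
    moreover have "?V - ?V / (1 + ?N * t) = t * (?V * ?N / (1 + ?N * t))"
    proof -
      have "V - V / (1 + X) = V * X / (1 + X)" if "X > 0" for V X :: real using that by (simp add: field_simps)
      from this[of "?N * t" ?V] show ?thesis using t by (simp add: mult.commute mult.left_commute)
    qed
    ultimately have "t * (?V * ?N / (1 + ?N * t)) \<le> t * ?\<omega>" by linarith
    then show ?thesis using t by (simp only: mult_le_cancel_left_pos)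
  qed
  have "((\<lambda>t. ?V * ?N / (1 + ?N * t)) \<longlongrightarrow> ?V * ?N / (1 + ?N * 0)) (at_right 0)"
    by (intro tendsto_intros) auto
  moreover have "\<forall>\<^sub>F t in at_right 0. ?V * ?N / (1 + ?N * t) \<le> ?\<omega>"
  proof -
    have "\<forall>\<^sub>F t in at_right (0::real). t \<in> {0<..<1}" by (rule eventually_at_right_real) simp
    then show ?thesis by eventually_elim (rule key, auto)
  qed
  ultimately have "?V * ?N / (1 + ?N * 0) \<le> ?\<omega>" by (rule tendsto_upperbound) simp
  then show ?thesis by (simp add: mult.commute)
qed

text \<open>Over the smaller disc of radius 1 - \<theta> the thin domain has height at least
  \<epsilon> \<theta>, the room that the test field for the perimeter needs.\<close>

lemma cyl_measure_exhaust:
  assumes e: "e < measure lborel (cyl b 1)"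
  obtains \<theta> where "0 < \<theta>" "\<theta> < 1" "e < measure lborel (cyl b (1 - \<theta>))"
proof -
  have bc: "bounded (cyl b 1)"
  proof -
    have "norm z \<le> 2" if "z \<in> cyl b 1" for z
    proof -
      show ?thesis using norm_le_proj[of z] that by simp
    qed
    then show ?thesis by (auto simp: bounded_iff)
  qed
  let ?h = "\<lambda>n::nat. inverse (real (Suc (Suc n)))"
  have "(\<lambda>n. measure lborel (cyl b (1 - ?h n))) \<longlonglongrightarrow> measure lborel (\<Union>n. cyl b (1 - ?h n))"
  proof (rule Lim_measure_incseq)
    show "range (\<lambda>n. cyl b (1 - ?h n)) \<subseteq> sets lborel" by auto
    show "incseq (\<lambda>n. cyl b (1 - ?h n))"
    proof (rule incseq_SucI, rule subsetI)
      fix n z assume z: "z \<in> cyl b (1 - ?h n)"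
      have "?h (Suc n) \<le> ?h n" by (intro le_imp_inverse_le) auto
      then have "norm (proj b z) < 1 - ?h (Suc n)" using z by (simp only: mem_Collect_eq) linarith
      then show "z \<in> cyl b (1 - ?h (Suc n))" using z by (simp only: mem_Collect_eq)
    qed
    have "(\<Union>n. cyl b (1 - ?h n)) \<subseteq> cyl b 1"
    proof
      fix z assume "z \<in> (\<Union>n. cyl b (1 - ?h n))"
      then obtain n where "z \<in> cyl b (1 - ?h n)" by blast
      moreover have "?h n > 0" by simp
      moreover from calculation have "norm (proj b z) < 1" by (simp only: mem_Collect_eq) linarith
      ultimately show "z \<in> cyl b 1" by (simp only: mem_Collect_eq)
    qed
    then have "bounded (\<Union>n. cyl b (1 - ?h n))" using bc bounded_subset by blast
    from emeasure_bounded_finite[OF this] show "emeasure lborel (\<Union>n. cyl b (1 - ?h n)) \<noteq> \<infinity>" by simp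
  qed
  moreover have "(\<Union>n. cyl b (1 - ?h n)) = cyl b 1"
  proof
    show "(\<Union>n. cyl b (1 - ?h n)) \<subseteq> cyl b 1"
    proof
      fix z assume "z \<in> (\<Union>n. cyl b (1 - ?h n))"
      then obtain n where "z \<in> cyl b (1 - ?h n)" by blast
      moreover have "?h n > 0" by simp
      moreover from calculation have "norm (proj b z) < 1" by (simp only: mem_Collect_eq) linarith
      ultimately show "z \<in> cyl b 1" by (simp only: mem_Collect_eq)
    qed
    show "cyl b 1 \<subseteq> (\<Union>n. cyl b (1 - ?h n))"
    proof
      fix z assume z: "z \<in> cyl b 1"
      then have "0 < 1 - norm (proj b z)" by simp
      then obtain n where "inverse (real (Suc n)) < 1 - norm (proj b z)" using reals_Archimedean by blast
      moreover have "?h n \<le> inverse (real (Suc n))" by (intro le_imp_inverse_le) auto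
      ultimately have "norm (proj b z) < 1 - ?h n" by linarith
      then have "z \<in> cyl b (1 - ?h n)" using z by (simp only: mem_Collect_eq)
      then show "z \<in> (\<Union>n. cyl b (1 - ?h n))" by blast
    qed
  qed
  ultimately have "(\<lambda>n. measure lborel (cyl b (1 - ?h n))) \<longlonglongrightarrow> measure lborel (cyl b 1)" by simp
  from order_tendstoD(1)[OF this e] obtain n where "e < measure lborel (cyl b (1 - ?h n))"
    by (auto simp: eventually_sequentially)
  then show ?thesis by (intro that[of "?h n"]) (auto simp: inverse_less_1_iff)
qed

end

lemma diverg_scaleR_Basis:
  fixes b :: "'a::euclidean_space"
  assumes b: "b \<in> Basis" and g: "\<And>x. (g has_derivative g' x) (at x)"
  shows "frechet_derivative (\<lambda>x. g x *\<^sub>R b) (at x) = (\<lambda>v. g' x v *\<^sub>R b)"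
    "diverg (\<lambda>x. g x *\<^sub>R b) x = g' x b"
proof -
  show 1: "frechet_derivative (\<lambda>x. g x *\<^sub>R b) (at x) = (\<lambda>v. g' x v *\<^sub>R b)"
    by (rule frechet_derivative_at[symmetric]) (rule has_derivative_scaleR_left[OF g])
  have "diverg (\<lambda>x. g x *\<^sub>R b) x = (\<Sum>j\<in>Basis. g' x j * (b \<bullet> j))" by (simp add: diverg_def 1)
  also have "\<dots> = (\<Sum>j\<in>Basis. if j = b then g' x b else 0)"
    by (rule sum.cong) (use b in \<open>auto simp: inner_Basis\<close>)
  also have "\<dots> = g' x b" using b by simp
  finally show "diverg (\<lambda>x. g x *\<^sub>R b) x = g' x b" .
qed

text \<open>The field points along b and turns from -b at the bottom to +b at height k = \<epsilon>
  \<theta>, so it flows out through both the base and the roof. Its divergence is nonnegative in the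
  domain and integrates to 2 along each vertical segment of length k over the smaller disc.\<close>

lemma perimeter_thin_dom_ge:
  fixes b :: "'a::euclidean_space"
  assumes b: "b \<in> Basis" and \<epsilon>: "\<epsilon> > 0" and \<theta>: "0 < \<theta>" "\<theta> < 1"
  shows "2 * measure lborel (cyl b (1 - \<theta>)) \<le> perimeter (thin_dom b \<epsilon>)"
proof -
  let ?\<Omega> = "thin_dom b \<epsilon>" and ?s = "smooth_step"
  define R where "R = 1 + \<epsilon>"
  define k where "k = \<epsilon> * \<theta>"
  have k: "k > 0" using \<epsilon> \<theta> by (simp add: k_def)
  \<comment> \<open>The first factor equals 1 on the domain, where the norm is at most R, and makes
    the support compact; the second runs from -1 to 1.\<close>
  define g where "g z = ?s (R\<^sup>2 + 1 - (norm z)\<^sup>2) * (2 * ?s ((z \<bullet> b) / k) - 1)" for z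
  have Ckg: "Ck n UNIV g" for n
  proof -
    have 1: "Ck n UNIV (\<lambda>z::'a. ?s (R\<^sup>2 + 1 - (norm z)\<^sup>2))"
      by (rule Ck_compose[OF open_UNIV UNIV_I Ck_smooth_step Ck_diff[OF open_UNIV Ck_const Ck_norm_power2]])
    have 2: "Ck n UNIV (\<lambda>z::'a. (1 / k) * (z \<bullet> b))" by (rule Ck_mult[OF open_UNIV Ck_const Ck_inner])
    have "Ck n UNIV (\<lambda>z::'a. ?s ((1 / k) * (z \<bullet> b)))"
      by (rule Ck_compose[OF open_UNIV UNIV_I Ck_smooth_step 2])
    then have "Ck n UNIV (\<lambda>z::'a. 2 * ?s ((1 / k) * (z \<bullet> b)) - 1)"
      by (rule Ck_diff[OF open_UNIV Ck_mult[OF open_UNIV Ck_const] Ck_const])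
    from Ck_mult[OF open_UNIV 1 this] show ?thesis by (simp add: g_def[abs_def])
  qed
  define \<phi> where "\<phi> z = g z *\<^sub>R b" for z
  let ?g' = "\<lambda>x. frechet_derivative g (at x)"
  have dg: "(g has_derivative ?g' x) (at x)" for x by (rule Ck_Suc_has_derivative[OF Ckg UNIV_I])
  note d\<phi> = diverg_scaleR_Basis[OF b dg, folded \<phi>_def[abs_def]]
  have out: "\<phi> z = 0" if "z \<notin> cball 0 (R + 1)" for z
  proof -
    have "R + 1 < norm z" using that by simp
    then have "(R + 1)\<^sup>2 \<le> (norm z)\<^sup>2" using \<epsilon> by (intro power_mono) (auto simp: R_def)
    moreover have "R\<^sup>2 + 1 \<le> (R + 1)\<^sup>2" using \<epsilon> by (simp add: power2_eq_square algebra_simps R_def)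
    ultimately show ?thesis by (simp add: \<phi>_def g_def smooth_step_eq)
  qed
  have \<phi>: "\<phi> \<in> C1c_fields"
    unfolding C1c_fields_def
  proof (intro CollectI conjI allI ballI)
    show "\<phi> differentiable at x" for x
      unfolding \<phi>_def[abs_def] differentiable_def using has_derivative_scaleR_left[OF dg] by blast
    show "continuous_on UNIV (\<lambda>x. frechet_derivative \<phi> (at x) j)" if "j \<in> Basis" for j
    proof -
      have "Ck (Suc 0) UNIV g" by (rule Ckg)
      then have "continuous_on UNIV (\<lambda>x. ?g' x j)" using that by simp
      then show ?thesis unfolding d\<phi>(1) by (intro continuous_intros)
    qed
    have "{x. \<phi> x \<noteq> 0} \<subseteq> cball 0 (R + 1)" using out by blast
    then have "tsupp \<phi> \<subseteq> cball 0 (R + 1)" unfolding tsupp_def by (rule closure_minimal) simp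
    then have "bounded (tsupp \<phi>)" by (rule bounded_subset[OF bounded_cball])
    moreover have "closed (tsupp \<phi>)" by (simp add: tsupp_def)
    ultimately show "compact (tsupp \<phi>)" by (simp add: compact_eq_bounded_closed)
  qed
  have n1: "norm (\<phi> x) \<le> 1" for x
  proof -
    have "\<bar>2 * ?s ((x \<bullet> b) / k) - 1\<bar> \<le> 1" using smooth_step_bounds[of "(x \<bullet> b) / k"] by (simp add: abs_le_iff)
    then have "\<bar>g x\<bar> \<le> 1 * 1"
      unfolding g_def abs_mult using smooth_step_bounds[of "R\<^sup>2 + 1 - (norm x)\<^sup>2"] by (intro mult_mono) auto
    then show ?thesis using b by (simp add: \<phi>_def)
  qed
  have sd: "(?s has_real_derivative deriv ?s t) (at t)" for t by (rule smooth_real_deriv(1)[OF Ck_smooth_step])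
  have s0: "deriv ?s t \<ge> 0" for t
    using mono_on_imp_deriv_nonneg[of UNIV ?s "deriv ?s t" t] smooth_step_mono sd by (simp add: mono_imp_mono_on)
  define D where "D y = 2 * deriv ?s (y / k) / k" for y
  have D0: "D y \<ge> 0" for y using s0 k by (simp add: D_def)
  have div: "diverg \<phi> z = D (z \<bullet> b)" if z: "z \<in> ?\<Omega>" for z
  proof -
    have "((\<lambda>w. 2 * ?s ((w \<bullet> b) / k) - 1) has_derivative (\<lambda>v. 2 * (deriv ?s ((z \<bullet> b) / k) * ((v \<bullet> b) / k)))) (at z)"
    proof -
      have "((\<lambda>w. (w \<bullet> b) / k) has_derivative (\<lambda>v. (v \<bullet> b) / k)) (at z)" using k by (auto intro!: derivative_eq_intros)
      moreover have "(?s has_derivative (*) (deriv ?s ((z \<bullet> b) / k))) (at ((z \<bullet> b) / k))"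
        using sd by (simp add: has_field_derivative_def)
      ultimately have "((\<lambda>w. ?s ((w \<bullet> b) / k)) has_derivative (\<lambda>v. deriv ?s ((z \<bullet> b) / k) * ((v \<bullet> b) / k))) (at z)"
        by (rule has_derivative_compose)
      from has_derivative_diff[OF has_derivative_mult_right[OF this] has_derivative_const] show ?thesis by simp
    qed
    then have "(g has_derivative (\<lambda>v. 2 * (deriv ?s ((z \<bullet> b) / k) * ((v \<bullet> b) / k)))) (at z)"
    proof (rule has_derivative_transform_within_open[OF _ open_thin_dom[OF b] z])
      fix w assume "w \<in> ?\<Omega>"
      then have "norm w \<le> R" using thin_dom_norm_le[OF b _ \<epsilon>] by (simp add: R_def)
      then have "(norm w)\<^sup>2 \<le> R\<^sup>2" by (intro power_mono) auto
      then show "2 * ?s ((w \<bullet> b) / k) - 1 = g w" by (simp add: g_def smooth_step_eq)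
    qed
    then have "?g' z = (\<lambda>v. 2 * (deriv ?s ((z \<bullet> b) / k) * ((v \<bullet> b) / k)))" by (rule frechet_derivative_at[symmetric])
    then show ?thesis using b by (simp add: d\<phi>(2) D_def)
  qed
  have cD: "continuous_on UNIV D"
    unfolding D_def using k by (intro continuous_intros continuous_on_compose2[OF smooth_real_deriv(3)[OF Ck_smooth_step]]) auto
  have [measurable]: "D \<in> borel_measurable borel" using cD by (rule borel_measurable_continuous_onI)
  have [measurable]: "?\<Omega> \<in> sets borel" "cyl b (1 - \<theta>) \<in> sets borel" "slab b \<in> sets borel"
    using borel_thin_dom[OF b] borel_cyl[OF b] by measurable
  have [measurable]: "(\<lambda>z. norm (proj b z)) \<in> borel_measurable borel" by (rule borel_proj_norm[OF b])
  have "bounded (diverg \<phi> ` closure ?\<Omega>)"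
    using continuous_on_diverg[OF \<phi>] bounded_thin_dom[OF b \<epsilon>]
    by (intro compact_imp_bounded compact_continuous_image) (auto intro: continuous_on_subset)
  then obtain M where M: "\<And>x. x \<in> closure ?\<Omega> \<Longrightarrow> \<bar>diverg \<phi> x\<bar> \<le> M" by (auto simp: bounded_iff)
  have [measurable]: "diverg \<phi> \<in> borel_measurable borel" 
    using continuous_on_diverg[OF \<phi>] by (rule borel_measurable_continuous_onI)
  have i: "integrable lborel (\<lambda>z. indicat_real ?\<Omega> z * diverg \<phi> z)"
  proof (rule integrable_lborel_bounded_support[where S="?\<Omega>" and C=M])
    show "bounded ?\<Omega>" by (rule bounded_thin_dom[OF b \<epsilon>])
    fix x assume "x \<in> ?\<Omega>"
    then show "\<bar>indicat_real ?\<Omega> x * diverg \<phi> x\<bar> \<le> M" using M closure_subset by (auto simp: subset_iff)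
  qed auto
  have AE0: "AE z in lborel. 0 \<le> indicat_real ?\<Omega> z * diverg \<phi> z"
  proof (rule AE_I2)
    show "0 \<le> indicat_real ?\<Omega> z * diverg \<phi> z" for z using div D0 by (cases "z \<in> ?\<Omega>") auto
  qed
  note I = integral_eq_lborel_indicator[OF i]
  have I0: "0 \<le> integral ?\<Omega> (diverg \<phi>)" unfolding I by (rule integral_nonneg_AE[OF AE0])
  have inner: "(\<integral>\<^sup>+y. indicator {0<..<k} y * ennreal (D y) \<partial>lborel) = 2"
  proof -
    have "(D has_integral (2 * ?s (k / k) - 2 * ?s (0 / k))) {0..k}"
    proof (rule fundamental_theorem_of_calculus)
      show "((\<lambda>y. 2 * ?s (y / k)) has_vector_derivative D y) (at y within {0..k})" for y
        unfolding has_real_derivative_iff_has_vector_derivative[symmetric] D_def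
        using k by (auto intro!: derivative_eq_intros DERIV_chain2[OF sd] simp: divide_inverse)
    qed (use k in simp)
    then have "integral {0..k} D = 2" using k by (simp add: smooth_step_eq integral_unique)
    then show ?thesis using nn_integral_interval_continuous[OF cD D0] by simp
  qed
  have "ennreal (2 * measure lborel (cyl b (1 - \<theta>))) = 2 * emeasure lborel (cyl b (1 - \<theta>))"
  proof -
    have "bounded (cyl b (1 - \<theta>))"
    proof -
      have "norm z \<le> 2" if "z \<in> cyl b (1 - \<theta>)" for z using norm_le_proj[OF b, of z] that \<theta> by simp
      then show ?thesis by (auto simp: bounded_iff)
    qed
    from emeasure_bounded_finite[OF this] show ?thesis
      by (subst emeasure_eq_ennreal_measure) (auto simp: ennreal_mult')
  qed
  also have "\<dots> = (\<integral>\<^sup>+z. 2 * indicator (cyl b (1 - \<theta>)) z \<partial>lborel)"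
    by (rule nn_integral_cmult_indicator[symmetric]) simp
  also have "\<dots> = (\<integral>\<^sup>+z. indicator (slab b) z * (\<integral>\<^sup>+y. (if norm (proj b z) < 1 - \<theta> then 1 else 0) * (indicator {0<..<k} y * ennreal (D y)) \<partial>lborel) \<partial>lborel)"
  proof (rule nn_integral_cong)
    fix z
    have "(\<integral>\<^sup>+y. (if norm (proj b z) < 1 - \<theta> then 1 else 0) * (indicator {0<..<k} y * ennreal (D y)) \<partial>lborel)
       = (if norm (proj b z) < 1 - \<theta> then 1 else 0) * 2"
      unfolding inner[symmetric] by (rule nn_integral_cmult) measurable
    then show "2 * indicator (cyl b (1 - \<theta>)) z = indicator (slab b) z * (\<integral>\<^sup>+y. (if norm (proj b z) < 1 - \<theta> then 1 else 0) * (indicator {0<..<k} y * ennreal (D y)) \<partial>lborel)"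
      by (simp add: indicator_def)
  qed
  also have "\<dots> = (\<integral>\<^sup>+z. indicator {z. norm (proj b z) < 1 - \<theta> \<and> 0 < z \<bullet> b \<and> z \<bullet> b < k} z * ennreal (D (z \<bullet> b)) \<partial>lborel)"
  proof (subst (2) nn_integral_vertical[OF b])
    have [measurable]: "{z. norm (proj b z) < 1 - \<theta> \<and> 0 < z \<bullet> b \<and> z \<bullet> b < k} \<in> sets borel" by measurable
    show "(\<lambda>z. indicator {z. norm (proj b z) < 1 - \<theta> \<and> 0 < z \<bullet> b \<and> z \<bullet> b < k} z * ennreal (D (z \<bullet> b))) \<in> borel_measurable borel"
      by measurable
    show "(\<integral>\<^sup>+z. indicator (slab b) z * (\<integral>\<^sup>+y. (if norm (proj b z) < 1 - \<theta> then 1 else 0) * (indicator {0<..<k} y * ennreal (D y)) \<partial>lborel) \<partial>lborel)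
      = (\<integral>\<^sup>+z. indicator (slab b) z * (\<integral>\<^sup>+y. indicator {z. norm (proj b z) < 1 - \<theta> \<and> 0 < z \<bullet> b \<and> z \<bullet> b < k} (proj b z + y *\<^sub>R b) * ennreal (D ((proj b z + y *\<^sub>R b) \<bullet> b)) \<partial>lborel) \<partial>lborel)"
      unfolding indicator_def mem_Collect_eq proj_vertical[OF b]
      by (intro nn_integral_cong arg_cong2[where f="(*)", OF refl]) (simp add: indicator_def)
  qed
  also have "\<dots> \<le> (\<integral>\<^sup>+z. ennreal (indicator ?\<Omega> z * diverg \<phi> z) \<partial>lborel)"
  proof (rule nn_integral_mono)
    fix z
    show "indicator {z. norm (proj b z) < 1 - \<theta> \<and> 0 < z \<bullet> b \<and> z \<bullet> b < k} z * ennreal (D (z \<bullet> b)) \<le> ennreal (indicator ?\<Omega> z * diverg \<phi> z)"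
    proof (cases "norm (proj b z) < 1 - \<theta> \<and> 0 < z \<bullet> b \<and> z \<bullet> b < k")
      case True
      then have "\<epsilon> * \<theta> < \<epsilon> * (1 - norm (proj b z))" using \<epsilon> by (intro mult_strict_left_mono) auto
      then have "z \<in> ?\<Omega>" using True \<theta> unfolding thin_dom_def k_def mem_Collect_eq by linarith
      then show ?thesis using True div by simp
    next
      case False
      then show ?thesis by (subst indicator_simps(2)) auto
    qed
  qed
  also have "\<dots> = ennreal (integral ?\<Omega> (diverg \<phi>))"
    unfolding I by (rule nn_integral_eq_integral[OF i AE0])
  finally have "ennreal (2 * measure lborel (cyl b (1 - \<theta>))) \<le> ennreal (integral ?\<Omega> (diverg \<phi>))" .
  then have "2 * measure lborel (cyl b (1 - \<theta>)) \<le> integral ?\<Omega> (diverg \<phi>)"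
    using I0 by (simp only: ennreal_le_iff)
  also have "\<dots> \<le> perimeter ?\<Omega>"
    by (rule flux_le_perimeter[OF open_thin_dom[OF b] bounded_thin_dom[OF b \<epsilon>] convex_thin_dom[OF b \<epsilon>] thin_dom_nonempty[OF b \<epsilon>] \<phi> n1])
  finally show ?thesis .
qed

context sublinear_exponents begin

text \<open>Integrating (1+\<beta>) y^\<beta> over a fibre of height 1 - |x| gives (1 -
  |x|)^(1+\<beta>), so the base integral is a moment of the height in the model cone, a cone
  distribution with T = 1.\<close>

lemma cone_moment:
  fixes b :: "'a::euclidean_space"
  assumes b: "b \<in> Basis"
  shows "(\<integral>\<^sup>+z. indicator (cyl b 1) z * ennreal ((1 - norm (proj b z)) powr (1 + \<beta>)) \<partial>lborel)
     = ennreal (measure lebesgue (thin_dom b 1) / beta_prod DIM('a))"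
proof -
  let ?V = "measure lebesgue (thin_dom b 1)" and ?N = "DIM('a)"
  have [measurable]: "thin_dom b 1 \<in> sets borel" "cyl b 1 \<in> sets borel" "slab b \<in> sets borel"
    using borel_thin_dom[OF b] borel_cyl[OF b] by measurable
  have 1: "(\<integral>\<^sup>+z. indicator (thin_dom b 1) z * ennreal ((z \<bullet> b) powr \<beta>) \<partial>lborel) = ennreal (?V * 1 powr \<beta> / (\<Prod>j\<in>{1..?N}. 1 + \<beta> / real j))"
  proof (rule powr_integral_eq_of_cone_distribution)
    show "0 \<le> z \<bullet> b" if "z \<in> thin_dom b 1" for z using that by (simp add: thin_dom_def)
    show "emeasure lborel {z \<in> thin_dom b 1. t < z \<bullet> b} = ennreal (?V * (1 - t / 1) ^ ?N)" if "0 < t" "t < 1" for t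
      by (rule emeasure_thin_dom_above[OF b that])
    show "emeasure lborel {z \<in> thin_dom b 1. t < z \<bullet> b} = 0" if "1 \<le> t" for t
    proof -
      have "{z \<in> thin_dom b 1. t < z \<bullet> b} = {}" using thin_dom_1_height[OF b] that by force
      then show ?thesis by (simp only: emeasure_empty)
    qed
  qed (use exponents_pos in auto)
  have e1: "0 \<le> 1 + \<beta>" using exponents_pos by simp
  have "(\<integral>\<^sup>+z. indicator (cyl b 1) z * ennreal ((1 - norm (proj b z)) powr (1 + \<beta>)) \<partial>lborel)
     = (\<integral>\<^sup>+z. indicator (slab b) z * (\<integral>\<^sup>+y. indicator (thin_dom b 1) (proj b z + y *\<^sub>R b) * ennreal ((1 + \<beta>) * ((proj b z + y *\<^sub>R b) \<bullet> b) powr \<beta>) \<partial>lborel) \<partial>lborel)"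
  proof (rule nn_integral_cong)
    fix z
    have "(\<integral>\<^sup>+y. indicator (thin_dom b 1) (proj b z + y *\<^sub>R b) * ennreal ((1 + \<beta>) * ((proj b z + y *\<^sub>R b) \<bullet> b) powr \<beta>) \<partial>lborel)
       = (if norm (proj b z) < 1 then ennreal ((1 - norm (proj b z)) powr (1 + \<beta>)) else 0)"
    proof (cases "norm (proj b z) < 1")
      case True
      have "(\<integral>\<^sup>+y. indicator (thin_dom b 1) (proj b z + y *\<^sub>R b) * ennreal ((1 + \<beta>) * ((proj b z + y *\<^sub>R b) \<bullet> b) powr \<beta>) \<partial>lborel)
        = (\<integral>\<^sup>+y. indicator {0<..<1 - norm (proj b z)} y * ennreal ((1 + \<beta>) * y powr (1 + \<beta> - 1)) \<partial>lborel)"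
        unfolding indicator_def thin_dom_def mem_Collect_eq proj_vertical[OF b]
        using True by (intro nn_integral_cong arg_cong2[where f="(*)"]) auto
      also have "\<dots> = ennreal ((1 - norm (proj b z)) powr (1 + \<beta>))"
        using True exponents_pos by (intro nn_integral_powr_from_0) auto
      finally show ?thesis using True by simp
    next
      case False
      have "(\<integral>\<^sup>+y. indicator (thin_dom b 1) (proj b z + y *\<^sub>R b) * ennreal ((1 + \<beta>) * ((proj b z + y *\<^sub>R b) \<bullet> b) powr \<beta>) \<partial>lborel) = (\<integral>\<^sup>+y. 0 \<partial>lborel)"
        unfolding indicator_def thin_dom_def mem_Collect_eq proj_vertical[OF b]
        using False by simp
      then show ?thesis using False by simp
    qed
    then show "indicator (cyl b 1) z * ennreal ((1 - norm (proj b z)) powr (1 + \<beta>)) = indicator (slab b) z * (\<integral>\<^sup>+y. indicator (thin_dom b 1) (proj b z + y *\<^sub>R b) * ennreal ((1 + \<beta>) * ((proj b z + y *\<^sub>R b) \<bullet> b) powr \<beta>) \<partial>lborel)"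
      by (simp add: indicator_def)
  qed
  also have "\<dots> = (\<integral>\<^sup>+z. indicator (thin_dom b 1) z * ennreal ((1 + \<beta>) * (z \<bullet> b) powr \<beta>) \<partial>lborel)"
    by (rule nn_integral_vertical[OF b, symmetric]) measurable
  also have "\<dots> = (\<integral>\<^sup>+z. ennreal (1 + \<beta>) * (indicator (thin_dom b 1) z * ennreal ((z \<bullet> b) powr \<beta>)) \<partial>lborel)"
    unfolding ennreal_mult'[OF e1] by (intro nn_integral_cong) (rule mult.left_commute)
  also have "\<dots> = ennreal (1 + \<beta>) * ennreal (?V * 1 powr \<beta> / (\<Prod>j\<in>{1..?N}. 1 + \<beta> / real j))"
    unfolding 1[symmetric] by (rule nn_integral_cmult) measurable
  also have "\<dots> = ennreal (?V / beta_prod ?N)"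
  proof -
    have pr: "(\<Prod>j\<in>{1..?N}. 1 + \<beta> / real j) = (1 + \<beta>) * beta_prod ?N"
      by (rule beta_prod_Suc) (use DIM_positive[where 'a='a] in simp)
    have 1: "(1 + \<beta>) * (X * 1 powr \<beta> / ((1 + \<beta>) * Y)) = X / Y" for X Y using exponents_pos(3) by simp
    show ?thesis unfolding pr ennreal_mult'[OF e1, symmetric] 1 ..
  qed
  finally show ?thesis .
qed

end

section \<open>Upper bounds on thin domains\<close>

lemma grad_real_eq_deriv:
  fixes v :: "real \<Rightarrow> real"
  assumes "v \<in> Cc_inf \<Omega>"
  shows "grad v x = deriv v x"
  by (simp add: grad_def smooth_real_deriv(4)[OF Cc_infD(1)[OF assms]])

text \<open>Convexity of the power at x + t y = (1-t) (x/(1-t)) + t y, proved by adding two tangent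
  inequalities at this common point. With t = \<epsilon> it keeps the coefficient of x^p close to 1
  and that of y^p small.\<close>

lemma powr_convex_bound:
  fixes x y t p :: real
  assumes "0 \<le> x" "0 \<le> y" "0 < t" "t < 1" "1 \<le> p"
  shows "(x + t * y) powr p \<le> (1 - t) powr (1 - p) * x powr p + t * y powr p"
proof -
  define a where "a = x / (1 - t)"
  define B where "B = x + t * y"
  have a: "a \<ge> 0" "x = (1 - t) * a" using assms by (auto simp: a_def)
  have "B powr p \<le> (1 - t) * a powr p + t * y powr p"
  proof (cases "B = 0")
    case True
    then show ?thesis using assms by simp
  next
    case False
    then have B: "B > 0" using assms by (simp add: B_def order_less_le)
    have "(1 - t) * (p * B powr (p - 1) * a - (p - 1) * B powr p) \<le> (1 - t) * a powr p"
      using a B assms by (intro mult_left_mono powr_Young_tangent) auto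
    moreover have "t * (p * B powr (p - 1) * y - (p - 1) * B powr p) \<le> t * y powr p"
      using B assms by (intro mult_left_mono powr_Young_tangent) auto
    moreover have "(1 - t) * (p * B powr (p - 1) * a - (p - 1) * B powr p) + t * (p * B powr (p - 1) * y - (p - 1) * B powr p)
        = p * B powr (p - 1) * B - (p - 1) * B powr p"
      unfolding B_def a(2) by (simp add: algebra_simps)
    moreover have "B powr (p - 1) * B = B powr p" using B by (simp add: powr_diff)
    then have "p * B powr (p - 1) * B - (p - 1) * B powr p = B powr p" by (simp add: algebra_simps)
    ultimately show ?thesis by linarith
  qed
  also have "(1 - t) * a powr p = (1 - t) powr (1 - p) * x powr p"
    using assms by (simp add: a_def powr_divide powr_diff)
  finally show ?thesis by (simp add: B_def)
qed

lemma lambda_pq_le_Rayleigh: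
  assumes pq: "p > 0" "q > 0" and \<psi>: "\<psi> \<in> Cc_inf \<Omega>" and S: "integral \<Omega> (\<lambda>x. \<bar>\<psi> x\<bar> powr q) > 0"
  shows "lambda_pq p q \<Omega> \<le> integral \<Omega> (\<lambda>x. norm (grad \<psi> x) powr p) / integral \<Omega> (\<lambda>x. \<bar>\<psi> x\<bar> powr q) powr (p / q)"
proof -
  let ?S = "integral \<Omega> (\<lambda>x. \<bar>\<psi> x\<bar> powr q)"
  define k where "k = ?S powr (- 1 / q)"
  have k: "k > 0" using S by (simp add: k_def)
  let ?w = "\<lambda>x. k * \<psi> x"
  have w: "?w \<in> Cc_inf \<Omega>" by (rule Cc_inf_scale[OF \<psi>])
  have gw: "grad ?w x = k *\<^sub>R grad \<psi> x" for x
  proof -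
    have "(\<psi> has_derivative frechet_derivative \<psi> (at x)) (at x)"
      using Cc_infD(5)[OF \<psi>] by (simp add: frechet_derivative_works)
    then have "(?w has_derivative (\<lambda>h. k * frechet_derivative \<psi> (at x) h)) (at x)"
      by (rule has_derivative_mult_right)
    then have "frechet_derivative ?w (at x) = (\<lambda>h. k * frechet_derivative \<psi> (at x) h)"
      by (rule frechet_derivative_at[symmetric])
    then show ?thesis by (simp add: grad_def scaleR_sum_right)
  qed
  have "integral \<Omega> (\<lambda>x. \<bar>?w x\<bar> powr q) = k powr q * ?S"
    using k by (simp add: abs_mult powr_mult)
  also have "k powr q = ?S powr (- 1)" using pq by (simp add: k_def powr_powr)
  finally have n: "integral \<Omega> (\<lambda>x. \<bar>?w x\<bar> powr q) = 1" using S by (simp add: powr_minus)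
  have "lambda_pq p q \<Omega> \<le> integral \<Omega> (\<lambda>x. norm (grad ?w x) powr p)"
    unfolding lambda_pq_def
  proof (rule cInf_lower)
    show "integral \<Omega> (\<lambda>x. norm (grad ?w x) powr p) \<in> {integral \<Omega> (\<lambda>x. norm (grad \<psi> x) powr p) |\<psi>. \<psi> \<in> Cc_inf \<Omega> \<and> integral \<Omega> (\<lambda>x. \<bar>\<psi> x\<bar> powr q) = 1}"
      by (intro CollectI exI[of _ ?w] conjI refl w n)
    show "bdd_below {integral \<Omega> (\<lambda>x. norm (grad \<psi> x) powr p) |\<psi>. \<psi> \<in> Cc_inf \<Omega> \<and> integral \<Omega> (\<lambda>x. \<bar>\<psi> x\<bar> powr q) = 1}"
    proof (rule bdd_belowI[of _ 0])
      fix y assume "y \<in> {integral \<Omega> (\<lambda>x. norm (grad \<psi> x) powr p) |\<psi>. \<psi> \<in> Cc_inf \<Omega> \<and> integral \<Omega> (\<lambda>x. \<bar>\<psi> x\<bar> powr q) = 1}"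
      then obtain w where w: "w \<in> Cc_inf \<Omega>" "y = integral \<Omega> (\<lambda>x. norm (grad w x) powr p)" by (elim CollectE exE conjE)
      show "0 \<le> y" unfolding w(2) by (rule integral_nonneg[OF Cc_inf_energies(4)[OF w(1) pq]]) simp
    qed
  qed
  also have "\<dots> = k powr p * integral \<Omega> (\<lambda>x. norm (grad \<psi> x) powr p)"
    using k by (simp add: gw powr_mult)
  also have "k powr p = 1 / ?S powr (p / q)"
  proof -
    have "k powr p = ?S powr (- (p / q))" by (simp add: k_def powr_powr)
    then show ?thesis by (simp add: powr_minus divide_inverse)
  qed
  finally show ?thesis by simp
qed

lemma norm_proj_le: "b \<in> Basis \<Longrightarrow> norm (proj b z) \<le> norm z"
proof -
  assume b: "b \<in> Basis"
  have "(norm (proj b z))\<^sup>2 = (norm z)\<^sup>2 - (z \<bullet> b)\<^sup>2"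
    unfolding power2_norm_eq_inner using unit_b[OF b]
    by (simp add: inner_diff_left inner_diff_right power2_eq_square inner_commute algebra_simps)
  then have "(norm (proj b z))\<^sup>2 \<le> (norm z)\<^sup>2" by simp
  then show ?thesis by (rule power2_le_imp_le) simp
qed

text \<open>A test function on the model cone is squeezed vertically by \<epsilon>. Its vertical
  derivative grows by 1/\<epsilon> while the horizontal one is unchanged, so after rescaling only
  the vertical energy H survives as \<epsilon> tends to 0 and the full energy G carries a factor
  \<epsilon>. The exponent p - 1 + p/q collects \<epsilon>^(1-p) from the energy and
  \<epsilon>^(p/q) from the normalisation of the mass.\<close>

lemma lambda_thin_dom_le:
  fixes b :: "'a::euclidean_space"
  assumes b: "b \<in> Basis" and pq: "1 \<le> q" "q < p" and \<epsilon>: "0 < \<epsilon>" "\<epsilon> < 1"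
    and \<Psi>: "\<Psi> \<in> Cc_inf (thin_dom b 1)"
    and H: "(\<integral>\<^sup>+z. ennreal (\<bar>grad \<Psi> z \<bullet> b\<bar> powr p) \<partial>lborel) \<le> ennreal H" "H \<ge> 0"
    and S: "S > 0" "ennreal S \<le> (\<integral>\<^sup>+z. ennreal (\<bar>\<Psi> z\<bar> powr q) \<partial>lborel)"
    and G: "(\<integral>\<^sup>+z. ennreal (norm (grad \<Psi> z) powr p) \<partial>lborel) = ennreal G" "G \<ge> 0"
  shows "lambda_pq p q (thin_dom b \<epsilon>) * \<epsilon> powr (p - 1 + p / q) \<le> ((1 - \<epsilon>) powr (1 - p) * H + \<epsilon> * G) / S powr (p / q)"
proof -
  have p0: "p > 0" "q > 0" "p \<ge> 1" using pq by auto
  let ?\<Omega> = "thin_dom b \<epsilon>"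
  define L where "L z = proj b z + ((z \<bullet> b) / \<epsilon>) *\<^sub>R b" for z
  define L' where "L' z = proj b z + (\<epsilon> * (z \<bullet> b)) *\<^sub>R b" for z
  have L'L: "L' (L z) = z" for z
  proof -
    have "L' (L z) = (proj b z + ((z \<bullet> b) / \<epsilon>) *\<^sub>R b) - ((z \<bullet> b) / \<epsilon>) *\<^sub>R b + (\<epsilon> * ((z \<bullet> b) / \<epsilon>)) *\<^sub>R b"
      unfolding L_def L'_def proj_vertical(2)[OF b] ..
    also have "\<dots> = z" using \<epsilon> by simp
    finally show ?thesis .
  qed
  have Llin: "bounded_linear L"
  proof -
    have "bounded_linear (\<lambda>z. z + ((1 / \<epsilon> - 1) * (z \<bullet> b)) *\<^sub>R b)"
      by (intro bounded_linear_add bounded_linear_ident bounded_linear_scaleR_const bounded_linear_const_mult bounded_linear_inner_left)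
    moreover have "(\<lambda>z. z + ((1 / \<epsilon> - 1) * (z \<bullet> b)) *\<^sub>R b) = L" by (simp add: fun_eq_iff L_def algebra_simps)
    ultimately show ?thesis by simp
  qed
  have mem: "z \<in> ?\<Omega> \<longleftrightarrow> L z \<in> thin_dom b 1" for z
    unfolding L_def thin_dom_def mem_Collect_eq proj_vertical[OF b]
    using \<epsilon> by (simp add: pos_divide_less_eq zero_less_divide_iff mult.commute)
  define \<psi> where "\<psi> z = \<Psi> (L z)" for z
  have \<psi>: "\<psi> \<in> Cc_inf ?\<Omega>"
  proof (rule Cc_infI[where K="L' ` tsupp \<Psi>"])
    show "Ck n UNIV \<psi>" for n
    proof -
      have "Ck n UNIV (\<lambda>z. \<Psi> (L z + 0))" by (rule Ck_compose_affine[OF Llin open_UNIV UNIV_I Cc_infD(1)[OF \<Psi>]])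
      then show ?thesis by (simp add: \<psi>_def[abs_def])
    qed
    show "compact (L' ` tsupp \<Psi>)"
      by (rule compact_continuous_image[OF _ Cc_infD(2)[OF \<Psi>]]) (auto simp: L'_def intro!: continuous_intros)
    show "L' ` tsupp \<Psi> \<subseteq> ?\<Omega>"
    proof
      fix z assume "z \<in> L' ` tsupp \<Psi>"
      then obtain w where w: "w \<in> tsupp \<Psi>" "z = L' w" by blast
      have "L (L' w) = (proj b w + (\<epsilon> * (w \<bullet> b)) *\<^sub>R b) - (\<epsilon> * (w \<bullet> b)) *\<^sub>R b + ((\<epsilon> * (w \<bullet> b)) / \<epsilon>) *\<^sub>R b"
        unfolding L_def L'_def proj_vertical(2)[OF b] ..
      also have "\<dots> = w" using \<epsilon> by simp
      finally have "L z = w" using w by simp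
      then show "z \<in> ?\<Omega>" using mem[of z] w Cc_infD(3)[OF \<Psi>] by blast
    qed
    show "\<psi> z = 0" if "z \<notin> L' ` tsupp \<Psi>" for z
    proof -
      have "L z \<notin> tsupp \<Psi>" using that L'L[of z] by (metis imageI)
      then show ?thesis using Cc_infD(4)[OF \<Psi>] by (simp add: \<psi>_def)
    qed
  qed
  \<comment> \<open>The gradient is tested against itself: its squared norm is the old gradient
    paired with the image under L, and L splits into a horizontal part and a vertical part stretched
    by 1/\<epsilon>.\<close>
  have gL: "norm (grad \<psi> z) \<le> (\<bar>grad \<Psi> (L z) \<bullet> b\<bar> + \<epsilon> * norm (grad \<Psi> (L z))) / \<epsilon>" for z
  proof -
    let ?g = "grad \<psi> z" and ?G = "grad \<Psi> (L z)"
    have "(\<Psi> has_derivative frechet_derivative \<Psi> (at (L z))) (at (L z))"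
      using Cc_infD(5)[OF \<Psi>] by (simp add: frechet_derivative_works)
    then have "((\<lambda>z. \<Psi> (L z)) has_derivative (\<lambda>v. frechet_derivative \<Psi> (at (L z)) (L v))) (at z)"
      by (rule has_derivative_compose[OF bounded_linear_imp_has_derivative[OF Llin]])
    then have "frechet_derivative \<psi> (at z) = (\<lambda>v. frechet_derivative \<Psi> (at (L z)) (L v))"
      unfolding \<psi>_def[abs_def] by (rule frechet_derivative_at[symmetric])
    then have e: "?g \<bullet> v = ?G \<bullet> L v" for v
      using grad_inner[OF \<psi>, of z v] grad_inner[OF \<Psi>, of "L z" "L v"] by simp
    have "(norm ?g)\<^sup>2 = ?G \<bullet> L ?g" using e[of ?g] by (simp add: power2_norm_eq_inner)
    also have "\<dots> = ?G \<bullet> proj b ?g + ((?g \<bullet> b) / \<epsilon>) * (?G \<bullet> b)" by (simp add: L_def inner_add_right)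
    also have "?G \<bullet> proj b ?g \<le> norm ?G * norm (proj b ?g)" by (rule norm_cauchy_schwarz)
    also have "\<dots> \<le> norm ?G * norm ?g" by (intro mult_left_mono norm_proj_le[OF b]) simp
    also have "((?g \<bullet> b) / \<epsilon>) * (?G \<bullet> b) \<le> \<bar>?g \<bullet> b\<bar> / \<epsilon> * \<bar>?G \<bullet> b\<bar>"
      using \<epsilon> abs_ge_self[of "((?g \<bullet> b) / \<epsilon>) * (?G \<bullet> b)"] by (simp add: abs_mult)
    also have "\<dots> \<le> norm ?g / \<epsilon> * \<bar>?G \<bullet> b\<bar>"
      using Basis_le_norm[OF b, of ?g] \<epsilon> by (intro mult_right_mono divide_right_mono) auto
    finally have "norm ?g * norm ?g \<le> norm ?g * ((\<bar>?G \<bullet> b\<bar> + \<epsilon> * norm ?G) / \<epsilon>)"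
      using \<epsilon> by (simp add: power2_eq_square field_simps)
    then show ?thesis
    proof (cases "norm ?g = 0")
      case True
      then show ?thesis using \<epsilon> by simp
    next
      case False
      then have "0 < norm ?g" by simp
      then show ?thesis using \<open>norm ?g * norm ?g \<le> _\<close> by (simp only: mult_le_cancel_left_pos)
    qed
  qed
  have [measurable]: "\<Psi> \<in> borel_measurable borel" "grad \<Psi> \<in> borel_measurable borel"
    using Cc_infD(6)[OF \<Psi>] continuous_on_grad[OF \<Psi>] by (auto intro: borel_measurable_continuous_onI)
  let ?A = "integral ?\<Omega> (\<lambda>x. \<bar>\<psi> x\<bar> powr q)" and ?E = "integral ?\<Omega> (\<lambda>x. norm (grad \<psi> x) powr p)"
  have A: "\<epsilon> * S \<le> ?A"
  proof -
    have "ennreal (\<epsilon> * S) = ennreal \<epsilon> * ennreal S" using \<epsilon> by (simp add: ennreal_mult')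
    also have "\<dots> \<le> ennreal \<epsilon> * (\<integral>\<^sup>+z. ennreal (\<bar>\<Psi> z\<bar> powr q) \<partial>lborel)" by (intro mult_left_mono S) simp
    also have "\<dots> = (\<integral>\<^sup>+z. ennreal (\<bar>\<psi> z\<bar> powr q) \<partial>lborel)"
      unfolding \<psi>_def L_def by (rule nn_integral_vertical_scale[OF b _ \<epsilon>(1), symmetric]) measurable
    also have "\<dots> = ennreal ?A" by (rule Cc_inf_energies(1)[OF \<psi> p0(1,2)])
    finally show ?thesis
      using ennreal_le_iff[of ?A "\<epsilon> * S"] integral_nonneg[OF Cc_inf_energies(3)[OF \<psi> p0(1,2)]] by simp
  qed
  have B: "?E \<le> \<epsilon> powr (1 - p) * ((1 - \<epsilon>) powr (1 - p) * H + \<epsilon> * G)"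
  proof -
    let ?h = "\<lambda>w. ennreal ((1 - \<epsilon>) powr (1 - p)) * ennreal (\<bar>grad \<Psi> w \<bullet> b\<bar> powr p) + ennreal \<epsilon> * ennreal (norm (grad \<Psi> w) powr p)"
    have "ennreal ?E = (\<integral>\<^sup>+z. ennreal (norm (grad \<psi> z) powr p) \<partial>lborel)"
      by (rule Cc_inf_energies(2)[OF \<psi> p0(1,2), symmetric])
    also have "\<dots> \<le> (\<integral>\<^sup>+z. ennreal (\<epsilon> powr (- p)) * ?h (L z) \<partial>lborel)"
    proof (rule nn_integral_mono)
      fix z
      let ?x = "\<bar>grad \<Psi> (L z) \<bullet> b\<bar>" and ?y = "norm (grad \<Psi> (L z))"
      have "norm (grad \<psi> z) powr p \<le> ((?x + \<epsilon> * ?y) / \<epsilon>) powr p" using gL[of z] p0 by (intro powr_mono2) auto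
      also have "\<dots> = \<epsilon> powr (- p) * (?x + \<epsilon> * ?y) powr p" using \<epsilon> by (simp add: powr_divide powr_minus_divide)
      also have "\<dots> \<le> \<epsilon> powr (- p) * ((1 - \<epsilon>) powr (1 - p) * ?x powr p + \<epsilon> * ?y powr p)"
        using \<epsilon> p0 by (intro mult_left_mono powr_convex_bound) auto
      finally have "ennreal (norm (grad \<psi> z) powr p) \<le> ennreal (\<epsilon> powr (- p) * ((1 - \<epsilon>) powr (1 - p) * ?x powr p + \<epsilon> * ?y powr p))"
        by (rule ennreal_leI)
      also have "\<dots> = ennreal (\<epsilon> powr (- p)) * ?h (L z)"
        using \<epsilon> by (simp add: ennreal_mult')
      finally show "ennreal (norm (grad \<psi> z) powr p) \<le> ennreal (\<epsilon> powr (- p)) * ?h (L z)" .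
    qed
    also have "\<dots> = ennreal \<epsilon> * (\<integral>\<^sup>+w. ennreal (\<epsilon> powr (- p)) * ?h w \<partial>lborel)"
      unfolding L_def by (rule nn_integral_vertical_scale[OF b _ \<epsilon>(1)]) measurable
    also have "(\<integral>\<^sup>+w. ennreal (\<epsilon> powr (- p)) * ?h w \<partial>lborel) = ennreal (\<epsilon> powr (- p)) * (\<integral>\<^sup>+w. ?h w \<partial>lborel)"
      by (rule nn_integral_cmult) measurable
    also have "(\<integral>\<^sup>+w. ?h w \<partial>lborel) = (\<integral>\<^sup>+w. ennreal ((1 - \<epsilon>) powr (1 - p)) * ennreal (\<bar>grad \<Psi> w \<bullet> b\<bar> powr p) \<partial>lborel) + (\<integral>\<^sup>+w. ennreal \<epsilon> * ennreal (norm (grad \<Psi> w) powr p) \<partial>lborel)"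
      by (rule nn_integral_add) measurable
    also have "(\<integral>\<^sup>+w. ennreal ((1 - \<epsilon>) powr (1 - p)) * ennreal (\<bar>grad \<Psi> w \<bullet> b\<bar> powr p) \<partial>lborel) = ennreal ((1 - \<epsilon>) powr (1 - p)) * (\<integral>\<^sup>+w. ennreal (\<bar>grad \<Psi> w \<bullet> b\<bar> powr p) \<partial>lborel)"
      by (rule nn_integral_cmult) measurable
    also have "(\<integral>\<^sup>+w. ennreal \<epsilon> * ennreal (norm (grad \<Psi> w) powr p) \<partial>lborel) = ennreal \<epsilon> * ennreal G"
      unfolding G(1)[symmetric] by (rule nn_integral_cmult) measurable
    also have "ennreal \<epsilon> * (ennreal (\<epsilon> powr (- p)) * (ennreal ((1 - \<epsilon>) powr (1 - p)) * (\<integral>\<^sup>+w. ennreal (\<bar>grad \<Psi> w \<bullet> b\<bar> powr p) \<partial>lborel) + ennreal \<epsilon> * ennreal G))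
       \<le> ennreal \<epsilon> * (ennreal (\<epsilon> powr (- p)) * (ennreal ((1 - \<epsilon>) powr (1 - p)) * ennreal H + ennreal \<epsilon> * ennreal G))"
      by (intro mult_left_mono add_right_mono H(1)) auto
    also have "\<dots> = ennreal (\<epsilon> * (\<epsilon> powr (- p) * ((1 - \<epsilon>) powr (1 - p) * H + \<epsilon> * G)))"
      using \<epsilon> H(2) G(2) by (simp add: ennreal_mult' ennreal_plus)
    finally have "?E \<le> \<epsilon> * (\<epsilon> powr (- p) * ((1 - \<epsilon>) powr (1 - p) * H + \<epsilon> * G))"
      using \<epsilon> H(2) G(2) by (subst (asm) ennreal_le_iff) (auto intro!: mult_nonneg_nonneg add_nonneg_nonneg)
    also have "\<dots> = \<epsilon> powr (1 - p) * ((1 - \<epsilon>) powr (1 - p) * H + \<epsilon> * G)"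
      using \<epsilon> by (simp add: powr_diff powr_minus divide_inverse)
    finally show ?thesis .
  qed
  let ?X = "(1 - \<epsilon>) powr (1 - p) * H + \<epsilon> * G"
  have X: "?X \<ge> 0" using \<epsilon> H(2) G(2) by (intro add_nonneg_nonneg mult_nonneg_nonneg) auto
  have eS: "\<epsilon> * S > 0" using \<epsilon> S(1) by simp
  have "lambda_pq p q ?\<Omega> \<le> ?E / ?A powr (p / q)"
    by (rule lambda_pq_le_Rayleigh[OF p0(1,2) \<psi>]) (use A eS in linarith)
  also have "\<dots> \<le> (\<epsilon> powr (1 - p) * ?X) / (\<epsilon> * S) powr (p / q)"
    using B A eS p0 X \<epsilon> S(1) by (intro frac_le powr_mono2 mult_nonneg_nonneg) auto
  finally have "lambda_pq p q ?\<Omega> * \<epsilon> powr (p - 1 + p / q) \<le> (\<epsilon> powr (1 - p) * ?X) / (\<epsilon> * S) powr (p / q) * \<epsilon> powr (p - 1 + p / q)"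
    by (intro mult_right_mono) auto
  also have "\<dots> = ?X / S powr (p / q) * (\<epsilon> powr (1 - p) * \<epsilon> powr (p - 1 + p / q) / \<epsilon> powr (p / q))"
    using \<epsilon> S(1) by (simp add: powr_mult mult_ac)
  also have "\<epsilon> powr (1 - p) * \<epsilon> powr (p - 1 + p / q) / \<epsilon> powr (p / q) = \<epsilon> powr 0"
    using \<epsilon> by (simp only: powr_add[symmetric] powr_diff[symmetric]) simp
  finally show ?thesis using \<epsilon> by simp
qed

subsection \<open>Trial functions\<close>

text \<open>It will be evaluated at s = |x|^2, which is smooth. Vanishing near s = 1 makes the
  support compact; vanishing near s = 0 removes the axis, where |x| is not smooth.\<close>

definition cutoff :: "real \<Rightarrow> real \<Rightarrow> real" where
  "cutoff \<eta> s = smooth_step ((s - \<eta>) / \<eta>) * smooth_step ((1 - \<eta> - s) / \<eta>)"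

lemma Ck_cutoff: "\<eta> > 0 \<Longrightarrow> Ck n UNIV (cutoff \<eta>)"
proof -
  assume \<eta>: "\<eta> > 0"
  have 1: "Ck n UNIV (\<lambda>s::real. (s \<bullet> 1) * (1 / \<eta>) - 1)"
    by (rule Ck_diff[OF open_UNIV Ck_mult[OF open_UNIV Ck_inner Ck_const] Ck_const])
  have 2: "Ck n UNIV (\<lambda>s::real. (1 - \<eta>) / \<eta> - (s \<bullet> 1) * (1 / \<eta>))"
    by (rule Ck_diff[OF open_UNIV Ck_const Ck_mult[OF open_UNIV Ck_inner Ck_const]])
  have 3: "Ck n UNIV (\<lambda>s::real. smooth_step ((s \<bullet> 1) * (1 / \<eta>) - 1))"
    by (rule Ck_compose[OF open_UNIV UNIV_I Ck_smooth_step 1])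
  have "Ck n UNIV (\<lambda>s::real. smooth_step ((1 - \<eta>) / \<eta> - (s \<bullet> 1) * (1 / \<eta>)))"
    by (rule Ck_compose[OF open_UNIV UNIV_I Ck_smooth_step 2])
  from Ck_mult[OF open_UNIV 3 this]
  have "Ck n UNIV (\<lambda>s::real. smooth_step ((s \<bullet> 1) * (1 / \<eta>) - 1) * smooth_step ((1 - \<eta>) / \<eta> - (s \<bullet> 1) * (1 / \<eta>)))" .
  moreover have "(\<lambda>s::real. smooth_step ((s \<bullet> 1) * (1 / \<eta>) - 1) * smooth_step ((1 - \<eta>) / \<eta> - (s \<bullet> 1) * (1 / \<eta>))) = cutoff \<eta>"
    using \<eta> by (simp add: fun_eq_iff cutoff_def diff_divide_distrib)
  ultimately show ?thesis by simp
qed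

lemma cutoff_bounds: "0 \<le> cutoff \<eta> s" "cutoff \<eta> s \<le> 1"
  unfolding cutoff_def by (simp_all add: smooth_step_bounds mult_le_one)

lemma cutoff_eq_0: "\<eta> > 0 \<Longrightarrow> s \<le> \<eta> \<or> 1 - \<eta> \<le> s \<Longrightarrow> cutoff \<eta> s = 0"
  by (auto simp: cutoff_def smooth_step_eq divide_nonpos_pos)

lemma cutoff_eq_1: "\<eta> > 0 \<Longrightarrow> 2 * \<eta> \<le> s \<Longrightarrow> s \<le> 1 - 2 * \<eta> \<Longrightarrow> cutoff \<eta> s = 1"
  by (simp add: cutoff_def smooth_step_eq)

lemma nn_integral_scaled_powr:
  fixes w :: "real \<Rightarrow> real"
  assumes [measurable]: "w \<in> borel_measurable borel" and A: "A \<ge> 0" and k: "k > 0"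
  shows "(\<integral>\<^sup>+y. ennreal (\<bar>A * w (y * inverse k)\<bar> powr r) \<partial>lborel)
    = ennreal (A powr r * k) * (\<integral>\<^sup>+y. ennreal (\<bar>w y\<bar> powr r) \<partial>lborel)"
proof -
  have e: "(0 + k * y) * inverse k = y" for y using k by (simp add: field_simps)
  have "(\<integral>\<^sup>+y. ennreal (\<bar>w (y * inverse k)\<bar> powr r) \<partial>lborel) = ennreal \<bar>k\<bar> * (\<integral>\<^sup>+y. ennreal (\<bar>w ((0 + k * y) * inverse k)\<bar> powr r) \<partial>lborel)"
    by (rule nn_integral_real_affine) (use k in auto)
  also have "\<dots> = ennreal k * (\<integral>\<^sup>+y. ennreal (\<bar>w y\<bar> powr r) \<partial>lborel)" using k by (simp only: e abs_of_pos)
  finally have 1: "(\<integral>\<^sup>+y. ennreal (\<bar>w (y * inverse k)\<bar> powr r) \<partial>lborel) = ennreal k * (\<integral>\<^sup>+y. ennreal (\<bar>w y\<bar> powr r) \<partial>lborel)" .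
  have "(\<integral>\<^sup>+y. ennreal (\<bar>A * w (y * inverse k)\<bar> powr r) \<partial>lborel) = (\<integral>\<^sup>+y. ennreal (A powr r) * ennreal (\<bar>w (y * inverse k)\<bar> powr r) \<partial>lborel)"
    using A by (simp add: abs_mult powr_mult ennreal_mult')
  also have "\<dots> = ennreal (A powr r) * (\<integral>\<^sup>+y. ennreal (\<bar>w (y * inverse k)\<bar> powr r) \<partial>lborel)"
    by (rule nn_integral_cmult) measurable
  finally show ?thesis unfolding 1 by (simp add: ennreal_mult' mult.assoc)
qed

context sublinear_exponents begin

text \<open>On the fibre of height k = 1 - |x| it is the profile k^(\<beta>/q) v(y/k), cut off
  radially. The exponent \<beta>/q gives a fibre the mass k^(1+\<beta>), and since \<beta> p/q - p =
  \<beta> also an energy proportional to k^(1+\<beta>); these are the proportions of equality in the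
  tangent inequality.\<close>

definition trial :: "'a::euclidean_space \<Rightarrow> (real \<Rightarrow> real) \<Rightarrow> real \<Rightarrow> 'a \<Rightarrow> real" where
  "trial b v \<eta> z = cutoff \<eta> ((norm (proj b z))\<^sup>2) * (1 - norm (proj b z)) powr (\<beta> / q)
     * v ((z \<bullet> b) * inverse (1 - norm (proj b z)))"

text \<open>For 0 < |x| < 1 the formula is a composition of smooth functions; where the cutoff
  vanishes the function is 0. As \<eta> < 1/2, these two open sets cover the space.\<close>

lemma Ck_trial:
  fixes b :: "'a::euclidean_space"
  assumes b: "b \<in> Basis" and v: "v \<in> Cc_inf {0<..<1}" and \<eta>: "0 < \<eta>" "\<eta> < 1/2"
  shows "Ck n UNIV (trial b v \<eta>)"
proof -
  let ?s = "\<lambda>z::'a. (norm (proj b z))\<^sup>2"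
  let ?U = "{z. 0 < ?s z \<and> ?s z < 1}" and ?W = "{z. ?s z < \<eta> \<or> 1 - \<eta> < ?s z}"
  have oU: "open ?U" by (intro open_Collect_conj open_Collect_less continuous_intros)
  have oW: "open ?W" by (intro open_Collect_disj open_Collect_less continuous_intros)
  have lin: "bounded_linear (proj b)"
    by (intro bounded_linear_sub bounded_linear_ident bounded_linear_scaleR_const bounded_linear_inner_left)
  have "Ck n UNIV (\<lambda>z. (norm (proj b z + 0))\<^sup>2)"
    by (rule Ck_compose_affine[OF lin open_UNIV UNIV_I Ck_norm_power2])
  then have s: "Ck n UNIV ?s" by simp
  have sU: "Ck n ?U ?s" by (rule Ck_subset[OF s]) simp
  have d: "Ck n ?U (\<lambda>z. 1 - sqrt (?s z))"
    by (rule Ck_diff[OF oU Ck_const Ck_compose[OF oU _ Ck_sqrt sU]]) simp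
  have dpos: "1 - sqrt (?s z) > 0" if "z \<in> ?U" for z using that by (simp add: power_less_one_iff abs_square_less_1)
  have c: "Ck n ?U (\<lambda>z. cutoff \<eta> (?s z))" by (rule Ck_compose[OF oU UNIV_I Ck_cutoff[OF \<eta>(1)] sU])
  have pw: "Ck n ?U (\<lambda>z. (1 - sqrt (?s z)) powr (\<beta> / q))"
    by (rule Ck_compose[OF oU _ Ck_powr d]) (use dpos in simp)
  have iv: "Ck n ?U (\<lambda>z. inverse (1 - sqrt (?s z)))"
    by (rule Ck_compose[OF oU _ Ck_inverse d]) (use dpos in force)
  have ar: "Ck n ?U (\<lambda>z. (z \<bullet> b) * inverse (1 - sqrt (?s z)))"
    by (rule Ck_mult[OF oU Ck_subset[OF Ck_inner] iv]) simp
  have vv: "Ck n ?U (\<lambda>z. v ((z \<bullet> b) * inverse (1 - sqrt (?s z))))"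
    by (rule Ck_compose[OF oU UNIV_I Cc_infD(1)[OF v] ar])
  have "Ck n ?U (\<lambda>z. cutoff \<eta> (?s z) * (1 - sqrt (?s z)) powr (\<beta> / q) * v ((z \<bullet> b) * inverse (1 - sqrt (?s z))))"
    by (rule Ck_mult[OF oU Ck_mult[OF oU c pw] vv])
  then have 1: "Ck n ?U (trial b v \<eta>)" by (simp add: trial_def[abs_def])
  have "Ck n ?W (trial b v \<eta>) \<longleftrightarrow> Ck n ?W (\<lambda>z. 0)"
  proof (rule Ck_cong[OF oW])
    fix z assume "z \<in> ?W"
    then have "cutoff \<eta> (?s z) = 0" by (intro cutoff_eq_0 \<eta>(1)) auto
    then show "trial b v \<eta> z = 0" by (simp add: trial_def)
  qed
  then have 2: "Ck n ?W (trial b v \<eta>)" by simp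
  have "?U \<union> ?W = UNIV"
  proof -
    have "z \<in> ?U \<or> z \<in> ?W" for z unfolding mem_Collect_eq using \<eta> by linarith
    then show ?thesis by blast
  qed
  then show ?thesis using Ck_Un[OF oU oW 1 2] by simp
qed

lemma trial_Cc_inf:
  fixes b :: "'a::euclidean_space"
  assumes b: "b \<in> Basis" and v: "v \<in> Cc_inf {0<..<1}" and \<eta>: "0 < \<eta>" "\<eta> < 1/2"
  shows "trial b v \<eta> \<in> Cc_inf (thin_dom b 1)"
proof -
  let ?s = "\<lambda>z::'a. (norm (proj b z))\<^sup>2"
  \<comment> \<open>The point over the projection of w at the fraction t of the fibre height. The
    image of a compact set under this map is a compact set inside the cone that contains the
    support.\<close>
  let ?J = "\<lambda>(w, t). proj b w + (t * (1 - norm (proj b w))) *\<^sub>R b"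
  let ?B = "cball 0 1 \<inter> {w. ?s w \<le> 1 - \<eta>}"
  define K where "K = ?J ` (?B \<times> tsupp v)"
  have lt: "norm (proj b w) < 1" if "?s w \<le> 1 - \<eta>" for w
  proof -
    have "(norm (proj b w))\<^sup>2 < 1\<^sup>2" using that \<eta> by simp
    then show ?thesis by (rule power2_less_imp_less) simp
  qed
  show ?thesis
  proof (rule Cc_infI[where K=K])
    show "Ck n UNIV (trial b v \<eta>)" for n by (rule Ck_trial[OF assms])
    have "closed {w. ?s w \<le> 1 - \<eta>}" by (intro closed_Collect_le continuous_intros)
    then have "compact ?B" by (intro compact_Int_closed) auto
    then have "compact (?B \<times> tsupp v)" by (intro compact_Times Cc_infD(2)[OF v])
    then show "compact K" unfolding K_def
      by (intro compact_continuous_image) (auto simp: case_prod_unfold intro!: continuous_intros)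
    show "K \<subseteq> thin_dom b 1"
    proof
      fix z assume "z \<in> K"
      then obtain w t where w: "?s w \<le> 1 - \<eta>" "t \<in> tsupp v" and z: "z = proj b w + (t * (1 - norm (proj b w))) *\<^sub>R b"
        unfolding K_def by force
      have t: "0 < t" "t < 1" using w(2) Cc_infD(3)[OF v] by auto
      have r: "norm (proj b w) < 1" by (rule lt[OF w(1)])
      have "t * (1 - norm (proj b w)) < 1 * (1 - norm (proj b w))" using t r by (intro mult_strict_right_mono) auto
      then show "z \<in> thin_dom b 1"
        unfolding z thin_dom_def mem_Collect_eq proj_vertical[OF b] using r t by simp
    qed
    show "trial b v \<eta> z = 0" if "z \<notin> K" for z
    proof (rule ccontr)
      assume nz: "trial b v \<eta> z \<noteq> 0"
      have "\<not> (1 - \<eta> \<le> ?s z)" using nz cutoff_eq_0[OF \<eta>(1), of "?s z"] by (auto simp: trial_def)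
      then have s: "?s z \<le> 1 - \<eta>" by simp
      note r = lt[OF s]
      have t: "(z \<bullet> b) * inverse (1 - norm (proj b z)) \<in> tsupp v" (is "?t \<in> _")
        using nz Cc_infD(4)[OF v] by (auto simp: trial_def)
      have pp: "proj b (proj b z) = proj b z" using proj_vertical(1)[OF b, of z 0] by simp
      have m: "(proj b z, ?t) \<in> ?B \<times> tsupp v" using s r t unfolding mem_Times_iff Int_iff mem_Collect_eq fst_conv snd_conv pp by simp
      have e: "?J (proj b z, ?t) = z" unfolding prod.case pp using r by simp
      have "?J (proj b z, ?t) \<in> K" unfolding K_def by (rule imageI[OF m])
      then have "z \<in> K" unfolding e .
      with that show False ..
    qed
  qed
qed

lemma grad_trial_vertical:
  fixes b :: "'a::euclidean_space"
  assumes b: "b \<in> Basis" and v: "v \<in> Cc_inf {0<..<1}" and \<eta>: "0 < \<eta>" "\<eta> < 1/2"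
  shows "grad (trial b v \<eta>) z \<bullet> b = cutoff \<eta> ((norm (proj b z))\<^sup>2) * (1 - norm (proj b z)) powr (\<beta> / q)
     * inverse (1 - norm (proj b z)) * deriv v ((z \<bullet> b) * inverse (1 - norm (proj b z)))"
proof -
  let ?T = "trial b v \<eta>" and ?r = "norm (proj b z)"
  note T = trial_Cc_inf[OF assms]
  have "(?T has_derivative frechet_derivative ?T (at (z + 0 *\<^sub>R b))) (at (z + 0 *\<^sub>R b))"
    using Cc_infD(5)[OF T] by (simp add: frechet_derivative_works)
  moreover have "((\<lambda>t. z + t *\<^sub>R b) has_derivative (\<lambda>t. t *\<^sub>R b)) (at 0)" by (auto intro!: derivative_eq_intros)
  ultimately have "((\<lambda>t. ?T (z + t *\<^sub>R b)) has_derivative (\<lambda>t. frechet_derivative ?T (at (z + 0 *\<^sub>R b)) (t *\<^sub>R b))) (at 0)"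
    by (rule has_derivative_compose[rotated])
  moreover have "(\<lambda>t. grad ?T (z + 0 *\<^sub>R b) \<bullet> (t *\<^sub>R b)) = (*) (grad ?T z \<bullet> b)" by (simp add: fun_eq_iff mult.commute)
  ultimately have 1: "((\<lambda>t. ?T (z + t *\<^sub>R b)) has_real_derivative (grad ?T z \<bullet> b)) (at 0)"
    by (simp only: has_field_derivative_def grad_inner[OF T])
  have "((\<lambda>t. cutoff \<eta> (?r\<^sup>2) * (1 - ?r) powr (\<beta> / q) * v ((z \<bullet> b + t) * inverse (1 - ?r))) has_real_derivative
     cutoff \<eta> (?r\<^sup>2) * (1 - ?r) powr (\<beta> / q) * (deriv v ((z \<bullet> b + 0) * inverse (1 - ?r)) * inverse (1 - ?r))) (at 0)"
    by (intro DERIV_cmult DERIV_chain2[OF smooth_real_deriv(1)[OF Cc_infD(1)[OF v]]]) (auto intro!: derivative_eq_intros)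
  moreover have "(\<lambda>t. cutoff \<eta> (?r\<^sup>2) * (1 - ?r) powr (\<beta> / q) * v ((z \<bullet> b + t) * inverse (1 - ?r))) = (\<lambda>t. ?T (z + t *\<^sub>R b))"
    unfolding trial_def unfolding proj_shift(1)[OF b] unfolding proj_shift(2)[OF b] ..
  ultimately show ?thesis using DERIV_unique[OF 1] by (simp add: mult_ac)
qed

lemma trial_mass:
  fixes b :: "'a::euclidean_space"
  assumes b: "b \<in> Basis" and v: "v \<in> Cc_inf {0<..<1}" "integral {0<..<1} (\<lambda>x. \<bar>v x\<bar> powr q) = 1" and \<eta>: "0 < \<eta>" "\<eta> < 1/2"
  shows "(\<integral>\<^sup>+z. ennreal (\<bar>trial b v \<eta> z\<bar> powr q) \<partial>lborel) =
    (\<integral>\<^sup>+z. indicator (cyl b 1) z * ennreal (cutoff \<eta> ((norm (proj b z))\<^sup>2) powr q * (1 - norm (proj b z)) powr (1 + \<beta>)) \<partial>lborel)"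
proof -
  have cT: "continuous_on UNIV (trial b v \<eta>)" by (rule Cc_infD(6)[OF trial_Cc_inf[OF b v(1) \<eta>]])
  have [measurable]: "trial b v \<eta> \<in> borel_measurable borel" using cT by (rule borel_measurable_continuous_onI)
  have [measurable]: "v \<in> borel_measurable borel" using Cc_infD(6)[OF v(1)] by (rule borel_measurable_continuous_onI)
  have v1: "(\<integral>\<^sup>+y. ennreal (\<bar>v y\<bar> powr q) \<partial>lborel) = 1"
    using Cc_inf_energies(1)[OF v(1) exponents_pos(1,2)] v(2) by simp
  have fib: "(\<integral>\<^sup>+y. ennreal (\<bar>trial b v \<eta> (proj b z + y *\<^sub>R b)\<bar> powr q) \<partial>lborel)
      = (if norm (proj b z) < 1 then 1 else 0) * ennreal (cutoff \<eta> ((norm (proj b z))\<^sup>2) powr q * (1 - norm (proj b z)) powr (1 + \<beta>))" for z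
  proof (cases "norm (proj b z) < 1")
    case True
    let ?k = "1 - norm (proj b z)" and ?c = "cutoff \<eta> ((norm (proj b z))\<^sup>2)"
    have "(\<integral>\<^sup>+y. ennreal (\<bar>trial b v \<eta> (proj b z + y *\<^sub>R b)\<bar> powr q) \<partial>lborel)
       = (\<integral>\<^sup>+y. ennreal (\<bar>(?c * ?k powr (\<beta> / q)) * v (y * inverse ?k)\<bar> powr q) \<partial>lborel)"
      unfolding trial_def proj_vertical[OF b] ..
    also have "\<dots> = ennreal ((?c * ?k powr (\<beta> / q)) powr q * ?k) * (\<integral>\<^sup>+y. ennreal (\<bar>v y\<bar> powr q) \<partial>lborel)"
      using True by (intro nn_integral_scaled_powr) (auto simp: cutoff_bounds)
    also have "(?c * ?k powr (\<beta> / q)) powr q * ?k = ?c powr q * ?k powr (1 + \<beta>)"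
      using True exponents_pos by (simp add: powr_mult powr_powr powr_add cutoff_bounds)
    finally show ?thesis using True v1 by simp
  next
    case False
    then have "1 \<le> (norm (proj b z))\<^sup>2" by simp
    then have "cutoff \<eta> ((norm (proj b z))\<^sup>2) = 0" using \<eta> by (intro cutoff_eq_0) auto
    then show ?thesis using False unfolding trial_def proj_vertical[OF b] by simp
  qed
  have "(\<integral>\<^sup>+z. ennreal (\<bar>trial b v \<eta> z\<bar> powr q) \<partial>lborel) = (\<integral>\<^sup>+z. indicator (slab b) z * (\<integral>\<^sup>+y. ennreal (\<bar>trial b v \<eta> (proj b z + y *\<^sub>R b)\<bar> powr q) \<partial>lborel) \<partial>lborel)"
    by (rule nn_integral_vertical[OF b]) measurable
  also have "\<dots> = (\<integral>\<^sup>+z. indicator (slab b) z * ((if norm (proj b z) < 1 then 1 else 0) * ennreal (cutoff \<eta> ((norm (proj b z))\<^sup>2) powr q * (1 - norm (proj b z)) powr (1 + \<beta>))) \<partial>lborel)"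
    unfolding fib ..
  also have "\<dots> = (\<integral>\<^sup>+z. indicator (cyl b 1) z * ennreal (cutoff \<eta> ((norm (proj b z))\<^sup>2) powr q * (1 - norm (proj b z)) powr (1 + \<beta>)) \<partial>lborel)"
    by (rule nn_integral_cong) (simp add: indicator_def)
  finally show ?thesis .
qed

text \<open>The vertical derivative does not touch the cutoff, which depends on the projection only
  and is at most 1; so the bound is independent of \<eta>.\<close>

lemma trial_vertical_energy:
  fixes b :: "'a::euclidean_space"
  assumes b: "b \<in> Basis" and v: "v \<in> Cc_inf {0<..<1}" and \<eta>: "0 < \<eta>" "\<eta> < 1/2"
  shows "(\<integral>\<^sup>+z. ennreal (\<bar>grad (trial b v \<eta>) z \<bullet> b\<bar> powr p) \<partial>lborel) \<le>
    (\<integral>\<^sup>+z. indicator (cyl b 1) z * ennreal ((1 - norm (proj b z)) powr (1 + \<beta>)) \<partial>lborel) * ennreal (integral {0<..<1} (\<lambda>x. \<bar>deriv v x\<bar> powr p))"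
proof -
  let ?E = "integral {0<..<1} (\<lambda>x. \<bar>deriv v x\<bar> powr p)"
  have [measurable]: "grad (trial b v \<eta>) \<in> borel_measurable borel"
    using continuous_on_grad[OF trial_Cc_inf[OF b v \<eta>]] by (rule borel_measurable_continuous_onI)
  have [measurable]: "deriv v \<in> borel_measurable borel"
    using smooth_real_deriv(3)[OF Cc_infD(1)[OF v]] by (rule borel_measurable_continuous_onI)
  have v1: "(\<integral>\<^sup>+y. ennreal (\<bar>deriv v y\<bar> powr p) \<partial>lborel) = ennreal ?E"
    using Cc_inf_energies(2)[OF v exponents_pos(1,2)] by (simp add: grad_real_eq_deriv[OF v])
  have [measurable]: "slab b \<in> sets borel" "(\<lambda>z. norm (proj b z)) \<in> borel_measurable borel" "cyl b 1 \<in> sets borel"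
    using borel_cyl[OF b] by measurable
  have le: "(\<integral>\<^sup>+y. ennreal (\<bar>grad (trial b v \<eta>) (proj b z + y *\<^sub>R b) \<bullet> b\<bar> powr p) \<partial>lborel)
      \<le> (if norm (proj b z) < 1 then 1 else 0) * ennreal ((1 - norm (proj b z)) powr (1 + \<beta>)) * ennreal ?E" for z
  proof (cases "norm (proj b z) < 1")
    case True
    let ?k = "1 - norm (proj b z)" and ?c = "cutoff \<eta> ((norm (proj b z))\<^sup>2)"
    have "(\<integral>\<^sup>+y. ennreal (\<bar>grad (trial b v \<eta>) (proj b z + y *\<^sub>R b) \<bullet> b\<bar> powr p) \<partial>lborel)
       = (\<integral>\<^sup>+y. ennreal (\<bar>(?c * ?k powr (\<beta> / q) * inverse ?k) * deriv v (y * inverse ?k)\<bar> powr p) \<partial>lborel)"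
      unfolding grad_trial_vertical[OF b v \<eta>] proj_vertical[OF b] ..
    also have "\<dots> = ennreal ((?c * ?k powr (\<beta> / q) * inverse ?k) powr p * ?k) * ennreal ?E"
      unfolding v1[symmetric] using True by (intro nn_integral_scaled_powr) (auto simp: cutoff_bounds)
    also have "\<dots> \<le> ennreal (?k powr (1 + \<beta>)) * ennreal ?E"
    proof (intro mult_right_mono ennreal_leI)
      have "(?c * ?k powr (\<beta> / q) * inverse ?k) powr p * ?k \<le> (1 * ?k powr (\<beta> / q) * inverse ?k) powr p * ?k"
        using True exponents_pos cutoff_bounds by (intro mult_right_mono powr_mono2) auto
      also have "\<dots> = ?k powr (\<beta> / q * p) * ?k powr (- p) * ?k powr 1"
        using True by (simp add: powr_mult powr_powr powr_minus inverse_powr)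
      also have "\<dots> = ?k powr (\<beta> / q * p + (- p) + 1)" by (simp only: powr_add)
      also have "\<beta> / q * p + (- p) + 1 = 1 + \<beta>" using exponents_pos(5) by (simp add: algebra_simps)
      finally show "(?c * ?k powr (\<beta> / q) * inverse ?k) powr p * ?k \<le> ?k powr (1 + \<beta>)" .
    qed simp
    finally show ?thesis using True by simp
  next
    case False
    then have "1 \<le> (norm (proj b z))\<^sup>2" by simp
    then have c0: "cutoff \<eta> ((norm (proj b z))\<^sup>2) = 0" using \<eta> by (intro cutoff_eq_0) auto
    have "grad (trial b v \<eta>) (proj b z + y *\<^sub>R b) \<bullet> b = 0" for y
      unfolding grad_trial_vertical[OF b v \<eta>] proj_vertical[OF b] c0 by (simp only: mult_zero_left)
    then show ?thesis by (simp only: abs_zero) simp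
  qed
  have "(\<integral>\<^sup>+z. ennreal (\<bar>grad (trial b v \<eta>) z \<bullet> b\<bar> powr p) \<partial>lborel)
     = (\<integral>\<^sup>+z. indicator (slab b) z * (\<integral>\<^sup>+y. ennreal (\<bar>grad (trial b v \<eta>) (proj b z + y *\<^sub>R b) \<bullet> b\<bar> powr p) \<partial>lborel) \<partial>lborel)"
    by (rule nn_integral_vertical[OF b]) measurable
  also have "\<dots> \<le> (\<integral>\<^sup>+z. indicator (slab b) z * ((if norm (proj b z) < 1 then 1 else 0) * ennreal ((1 - norm (proj b z)) powr (1 + \<beta>)) * ennreal ?E) \<partial>lborel)"
    by (intro nn_integral_mono mult_left_mono le) simp
  also have "\<dots> = (\<integral>\<^sup>+z. indicator (cyl b 1) z * ennreal ((1 - norm (proj b z)) powr (1 + \<beta>)) * ennreal ?E \<partial>lborel)"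
    by (rule nn_integral_cong) (simp add: indicator_def)
  also have "\<dots> = (\<integral>\<^sup>+z. indicator (cyl b 1) z * ennreal ((1 - norm (proj b z)) powr (1 + \<beta>)) \<partial>lborel) * ennreal ?E"
    by (rule nn_integral_multc) measurable
  finally show ?thesis .
qed

text \<open>The cutoffs tend to 1 off the axis, with the uncut integrand as majorant. Dimension at
  least 2 makes the axis null: it lies in the hyperplane orthogonal to a second basis
  vector.\<close>

lemma trial_mass_tendsto:
  fixes b :: "'a::euclidean_space"
  assumes b: "b \<in> Basis" and N: "DIM('a) \<ge> 2"
    and fin: "(\<integral>\<^sup>+z. indicator (cyl b 1) z * ennreal ((1 - norm (proj b z)) powr (1 + \<beta>)) \<partial>lborel) < \<infinity>"
  defines "\<eta> \<equiv> \<lambda>n. inverse (real (Suc n))"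
  shows "(\<lambda>n. \<integral>\<^sup>+z. indicator (cyl b 1) z * ennreal (cutoff (\<eta> n) ((norm (proj b z))\<^sup>2) powr q * (1 - norm (proj b z)) powr (1 + \<beta>)) \<partial>lborel)
    \<longlonglongrightarrow> (\<integral>\<^sup>+z. indicator (cyl b 1) z * ennreal ((1 - norm (proj b z)) powr (1 + \<beta>)) \<partial>lborel)"
proof (rule nn_integral_dominated_convergence[where w="\<lambda>z. indicator (cyl b 1) z * ennreal ((1 - norm (proj b z)) powr (1 + \<beta>))"])
  have \<eta>: "\<eta> n > 0" for n by (simp add: \<eta>_def)
  have [measurable]: "slab b \<in> sets borel" "(\<lambda>z. norm (proj b z)) \<in> borel_measurable borel" "cyl b 1 \<in> sets borel"
    using borel_cyl[OF b] by measurable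
  have [measurable]: "cutoff (\<eta> n) \<in> borel_measurable borel" for n
    by (rule borel_measurable_continuous_onI[OF Ck_continuous_on[OF Ck_cutoff[OF \<eta>]]])
  show "(\<lambda>z. indicator (cyl b 1) z * ennreal (cutoff (\<eta> n) ((norm (proj b z))\<^sup>2) powr q * (1 - norm (proj b z)) powr (1 + \<beta>))) \<in> borel_measurable lborel" for n
    by measurable
  show "(\<lambda>z. indicator (cyl b 1) z * ennreal ((1 - norm (proj b z)) powr (1 + \<beta>))) \<in> borel_measurable lborel" by measurable
  then show "(\<lambda>z. indicator (cyl b 1) z * ennreal ((1 - norm (proj b z)) powr (1 + \<beta>))) \<in> borel_measurable lborel" .
  show "AE z in lborel. indicator (cyl b 1) z * ennreal (cutoff (\<eta> n) ((norm (proj b z))\<^sup>2) powr q * (1 - norm (proj b z)) powr (1 + \<beta>)) \<le> indicator (cyl b 1) z * ennreal ((1 - norm (proj b z)) powr (1 + \<beta>))" for n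
  proof (rule AE_I2, intro mult_left_mono ennreal_leI)
    fix z
    have "cutoff (\<eta> n) ((norm (proj b z))\<^sup>2) powr q \<le> 1 powr q"
      using cutoff_bounds exponents_pos by (intro powr_mono2) auto
    then show "cutoff (\<eta> n) ((norm (proj b z))\<^sup>2) powr q * (1 - norm (proj b z)) powr (1 + \<beta>) \<le> (1 - norm (proj b z)) powr (1 + \<beta>)"
      by (intro mult_left_le_one_le) auto
  qed simp
  show "(\<integral>\<^sup>+z. indicator (cyl b 1) z * ennreal ((1 - norm (proj b z)) powr (1 + \<beta>)) \<partial>lborel) < \<infinity>" by (rule fin)
  have "\<exists>j. j \<in> Basis \<and> j \<noteq> b"
  proof (rule ccontr)
    assume "\<not> ?thesis"
    then have "(Basis :: 'a set) \<subseteq> {b}" by blast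
    then have "DIM('a) \<le> card {b}" by (intro card_mono) auto
    then show False using N by simp
  qed
  then obtain j where j: "j \<in> Basis" "j \<noteq> b" by blast
  have "AE z in lborel. j \<bullet> z \<noteq> 0" by (rule AE_hyperplane) (use j nonzero_Basis in blast)
  then show "AE z in lborel. (\<lambda>n. indicator (cyl b 1) z * ennreal (cutoff (\<eta> n) ((norm (proj b z))\<^sup>2) powr q * (1 - norm (proj b z)) powr (1 + \<beta>))) \<longlonglongrightarrow> indicator (cyl b 1) z * ennreal ((1 - norm (proj b z)) powr (1 + \<beta>))"
  proof (rule AE_mp, intro AE_I2 impI)
    fix z :: 'a assume z: "j \<bullet> z \<noteq> 0"
    show "(\<lambda>n. indicator (cyl b 1) z * ennreal (cutoff (\<eta> n) ((norm (proj b z))\<^sup>2) powr q * (1 - norm (proj b z)) powr (1 + \<beta>))) \<longlonglongrightarrow> indicator (cyl b 1) z * ennreal ((1 - norm (proj b z)) powr (1 + \<beta>))"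
    proof (cases "z \<in> cyl b 1")
      case True
      let ?s = "(norm (proj b z))\<^sup>2"
      have "proj b z \<noteq> 0"
      proof
        assume "proj b z = 0"
        then have "j \<bullet> z = j \<bullet> ((z \<bullet> b) *\<^sub>R b)" by simp
        also have "\<dots> = 0" using j b by (simp add: inner_Basis)
        finally show False using z by simp
      qed
      then have s: "0 < ?s" "?s < 1" using True by (simp_all add: power_less_one_iff abs_square_less_1)
      have "\<eta> \<longlonglongrightarrow> 0" unfolding \<eta>_def by (rule LIMSEQ_inverse_real_of_nat)
      then have "\<forall>\<^sub>F n in sequentially. \<eta> n < min (?s / 2) ((1 - ?s) / 2)" by (rule order_tendstoD) (use s in simp)
      then have "\<forall>\<^sub>F n in sequentially. indicator (cyl b 1) z * ennreal (cutoff (\<eta> n) ?s powr q * (1 - norm (proj b z)) powr (1 + \<beta>)) = indicator (cyl b 1) z * ennreal ((1 - norm (proj b z)) powr (1 + \<beta>))"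
      proof eventually_elim
        case (elim n)
        then have "cutoff (\<eta> n) ?s = 1" by (intro cutoff_eq_1 \<eta>) auto
        then show ?case by simp
      qed
      then show ?thesis by (rule tendsto_eventually)
    qed simp
  qed
qed

end

subsection \<open>Sharpness\<close>

context sublinear_exponents begin

text \<open>The energy bound holds for every cutoff, while the mass comes arbitrarily close to M; so
  one may stop at any prescribed S < M. From n > 1 on, \<eta> is below 1/2.\<close>

lemma exists_trial:
  fixes b :: "'a::euclidean_space"
  assumes b: "b \<in> Basis" and N: "DIM('a) \<ge> 2"
    and v: "v \<in> Cc_inf {0<..<1}" "integral {0<..<1} (\<lambda>x. \<bar>v x\<bar> powr q) = 1"
  defines "M \<equiv> measure lebesgue (thin_dom b 1) / beta_prod DIM('a)"
  assumes S: "0 \<le> S" "S < M"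
  obtains \<Psi> where "\<Psi> \<in> Cc_inf (thin_dom b 1)"
    "(\<integral>\<^sup>+z. ennreal (\<bar>grad \<Psi> z \<bullet> b\<bar> powr p) \<partial>lborel) \<le> ennreal (integral {0<..<1} (\<lambda>x. \<bar>deriv v x\<bar> powr p) * M)"
    "ennreal S \<le> (\<integral>\<^sup>+z. ennreal (\<bar>\<Psi> z\<bar> powr q) \<partial>lborel)"
proof -
  let ?\<eta> = "\<lambda>n. inverse (real (Suc n))"
  note M = cone_moment[OF b, folded M_def]
  have "(\<lambda>n. \<integral>\<^sup>+z. indicator (cyl b 1) z * ennreal (cutoff (?\<eta> n) ((norm (proj b z))\<^sup>2) powr q * (1 - norm (proj b z)) powr (1 + \<beta>)) \<partial>lborel) \<longlonglongrightarrow> ennreal M"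
    using trial_mass_tendsto[OF b N] unfolding M by simp
  moreover have "ennreal S < ennreal M" using S by (simp add: ennreal_less_iff)
  ultimately have "\<forall>\<^sub>F n in sequentially. ennreal S < (\<integral>\<^sup>+z. indicator (cyl b 1) z * ennreal (cutoff (?\<eta> n) ((norm (proj b z))\<^sup>2) powr q * (1 - norm (proj b z)) powr (1 + \<beta>)) \<partial>lborel)"
    by (rule order_tendstoD(1))
  with eventually_gt_at_top[of 1] obtain n where n: "n > 1"
    "ennreal S < (\<integral>\<^sup>+z. indicator (cyl b 1) z * ennreal (cutoff (?\<eta> n) ((norm (proj b z))\<^sup>2) powr q * (1 - norm (proj b z)) powr (1 + \<beta>)) \<partial>lborel)"
    by (rule eventually_happens'[OF sequentially_bot eventually_conj, THEN exE]) (elim conjE)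
  have \<eta>: "0 < ?\<eta> n" "?\<eta> n < 1/2" using n(1) by (simp_all add: field_simps)
  show thesis
  proof (rule that)
    show "trial b v (?\<eta> n) \<in> Cc_inf (thin_dom b 1)" by (rule trial_Cc_inf[OF b v(1) \<eta>])
    have "(\<integral>\<^sup>+z. ennreal (\<bar>grad (trial b v (?\<eta> n)) z \<bullet> b\<bar> powr p) \<partial>lborel) \<le> ennreal M * ennreal (integral {0<..<1} (\<lambda>x. \<bar>deriv v x\<bar> powr p))"
      using trial_vertical_energy[OF b v(1) \<eta>] unfolding M .
    also have "\<dots> = ennreal (integral {0<..<1} (\<lambda>x. \<bar>deriv v x\<bar> powr p) * M)"
      using S by (subst ennreal_mult'[symmetric]) (auto simp: mult.commute)
    finally show "(\<integral>\<^sup>+z. ennreal (\<bar>grad (trial b v (?\<eta> n)) z \<bullet> b\<bar> powr p) \<partial>lborel) \<le> ennreal (integral {0<..<1} (\<lambda>x. \<bar>deriv v x\<bar> powr p) * M)" .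
    show "ennreal S \<le> (\<integral>\<^sup>+z. ennreal (\<bar>trial b v (?\<eta> n) z\<bar> powr q) \<partial>lborel)"
      unfolding trial_mass[OF b v \<eta>] using n(2) by (rule less_imp_le)
  qed
qed

lemma pi_pq_near_minimiser:
  assumes t: "t > 0"
  obtains v where "v \<in> Cc_inf {0<..<1::real}" "integral {0<..<1} (\<lambda>x. \<bar>v x\<bar> powr q) = 1"
    "integral {0<..<1} (\<lambda>x. \<bar>deriv v x\<bar> powr p) \<le> pi_pq p q powr p + t"
proof -
  let ?A = "{(integral {0<..<1} (\<lambda>x. \<bar>deriv u x\<bar> powr p)) powr (1/p) | u.
      u \<in> Cc_inf {0<..<1::real} \<and> (integral {0<..<1} (\<lambda>x. \<bar>u x\<bar> powr q)) powr (1/q) = 1}"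
  let ?c = "(pi_pq p q powr p + t) powr (1 / p)"
  have "\<exists>\<psi>\<in>Cc_inf {0<..<1::real}. integral {0<..<1} (\<lambda>x. \<bar>\<psi> x\<bar> powr q) = 1"
    by (rule exists_normalised_Cc_inf) (use exponents_pos in auto)
  then obtain \<psi> where \<psi>: "\<psi> \<in> Cc_inf {0<..<1::real}" "integral {0<..<1} (\<lambda>x. \<bar>\<psi> x\<bar> powr q) = 1" by blast
  have "(integral {0<..<1} (\<lambda>x. \<bar>deriv \<psi> x\<bar> powr p)) powr (1/p) \<in> ?A"
    by (intro CollectI exI[of _ \<psi>] conjI refl \<psi>(1)) (simp add: \<psi>(2))
  then have ne: "?A \<noteq> {}" by blast
  have "pi_pq p q = (pi_pq p q powr p) powr (1 / p)"
    using pi_nonneg exponents_pos by (simp add: powr_powr)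
  also have "\<dots> < ?c" using t exponents_pos by (intro powr_less_mono2) auto
  finally have "Inf ?A < ?c" unfolding pi_pq_def .
  from cInf_lessD[OF ne this] obtain v where v: "v \<in> Cc_inf {0<..<1::real}"
      "(integral {0<..<1} (\<lambda>x. \<bar>v x\<bar> powr q)) powr (1/q) = 1"
      "(integral {0<..<1} (\<lambda>x. \<bar>deriv v x\<bar> powr p)) powr (1/p) < ?c"
    by (elim bexE CollectE exE conjE) simp
  note e = Cc_inf_energies(3,4)[OF v(1) exponents_pos(1,2)]
  show thesis
  proof (rule that[OF v(1)])
    let ?X = "integral {0<..<1} (\<lambda>x. \<bar>v x\<bar> powr q)"
    have "?X \<ge> 0" by (rule integral_nonneg[OF e(1)]) simp
    then have "?X = (?X powr (1 / q)) powr q" using exponents_pos by (simp add: powr_powr)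
    then show "?X = 1" using v(2) by simp
    let ?Y = "integral {0<..<1} (\<lambda>x. \<bar>deriv v x\<bar> powr p)"
    show "?Y \<le> pi_pq p q powr p + t"
    proof (rule ccontr)
      assume "\<not> ?thesis"
      then have "?c \<le> ?Y powr (1 / p)" using t exponents_pos by (intro powr_mono2) auto
      then show False using v(3) by simp
    qed
  qed
qed

context
  fixes b :: "'a::euclidean_space" and V M :: real
  assumes b: "b \<in> Basis" and N: "DIM('a) \<ge> 2"
  defines "V \<equiv> measure lebesgue (thin_dom b 1)" and "M \<equiv> measure lebesgue (thin_dom b 1) / beta_prod DIM('a)"
begin

lemma thin_dom_volume_pos: "V > 0" "M > 0"
proof -
  show "V > 0" unfolding V_def
    by (rule convex_volume_pos[OF open_thin_dom[OF b] bounded_thin_dom[OF b] convex_thin_dom[OF b] thin_dom_nonempty[OF b]]) simp_all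
  then show "M > 0" unfolding M_def V_def using beta_prod_pos by simp
qed

text \<open>N V is at most the base area, and the perimeter is at least twice the area of every
  smaller disc; the resulting bound does not depend on \<epsilon>.\<close>

lemma perimeter_thin_dom_lower:
  assumes e: "e < real DIM('a) * V" and \<epsilon>: "\<epsilon> > 0"
  shows "2 * e \<le> perimeter (thin_dom b \<epsilon>)"
proof -
  have "e < measure lborel (cyl b 1)" using e cyl_measure_ge[OF b] unfolding V_def by linarith
  then obtain \<theta> where "0 < \<theta>" "\<theta> < 1" "e < measure lborel (cyl b (1 - \<theta>))" by (rule cyl_measure_exhaust[OF b])
  with perimeter_thin_dom_ge[OF b \<epsilon>, of \<theta>] show ?thesis by linarith
qed

text \<open>The right-hand side is what the upper bound becomes once all losses vanish: energy
  \<pi>^p M, mass M, perimeter 2 N V and volume factor V. That it equals K is the sharpness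
  computation.\<close>

lemma K_const_thin_dom:
  "K_const p q DIM('a) = pi_pq p q powr p * M / M powr (p / q) * V powr (p - 1 + p / q) / (2 * (real DIM('a) * V)) powr p"
proof -
  let ?B = "beta_prod DIM('a)" and ?n = "real DIM('a)"
  have n: "?n > 0" using DIM_positive[where 'a='a] by simp
  note B = beta_prod_pos[of "DIM('a)"] and V = thin_dom_volume_pos
  have M: "M = V / ?B" by (simp add: M_def V_def)
  have "M / M powr (p / q) = M powr (1 - p / q)" using V by (simp add: powr_diff)
  also have "\<dots> = V powr (1 - p / q) * ?B powr (p / q - 1)"
    unfolding M using V B by (simp add: powr_divide powr_diff)
  finally have 1: "M / M powr (p / q) = V powr (1 - p / q) * ?B powr (p / q - 1)" .
  have "V powr (1 - p / q) * V powr (p - 1 + p / q) = V powr p" using V by (simp add: powr_add[symmetric])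
  then have 2: "V powr (1 - p / q) * V powr (p - 1 + p / q) / V powr p = 1" using V by simp
  have "pi_pq p q powr p * M / M powr (p / q) * V powr (p - 1 + p / q) / (2 * (?n * V)) powr p
      = pi_pq p q powr p * (M / M powr (p / q)) * V powr (p - 1 + p / q) / ((2 * ?n) powr p * V powr p)"
    using V n by (simp add: powr_mult)
  also have "\<dots> = pi_pq p q powr p / (2 * ?n) powr p * ?B powr (p / q - 1) * (V powr (1 - p / q) * V powr (p - 1 + p / q) / V powr p)"
    unfolding 1 by simp
  also have "\<dots> = K_const p q DIM('a)"
    unfolding 2 K_const_eq using pi_nonneg n by (simp add: powr_divide)
  finally show ?thesis ..
qed

lemma thin_dom_ratio_eq:
  assumes \<epsilon>: "\<epsilon> > 0"
  shows "(measure lebesgue (thin_dom b \<epsilon>) powr (1 - 1/p + 1/q) / perimeter (thin_dom b \<epsilon>)) powr p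
     = \<epsilon> powr (p - 1 + p / q) * V powr (p - 1 + p / q) / perimeter (thin_dom b \<epsilon>) powr p"
proof -
  have P: "perimeter (thin_dom b \<epsilon>) \<ge> 0" 
    using perimeter_thin_dom_lower[OF _ \<epsilon>, of 0] thin_dom_volume_pos DIM_positive[where 'a='a] by simp
  have "(1 - 1/p + 1/q) * p = p - 1 + p / q" using exponents_pos by (simp add: field_simps)
  then show ?thesis
    using measure_thin_dom_scale[OF b \<epsilon>] P \<epsilon> thin_dom_volume_pos by (simp add: powr_divide powr_powr powr_mult V_def)
qed

text \<open>No value lies below K, by the bound for convex domains applied to each thin domain. From
  above, a single parameter t measures three losses at once: the excess energy of the profile, the
  missing mass of the trial function and the deficit in the perimeter.\<close>

lemma thin_dom_limit:
  "((\<lambda>\<epsilon>. lambda_pq p q (thin_dom b \<epsilon>) *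
       (measure lebesgue (thin_dom b \<epsilon>) powr (1 - 1/p + 1/q) / perimeter (thin_dom b \<epsilon>)) powr p)
     \<longlongrightarrow> K_const p q DIM('a)) (at_right 0)" (is "(?Q \<longlongrightarrow> ?K) _")
proof (rule order_tendstoI)
  let ?n = "real DIM('a)" and ?a = "p - 1 + p / q"
  have n: "?n > 0" using DIM_positive[where 'a='a] by simp
  note V = thin_dom_volume_pos
  have P0: "perimeter (thin_dom b \<epsilon>) > 0" if "\<epsilon> > 0" for \<epsilon>
  proof -
    have "?n * V / 2 < ?n * V" using V n by simp
    from perimeter_thin_dom_lower[OF this that] have "?n * V \<le> perimeter (thin_dom b \<epsilon>)" by simp
    moreover have "?n * V > 0" using V n by simp
    ultimately show ?thesis by linarith
  qed
  fix x :: real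
  {
    assume x: "x < ?K"
    have "x < ?Q \<epsilon>" if \<epsilon>: "\<epsilon> > 0" for \<epsilon>
    proof -
      let ?\<Omega> = "thin_dom b \<epsilon>"
      let ?m = "measure lebesgue ?\<Omega> powr (1 - 1/p + 1/q)"
      have m: "?m > 0" using measure_thin_dom_scale[OF b \<epsilon>] \<epsilon> V by (simp add: V_def)
      have "?K * (perimeter ?\<Omega> / ?m) powr p \<le> lambda_pq p q ?\<Omega>"
        by (rule convex_lower_bound[OF open_thin_dom[OF b] bounded_thin_dom[OF b \<epsilon>] convex_thin_dom[OF b \<epsilon>] thin_dom_nonempty[OF b \<epsilon>]])
      then have "?K * (perimeter ?\<Omega> / ?m) powr p * (?m / perimeter ?\<Omega>) powr p \<le> ?Q \<epsilon>"
        by (rule mult_right_mono) simp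
      moreover have "(perimeter ?\<Omega> / ?m) powr p * (?m / perimeter ?\<Omega>) powr p = 1"
        using P0[OF \<epsilon>] m by (simp add: powr_mult[symmetric])
      ultimately have "?K \<le> ?Q \<epsilon>" by (simp only: mult.assoc mult_1_right)
      with x show ?thesis by linarith
    qed
    then show "\<forall>\<^sub>F \<epsilon> in at_right 0. x < ?Q \<epsilon>"
      by (intro eventually_at_right_less[THEN eventually_mono]) 
  }
  {
    assume x: "?K < x"
    \<comment> \<open>t is fixed so that f t < x before \<epsilon> is sent to 0, because the full
      energy G of the chosen trial function depends on t.\<close>
    define f where "f t = (pi_pq p q powr p + t) * M / (M * (1 - t)) powr (p / q) * V powr ?a / (2 * (?n * V * (1 - t))) powr p" for t
    have "(f \<longlongrightarrow> (pi_pq p q powr p + 0) * M / (M * (1 - 0)) powr (p / q) * V powr ?a / (2 * (?n * V * (1 - 0))) powr p) (at_right 0)"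
      unfolding f_def[abs_def] using V n by (intro tendsto_intros) auto
    then have "(f \<longlongrightarrow> ?K) (at_right 0)" unfolding K_const_thin_dom by simp
    then have "\<forall>\<^sub>F t in at_right 0. f t < x" using x by (rule order_tendstoD(2))
    moreover have "\<forall>\<^sub>F t in at_right (0::real). 0 < t \<and> t < 1"
      unfolding eventually_at_right_field by (intro exI[of _ 1]) auto
    ultimately have "\<forall>\<^sub>F t in at_right 0. f t < x \<and> 0 < t \<and> t < 1" by (rule eventually_conj)
    then obtain t where t: "f t < x" "0 < t" "t < 1"
      using eventually_happens'[OF trivial_limit_at_right_real] by blast
    obtain v where v: "v \<in> Cc_inf {0<..<1::real}" "integral {0<..<1} (\<lambda>x. \<bar>v x\<bar> powr q) = 1"
      and E: "integral {0<..<1} (\<lambda>x. \<bar>deriv v x\<bar> powr p) \<le> pi_pq p q powr p + t"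
      by (rule pi_pq_near_minimiser[OF t(2)])
    define S where "S = M * (1 - t)"
    have S: "0 < S" "S < M" using V t by (simp_all add: S_def)
    obtain \<Psi> where \<Psi>: "\<Psi> \<in> Cc_inf (thin_dom b 1)"
      and H: "(\<integral>\<^sup>+z. ennreal (\<bar>grad \<Psi> z \<bullet> b\<bar> powr p) \<partial>lborel) \<le> ennreal (integral {0<..<1} (\<lambda>x. \<bar>deriv v x\<bar> powr p) * M)"
      and S': "ennreal S \<le> (\<integral>\<^sup>+z. ennreal (\<bar>\<Psi> z\<bar> powr q) \<partial>lborel)"
      by (rule exists_trial[OF b N v less_imp_le[OF S(1)] S(2)[unfolded M_def], folded M_def])
    define h where "h = (pi_pq p q powr p + t) * M"
    have h0: "h \<ge> 0" using V t by (simp add: h_def)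
    have "ennreal (integral {0<..<1} (\<lambda>x. \<bar>deriv v x\<bar> powr p) * M) \<le> ennreal h"
      unfolding h_def using E V by (intro ennreal_leI mult_right_mono) auto
    with H have H': "(\<integral>\<^sup>+z. ennreal (\<bar>grad \<Psi> z \<bullet> b\<bar> powr p) \<partial>lborel) \<le> ennreal h" by (rule order_trans)
    define G where "G = integral (thin_dom b 1) (\<lambda>x. norm (grad \<Psi> x) powr p)"
    have G: "(\<integral>\<^sup>+z. ennreal (norm (grad \<Psi> z) powr p) \<partial>lborel) = ennreal G" "G \<ge> 0"
      unfolding G_def by (rule Cc_inf_energies(2)[OF \<Psi> exponents_pos(1,2)], rule integral_nonneg[OF Cc_inf_energies(4)[OF \<Psi> exponents_pos(1,2)]]) simp
    \<comment> \<open>The term \<epsilon> G and the factor (1-\<epsilon>)^(1-p) disappear in the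
      limit, which leaves f t.\<close>
    define g where "g \<epsilon> = ((1 - \<epsilon>) powr (1 - p) * h + \<epsilon> * G) / S powr (p / q) * V powr ?a / (2 * (?n * V * (1 - t))) powr p" for \<epsilon>
    have "(g \<longlongrightarrow> ((1 - 0) powr (1 - p) * h + 0 * G) / S powr (p / q) * V powr ?a / (2 * (?n * V * (1 - t))) powr p) (at_right 0)"
      unfolding g_def[abs_def] using V n S t by (intro tendsto_intros) auto
    then have "(g \<longlongrightarrow> f t) (at_right 0)" by (simp add: f_def h_def S_def)
    then have gx: "\<forall>\<^sub>F \<epsilon> in at_right 0. g \<epsilon> < x" using t(1) by (rule order_tendstoD(2))
    have "?Q \<epsilon> \<le> g \<epsilon>" if \<epsilon>: "0 < \<epsilon>" "\<epsilon> < 1" for \<epsilon>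
    proof -
      let ?P = "perimeter (thin_dom b \<epsilon>)" and ?X = "((1 - \<epsilon>) powr (1 - p) * h + \<epsilon> * G) / S powr (p / q)"
      have X: "lambda_pq p q (thin_dom b \<epsilon>) * \<epsilon> powr ?a \<le> ?X"
        by (rule lambda_thin_dom_le[OF b pq \<epsilon> \<Psi> H' h0 S(1) S' G])
      have X0: "?X \<ge> 0" using h0 G(2) \<epsilon> by simp
      have nV: "?n * V > 0" using V n by (intro mult_pos_pos)
      have e: "?n * V * (1 - t) < ?n * V" "0 < ?n * V * (1 - t)"
        using mult_strict_left_mono[OF _ nV, of "1 - t" 1] mult_pos_pos[OF nV, of "1 - t"] t by simp_all
      have PP: "2 * (?n * V * (1 - t)) \<le> ?P" by (rule perimeter_thin_dom_lower[OF e(1) \<epsilon>(1)])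
      have "?Q \<epsilon> = (lambda_pq p q (thin_dom b \<epsilon>) * \<epsilon> powr ?a) * V powr ?a / ?P powr p"
        unfolding thin_dom_ratio_eq[OF \<epsilon>(1)] by simp
      also have "\<dots> \<le> ?X * V powr ?a / ?P powr p"
        using X by (intro divide_right_mono mult_right_mono) auto
      also have "\<dots> \<le> ?X * V powr ?a / (2 * (?n * V * (1 - t))) powr p"
      proof (rule divide_left_mono)
        show "(2 * (?n * V * (1 - t))) powr p \<le> ?P powr p" using PP e exponents_pos by (intro powr_mono2) auto
        show "0 \<le> ?X * V powr ?a" using X0 by (intro mult_nonneg_nonneg) auto
        have "0 < ?P powr p" "0 < (2 * (?n * V * (1 - t))) powr p"
          unfolding powr_gt_zero using P0[OF \<epsilon>(1)] e(2) by linarith+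
        then show "0 < ?P powr p * (2 * (?n * V * (1 - t))) powr p" by (rule mult_pos_pos)
      qed
      finally show ?thesis by (simp only: g_def)
    qed
    then have Qx: "?Q \<epsilon> < x" if "0 < \<epsilon> \<and> \<epsilon> < 1" "g \<epsilon> < x" for \<epsilon>
      using that by (meson le_less_trans)
    have "\<forall>\<^sub>F \<epsilon> in at_right (0::real). 0 < \<epsilon> \<and> \<epsilon> < 1"
      unfolding eventually_at_right_field by (intro exI[of _ 1]) auto
    then show "\<forall>\<^sub>F \<epsilon> in at_right 0. ?Q \<epsilon> < x"
      using gx by eventually_elim (rule Qx)
  }
qed

end

end

theorem theorem1p1:
  fixes p q :: real
  assumes "DIM('a::euclidean_space) \<ge> 2" and "1 \<le> q" and "q < p"
  shows "(\<forall>\<Omega>::'a set. bounded \<Omega> \<and> convex \<Omega> \<and> open \<Omega> \<and> \<Omega> \<noteq> {} \<longrightarrow>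
            lambda_pq p q \<Omega> \<ge> K_const p q DIM('a) *
              (perimeter \<Omega> / measure lebesgue \<Omega> powr (1 - 1/p + 1/q)) powr p)
       \<and> (\<forall>b::'a. b \<in> Basis \<longrightarrow>
            ((\<lambda>\<epsilon>. lambda_pq p q (thin_dom b \<epsilon>) *
                  (measure lebesgue (thin_dom b \<epsilon>) powr (1 - 1/p + 1/q) / perimeter (thin_dom b \<epsilon>)) powr p)
             \<longlongrightarrow> K_const p q DIM('a)) (at_right 0))"
proof -
  interpret sublinear_exponents p q "p * q / (p - q)"
    by standard (use assms in simp_all)
  show ?thesis
  proof (intro conjI allI impI)
    fix \<Omega> :: "'a set" assume "bounded \<Omega> \<and> convex \<Omega> \<and> open \<Omega> \<and> \<Omega> \<noteq> {}"
    then show "lambda_pq p q \<Omega> \<ge> K_const p q DIM('a) * (perimeter \<Omega> / measure lebesgue \<Omega> powr (1 - 1/p + 1/q)) powr p"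
      by (intro convex_lower_bound) auto
  qed (rule thin_dom_limit[OF _ assms(1)])
qed

end
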